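(* Let $\mathscr{K}$ be an essentially small rigid tt-category. Suppose that $\mathscr{K}=\mathrm{thick}\langle\mathbb{1}\rangle$ and that the graded ring $R_{\mathscr{K}}=\mathrm{End}^{\bullet}_{\mathscr{K}}(\mathbb{1})$ is coherent. Then the graded comparison map $\rho_{\mathscr{K}}:\mathrm{Spc}(\mathscr{K})\to\mathrm{Spec}(R_{\mathscr{K}})$ is a closed quotient map. Moreover, $$\rho_{\mathscr{K}}(\mathrm{supp}(x))=\{\mathfrak{p}\in\mathrm{Spec}(R_{\mathscr{K}}) : x_{\mathfrak{p}}\neq 0\text{ in }\mathscr{K}_{\mathfrak{p}}\}$$ for each $x\in\mathscr{K}$.
   Context: A tt-category is a triangulated category with a compatible symmetric monoidal structure $(\otimes,\mathbb{1})$; it is rigid if every object is dualizable. $\mathrm{thick}\langle\mathbb{1}\rangle$ is the smallest thick (triangulated, closed under direct summands) subcategory containing $\mathbb{1}$. $\mathrm{End}^{\bullet}_{\mathscr{K}}(\mathbb{1})=\bigoplus_{n\in\mathbb{Z}}\mathrm{Hom}_{\mathscr{K}}(\mathbb{1},\Sigma^n\mathbb{1})$ is the graded (graded-commutative) endomorphism ring of the unit and $\mathrm{Spec}$ denotes its homogeneous Zariski spectrum. Coherent is understood in the graded sense: every finitely generated homogeneous ideal is finitely presented. $\mathrm{Spc}(\mathscr{K})$ is the Balmer spectrum: the set of prime thick tensor-ideals with basis of closed sets $\mathrm{supp}(a)=\{\mathscr{P}: a\notin\mathscr{P}\}$. The graded comparison map $\rho_{\mathscr{K}}$ sends $\mathscr{P}$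 to the homogeneous prime ideal generated by the homogeneous elements $f$ with $\mathrm{cone}(f)\notin\mathscr{P}$; it is a spectral map. For a homogeneous prime $\mathfrak{p}$, the algebraic localization $\mathscr{K}\to\mathscr{K}_{\mathfrak{p}}$, $x\mapsto x_{\mathfrak{p}}$, is the Verdier quotient of $\mathscr{K}$ by the thick tensor-ideal generated by $\{\mathrm{cone}(s): s\in R_{\mathscr{K}}\text{ homogeneous},\ s\notin\mathfrak{p}\}$ (up to idempotent completion). It satisfies $\mathrm{Hom}^{\bullet}_{\mathscr{K}_{\mathfrak{p}}}(x_{\mathfrak{p}},y_{\mathfrak{p}})\cong\mathrm{Hom}^{\bullet}_{\mathscr{K}}(x,y)_{\mathfrak{p}}$. A closed quotient map is a topological quotient map which is a closed map. *)

theory Defs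
  imports "HOL-Analysis.Analysis" "HOL-Algebra.Ideal"
begin

section \<open>Categories\<close>

record ('o, 'm) category =
  ob :: "'o set"
  ar :: "'m set"
  src :: "'m \<Rightarrow> 'o"
  tgt :: "'m \<Rightarrow> 'o"
  idt :: "'o \<Rightarrow> 'm"
  cmp :: "'m \<Rightarrow> 'm \<Rightarrow> 'm"  (infixr \<open>\<cdot>\<index>\<close> 75)

definition Hom :: "('o, 'm, 'b) category_scheme \<Rightarrow> 'o \<Rightarrow> 'o \<Rightarrow> 'm set" where
  "Hom K x y = {f \<in> ar K. src K f = x \<and> tgt K f = y}"

definition is_inverse :: "('o, 'm, 'b) category_scheme \<Rightarrow> 'm \<Rightarrow> 'm \<Rightarrow> bool" where
  "is_inverse K f g \<longleftrightarrow> f \<in> ar K \<and> g \<in> Hom K (tgt K f) (src K f) \<and>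
     g \<cdot>\<^bsub>K\<^esub> f = idt K (src K f) \<and> f \<cdot>\<^bsub>K\<^esub> g = idt K (tgt K f)"

definition Iso :: "('o, 'm, 'b) category_scheme \<Rightarrow> 'o \<Rightarrow> 'o \<Rightarrow> 'm set" where
  "Iso K x y = {f \<in> Hom K x y. \<exists>g. is_inverse K f g}"

definition is_zero :: "('o, 'm, 'b) category_scheme \<Rightarrow> 'o \<Rightarrow> bool" where
  "is_zero K z \<longleftrightarrow> z \<in> ob K \<and>
     (\<forall>x\<in>ob K. (\<exists>!f. f \<in> Hom K x z) \<and> (\<exists>!f. f \<in> Hom K z x))"

text \<open>Objects and arrows are taken from types, i.e. the categories are small; every essentially
  small category is equivalent to such a category.\<close>

locale category =
  fixes K (structure)
  assumes src_tgt: "f \<in> ar K \<Longrightarrow> src K f \<in> ob K \<and> tgt K f \<in> ob K"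
    and idt: "x \<in> ob K \<Longrightarrow> idt K x \<in> Hom K x x"
    and cmp: "\<lbrakk>f \<in> Hom K x y; g \<in> Hom K y z\<rbrakk> \<Longrightarrow> g \<cdot> f \<in> Hom K x z"
    and idt_left: "f \<in> Hom K x y \<Longrightarrow> idt K y \<cdot> f = f"
    and idt_right: "f \<in> Hom K x y \<Longrightarrow> f \<cdot> idt K x = f"
    and cmp_assoc: "\<lbrakk>f \<in> Hom K w x; g \<in> Hom K x y; h \<in> Hom K y z\<rbrakk> \<Longrightarrow> (h \<cdot> g) \<cdot> f = h \<cdot> (g \<cdot> f)"


section \<open>Triangulated categories\<close>

text \<open>The suspension \<open>\<Sigma> = shift 1\<close> is an auto-equivalence rather than an automorphism. Its integral
  powers \<open>\<Sigma>\<^sup>n = shift n\<close> are part of the data, together with the coherent isomorphisms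
  \<open>shmul m n x : \<Sigma>\<^sup>m \<Sigma>\<^sup>n x \<rightarrow> \<Sigma>\<^sup>m\<^sup>+\<^sup>n x\<close> and \<open>shunit x : x \<rightarrow> \<Sigma>\<^sup>0 x\<close>. Every adjoint auto-equivalence
  extends to such data; if \<open>\<Sigma>\<close> is an automorphism, \<open>shmul\<close> and \<open>shunit\<close> can be taken to be identities.\<close>

record ('o, 'm) tricategory = "('o, 'm) category" +
  padd :: "'m \<Rightarrow> 'm \<Rightarrow> 'm"
  pzero :: "'o \<Rightarrow> 'o \<Rightarrow> 'm"
  shift :: "int \<Rightarrow> 'o \<Rightarrow> 'o"
  shiftm :: "int \<Rightarrow> 'm \<Rightarrow> 'm"
  shmul :: "int \<Rightarrow> int \<Rightarrow> 'o \<Rightarrow> 'm"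
  shunit :: "'o \<Rightarrow> 'm"
  tri :: "('m \<times> 'm \<times> 'm) set"

definition hom_group :: "('o, 'm, 'b) tricategory_scheme \<Rightarrow> 'o \<Rightarrow> 'o \<Rightarrow> 'm monoid" where
  "hom_group K x y = \<lparr>carrier = Hom K x y, mult = padd K, one = pzero K x y\<rparr>"

definition pneg :: "('o, 'm, 'b) tricategory_scheme \<Rightarrow> 'm \<Rightarrow> 'm" where
  "pneg K f = inv\<^bsub>hom_group K (src K f) (tgt K f)\<^esub> f"

definition is_biproduct :: "('o, 'm, 'b) tricategory_scheme \<Rightarrow> 'o \<Rightarrow> 'o \<Rightarrow> 'o \<Rightarrow> bool" where
  "is_biproduct K x y z \<longleftrightarrow>
     (\<exists>i\<in>Hom K x z. \<exists>p\<in>Hom K z x. \<exists>j\<in>Hom K y z. \<exists>q\<in>Hom K z y.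
        p \<cdot>\<^bsub>K\<^esub> i = idt K x \<and> q \<cdot>\<^bsub>K\<^esub> j = idt K y \<and> q \<cdot>\<^bsub>K\<^esub> i = pzero K x y \<and> p \<cdot>\<^bsub>K\<^esub> j = pzero K y x \<and>
        padd K (i \<cdot>\<^bsub>K\<^esub> p) (j \<cdot>\<^bsub>K\<^esub> q) = idt K z)"

locale additive_category = category K for K :: "('o, 'm, 'b) tricategory_scheme" (structure) +
  assumes hom_comm_group: "\<lbrakk>x \<in> ob K; y \<in> ob K\<rbrakk> \<Longrightarrow> comm_group (hom_group K x y)"
    and cmp_padd_left: "\<lbrakk>f \<in> Hom K x y; g \<in> Hom K y z; g' \<in> Hom K y z\<rbrakk>
          \<Longrightarrow> padd K g g' \<cdot> f = padd K (g \<cdot> f) (g' \<cdot> f)"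
    and cmp_padd_right: "\<lbrakk>f \<in> Hom K x y; f' \<in> Hom K x y; g \<in> Hom K y z\<rbrakk>
          \<Longrightarrow> g \<cdot> padd K f f' = padd K (g \<cdot> f) (g \<cdot> f')"
    and zero_object: "\<exists>z. is_zero K z"
    and biproducts: "\<lbrakk>x \<in> ob K; y \<in> ob K\<rbrakk> \<Longrightarrow> \<exists>z\<in>ob K. is_biproduct K x y z"

locale category_with_shifts = additive_category K
  for K :: "('o, 'm, 'b) tricategory_scheme" (structure) +
  assumes shift_ob: "x \<in> ob K \<Longrightarrow> shift K n x \<in> ob K"
    and shiftm_hom: "f \<in> Hom K x y \<Longrightarrow> shiftm K n f \<in> Hom K (shift K n x) (shift K n y)"
    and shiftm_idt: "x \<in> ob K \<Longrightarrow> shiftm K n (idt K x) = idt K (shift K n x)"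
    and shiftm_cmp: "\<lbrakk>f \<in> Hom K x y; g \<in> Hom K y z\<rbrakk> \<Longrightarrow> shiftm K n (g \<cdot> f) = shiftm K n g \<cdot> shiftm K n f"
    and shiftm_padd: "\<lbrakk>f \<in> Hom K x y; g \<in> Hom K x y\<rbrakk>
          \<Longrightarrow> shiftm K n (padd K f g) = padd K (shiftm K n f) (shiftm K n g)"
    and shmul_iso: "x \<in> ob K \<Longrightarrow> shmul K m n x \<in> Iso K (shift K m (shift K n x)) (shift K (m + n) x)"
    and shmul_nat: "f \<in> Hom K x y
          \<Longrightarrow> shmul K m n y \<cdot> shiftm K m (shiftm K n f) = shiftm K (m + n) f \<cdot> shmul K m n x"
    and shunit_iso: "x \<in> ob K \<Longrightarrow> shunit K x \<in> Iso K x (shift K 0 x)"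
    and shunit_nat: "f \<in> Hom K x y \<Longrightarrow> shunit K y \<cdot> f = shiftm K 0 f \<cdot> shunit K x"
    and shmul_assoc: "x \<in> ob K \<Longrightarrow>
          shmul K (l + m) n x \<cdot> shmul K l m (shift K n x) = shmul K l (m + n) x \<cdot> shiftm K l (shmul K m n x)"
    and shmul_unit_left: "x \<in> ob K \<Longrightarrow> shmul K 0 n x \<cdot> shunit K (shift K n x) = idt K (shift K n x)"
    and shmul_unit_right: "x \<in> ob K \<Longrightarrow> shmul K n 0 x \<cdot> shiftm K n (shunit K x) = idt K (shift K n x)"

locale triangulated_category = category_with_shifts K
  for K :: "('o, 'm, 'b) tricategory_scheme" (structure) +
  assumes tri_hom: "(f, g, h) \<in> tri K \<Longrightarrow>
            f \<in> ar K \<and> g \<in> Hom K (tgt K f) (tgt K g) \<and> h \<in> Hom K (tgt K g) (shift K 1 (src K f))"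
    and tri_iso: "\<lbrakk>(f, g, h) \<in> tri K; f \<in> Hom K x y; g \<in> Hom K y z;
            f' \<in> Hom K x' y'; g' \<in> Hom K y' z'; h' \<in> Hom K z' (shift K 1 x');
            u \<in> Iso K x x'; v \<in> Iso K y y'; w \<in> Iso K z z';
            f' \<cdot> u = v \<cdot> f; g' \<cdot> v = w \<cdot> g; h' \<cdot> w = shiftm K 1 u \<cdot> h\<rbrakk> \<Longrightarrow> (f', g', h') \<in> tri K"
    and tri_idt: "\<lbrakk>x \<in> ob K; is_zero K z\<rbrakk> \<Longrightarrow> (idt K x, pzero K x z, pzero K z (shift K 1 x)) \<in> tri K"
    and tri_cone: "f \<in> ar K \<Longrightarrow> \<exists>g h. (f, g, h) \<in> tri K"
    and tri_rotate: "\<lbrakk>f \<in> Hom K x y; g \<in> Hom K y z; h \<in> Hom K z (shift K 1 x)\<rbrakk>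
          \<Longrightarrow> (f, g, h) \<in> tri K \<longleftrightarrow> (g, h, pneg K (shiftm K 1 f)) \<in> tri K"
    and tri_complete: "\<lbrakk>(f, g, h) \<in> tri K; f \<in> Hom K x y; g \<in> Hom K y z;
            (f', g', h') \<in> tri K; f' \<in> Hom K x' y'; g' \<in> Hom K y' z';
            u \<in> Hom K x x'; v \<in> Hom K y y'; f' \<cdot> u = v \<cdot> f\<rbrakk>
          \<Longrightarrow> \<exists>w\<in>Hom K z z'. g' \<cdot> v = w \<cdot> g \<and> h' \<cdot> w = shiftm K 1 u \<cdot> h"
    and octahedral: "\<lbrakk>f \<in> Hom K x y; g \<in> Hom K y z;
            (f, a, b) \<in> tri K; a \<in> Hom K y r; (g, c, d) \<in> tri K; c \<in> Hom K z t;
            (g \<cdot> f, k, l) \<in> tri K; k \<in> Hom K z s\<rbrakk>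
          \<Longrightarrow> \<exists>p\<in>Hom K r s. \<exists>q\<in>Hom K s t. (p, q, shiftm K 1 a \<cdot> d) \<in> tri K \<and>
                p \<cdot> a = k \<cdot> g \<and> l \<cdot> p = b \<and> q \<cdot> k = c \<and> d \<cdot> q = shiftm K 1 f \<cdot> l"

definition is_cone :: "('o, 'm, 'b) tricategory_scheme \<Rightarrow> 'm \<Rightarrow> 'o \<Rightarrow> bool" where
  "is_cone K f c \<longleftrightarrow> (\<exists>g h. (f, g, h) \<in> tri K \<and> tgt K g = c)"

definition thick :: "('o, 'm, 'b) tricategory_scheme \<Rightarrow> 'o set \<Rightarrow> bool" where
  "thick K T \<longleftrightarrow> T \<subseteq> ob K \<and> (\<forall>z. is_zero K z \<longrightarrow> z \<in> T) \<and>
     (\<forall>x\<in>T. \<forall>n. shift K n x \<in> T) \<and>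
     (\<forall>f x y c. f \<in> Hom K x y \<and> x \<in> T \<and> y \<in> T \<and> is_cone K f c \<longrightarrow> c \<in> T) \<and>
     (\<forall>x\<in>ob K. \<forall>y\<in>ob K. \<forall>z\<in>T. is_biproduct K x y z \<longrightarrow> x \<in> T)"

definition thick_gen :: "('o, 'm, 'b) tricategory_scheme \<Rightarrow> 'o set \<Rightarrow> 'o set" where
  "thick_gen K S = \<Inter>{T. thick K T \<and> S \<subseteq> T}"


section \<open>Verdier quotients\<close>

text \<open>An arrow \<open>x \<rightarrow> y\<close> of the quotient of \<open>K\<close> by \<open>J\<close> is a class of roofs \<open>x \<leftarrow>s\<midarrow> w \<midarrow>f\<rightarrow> y\<close>, written
  \<open>(s, f)\<close>, where the cone of \<open>s\<close> lies in \<open>J\<close>. Only the category underlying the quotient is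
  constructed, and the quotient functor is the identity on objects.\<close>

definition cone_in :: "('o, 'm, 'b) tricategory_scheme \<Rightarrow> 'o set \<Rightarrow> 'm set" where
  "cone_in K J = {s \<in> ar K. \<exists>c\<in>J. is_cone K s c}"

definition roofs :: "('o, 'm, 'b) tricategory_scheme \<Rightarrow> 'o set \<Rightarrow> ('m \<times> 'm) set" where
  "roofs K J = {(s, f). s \<in> cone_in K J \<and> f \<in> ar K \<and> src K s = src K f}"

definition roof_rel :: "('o, 'm, 'b) tricategory_scheme \<Rightarrow> 'o set \<Rightarrow> (('m \<times> 'm) \<times> ('m \<times> 'm)) set" where
  "roof_rel K J = {((s, f), (s', f')). (s, f) \<in> roofs K J \<and> (s', f') \<in> roofs K J \<and>
     tgt K s = tgt K s' \<and> tgt K f = tgt K f' \<and>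
     (\<exists>w. \<exists>u\<in>Hom K w (src K s). \<exists>v\<in>Hom K w (src K s').
        s \<cdot>\<^bsub>K\<^esub> u = s' \<cdot>\<^bsub>K\<^esub> v \<and> f \<cdot>\<^bsub>K\<^esub> u = f' \<cdot>\<^bsub>K\<^esub> v \<and> s \<cdot>\<^bsub>K\<^esub> u \<in> cone_in K J)}"

text \<open>The union in the composition ranges over all choices of representatives and of fill-ins;
  all of them give the same class.\<close>

definition roof_cmp ::
  "('o, 'm, 'b) tricategory_scheme \<Rightarrow> 'o set \<Rightarrow> ('m \<times> 'm) set \<Rightarrow> ('m \<times> 'm) set \<Rightarrow> ('m \<times> 'm) set" where
  "roof_cmp K J B A = \<Union>{roof_rel K J `` {(s \<cdot>\<^bsub>K\<^esub> t, g \<cdot>\<^bsub>K\<^esub> u)} | s f s' g t u w.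
     (s, f) \<in> A \<and> (s', g) \<in> B \<and> t \<in> Hom K w (src K f) \<and> u \<in> Hom K w (src K g) \<and>
     t \<in> cone_in K J \<and> f \<cdot>\<^bsub>K\<^esub> t = s' \<cdot>\<^bsub>K\<^esub> u}"

definition verdier_quotient ::
  "('o, 'm, 'b) tricategory_scheme \<Rightarrow> 'o set \<Rightarrow> ('o, ('m \<times> 'm) set) category" where
  "verdier_quotient K J =
     \<lparr>ob = ob K,
      ar = roofs K J // roof_rel K J,
      src = (\<lambda>A. the_elem ((\<lambda>(s, f). tgt K s) ` A)),
      tgt = (\<lambda>A. the_elem ((\<lambda>(s, f). tgt K f) ` A)),
      idt = (\<lambda>x. roof_rel K J `` {(idt K x, idt K x)}),
      cmp = roof_cmp K J\<rparr>"


section \<open>Rigid tensor triangulated categories\<close>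

record ('o, 'm) ttcategory = "('o, 'm) tricategory" +
  tens :: "'o \<Rightarrow> 'o \<Rightarrow> 'o"  (infixr \<open>\<boxtimes>\<index>\<close> 80)
  tensm :: "'m \<Rightarrow> 'm \<Rightarrow> 'm"  (infixr \<open>\<boxdot>\<index>\<close> 80)
  unit :: "'o"
  assoc :: "'o \<Rightarrow> 'o \<Rightarrow> 'o \<Rightarrow> 'm"
  lunit :: "'o \<Rightarrow> 'm"
  runit :: "'o \<Rightarrow> 'm"
  braid :: "'o \<Rightarrow> 'o \<Rightarrow> 'm"
  tsusp :: "'o \<Rightarrow> 'o \<Rightarrow> 'm"

locale symmetric_monoidal_category = category K
  for K :: "('o, 'm, 'b) ttcategory_scheme" (structure) +
  assumes tens_ob: "\<lbrakk>x \<in> ob K; y \<in> ob K\<rbrakk> \<Longrightarrow> x \<boxtimes> y \<in> ob K"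
    and tensm_hom: "\<lbrakk>f \<in> Hom K x x'; g \<in> Hom K y y'\<rbrakk> \<Longrightarrow> f \<boxdot> g \<in> Hom K (x \<boxtimes> y) (x' \<boxtimes> y')"
    and tensm_idt: "\<lbrakk>x \<in> ob K; y \<in> ob K\<rbrakk> \<Longrightarrow> idt K x \<boxdot> idt K y = idt K (x \<boxtimes> y)"
    and tensm_cmp: "\<lbrakk>f \<in> Hom K x x'; f' \<in> Hom K x' x''; g \<in> Hom K y y'; g' \<in> Hom K y' y''\<rbrakk>
          \<Longrightarrow> (f' \<cdot> f) \<boxdot> (g' \<cdot> g) = (f' \<boxdot> g') \<cdot> (f \<boxdot> g)"
    and unit_ob: "unit K \<in> ob K"
    and assoc_iso: "\<lbrakk>x \<in> ob K; y \<in> ob K; z \<in> ob K\<rbrakk>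
          \<Longrightarrow> assoc K x y z \<in> Iso K ((x \<boxtimes> y) \<boxtimes> z) (x \<boxtimes> (y \<boxtimes> z))"
    and assoc_nat: "\<lbrakk>f \<in> Hom K x x'; g \<in> Hom K y y'; h \<in> Hom K z z'\<rbrakk>
          \<Longrightarrow> assoc K x' y' z' \<cdot> ((f \<boxdot> g) \<boxdot> h) = (f \<boxdot> (g \<boxdot> h)) \<cdot> assoc K x y z"
    and lunit_iso: "x \<in> ob K \<Longrightarrow> lunit K x \<in> Iso K (unit K \<boxtimes> x) x"
    and lunit_nat: "f \<in> Hom K x y \<Longrightarrow> lunit K y \<cdot> (idt K (unit K) \<boxdot> f) = f \<cdot> lunit K x"
    and runit_iso: "x \<in> ob K \<Longrightarrow> runit K x \<in> Iso K (x \<boxtimes> unit K) x"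
    and runit_nat: "f \<in> Hom K x y \<Longrightarrow> runit K y \<cdot> (f \<boxdot> idt K (unit K)) = f \<cdot> runit K x"
    and braid_iso: "\<lbrakk>x \<in> ob K; y \<in> ob K\<rbrakk> \<Longrightarrow> braid K x y \<in> Iso K (x \<boxtimes> y) (y \<boxtimes> x)"
    and braid_nat: "\<lbrakk>f \<in> Hom K x x'; g \<in> Hom K y y'\<rbrakk>
          \<Longrightarrow> braid K x' y' \<cdot> (f \<boxdot> g) = (g \<boxdot> f) \<cdot> braid K x y"
    and pentagon: "\<lbrakk>w \<in> ob K; x \<in> ob K; y \<in> ob K; z \<in> ob K\<rbrakk> \<Longrightarrow>
          assoc K w x (y \<boxtimes> z) \<cdot> assoc K (w \<boxtimes> x) y z =
          (idt K w \<boxdot> assoc K x y z) \<cdot> assoc K w (x \<boxtimes> y) z \<cdot> (assoc K w x y \<boxdot> idt K z)"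
    and triangle: "\<lbrakk>x \<in> ob K; y \<in> ob K\<rbrakk> \<Longrightarrow>
          (idt K x \<boxdot> lunit K y) \<cdot> assoc K x (unit K) y = runit K x \<boxdot> idt K y"
    and hexagon: "\<lbrakk>x \<in> ob K; y \<in> ob K; z \<in> ob K\<rbrakk> \<Longrightarrow>
          assoc K y z x \<cdot> braid K x (y \<boxtimes> z) \<cdot> assoc K x y z =
          (idt K y \<boxdot> braid K x z) \<cdot> assoc K y x z \<cdot> (braid K x y \<boxdot> idt K z)"
    and braid_sym: "\<lbrakk>x \<in> ob K; y \<in> ob K\<rbrakk> \<Longrightarrow> braid K y x \<cdot> braid K x y = idt K (x \<boxtimes> y)"

text \<open>The isomorphism \<open>tsusp x y : \<Sigma>x \<otimes> y \<rightarrow> \<Sigma>(x \<otimes> y)\<close> determines its mirror image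
  \<open>x \<otimes> \<Sigma>y \<rightarrow> \<Sigma>(x \<otimes> y)\<close> by symmetry.\<close>

definition tsusp' :: "('o, 'm, 'b) ttcategory_scheme \<Rightarrow> 'o \<Rightarrow> 'o \<Rightarrow> 'm" where
  "tsusp' K x y = shiftm K 1 (braid K y x) \<cdot>\<^bsub>K\<^esub> tsusp K y x \<cdot>\<^bsub>K\<^esub> braid K x (shift K 1 y)"

text \<open>Compatibility of the tensor product with the triangulation is in the sense of
  Hovey, Palmieri and Strickland: the tensor product is exact in each variable, \<open>tsusp\<close> is coherent with
  the unit and the associator, and the two ways of moving suspensions out of \<open>\<Sigma>x \<otimes> \<Sigma>y\<close> differ by
  the sign \<open>-1\<close>. Exactness in the second variable follows by symmetry.\<close>

locale tt_category = triangulated_category K + symmetric_monoidal_category K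
  for K :: "('o, 'm, 'b) ttcategory_scheme" (structure) +
  assumes tensm_padd_left: "\<lbrakk>f \<in> Hom K x x'; f' \<in> Hom K x x'; g \<in> Hom K y y'\<rbrakk>
          \<Longrightarrow> padd K f f' \<boxdot> g = padd K (f \<boxdot> g) (f' \<boxdot> g)"
    and tensm_padd_right: "\<lbrakk>f \<in> Hom K x x'; g \<in> Hom K y y'; g' \<in> Hom K y y'\<rbrakk>
          \<Longrightarrow> f \<boxdot> padd K g g' = padd K (f \<boxdot> g) (f \<boxdot> g')"
    and tsusp_iso: "\<lbrakk>x \<in> ob K; y \<in> ob K\<rbrakk> \<Longrightarrow> tsusp K x y \<in> Iso K (shift K 1 x \<boxtimes> y) (shift K 1 (x \<boxtimes> y))"
    and tsusp_nat: "\<lbrakk>f \<in> Hom K x x'; g \<in> Hom K y y'\<rbrakk>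
          \<Longrightarrow> tsusp K x' y' \<cdot> (shiftm K 1 f \<boxdot> g) = shiftm K 1 (f \<boxdot> g) \<cdot> tsusp K x y"
    and tens_exact: "\<lbrakk>(f, g, h) \<in> tri K; f \<in> Hom K x y; w \<in> ob K\<rbrakk>
          \<Longrightarrow> (f \<boxdot> idt K w, g \<boxdot> idt K w, tsusp K x w \<cdot> (h \<boxdot> idt K w)) \<in> tri K"
    and tsusp_unit: "x \<in> ob K
          \<Longrightarrow> shiftm K 1 (runit K x) \<cdot> tsusp K x (unit K) = runit K (shift K 1 x)"
    and tsusp_assoc: "\<lbrakk>x \<in> ob K; y \<in> ob K; z \<in> ob K\<rbrakk> \<Longrightarrow>
          tsusp K x (y \<boxtimes> z) \<cdot> assoc K (shift K 1 x) y z =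
          shiftm K 1 (assoc K x y z) \<cdot> tsusp K (x \<boxtimes> y) z \<cdot> (tsusp K x y \<boxdot> idt K z)"
    and tsusp_anticommute: "\<lbrakk>x \<in> ob K; y \<in> ob K\<rbrakk> \<Longrightarrow>
          shiftm K 1 (tsusp K x y) \<cdot> tsusp' K (shift K 1 x) y =
          pneg K (shiftm K 1 (tsusp' K x y) \<cdot> tsusp K x (shift K 1 y))"

definition is_dual :: "('o, 'm, 'b) ttcategory_scheme \<Rightarrow> 'o \<Rightarrow> 'o \<Rightarrow> bool" where
  "is_dual K x y \<longleftrightarrow> y \<in> ob K \<and>
     (\<exists>coev\<in>Hom K (unit K) (x \<boxtimes>\<^bsub>K\<^esub> y). \<exists>ev\<in>Hom K (y \<boxtimes>\<^bsub>K\<^esub> x) (unit K).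
        runit K x \<cdot>\<^bsub>K\<^esub> (idt K x \<boxdot>\<^bsub>K\<^esub> ev) \<cdot>\<^bsub>K\<^esub> assoc K x y x \<cdot>\<^bsub>K\<^esub> (coev \<boxdot>\<^bsub>K\<^esub> idt K x) = lunit K x \<and>
        (\<exists>a. is_inverse K (assoc K y x y) a \<and>
          lunit K y \<cdot>\<^bsub>K\<^esub> (ev \<boxdot>\<^bsub>K\<^esub> idt K y) \<cdot>\<^bsub>K\<^esub> a \<cdot>\<^bsub>K\<^esub> (idt K y \<boxdot>\<^bsub>K\<^esub> coev) = runit K y))"

locale rigid_tt_category = tt_category K
  for K :: "('o, 'm, 'b) ttcategory_scheme" (structure) +
  assumes dualizable: "x \<in> ob K \<Longrightarrow> \<exists>y. is_dual K x y"

definition thick_ideal :: "('o, 'm, 'b) ttcategory_scheme \<Rightarrow> 'o set \<Rightarrow> bool" where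
  "thick_ideal K T \<longleftrightarrow> thick K T \<and> (\<forall>x\<in>T. \<forall>y\<in>ob K. x \<boxtimes>\<^bsub>K\<^esub> y \<in> T)"

definition thick_ideal_gen :: "('o, 'm, 'b) ttcategory_scheme \<Rightarrow> 'o set \<Rightarrow> 'o set" where
  "thick_ideal_gen K S = \<Inter>{T. thick_ideal K T \<and> S \<subseteq> T}"


section \<open>The Balmer spectrum\<close>

definition tt_primes :: "('o, 'm, 'b) ttcategory_scheme \<Rightarrow> 'o set set" where
  "tt_primes K = {P. thick_ideal K P \<and> P \<noteq> ob K \<and>
     (\<forall>x\<in>ob K. \<forall>y\<in>ob K. x \<boxtimes>\<^bsub>K\<^esub> y \<in> P \<longrightarrow> x \<in> P \<or> y \<in> P)}"

definition supp :: "('o, 'm, 'b) ttcategory_scheme \<Rightarrow> 'o \<Rightarrow> 'o set set" where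
  "supp K x = {P \<in> tt_primes K. x \<notin> P}"

definition Spc :: "('o, 'm, 'b) ttcategory_scheme \<Rightarrow> 'o set topology" where
  "Spc K = topology_generated_by {tt_primes K - supp K x | x. x \<in> ob K}"


section \<open>Graded rings\<close>

text \<open>In this section \<open>D n\<close> is the set of elements of degree \<open>n\<close> of the graded ring \<open>R\<close>.\<close>

definition homogeneous_ideal :: "('a, 'b) ring_scheme \<Rightarrow> (int \<Rightarrow> 'a set) \<Rightarrow> 'a set \<Rightarrow> bool" where
  "homogeneous_ideal R D I \<longleftrightarrow> ideal I R \<and> I = Idl\<^bsub>R\<^esub> (I \<inter> (\<Union>n. D n))"

definition homogeneous_primes :: "('a, 'b) ring_scheme \<Rightarrow> (int \<Rightarrow> 'a set) \<Rightarrow> 'a set set" where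
  "homogeneous_primes R D = {p. homogeneous_ideal R D p \<and> p \<noteq> carrier R \<and>
     (\<forall>a\<in>(\<Union>n. D n). \<forall>b\<in>(\<Union>n. D n). a \<otimes>\<^bsub>R\<^esub> b \<in> p \<longrightarrow> a \<in> p \<or> b \<in> p)}"

definition homogeneous_Spec :: "('a, 'b) ring_scheme \<Rightarrow> (int \<Rightarrow> 'a set) \<Rightarrow> 'a set topology" where
  "homogeneous_Spec R D =
     topology_generated_by {{p \<in> homogeneous_primes R D. a \<notin> p} | a. a \<in> (\<Union>n. D n)}"

text \<open>A presentation \<open>\<Oplus>\<^sub>j R(-e\<^sub>j) \<rightarrow> \<Oplus>\<^sub>i R(-d\<^sub>i) \<rightarrow> I \<rightarrow> 0\<close> by finite free graded left modules: \<open>a\<close> lists the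
  images of the \<open>n\<close> basis vectors of the middle term, and \<open>b\<close> those of the \<open>m\<close> basis vectors of
  the left-hand term. (Over a graded-commutative ring left and two-sided homogeneous ideals
  coincide.)\<close>

definition graded_finitely_presented :: "('a, 'b) ring_scheme \<Rightarrow> (int \<Rightarrow> 'a set) \<Rightarrow> 'a set \<Rightarrow> bool" where
  "graded_finitely_presented R D I \<longleftrightarrow>
     (\<exists>(n::nat) (d::nat \<Rightarrow> int) a (m::nat) (e::nat \<Rightarrow> int) b.
        (\<forall>i<n. a i \<in> D (d i)) \<and> (\<forall>j<m. \<forall>i<n. b j i \<in> D (e j - d i)) \<and>
        I = (\<lambda>r. \<Oplus>\<^bsub>R\<^esub>i\<in>{..<n}. r i \<otimes>\<^bsub>R\<^esub> a i) ` ({..<n} \<rightarrow>\<^sub>E carrier R) \<and>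
        {r \<in> {..<n} \<rightarrow>\<^sub>E carrier R. (\<Oplus>\<^bsub>R\<^esub>i\<in>{..<n}. r i \<otimes>\<^bsub>R\<^esub> a i) = \<zero>\<^bsub>R\<^esub>} =
        (\<lambda>c. \<lambda>i\<in>{..<n}. \<Oplus>\<^bsub>R\<^esub>j\<in>{..<m}. c j \<otimes>\<^bsub>R\<^esub> b j i) ` ({..<m} \<rightarrow>\<^sub>E carrier R))"

definition graded_coherent :: "('a, 'b) ring_scheme \<Rightarrow> (int \<Rightarrow> 'a set) \<Rightarrow> bool" where
  "graded_coherent R D \<longleftrightarrow>
     (\<forall>I. homogeneous_ideal R D I \<and> (\<exists>S. finite S \<and> S \<subseteq> carrier R \<and> I = Idl\<^bsub>R\<^esub> S)
        \<longrightarrow> graded_finitely_presented R D I)"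


section \<open>The graded endomorphism ring of the unit\<close>

text \<open>Elements of \<open>\<Oplus>\<^sub>n Hom(1, \<Sigma>\<^sup>n 1)\<close> are families of finite support. The product of
  \<open>f : 1 \<rightarrow> \<Sigma>\<^sup>m 1\<close> and \<open>g : 1 \<rightarrow> \<Sigma>\<^sup>n 1\<close> is \<open>\<Sigma>\<^sup>n(f) \<cdot> g\<close>, composed with \<open>\<Sigma>\<^sup>n \<Sigma>\<^sup>m 1 \<cong> \<Sigma>\<^sup>n\<^sup>+\<^sup>m 1\<close>; it is
  extended biadditively.\<close>

definition unit_hom :: "('o, 'm, 'b) ttcategory_scheme \<Rightarrow> int \<Rightarrow> 'm set" where
  "unit_hom K n = Hom K (unit K) (shift K n (unit K))"

definition unit_zero :: "('o, 'm, 'b) ttcategory_scheme \<Rightarrow> int \<Rightarrow> 'm" where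
  "unit_zero K n = pzero K (unit K) (shift K n (unit K))"

definition homogeneous_elem :: "('o, 'm, 'b) ttcategory_scheme \<Rightarrow> int \<Rightarrow> 'm \<Rightarrow> int \<Rightarrow> 'm" where
  "homogeneous_elem K n f = (unit_zero K)(n := f)"

definition end_ring :: "('o, 'm, 'b) ttcategory_scheme \<Rightarrow> (int \<Rightarrow> 'm) ring" where
  "end_ring K =
     \<lparr>carrier = {a. (\<forall>n. a n \<in> unit_hom K n) \<and> finite {n. a n \<noteq> unit_zero K n}},
      mult = (\<lambda>a b k. finprod (hom_group K (unit K) (shift K k (unit K)))
                (\<lambda>n. shmul K n (k - n) (unit K) \<cdot>\<^bsub>K\<^esub> shiftm K n (a (k - n)) \<cdot>\<^bsub>K\<^esub> b n)
                {n. b n \<noteq> unit_zero K n}),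
      one = homogeneous_elem K 0 (shunit K (unit K)),
      zero = unit_zero K,
      add = (\<lambda>a b n. padd K (a n) (b n))\<rparr>"

definition end_degree :: "('o, 'm, 'b) ttcategory_scheme \<Rightarrow> int \<Rightarrow> (int \<Rightarrow> 'm) set" where
  "end_degree K n = homogeneous_elem K n ` unit_hom K n"


section \<open>Comparison map and algebraic localization\<close>

text \<open>Cones are unique up to isomorphism and tt-primes are closed under isomorphism, so it does not
  matter which cone is chosen.\<close>

definition comparison :: "('o, 'm, 'b) ttcategory_scheme \<Rightarrow> 'o set \<Rightarrow> (int \<Rightarrow> 'm) set" where
  "comparison K P = Idl\<^bsub>end_ring K\<^esub>
     {homogeneous_elem K n f | n f. f \<in> unit_hom K n \<and> (\<exists>c. is_cone K f c \<and> c \<notin> P)}"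

text \<open>A further idempotent completion would be fully faithful, so it does not change which objects become
  zero.\<close>

definition localization ::
  "('o, 'm, 'b) ttcategory_scheme \<Rightarrow> (int \<Rightarrow> 'm) set \<Rightarrow> ('o, ('m \<times> 'm) set) category" where
  "localization K p = verdier_quotient K (thick_ideal_gen K
     {c. \<exists>n. \<exists>s\<in>unit_hom K n. homogeneous_elem K n s \<notin> p \<and> is_cone K s c})"

end

theory Submission
  imports Defs
begin

text \<open>For a homogeneous prime \<open>p\<close> let \<open>J\<close> be the thick tensor ideal of the objects killed by some homogeneous
  element outside of \<open>p\<close>, i.e. of the objects that vanish in the localization at \<open>p\<close>. Coherence makes
  \<open>Hom\<^sup>\<bullet>(x, 1)\<close> a finitely generated module for every \<open>x\<close> in \<open>thick\<langle>1\<rangle>\<close>. If \<open>f \<in> p\<close> and \<open>cone(f) \<otimes> x \<in> J\<close>, then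
  multiplication by \<open>f\<close> is surjective on its localization at \<open>p\<close>, which therefore vanishes by Nakayama's
  lemma; as \<open>1\<close> generates, this means \<open>x \<in> J\<close>. Hence cones of elements of \<open>p\<close> can be cancelled modulo \<open>J\<close>,
  and a prime that is maximal among the thick tensor ideals containing \<open>J\<close> but no product of such cones
  lies over \<open>p\<close>. It can also be made to avoid an object \<open>x \<notin> J\<close>, because \<open>x \<otimes> x \<in> J\<close> implies
  \<open>x \<in> J\<close> by rigidity, or to avoid a family of objects outside of \<open>J\<close> that is closed under tensor products.
  A closed set of tt-primes is the intersection of the supports of such a family, so its image consists
  of those \<open>p\<close> at which no member of the family vanishes; this is a closed condition on \<open>p\<close>.\<close>

section \<open>Categories, additive categories and shifts\<close>

text \<open>No localized module is formed: a claim about the localization at \<open>p\<close> is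
  phrased as a claim that holds after multiplication by one homogeneous element outside of
  \<open>p\<close>, and an object vanishes there when such an \<open>s\<close> acts on it as zero,
  i.e. when \<open>s \<boxdot> idt K x\<close> is zero. That this describes the kernel of the
  localization rests on one fact: \<open>f\<close> need not annihilate its own cone, but its square
  does. The same fact makes the elements with cone outside a tt-prime closed under addition, since
  the tensor product of two such cones is killed by the cube of the sum.

  The modules are contravariant, made of arrows from \<open>x\<close> to shifts of the unit. A
  finite free module is thus represented by a sum of shifts of the unit, and generators and
  relations become arrows into such sums that can be chased through triangles.

  The obstacle is bookkeeping: the shift is only an auto-equivalence and the tensor product is not
  strict. Commutativity of the ring therefore enters mostly in the form that exchanging two factors
  costs a factor of degree 0, which every homogeneous ideal absorbs.\<close>

context category
begin

lemma Hom_iff [simp]: "f \<in> Hom K x y \<longleftrightarrow> f \<in> ar K \<and> src K f = x \<and> tgt K f = y"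
  by (simp add: Hom_def)

lemma src_ob [simp]: "f \<in> ar K \<Longrightarrow> src K f \<in> ob K"
  and tgt_ob [simp]: "f \<in> ar K \<Longrightarrow> tgt K f \<in> ob K"
  by (simp_all add: src_tgt)

lemma idt_arrow [simp]:
  "x \<in> ob K \<Longrightarrow> idt K x \<in> ar K" "x \<in> ob K \<Longrightarrow> src K (idt K x) = x" "x \<in> ob K \<Longrightarrow> tgt K (idt K x) = x"
  using idt by auto

lemma cmp_arrow [simp]:
  assumes "f \<in> ar K" "g \<in> ar K" "tgt K f = src K g"
  shows "g \<cdot> f \<in> ar K" "src K (g \<cdot> f) = src K f" "tgt K (g \<cdot> f) = tgt K g"
  using cmp[of f "src K f" "src K g" g "tgt K g"] assms by auto

lemma cmp_idt [simp]:
  "\<lbrakk>f \<in> ar K; tgt K f = y\<rbrakk> \<Longrightarrow> idt K y \<cdot> f = f" "\<lbrakk>f \<in> ar K; src K f = x\<rbrakk> \<Longrightarrow> f \<cdot> idt K x = f"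
  using idt_left[of f] idt_right[of f] by auto

lemma cmp_assoc' [simp]:
  "\<lbrakk>f \<in> ar K; g \<in> ar K; h \<in> ar K; tgt K f = src K g; tgt K g = src K h\<rbrakk> \<Longrightarrow> (h \<cdot> g) \<cdot> f = h \<cdot> g \<cdot> f"
  using cmp_assoc[of f "src K f" "src K g" g "src K h" h] by auto

text \<open>The simplifier nests composites to the right, so an equation between two composites does
  not match at the front of a longer chain. This form applies it there.\<close>

lemma reassoc:
  "\<lbrakk>g \<cdot> f = k; e \<in> ar K; f \<in> ar K; g \<in> ar K; tgt K e = src K f; tgt K f = src K g\<rbrakk> \<Longrightarrow> g \<cdot> f \<cdot> e = k \<cdot> e"
  by (metis cmp_assoc')

definition iso where
  "iso f \<longleftrightarrow> (\<exists>g. is_inverse K f g)"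

definition inva where
  "inva f = (SOME g. is_inverse K f g)"

lemma Iso_iff [simp]: "f \<in> Iso K x y \<longleftrightarrow> f \<in> ar K \<and> src K f = x \<and> tgt K f = y \<and> iso f"
  by (auto simp: Iso_def iso_def)

lemma isoI: "\<lbrakk>f \<in> Hom K x y; g \<in> Hom K y x; g \<cdot> f = idt K x; f \<cdot> g = idt K y\<rbrakk> \<Longrightarrow> iso f"
  unfolding iso_def is_inverse_def by auto

lemma iso_arrow: "iso f \<Longrightarrow> f \<in> ar K"
  by (auto simp: iso_def is_inverse_def)

lemma inva [simp]:
  assumes "iso f"
  shows "inva f \<in> ar K" "src K (inva f) = tgt K f" "tgt K (inva f) = src K f"
    "inva f \<cdot> f = idt K (src K f)" "f \<cdot> inva f = idt K (tgt K f)"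
proof -
  have "is_inverse K f (inva f)" using assms unfolding iso_def inva_def by (auto intro: someI_ex)
  then show "inva f \<in> ar K" "src K (inva f) = tgt K f" "tgt K (inva f) = src K f"
    "inva f \<cdot> f = idt K (src K f)" "f \<cdot> inva f = idt K (tgt K f)" by (auto simp: is_inverse_def)
qed

lemma iso_inva [simp]: "iso f \<Longrightarrow> iso (inva f)"
  using iso_arrow[of f] by (intro isoI[of _ "tgt K f" "src K f" f]) auto

lemma inva_left [simp]: "\<lbrakk>iso f; e \<in> ar K; tgt K e = src K f\<rbrakk> \<Longrightarrow> inva f \<cdot> f \<cdot> e = e"
  and inva_right [simp]: "\<lbrakk>iso f; e \<in> ar K; tgt K e = tgt K f\<rbrakk> \<Longrightarrow> f \<cdot> inva f \<cdot> e = e"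
  by (simp_all add: reassoc[OF inva(4)] reassoc[OF inva(5)] iso_arrow)

lemma iso_idt [simp]: "x \<in> ob K \<Longrightarrow> iso (idt K x)"
  by (rule isoI[of _ x x "idt K x"]) auto

lemma iso_cmp [simp]: "\<lbrakk>iso f; iso g; tgt K f = src K g\<rbrakk> \<Longrightarrow> iso (g \<cdot> f)"
  using iso_arrow[of f] iso_arrow[of g]
  by (intro isoI[of _ "src K f" "tgt K g" "inva f \<cdot> inva g"]) auto

lemma iso_cancel_left: "\<lbrakk>iso f; a \<in> ar K; b \<in> ar K; tgt K a = src K f; tgt K b = src K f; f \<cdot> a = f \<cdot> b\<rbrakk> \<Longrightarrow> a = b"
  by (metis inva_left)

lemma iso_cancel_right:
  assumes "iso f" "a \<in> ar K" "b \<in> ar K" "src K a = tgt K f" "src K b = tgt K f" "a \<cdot> f = b \<cdot> f"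
  shows "a = b"
proof -
  have "(a \<cdot> f) \<cdot> inva f = (b \<cdot> f) \<cdot> inva f" using assms(6) by simp
  then show ?thesis using assms(1-5) by (simp add: iso_arrow)
qed

lemma inva_nat:
  assumes "iso f" "iso f'" "a \<in> Hom K (src K f) (src K f')" "b \<in> Hom K (tgt K f) (tgt K f')" "f' \<cdot> a = b \<cdot> f"
  shows "inva f' \<cdot> b = a \<cdot> inva f"
proof (rule iso_cancel_left[OF assms(2)])
  show "f' \<cdot> inva f' \<cdot> b = f' \<cdot> a \<cdot> inva f"
    using assms(1-4) by (simp add: reassoc[OF assms(5)] iso_arrow)
qed (use assms in \<open>auto simp: iso_arrow\<close>)

end

context additive_category
begin

abbreviation plus_arrow (infixl \<open>\<boxplus>\<close> 65) where "f \<boxplus> g \<equiv> padd K f g"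

lemma hom_group_simps [simp]:
  "carrier (hom_group K x y) = Hom K x y" "mult (hom_group K x y) = padd K" "one (hom_group K x y) = pzero K x y"
  by (simp_all add: hom_group_def)

lemma padd_arrow [simp]:
  assumes "f \<in> ar K" "g \<in> ar K" "src K f = src K g" "tgt K f = tgt K g"
  shows "f \<boxplus> g \<in> ar K" "src K (f \<boxplus> g) = src K g" "tgt K (f \<boxplus> g) = tgt K g"
proof -
  interpret comm_group "hom_group K (src K g) (tgt K g)" using assms by (intro hom_comm_group) auto
  show "f \<boxplus> g \<in> ar K" "src K (f \<boxplus> g) = src K g" "tgt K (f \<boxplus> g) = tgt K g"
    using m_closed[of f g] assms by auto
qed

lemma pzero_arrow [simp]:
  assumes "x \<in> ob K" "y \<in> ob K"
  shows "pzero K x y \<in> ar K" "src K (pzero K x y) = x" "tgt K (pzero K x y) = y"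
proof -
  interpret comm_group "hom_group K x y" using assms by (intro hom_comm_group) auto
  show "pzero K x y \<in> ar K" "src K (pzero K x y) = x" "tgt K (pzero K x y) = y"
    using one_closed by auto
qed

lemma pneg_arrow [simp]:
  assumes "f \<in> ar K"
  shows "pneg K f \<in> ar K" "src K (pneg K f) = src K f" "tgt K (pneg K f) = tgt K f"
proof -
  interpret comm_group "hom_group K (src K f) (tgt K f)" using assms by (intro hom_comm_group) auto
  show "pneg K f \<in> ar K" "src K (pneg K f) = src K f" "tgt K (pneg K f) = tgt K f"
    using inv_closed[of f] assms by (auto simp: pneg_def)
qed

lemma padd_assoc:
  assumes "f \<in> Hom K x y" "g \<in> Hom K x y" "h \<in> Hom K x y"
  shows "f \<boxplus> g \<boxplus> h = f \<boxplus> (g \<boxplus> h)"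
proof -
  interpret comm_group "hom_group K x y" using assms by (intro hom_comm_group) auto
  show ?thesis using m_assoc[of f g h] assms by simp
qed

lemma padd_comm:
  assumes "f \<in> Hom K x y" "g \<in> Hom K x y"
  shows "f \<boxplus> g = g \<boxplus> f"
proof -
  interpret comm_group "hom_group K x y" using assms by (intro hom_comm_group) auto
  show ?thesis using m_comm[of f g] assms by simp
qed

lemma padd_pzero [simp]:
  assumes "f \<in> ar K"
  shows "\<lbrakk>src K f = x; tgt K f = y\<rbrakk> \<Longrightarrow> f \<boxplus> pzero K x y = f"
    and "\<lbrakk>src K f = x; tgt K f = y\<rbrakk> \<Longrightarrow> pzero K x y \<boxplus> f = f"
proof -
  interpret comm_group "hom_group K (src K f) (tgt K f)" using assms by (intro hom_comm_group) auto
  show "\<lbrakk>src K f = x; tgt K f = y\<rbrakk> \<Longrightarrow> f \<boxplus> pzero K x y = f" "\<lbrakk>src K f = x; tgt K f = y\<rbrakk> \<Longrightarrow> pzero K x y \<boxplus> f = f"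
    using r_one[of f] l_one[of f] assms by auto
qed

lemma padd_pneg [simp]:
  assumes "f \<in> ar K"
  shows "f \<boxplus> pneg K f = pzero K (src K f) (tgt K f)" "pneg K f \<boxplus> f = pzero K (src K f) (tgt K f)"
proof -
  interpret comm_group "hom_group K (src K f) (tgt K f)" using assms by (intro hom_comm_group) auto
  show "f \<boxplus> pneg K f = pzero K (src K f) (tgt K f)" "pneg K f \<boxplus> f = pzero K (src K f) (tgt K f)"
    using r_inv[of f] l_inv[of f] assms by (auto simp: pneg_def)
qed

lemma pneg_unique:
  assumes "f \<in> Hom K x y" "g \<in> Hom K x y" "f \<boxplus> g = pzero K x y"
  shows "g = pneg K f"
proof -
  have "g = pneg K f \<boxplus> f \<boxplus> g" using assms by simp
  also have "\<dots> = pneg K f \<boxplus> (f \<boxplus> g)" using assms by (intro padd_assoc) auto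
  finally show ?thesis using assms by simp
qed

lemma padd_pneg_eq_zeroD:
  assumes "f \<in> Hom K x y" "g \<in> Hom K x y" "f \<boxplus> pneg K g = pzero K x y"
  shows "f = g"
proof -
  have "f = f \<boxplus> (pneg K g \<boxplus> g)" using assms by simp
  also have "\<dots> = f \<boxplus> pneg K g \<boxplus> g" using assms by (intro padd_assoc[symmetric]) auto
  finally show ?thesis using assms by simp
qed

lemma padd_pneg_cancel [simp]:
  assumes "f \<in> ar K" "g \<in> ar K" "src K f = src K g" "tgt K f = tgt K g"
  shows "f \<boxplus> pneg K g \<boxplus> g = f" "f \<boxplus> g \<boxplus> pneg K g = f"
  using assms padd_assoc[of f "src K f" "tgt K f" "pneg K g" g] padd_assoc[of f "src K f" "tgt K f" g "pneg K g"]
  by auto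

lemma pneg_pneg [simp]: "f \<in> ar K \<Longrightarrow> pneg K (pneg K f) = f"
  by (rule pneg_unique[symmetric]) auto

lemma pneg_pzero [simp]: "\<lbrakk>x \<in> ob K; y \<in> ob K\<rbrakk> \<Longrightarrow> pneg K (pzero K x y) = pzero K x y"
  by (rule pneg_unique[symmetric]) auto

lemma cmp_padd [simp]:
  assumes "f \<in> ar K" "g \<in> ar K" "src K f = src K g" "tgt K f = tgt K g"
  shows "\<lbrakk>h \<in> ar K; src K h = tgt K f\<rbrakk> \<Longrightarrow> h \<cdot> (f \<boxplus> g) = h \<cdot> f \<boxplus> h \<cdot> g"
    and "\<lbrakk>h \<in> ar K; tgt K h = src K f\<rbrakk> \<Longrightarrow> (f \<boxplus> g) \<cdot> h = f \<cdot> h \<boxplus> g \<cdot> h"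
proof -
  show "h \<cdot> (f \<boxplus> g) = h \<cdot> f \<boxplus> h \<cdot> g" if "h \<in> ar K" "src K h = tgt K f"
    by (rule cmp_padd_right[of _ "src K f" "tgt K f" _ _ "tgt K h"]) (use assms that in \<open>simp_all only: Hom_iff\<close>)
  show "(f \<boxplus> g) \<cdot> h = f \<cdot> h \<boxplus> g \<cdot> h" if "h \<in> ar K" "tgt K h = src K f"
    by (rule cmp_padd_left[of _ "src K h" "src K f" _ "tgt K f"]) (use assms that in \<open>simp_all only: Hom_iff\<close>)
qed

text \<open>Cancellation in the hom group. It is how composition, shifts and tensor products, being
  additive, are shown to preserve zero arrows.\<close>

lemma zero_idem:
  assumes "f \<in> Hom K x y" "f \<boxplus> f = f"
  shows "f = pzero K x y"
proof -
  have "f \<boxplus> f \<boxplus> pneg K f = f" using assms(1) by simp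
  then show ?thesis using assms by simp
qed

lemma cmp_pzero_right [simp]:
  assumes "g \<in> ar K" "src K g = y" "x \<in> ob K"
  shows "g \<cdot> pzero K x y = pzero K x (tgt K g)"
proof -
  have "g \<cdot> pzero K x y \<boxplus> g \<cdot> pzero K x y = g \<cdot> pzero K x y"
    using assms by (subst cmp_padd(1)[symmetric]) auto
  then show ?thesis using assms by (intro zero_idem) auto
qed

lemma cmp_pzero_left [simp]:
  assumes "f \<in> ar K" "tgt K f = y" "z \<in> ob K"
  shows "pzero K y z \<cdot> f = pzero K (src K f) z"
proof -
  have "pzero K y z \<cdot> f \<boxplus> pzero K y z \<cdot> f = pzero K y z \<cdot> f"
    using assms by (subst cmp_padd(2)[symmetric]) auto
  then show ?thesis using assms by (intro zero_idem) auto
qed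

lemma cmp_pneg [simp]:
  assumes "f \<in> ar K" "g \<in> ar K" "tgt K f = src K g"
  shows "pneg K g \<cdot> f = pneg K (g \<cdot> f)" "g \<cdot> pneg K f = pneg K (g \<cdot> f)"
proof -
  show "pneg K g \<cdot> f = pneg K (g \<cdot> f)"
    by (rule pneg_unique[of _ "src K f" "tgt K g"], use assms in simp, use assms in simp, subst cmp_padd(2)[symmetric])
       (use assms in auto)
  show "g \<cdot> pneg K f = pneg K (g \<cdot> f)"
    by (rule pneg_unique[of _ "src K f" "tgt K g"], use assms in simp, use assms in simp, subst cmp_padd(1)[symmetric])
       (use assms in auto)
qed

lemma is_zeroD:
  assumes "idt K z = pzero K z z" "z \<in> ob K" "f \<in> ar K"
  shows "tgt K f = z \<Longrightarrow> f = pzero K (src K f) z" "src K f = z \<Longrightarrow> f = pzero K z (tgt K f)"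
proof -
  assume "tgt K f = z"
  then show "f = pzero K (src K f) z"
    using cmp_idt(1)[of f z] cmp_pzero_left[of f z z] assms by simp
next
  assume "src K f = z"
  then show "f = pzero K z (tgt K f)"
    using cmp_idt(2)[of f z] cmp_pzero_right[of f z z] assms by simp
qed

lemma is_zero_iff: "is_zero K z \<longleftrightarrow> z \<in> ob K \<and> idt K z = pzero K z z"
proof
  assume z: "is_zero K z"
  then have ob: "z \<in> ob K" and ex: "\<exists>!f. f \<in> Hom K z z" by (auto simp: is_zero_def)
  have "idt K z \<in> Hom K z z" "pzero K z z \<in> Hom K z z" using ob by simp_all
  with ex have "idt K z = pzero K z z" by blast
  with ob show "z \<in> ob K \<and> idt K z = pzero K z z" by simp
next
  assume z: "z \<in> ob K \<and> idt K z = pzero K z z"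
  have "\<exists>!f. f \<in> Hom K x z" "\<exists>!f. f \<in> Hom K z x" if "x \<in> ob K" for x
  proof -
    show "\<exists>!f. f \<in> Hom K x z"
      using z that is_zeroD(1)[of z] by (intro ex1I[of _ "pzero K x z"]) auto
    show "\<exists>!f. f \<in> Hom K z x"
      using z that is_zeroD(2)[of z] by (intro ex1I[of _ "pzero K z x"]) auto
  qed
  then show "is_zero K z" using z unfolding is_zero_def by simp
qed

lemma is_zero_ob: "is_zero K z \<Longrightarrow> z \<in> ob K"
  by (simp add: is_zero_def)

lemma to_zero: "\<lbrakk>is_zero K z; f \<in> ar K; tgt K f = z\<rbrakk> \<Longrightarrow> f = pzero K (src K f) z"
  and from_zero: "\<lbrakk>is_zero K z; f \<in> ar K; src K f = z\<rbrakk> \<Longrightarrow> f = pzero K z (tgt K f)"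
  using is_zeroD[of z f] by (auto simp: is_zero_iff)

lemma biproductE:
  assumes "is_biproduct K x y z"
  obtains i p j q where "i \<in> Hom K x z" "p \<in> Hom K z x" "j \<in> Hom K y z" "q \<in> Hom K z y"
    "p \<cdot> i = idt K x" "q \<cdot> j = idt K y" "q \<cdot> i = pzero K x y" "p \<cdot> j = pzero K y x" "i \<cdot> p \<boxplus> j \<cdot> q = idt K z"
  using assms unfolding is_biproduct_def by metis

lemma biproductI:
  assumes "i \<in> Hom K x z" "p \<in> Hom K z x" "j \<in> Hom K y z" "q \<in> Hom K z y"
    "p \<cdot> i = idt K x" "q \<cdot> j = idt K y" "q \<cdot> i = pzero K x y" "p \<cdot> j = pzero K y x" "i \<cdot> p \<boxplus> j \<cdot> q = idt K z"
  shows "is_biproduct K x y z"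
  using assms unfolding is_biproduct_def by blast

end

context category_with_shifts
begin

lemma shift_ob' [simp]: "x \<in> ob K \<Longrightarrow> shift K n x \<in> ob K"
  by (rule shift_ob)

lemma shiftm_arrow [simp]:
  assumes "f \<in> ar K"
  shows "shiftm K n f \<in> ar K" "src K (shiftm K n f) = shift K n (src K f)" "tgt K (shiftm K n f) = shift K n (tgt K f)"
  using shiftm_hom[of f "src K f" "tgt K f"] assms by auto

lemma shiftm_idt' [simp]: "x \<in> ob K \<Longrightarrow> shiftm K n (idt K x) = idt K (shift K n x)"
  by (rule shiftm_idt)

lemma shiftm_cmp' [simp]:
  "\<lbrakk>f \<in> ar K; g \<in> ar K; tgt K f = src K g\<rbrakk> \<Longrightarrow> shiftm K n (g \<cdot> f) = shiftm K n g \<cdot> shiftm K n f"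
  using shiftm_cmp[of f "src K f" "src K g" g "tgt K g"] by auto

lemma shiftm_padd' [simp]:
  "\<lbrakk>f \<in> ar K; g \<in> ar K; src K f = src K g; tgt K f = tgt K g\<rbrakk> \<Longrightarrow> shiftm K n (f \<boxplus> g) = shiftm K n f \<boxplus> shiftm K n g"
  using shiftm_padd[of f "src K f" "tgt K f" g] by auto

lemma shiftm_pzero [simp]:
  assumes "x \<in> ob K" "y \<in> ob K"
  shows "shiftm K n (pzero K x y) = pzero K (shift K n x) (shift K n y)"
  using assms shiftm_padd'[of "pzero K x y" "pzero K x y" n] by (intro zero_idem) auto

lemma shiftm_pneg [simp]: "f \<in> ar K \<Longrightarrow> shiftm K n (pneg K f) = pneg K (shiftm K n f)"
  using shiftm_padd'[of f "pneg K f" n]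
  by (intro pneg_unique[of _ "shift K n (src K f)" "shift K n (tgt K f)"]) auto

lemma shiftm_iso [simp]:
  assumes "iso f"
  shows "iso (shiftm K n f)"
proof -
  have "shiftm K n (inva f) \<cdot> shiftm K n f = idt K (shift K n (src K f))"
    "shiftm K n f \<cdot> shiftm K n (inva f) = idt K (shift K n (tgt K f))"
    using assms shiftm_cmp'[of f "inva f" n] shiftm_cmp'[of "inva f" f n] by (simp_all add: iso_arrow)
  then show ?thesis using assms by (intro isoI[of _ _ _ "shiftm K n (inva f)"]) (auto simp: iso_arrow)
qed

lemma shmul_arrow [simp]:
  assumes "x \<in> ob K"
  shows "shmul K m n x \<in> ar K" "src K (shmul K m n x) = shift K m (shift K n x)"
    "tgt K (shmul K m n x) = shift K (m + n) x"
    "iso (shmul K m n x)"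
  using shmul_iso[OF assms, of m n] by auto

lemma shunit_arrow [simp]:
  assumes "x \<in> ob K"
  shows "shunit K x \<in> ar K" "src K (shunit K x) = x" "tgt K (shunit K x) = shift K 0 x" "iso (shunit K x)"
  using shunit_iso[OF assms] by auto

text \<open>Plays the role of a counit for the equivalence \<open>shift K n\<close>. Its naturality
  yields that shifts are faithful and full.\<close>

definition unshift where
  "unshift (n::int) x = inva (shunit K x) \<cdot> shmul K (- n) n x"

lemma unshift [simp]:
  assumes "x \<in> ob K"
  shows "unshift n x \<in> ar K" "src K (unshift n x) = shift K (- n) (shift K n x)" "tgt K (unshift n x) = x"
    "iso (unshift n x)"
  using assms by (simp_all add: unshift_def)

lemma unshift_nat:
  assumes f: "f \<in> Hom K x y"
  shows "unshift n y \<cdot> shiftm K (- n) (shiftm K n f) = f \<cdot> unshift n x"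
proof -
  have xy: "x \<in> ob K" "y \<in> ob K" using f by auto
  have *: "unshift n y \<cdot> shiftm K (- n) (shiftm K n f) = inva (shunit K y) \<cdot> shiftm K 0 f \<cdot> shmul K (- n) n x"
    using shmul_nat[OF f, of "-n" n] f xy by (simp add: unshift_def)
  have nat: "inva (shunit K y) \<cdot> shiftm K 0 f = f \<cdot> inva (shunit K x)"
    by (rule inva_nat) (use f xy shunit_nat[OF f] in auto)
  have "inva (shunit K y) \<cdot> shiftm K 0 f \<cdot> shmul K (- n) n x = (f \<cdot> inva (shunit K x)) \<cdot> shmul K (- n) n x"
    by (rule reassoc[OF nat]) (use f xy in auto)
  also have "\<dots> = f \<cdot> unshift n x"
    using f xy by (simp add: unshift_def)
  finally show ?thesis using * by simp
qed

lemma shiftm_faithful: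
  assumes "f \<in> Hom K x y" "g \<in> Hom K x y" "shiftm K n f = shiftm K n g"
  shows "f = g"
proof -
  have "f \<cdot> unshift n x = g \<cdot> unshift n x"
    using unshift_nat[OF assms(1), of n] unshift_nat[OF assms(2), of n] assms(3) by metis
  then show ?thesis
    by (rule iso_cancel_right[of "unshift n x", rotated 5]) (use assms(1,2) in auto)
qed

text \<open>The candidate is \<open>b\<close> shifted back by \<open>-n\<close> and conjugated with
  \<open>unshift\<close>. That its shift by \<open>n\<close> is \<open>b\<close> is checked after
  one more shift by \<open>-n\<close>, where faithfulness applies.\<close>

lemma shiftm_full:
  assumes x: "x \<in> ob K" and y: "y \<in> ob K" and b: "b \<in> Hom K (shift K n x) (shift K n y)"
  shows "\<exists>f\<in>Hom K x y. shiftm K n f = b"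
proof
  define f where "f = unshift n y \<cdot> shiftm K (- n) b \<cdot> inva (unshift n x)"
  show f: "f \<in> Hom K x y" using x y b by (simp add: f_def)
  have "unshift n y \<cdot> shiftm K (- n) (shiftm K n f) = unshift n y \<cdot> shiftm K (- n) b"
    using x y b by (simp add: unshift_nat[OF f], simp add: f_def)
  then have "shiftm K (- n) (shiftm K n f) = shiftm K (- n) b"
    by (rule iso_cancel_left[of "unshift n y", rotated 5]) (use x y f b in auto)
  then show "shiftm K n f = b"
    by (rule shiftm_faithful[of _ "shift K n x" "shift K n y" _ "- n", rotated 2]) (use f b in auto)
qed

lemma shift_is_zero: "is_zero K z \<Longrightarrow> is_zero K (shift K n z)"
  unfolding is_zero_iff using shiftm_idt'[of z n] by simp

end

section \<open>Triangles and thick subcategories\<close>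

context triangulated_category
begin

section \<open>Triangles and the exact sequences of hom groups\<close>

definition triangle where
  "triangle x y z f g h \<longleftrightarrow>
     (f, g, h) \<in> tri K \<and> f \<in> Hom K x y \<and> g \<in> Hom K y z \<and> h \<in> Hom K z (shift K 1 x)"

lemma triangle_arrow:
  assumes "triangle x y z f g h"
  shows "f \<in> ar K" "src K f = x" "tgt K f = y" "g \<in> ar K" "src K g = y" "tgt K g = z"
    "h \<in> ar K" "src K h = z" "tgt K h = shift K 1 x" "x \<in> ob K" "y \<in> ob K" "z \<in> ob K"
  using assms by (auto simp: triangle_def)

lemma tri_triangle: "(f, g, h) \<in> tri K \<Longrightarrow> triangle (src K f) (tgt K f) (tgt K g) f g h"
  using tri_hom[of f g h] by (auto simp: triangle_def)

lemma is_cone_iff: "is_cone K f c \<longleftrightarrow> (\<exists>g h. triangle (src K f) (tgt K f) c f g h)"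
  unfolding is_cone_def using tri_triangle[of f] by (metis Hom_iff triangle_def)

lemma triangle_exists:
  assumes "f \<in> Hom K x y"
  shows "\<exists>z g h. triangle x y z f g h"
proof -
  obtain g h where "(f, g, h) \<in> tri K" using tri_cone[of f] assms by auto
  from tri_triangle[OF this] show ?thesis using assms by auto
qed

lemma triangle_rotate:
  assumes "triangle x y z f g h"
  shows "triangle y z (shift K 1 x) g h (pneg K (shiftm K 1 f))"
  using assms tri_rotate[of f x y g z h] by (auto simp: triangle_def)

lemma triangle_idt:
  assumes "x \<in> ob K" "is_zero K z"
  shows "triangle x x z (idt K x) (pzero K x z) (pzero K z (shift K 1 x))"
  using tri_idt[OF assms] assms by (auto simp: triangle_def is_zero_ob)

lemma triangle_from_zero:
  assumes "x \<in> ob K" "is_zero K z"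
  shows "triangle z x x (pzero K z x) (idt K x) (pzero K x (shift K 1 z))"
  using tri_idt[OF assms(1) shift_is_zero[OF assms(2), of 1]]
    tri_rotate[of "pzero K z x" z x "idt K x" x "pzero K x (shift K 1 z)"] assms
  by (auto simp: triangle_def is_zero_ob)

text \<open>Rotating backwards: the third arrow of a triangle on \<open>g\<close> is desuspended by
  fullness of the shift. As rotation introduces a sign, \<open>f\<close> is chosen as a desuspension
  of the negative.\<close>

lemma rotated_triangle_exists:
  assumes g: "g \<in> Hom K y z"
  shows "\<exists>x f h. triangle x y z f g h"
proof -
  obtain c k l where t: "triangle y z c g k l" using triangle_exists[OF g] by blast
  note ta = triangle_arrow[OF t]
  define x where "x = shift K (- 1) c"
  define e where "e = inva (shmul K 1 (- 1) c) \<cdot> shunit K c"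
  have x: "x \<in> ob K" using ta by (simp add: x_def)
  have e: "e \<in> ar K" "src K e = c" "tgt K e = shift K 1 x" "iso e"
    using ta by (simp_all add: e_def x_def)
  obtain f where f: "f \<in> Hom K x y" "shiftm K 1 f = pneg K (l \<cdot> inva e)"
    using shiftm_full[of x y "pneg K (l \<cdot> inva e)" 1] e ta x by auto
  have "(g, e \<cdot> k, l \<cdot> inva e) \<in> tri K"
    by (rule tri_iso[of g k l y z c g y z "e \<cdot> k" "shift K 1 x" "l \<cdot> inva e" "idt K y" "idt K z" e])
       (use t e ta in \<open>auto simp: triangle_def\<close>)
  then have "(g, e \<cdot> k, pneg K (shiftm K 1 f)) \<in> tri K" using f e ta by simp
  then have "(f, g, e \<cdot> k) \<in> tri K"
    using tri_rotate[of f x y g z "e \<cdot> k"] f e ta by simp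
  then have "triangle x y z f g (e \<cdot> k)" using f e ta by (simp add: triangle_def)
  then show ?thesis by blast
qed

lemma triangle_complete:
  assumes "triangle x y z f g h" "triangle x' y' z' f' g' h'" "u \<in> Hom K x x'" "v \<in> Hom K y y'" "f' \<cdot> u = v \<cdot> f"
  shows "\<exists>w\<in>Hom K z z'. g' \<cdot> v = w \<cdot> g \<and> h' \<cdot> w = shiftm K 1 u \<cdot> h"
  by (rule tri_complete[of f g h x y z f' g' h' x' y' z' u v]) (use assms in \<open>simp_all add: triangle_def\<close>)

text \<open>The triangle on \<open>idt K x\<close> maps to the given one, so
  \<open>g \<cdot> f\<close> factors through a zero object. The other two composites follow by
  rotation.\<close>

lemma triangle_cmp:
  assumes "triangle x y z f g h"
  shows "g \<cdot> f = pzero K x z" "h \<cdot> g = pzero K y (shift K 1 x)" "shiftm K 1 f \<cdot> h = pzero K z (shift K 1 y)"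
proof -
  obtain z0 where z0: "is_zero K z0" using zero_object by blast
  have *: "g \<cdot> f = pzero K x z" if t: "triangle x y z f g h" for x y z f g h
  proof -
    note ta = triangle_arrow[OF t]
    obtain w where "w \<in> Hom K z0 z" "g \<cdot> f = w \<cdot> pzero K x z0"
      using triangle_complete[OF triangle_idt[OF ta(10) z0] t, of "idt K x" f] ta by auto
    then show ?thesis using ta z0 by (simp add: is_zero_ob)
  qed
  note ta = triangle_arrow[OF assms]
  show "g \<cdot> f = pzero K x z" "h \<cdot> g = pzero K y (shift K 1 x)"
    using *[OF assms] *[OF triangle_rotate[OF assms]] by auto
  have "pneg K (shiftm K 1 f) \<cdot> h = pzero K z (shift K 1 y)"
    using *[OF triangle_rotate[OF triangle_rotate[OF assms]]] by auto
  then have "pneg K (shiftm K 1 f \<cdot> h) = pzero K z (shift K 1 y)" using ta by simp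
  then have "pneg K (pneg K (shiftm K 1 f \<cdot> h)) = pneg K (pzero K z (shift K 1 y))" by simp
  then show "shiftm K 1 f \<cdot> h = pzero K z (shift K 1 y)" using ta by simp
qed

text \<open>The square from the given triangle to the triangle \<open>0 -> w -> w\<close> is
  completed; its third component is the factorization.\<close>

lemma exact_contra_mid:
  assumes t: "triangle x y z f g h" and a: "a \<in> Hom K y w" "a \<cdot> f = pzero K x w"
  shows "\<exists>b\<in>Hom K z w. a = b \<cdot> g"
proof -
  obtain z0 where z0: "is_zero K z0" using zero_object by blast
  note ta = triangle_arrow[OF t]
  have w: "w \<in> ob K" using a by auto
  show ?thesis
    using triangle_complete[OF t triangle_from_zero[OF w z0], of "pzero K x z0" a] ta a w z0
    by (auto simp: is_zero_ob)
qed

lemma exact_contra_right: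
  assumes t: "triangle x y z f g h" and a: "a \<in> Hom K z w" "a \<cdot> g = pzero K y w"
  shows "\<exists>b\<in>Hom K (shift K 1 x) w. a = b \<cdot> h"
  using exact_contra_mid[OF triangle_rotate[OF t] a] .

lemma exact_contra_shift:
  assumes t: "triangle x y z f g h" and a: "a \<in> Hom K (shift K 1 x) w" "a \<cdot> h = pzero K z w"
  shows "\<exists>b\<in>Hom K (shift K 1 y) w. a = b \<cdot> shiftm K 1 f"
proof -
  note ta = triangle_arrow[OF t]
  obtain b where b: "b \<in> Hom K (shift K 1 y) w" "a = b \<cdot> pneg K (shiftm K 1 f)"
    using exact_contra_right[OF triangle_rotate[OF t] a] by blast
  then show ?thesis using ta by (intro bexI[of _ "pneg K b"]) auto
qed

text \<open>The axiom completes the last arrow of a map of triangles, whereas here the first one is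
  wanted. Both triangles are rotated once, so the factorization appears suspended; fullness and
  faithfulness of the shift remove the suspension.\<close>

lemma exact_co_mid:
  assumes t: "triangle x y z f g h" and a: "a \<in> Hom K w y" "g \<cdot> a = pzero K w z"
  shows "\<exists>b\<in>Hom K w x. a = f \<cdot> b"
proof -
  obtain z0 where z0: "is_zero K z0" using zero_object by blast
  note ta = triangle_arrow[OF t] and z0' = is_zero_ob[OF z0]
  have w: "w \<in> ob K" using a by auto
  obtain c where c: "c \<in> Hom K (shift K 1 w) (shift K 1 x)"
    "pneg K (shiftm K 1 f) \<cdot> c = shiftm K 1 a \<cdot> pneg K (shiftm K 1 (idt K w))"
    using triangle_complete[OF triangle_rotate[OF triangle_idt[OF w z0]] triangle_rotate[OF t], of a "pzero K z0 z"]
      ta a w z0' by auto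
  obtain b where b: "b \<in> Hom K w x" "c = shiftm K 1 b" using shiftm_full[of w x c 1] c w ta by auto
  have "pneg K (shiftm K 1 (f \<cdot> b)) = pneg K (shiftm K 1 a)" using c b ta a w by simp
  then have "pneg K (pneg K (shiftm K 1 (f \<cdot> b))) = pneg K (pneg K (shiftm K 1 a))" by simp
  then have "shiftm K 1 a = shiftm K 1 (f \<cdot> b)" using b ta a by simp
  then have "a = f \<cdot> b"
    by (rule shiftm_faithful[of _ w y, rotated 2]) (use b ta a in auto)
  with b show ?thesis by blast
qed

lemma exact_co_right:
  assumes t: "triangle x y z f g h" and a: "a \<in> Hom K w z" "h \<cdot> a = pzero K w (shift K 1 x)"
  shows "\<exists>b\<in>Hom K w y. a = g \<cdot> b"
  using exact_co_mid[OF triangle_rotate[OF t] a] .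

lemma exact_co_shift:
  assumes t: "triangle x y z f g h" and a: "a \<in> Hom K w (shift K 1 x)" "shiftm K 1 f \<cdot> a = pzero K w (shift K 1 y)"
  shows "\<exists>b\<in>Hom K w z. a = h \<cdot> b"
proof -
  note ta = triangle_arrow[OF t]
  have "pneg K (shiftm K 1 f) \<cdot> a = pzero K w (shift K 1 y)" using ta a by auto
  from exact_co_right[OF triangle_rotate[OF t] a(1) this] show ?thesis .
qed

text \<open>Since the first arrow is zero, the identity of \<open>y\<close> extends over
  \<open>g\<close> and that of \<open>shift K 1 x\<close> lifts along \<open>h\<close>. So the cone
  of a zero arrow contains both objects as retracts.\<close>

lemma split_triangle:
  assumes t: "triangle x y z (pzero K x y) g h"
  shows "\<exists>r\<in>Hom K z y. r \<cdot> g = idt K y" "\<exists>j\<in>Hom K (shift K 1 x) z. h \<cdot> j = idt K (shift K 1 x)"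
proof -
  note ta = triangle_arrow[OF t]
  show "\<exists>r\<in>Hom K z y. r \<cdot> g = idt K y"
    using exact_contra_mid[OF t, of "idt K y" y] ta by force
  show "\<exists>j\<in>Hom K (shift K 1 x) z. h \<cdot> j = idt K (shift K 1 x)"
    using exact_co_shift[OF t, of "idt K (shift K 1 x)"] ta by force
qed

lemma iso_cone_zero:
  assumes t: "triangle x y z f g h" and f: "iso f"
  shows "is_zero K z"
proof -
  note ta = triangle_arrow[OF t]
  have "g = pzero K y z"
    by (rule iso_cancel_right[OF f]) (use triangle_cmp[OF t] ta in auto)
  moreover have "h = pzero K z (shift K 1 x)"
    by (rule iso_cancel_left[OF shiftm_iso[OF f, of 1]]) (use triangle_cmp[OF t] ta in auto)
  ultimately have "idt K z = pzero K z z" using exact_co_right[OF t, of "idt K z" z] ta by auto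
  then show ?thesis using ta by (simp add: is_zero_iff)
qed

text \<open>The complement is the cone of \<open>i\<close>: the connecting arrow \<open>l\<close>
  vanishes because \<open>r\<close> splits \<open>i\<close>, so \<open>k\<close> has a section
  \<open>j0\<close>, and subtracting \<open>i \<cdot> r \<cdot> j0\<close> makes it orthogonal to
  \<open>r\<close>. This lets \<open>thick\<close>, defined by direct summands, be used with
  retracts.\<close>

lemma biproduct_of_retract:
  assumes i: "i \<in> Hom K x c" and r: "r \<in> Hom K c x" and ri: "r \<cdot> i = idt K x"
  shows "\<exists>y\<in>ob K. is_biproduct K x y c"
proof -
  obtain y k l where t: "triangle x c y i k l" using triangle_exists[OF i] by blast
  note ta = triangle_arrow[OF t]
  have "shiftm K 1 i \<cdot> l = pzero K y (shift K 1 c)" by (rule triangle_cmp[OF t])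
  then have "shiftm K 1 r \<cdot> shiftm K 1 i \<cdot> l = pzero K y (shift K 1 x)" using ta r by simp
  moreover have "shiftm K 1 r \<cdot> shiftm K 1 i = idt K (shift K 1 x)"
    using ta r ri shiftm_cmp'[of i r 1] by simp
  from reassoc[OF this, of l] have "shiftm K 1 r \<cdot> shiftm K 1 i \<cdot> l = l" using ta r by simp
  ultimately have l: "l = pzero K y (shift K 1 x)" by simp
  obtain j0 where j0: "j0 \<in> Hom K y c" "idt K y = k \<cdot> j0"
    using exact_co_right[OF t, of "idt K y"] ta l by auto
  define j where "j = j0 \<boxplus> pneg K (i \<cdot> r \<cdot> j0)"
  have j: "j \<in> Hom K y c" using j0 ta r by (simp add: j_def)
  have "k \<cdot> i \<cdot> r \<cdot> j0 = pzero K x y \<cdot> r \<cdot> j0"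
    by (rule reassoc[OF triangle_cmp(1)[OF t]]) (use ta r j0 in auto)
  then have kj: "k \<cdot> j = idt K y" using j0 ta r by (simp add: j_def)
  have "r \<cdot> i \<cdot> r \<cdot> j0 = idt K x \<cdot> r \<cdot> j0" by (rule reassoc[OF ri]) (use ta r j0 in auto)
  then have rj: "r \<cdot> j = pzero K y x" using j0 ta r by (simp add: j_def)
  have "k \<cdot> j \<cdot> k = idt K y \<cdot> k" by (rule reassoc[OF kj]) (use ta j in auto)
  then have "k \<cdot> (idt K c \<boxplus> pneg K (j \<cdot> k)) = pzero K c y" using ta j by simp
  then obtain s where s: "s \<in> Hom K c x" "idt K c \<boxplus> pneg K (j \<cdot> k) = i \<cdot> s"
    using exact_co_mid[OF t, of "idt K c \<boxplus> pneg K (j \<cdot> k)" c] ta j by auto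
  have "r \<cdot> i \<cdot> s = idt K x \<cdot> s" by (rule reassoc[OF ri]) (use ta r s in auto)
  then have "s = r \<cdot> (idt K c \<boxplus> pneg K (j \<cdot> k))" using s by simp
  also have "\<dots> = r \<boxplus> pneg K (r \<cdot> j \<cdot> k)" using ta r j by simp
  also have "r \<cdot> j \<cdot> k = pzero K y x \<cdot> k" by (rule reassoc[OF rj]) (use ta r j in auto)
  finally have "s = r" using ta r by simp
  then have "i \<cdot> r \<boxplus> j \<cdot> k = idt K c \<boxplus> pneg K (j \<cdot> k) \<boxplus> j \<cdot> k" using s by simp
  also have "\<dots> = idt K c" using ta j by simp
  finally have "is_biproduct K x y c"
    by (intro biproductI[of i x c r j y k]) (use i r j ta ri rj kj triangle_cmp(1)[OF t] in auto)
  with ta show ?thesis by blast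
qed

section \<open>Thick subcategories and arrows with cone in them\<close>

lemma thickD:
  assumes "thick K T"
  shows thick_ob: "x \<in> T \<Longrightarrow> x \<in> ob K"
    and thick_zero: "is_zero K z \<Longrightarrow> z \<in> T"
    and thick_shift: "x \<in> T \<Longrightarrow> shift K n x \<in> T"
    and thick_third: "\<lbrakk>triangle x y z f g h; x \<in> T; y \<in> T\<rbrakk> \<Longrightarrow> z \<in> T"
    and thick_retract: "\<lbrakk>y \<in> T; i \<in> Hom K x y; r \<in> Hom K y x; r \<cdot> i = idt K x\<rbrakk> \<Longrightarrow> x \<in> T"
proof -
  show "x \<in> T \<Longrightarrow> x \<in> ob K" "is_zero K z \<Longrightarrow> z \<in> T" "x \<in> T \<Longrightarrow> shift K n x \<in> T"
    using assms unfolding thick_def by blast+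
  assume t: "triangle x y z f g h" and xy: "x \<in> T" "y \<in> T"
  have "is_cone K f z" "f \<in> Hom K x y"
    using t triangle_arrow[OF t] by (auto simp: is_cone_iff)
  then show "z \<in> T" using assms xy unfolding thick_def by blast
next
  assume yirx: "y \<in> T" "i \<in> Hom K x y" "r \<in> Hom K y x" "r \<cdot> i = idt K x"
  then obtain w where "w \<in> ob K" "is_biproduct K x w y" using biproduct_of_retract by blast
  moreover have "x \<in> ob K" using yirx by auto
  ultimately show "x \<in> T" using assms yirx(1) unfolding thick_def by blast
qed

lemma thickI:
  assumes "T \<subseteq> ob K" "\<And>z. is_zero K z \<Longrightarrow> z \<in> T" "\<And>x n. x \<in> T \<Longrightarrow> shift K n x \<in> T"
    "\<And>x y z f g h. \<lbrakk>triangle x y z f g h; x \<in> T; y \<in> T\<rbrakk> \<Longrightarrow> z \<in> T"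
    "\<And>x y i r. \<lbrakk>y \<in> T; i \<in> Hom K x y; r \<in> Hom K y x; r \<cdot> i = idt K x\<rbrakk> \<Longrightarrow> x \<in> T"
  shows "thick K T"
  unfolding thick_def
proof (intro conjI allI impI ballI)
  show "c \<in> T" if "f \<in> Hom K x y \<and> x \<in> T \<and> y \<in> T \<and> is_cone K f c" for f x y c
    using that assms(4)[of x y c f] by (auto simp: is_cone_iff)
  show "x \<in> T" if "x \<in> ob K" "y \<in> ob K" "z \<in> T" "is_biproduct K x y z" for x y z
    using that(4) by (rule biproductE) (use assms(5)[OF that(3)] in blast)
qed (use assms in auto)

context
  fixes T assumes T: "thick K T"
begin

lemma thick_iso:
  assumes "x \<in> T" "u \<in> Hom K x y" "iso u"
  shows "y \<in> T"
  by (rule thick_retract[OF T assms(1), of "inva u" y u]) (use assms in auto)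

lemma thick_unshift:
  assumes "shift K n x \<in> T" "x \<in> ob K"
  shows "x \<in> T"
  by (rule thick_iso[OF thick_shift[OF T assms(1), of "- n"], of "unshift n x"]) (use assms in auto)

lemma thick_first:
  assumes "triangle x y z f g h" "y \<in> T" "z \<in> T"
  shows "x \<in> T"
  using thick_unshift[OF thick_third[OF T triangle_rotate[OF assms(1)] assms(2,3)]] triangle_arrow[OF assms(1)] by simp

lemma thick_second:
  assumes "triangle x y z f g h" "x \<in> T" "z \<in> T"
  shows "y \<in> T"
  using thick_first[OF triangle_rotate[OF assms(1)] assms(3) thick_shift[OF T assms(2)]] .

text \<open>The cone \<open>c\<close> of the inclusion \<open>i\<close> is a retract of
  \<open>y\<close>: the difference \<open>e\<close> of \<open>(g \<cdot> j) \<cdot> b\<close> and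
  the identity vanishes on \<open>g\<close>, hence factors through \<open>h\<close>, and
  \<open>h\<close> is zero because \<open>p\<close> splits \<open>i\<close>.\<close>

lemma thick_biproduct:
  assumes "is_biproduct K x y z" "x \<in> T" "y \<in> T"
  shows "z \<in> T"
  using assms(1)
proof (rule biproductE)
  fix i p j q
  assume *: "i \<in> Hom K x z" "p \<in> Hom K z x" "j \<in> Hom K y z" "q \<in> Hom K z y"
    "p \<cdot> i = idt K x" "q \<cdot> j = idt K y" "q \<cdot> i = pzero K x y" "p \<cdot> j = pzero K y x" "i \<cdot> p \<boxplus> j \<cdot> q = idt K z"
  obtain c g h where t: "triangle x z c i g h" using triangle_exists[OF *(1)] by blast
  note ta = triangle_arrow[OF t]
  obtain b where b: "b \<in> Hom K c y" "q = b \<cdot> g" using exact_contra_mid[OF t *(4,7)] by blast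
  have "g \<cdot> i \<cdot> p \<boxplus> g \<cdot> j \<cdot> q = g \<cdot> (i \<cdot> p \<boxplus> j \<cdot> q)" using *(1-4) ta by simp
  moreover have "\<dots> = g" using *(9) ta by simp
  moreover have "g \<cdot> i \<cdot> p = pzero K x c \<cdot> p" by (rule reassoc[OF triangle_cmp(1)[OF t]]) (use * ta in auto)
  ultimately have "g \<cdot> j \<cdot> q = g" using * ta by simp
  then have g: "(g \<cdot> j \<cdot> b) \<cdot> g = g" using * ta b by simp
  define e where "e = g \<cdot> j \<cdot> b \<boxplus> pneg K (idt K c)"
  have e: "e \<in> Hom K c c" using * ta b by (simp add: e_def)
  have "e \<cdot> g = pzero K z c" using g * ta b by (simp add: e_def)
  then obtain d where d: "d \<in> Hom K (shift K 1 x) c" "e = d \<cdot> h" using exact_contra_right[OF t] e by blast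
  have "shiftm K 1 i \<cdot> h = pzero K c (shift K 1 z)" by (rule triangle_cmp[OF t])
  then have "shiftm K 1 p \<cdot> shiftm K 1 i \<cdot> h = pzero K c (shift K 1 x)" using * ta by simp
  moreover have "shiftm K 1 p \<cdot> shiftm K 1 i = idt K (shift K 1 x)"
    using ta * shiftm_cmp'[of i p 1] by simp
  from reassoc[OF this, of h] have "shiftm K 1 p \<cdot> shiftm K 1 i \<cdot> h = h" using ta * by simp
  ultimately have "h = pzero K c (shift K 1 x)" by simp
  then have "e = pzero K c c" using d ta by auto
  then have gjb: "(g \<cdot> j) \<cdot> b = idt K c"
    using padd_pneg_eq_zeroD[of "g \<cdot> j \<cdot> b" c c "idt K c"] * ta b by (auto simp: e_def)
  have "c \<in> T" by (rule thick_retract[OF T assms(3), of b c "g \<cdot> j"]) (use gjb * ta b in auto)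
  then show "z \<in> T" using thick_second[OF t assms(2)] by blast
qed

text \<open>Membership does not depend on the chosen cone: the octahedron for \<open>f\<close>
  followed by an identity puts two cones of \<open>f\<close> and a zero object into one
  triangle.\<close>

lemma cone_in_iff:
  assumes "f \<in> ar K" "is_cone K f c"
  shows "f \<in> cone_in K T \<longleftrightarrow> c \<in> T"
proof
  assume "f \<in> cone_in K T"
  then obtain r where "r \<in> T" "is_cone K f r" by (auto simp: cone_in_def)
  then obtain a b k l where ab: "triangle (src K f) (tgt K f) r f a b" and kl: "triangle (src K f) (tgt K f) c f k l"
    using assms by (auto simp: is_cone_iff)
  obtain z0 where z0: "is_zero K z0" using zero_object by blast
  define y where "y = tgt K f"
  have y: "y \<in> ob K" using assms by (simp add: y_def)
  note t0 = triangle_idt[OF y z0]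
  have "\<exists>p\<in>Hom K r c. \<exists>q\<in>Hom K c z0. (p, q, shiftm K 1 a \<cdot> pzero K z0 (shift K 1 y)) \<in> tri K"
    using octahedral[of f "src K f" y "idt K y" y a b r "pzero K y z0" "pzero K z0 (shift K 1 y)" z0 k l c]
      ab kl t0 by (auto simp: triangle_def y_def)
  then obtain p q m where "triangle r c z0 p q m" using tri_triangle by force
  then show "c \<in> T" using thick_second \<open>r \<in> T\<close> thick_zero[OF T z0] by blast
qed (use assms in \<open>auto simp: cone_in_def\<close>)

lemma cone_in_cmp:
  assumes "f \<in> cone_in K T" "g \<in> cone_in K T" "tgt K f = src K g"
  shows "g \<cdot> f \<in> cone_in K T"
proof -
  have ar: "f \<in> ar K" "g \<in> ar K" using assms by (auto simp: cone_in_def)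
  obtain r a b where ab: "triangle (src K f) (tgt K f) r f a b" "r \<in> T"
    using assms by (auto simp: cone_in_def is_cone_iff)
  obtain t c d where cd: "triangle (tgt K f) (tgt K g) t g c d" "t \<in> T"
    using assms by (auto simp: cone_in_def is_cone_iff)
  obtain s k l where kl: "triangle (src K f) (tgt K g) s (g \<cdot> f) k l"
    using triangle_exists[of "g \<cdot> f" "src K f" "tgt K g"] ar assms by auto
  have "\<exists>p\<in>Hom K r s. \<exists>q\<in>Hom K s t. (p, q, shiftm K 1 a \<cdot> d) \<in> tri K"
    using octahedral[of f "src K f" "tgt K f" g "tgt K g" a b r c d t k l s]
      ab cd kl by (auto simp: triangle_def)
  then obtain p q m where "triangle r s t p q m" using tri_triangle by force
  then have "s \<in> T" using thick_second ab cd by blast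
  moreover have "is_cone K (g \<cdot> f) s" using kl ar assms by (auto simp: is_cone_iff)
  ultimately show ?thesis using ar assms by (auto simp: cone_in_def)
qed

lemma cone_in_iso:
  assumes "iso f"
  shows "f \<in> cone_in K T"
proof -
  obtain z g h where t: "triangle (src K f) (tgt K f) z f g h"
    using triangle_exists[of f] iso_arrow[OF assms] by auto
  then have "z \<in> T" using iso_cone_zero[OF t assms] thick_zero[OF T] by blast
  with t show ?thesis using iso_arrow[OF assms] by (auto simp: cone_in_def is_cone_iff)
qed

lemma cone_in_conj:
  assumes "f \<in> cone_in K T" "iso u" "iso v" "f' \<cdot> u = v \<cdot> f" "f' \<in> Hom K (tgt K u) (tgt K v)"
    "src K u = src K f" "src K v = tgt K f"
  shows "f' \<in> cone_in K T"
proof -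
  have "f \<in> ar K" using assms by (auto simp: cone_in_def)
  have "f' = f' \<cdot> u \<cdot> inva u" using assms(2,5) by (simp add: iso_arrow)
  also have "\<dots> = (v \<cdot> f) \<cdot> inva u"
    by (rule reassoc[OF assms(4)]) (use assms(2,5) in \<open>auto simp: iso_arrow\<close>)
  finally have "f' = v \<cdot> f \<cdot> inva u" using assms(2,3,6,7) \<open>f \<in> ar K\<close> by (simp add: iso_arrow)
  moreover have "f \<cdot> inva u \<in> cone_in K T"
    by (rule cone_in_cmp[OF cone_in_iso]) (use assms in auto)
  then have "v \<cdot> f \<cdot> inva u \<in> cone_in K T"
    by (rule cone_in_cmp[OF _ cone_in_iso]) (use assms \<open>f \<in> ar K\<close> in auto)
  ultimately show ?thesis by simp
qed

lemma cone_in_zero: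
  assumes "pzero K x y \<in> cone_in K T" "x \<in> ob K" "y \<in> ob K"
  shows "x \<in> T" "y \<in> T"
proof -
  obtain z g h where t: "triangle x y z (pzero K x y) g h" "z \<in> T"
    using assms by (auto simp: cone_in_def is_cone_iff)
  note ta = triangle_arrow[OF t(1)]
  show "y \<in> T" using split_triangle(1)[OF t(1)] thick_retract[OF T t(2), of g y] ta by auto
  have "shift K 1 x \<in> T" using split_triangle(2)[OF t(1)] thick_retract[OF T t(2), of _ "shift K 1 x" h] ta by auto
  then show "x \<in> T" using thick_unshift assms by blast
qed

end

end

section \<open>Zero objects of Verdier quotients\<close>

context triangulated_category
begin

context
  fixes J assumes J: "thick K J"
begin

text \<open>A weak pullback: \<open>u\<close> is the fibre of \<open>s\<close> followed by the cone
  map \<open>g\<close> of \<open>s'\<close>. Hence \<open>u\<close> and \<open>s'\<close> have the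
  same cone \<open>c\<close>, and \<open>s \<cdot> u\<close>, being killed by \<open>g\<close>,
  lifts along \<open>s'\<close>.\<close>

lemma ore:
  assumes "s \<in> cone_in K J" "s' \<in> cone_in K J" "tgt K s = tgt K s'"
  shows "\<exists>w. \<exists>u\<in>Hom K w (src K s). \<exists>v\<in>Hom K w (src K s'). s \<cdot> u = s' \<cdot> v \<and> u \<in> cone_in K J"
proof -
  have ar: "s \<in> ar K" "s' \<in> ar K" using assms by (auto simp: cone_in_def)
  obtain c g h where t: "triangle (src K s') (tgt K s') c s' g h" "c \<in> J"
    using assms by (auto simp: cone_in_def is_cone_iff)
  note ta = triangle_arrow[OF t(1)]
  obtain w u k where t2: "triangle w (src K s) c u (g \<cdot> s) k"
    using rotated_triangle_exists[of "g \<cdot> s" "src K s" c] ar assms ta by auto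
  note ta2 = triangle_arrow[OF t2]
  have "g \<cdot> s \<cdot> u = pzero K w c" using triangle_cmp(1)[OF t2] ta ta2 ar assms by simp
  then obtain v where v: "v \<in> Hom K w (src K s')" "s \<cdot> u = s' \<cdot> v"
    using exact_co_mid[OF t(1), of "s \<cdot> u" w] ta ta2 ar assms by auto
  have "is_cone K u c" using t2 ta2 by (auto simp: is_cone_iff)
  then have u: "u \<in> cone_in K J" using \<open>c \<in> J\<close> ta2 by (auto simp: cone_in_def)
  show ?thesis
    by (rule exI[of _ w], rule bexI[of _ u], rule bexI[of _ v]) (use u v ta2 in auto)
qed

lemma image_singletonI: "\<lbrakk>a \<in> X; \<And>b. b \<in> X \<Longrightarrow> g b = g a\<rbrakk> \<Longrightarrow> g ` X = {g a}"
  by blast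

lemma roof_rel_iff:
  "((s, f), (s', f')) \<in> roof_rel K J \<longleftrightarrow> (s, f) \<in> roofs K J \<and> (s', f') \<in> roofs K J \<and>
     tgt K s = tgt K s' \<and> tgt K f = tgt K f' \<and>
     (\<exists>w. \<exists>u\<in>Hom K w (src K s). \<exists>v\<in>Hom K w (src K s').
        s \<cdot> u = s' \<cdot> v \<and> f \<cdot> u = f' \<cdot> v \<and> s \<cdot> u \<in> cone_in K J)"
  by (simp add: roof_rel_def)

lemma roofsD: "(s, f) \<in> roofs K J \<Longrightarrow> s \<in> ar K \<and> f \<in> ar K \<and> src K s = src K f \<and> s \<in> cone_in K J"
  by (auto simp: roofs_def cone_in_def)

lemma roof_rel_refl:
  assumes "(s, f) \<in> roofs K J"
  shows "((s, f), (s, f)) \<in> roof_rel K J"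
proof -
  have ar: "s \<in> ar K" "f \<in> ar K" "src K s = src K f" "s \<in> cone_in K J"
    using assms by (auto simp: roofs_def cone_in_def)
  have "\<exists>w. \<exists>u\<in>Hom K w (src K s). \<exists>v\<in>Hom K w (src K s). s \<cdot> u = s \<cdot> v \<and> f \<cdot> u = f \<cdot> v \<and> s \<cdot> u \<in> cone_in K J"
    by (rule exI[of _ "src K f"], rule bexI[of _ "idt K (src K f)"], rule bexI[of _ "idt K (src K f)"])
       (use ar in auto)
  with assms show ?thesis by (intro iffD2[OF roof_rel_iff] conjI refl)
qed

lemma verdier_ob: "ob (verdier_quotient K J) = ob K"
  by (simp add: verdier_quotient_def)

lemma verdier_Hom_iff:
  "A \<in> Hom (verdier_quotient K J) x y \<longleftrightarrow>
     (\<exists>s f. (s, f) \<in> roofs K J \<and> tgt K s = x \<and> tgt K f = y \<and> A = roof_rel K J `` {(s, f)})"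
proof -
  let ?Q = "verdier_quotient K J"
  have *: "src ?Q (roof_rel K J `` {(s, f)}) = tgt K s" "tgt ?Q (roof_rel K J `` {(s, f)}) = tgt K f"
    if "(s, f) \<in> roofs K J" for s f
  proof -
    have 1: "(s, f) \<in> roof_rel K J `` {(s, f)}" using roof_rel_refl[OF that] by simp
    have 2: "tgt K (fst b) = tgt K s \<and> tgt K (snd b) = tgt K f" if "b \<in> roof_rel K J `` {(s, f)}" for b
      using that unfolding roof_rel_def by (cases b) (simp only: Image_singleton_iff mem_Collect_eq case_prod_conv fst_conv snd_conv)
    have "(\<lambda>(s, f). tgt K s) ` (roof_rel K J `` {(s, f)}) = {tgt K s}"
      "(\<lambda>(s, f). tgt K f) ` (roof_rel K J `` {(s, f)}) = {tgt K f}"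
      using image_singletonI[OF 1, of "\<lambda>(s, f). tgt K s"] image_singletonI[OF 1, of "\<lambda>(s, f). tgt K f"] 2 by (simp_all add: case_prod_beta)
    then show "src ?Q (roof_rel K J `` {(s, f)}) = tgt K s" "tgt ?Q (roof_rel K J `` {(s, f)}) = tgt K f"
      by (simp_all add: verdier_quotient_def)
  qed
  have "A \<in> Hom ?Q x y \<longleftrightarrow> A \<in> roofs K J // roof_rel K J \<and> src ?Q A = x \<and> tgt ?Q A = y"
    by (simp add: Hom_def verdier_quotient_def)
  also have "A \<in> roofs K J // roof_rel K J \<longleftrightarrow> (\<exists>s f. (s, f) \<in> roofs K J \<and> A = roof_rel K J `` {(s, f)})"
    by (auto simp: quotient_def)
  finally show ?thesis using * by metis
qed

lemma idt_roof: "f \<in> Hom K x y \<Longrightarrow> (idt K x, f) \<in> roofs K J"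
  using cone_in_iso[OF J iso_idt, of x] by (auto simp: roofs_def)

text \<open>If any two roofs from \<open>x\<close> to \<open>y\<close> have a common refinement,
  each class is the set of all such roofs; the zero roof shows that there is one.\<close>

lemma verdier_unique:
  assumes "x \<in> ob K" "y \<in> ob K"
    and "\<And>s f s' f'. \<lbrakk>(s, f) \<in> roofs K J; (s', f') \<in> roofs K J; tgt K s = x; tgt K s' = x; tgt K f = y; tgt K f' = y\<rbrakk>
       \<Longrightarrow> \<exists>w. \<exists>u\<in>Hom K w (src K s). \<exists>v\<in>Hom K w (src K s').
        s \<cdot> u = s' \<cdot> v \<and> f \<cdot> u = f' \<cdot> v \<and> s \<cdot> u \<in> cone_in K J"
  shows "\<exists>!A. A \<in> Hom (verdier_quotient K J) x y"
proof -
  have r: "((s, f), (s', f')) \<in> roof_rel K J"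
    if "(s, f) \<in> roofs K J" "(s', f') \<in> roofs K J" "tgt K s = x" "tgt K s' = x" "tgt K f = y" "tgt K f' = y"
    for s f s' f'
  proof -
    have "tgt K s = tgt K s'" "tgt K f = tgt K f'" using that by simp_all
    then show ?thesis using that(1,2) assms(3)[OF that] by (intro iffD2[OF roof_rel_iff] conjI)
  qed
  have all: "roof_rel K J `` {(s, f)} = {(s', f'). (s', f') \<in> roofs K J \<and> tgt K s' = x \<and> tgt K f' = y}"
    if "(s, f) \<in> roofs K J" "tgt K s = x" "tgt K f = y" for s f
  proof -
    have "((s, f), (s', f')) \<in> roof_rel K J \<longleftrightarrow> (s', f') \<in> roofs K J \<and> tgt K s' = x \<and> tgt K f' = y" for s' f'
      using that r[of s f s' f'] unfolding roof_rel_iff by metis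
    then show ?thesis by auto
  qed
  have z: "(idt K x, pzero K x y) \<in> roofs K J" using assms by (intro idt_roof) auto
  show ?thesis
  proof (rule ex1I[of _ "roof_rel K J `` {(idt K x, pzero K x y)}"])
    show "roof_rel K J `` {(idt K x, pzero K x y)} \<in> Hom (verdier_quotient K J) x y"
      unfolding verdier_Hom_iff using z assms(1,2) by (intro exI[of _ "idt K x"] exI[of _ "pzero K x y"]) simp
    show "A = roof_rel K J `` {(idt K x, pzero K x y)}" if A: "A \<in> Hom (verdier_quotient K J) x y" for A
    proof -
      obtain s f where "(s, f) \<in> roofs K J" "tgt K s = x" "tgt K f = y" "A = roof_rel K J `` {(s, f)}"
        using A unfolding verdier_Hom_iff by blast
      then show ?thesis using all[of s f] all[OF z] assms(1,2) by simp
    qed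
  qed
qed

text \<open>A zero object gets identified with the zero roof, so that \<open>0 : w \<rightarrow> x\<close> has a cone in \<open>J\<close>
  for some \<open>w\<close>; this cone contains \<open>x\<close> as a summand.\<close>

lemma verdier_zero_iff: "is_zero (verdier_quotient K J) x \<longleftrightarrow> x \<in> J"
proof
  assume z: "is_zero (verdier_quotient K J) x"
  then have x: "x \<in> ob K" by (simp add: is_zero_def verdier_ob)
  then have "\<exists>!A. A \<in> Hom (verdier_quotient K J) x x"
    by (rule bspec[OF conjunct2[OF z[unfolded is_zero_def verdier_ob]], THEN conjunct1])
  moreover have r: "roof_rel K J `` {(idt K x, f)} \<in> Hom (verdier_quotient K J) x x" if "f \<in> Hom K x x" for f
    unfolding verdier_Hom_iff using idt_roof[OF that] that x by (intro exI[of _ "idt K x"] exI[of _ f]) simp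
  have "roof_rel K J `` {(idt K x, idt K x)} \<in> Hom (verdier_quotient K J) x x"
    "roof_rel K J `` {(idt K x, pzero K x x)} \<in> Hom (verdier_quotient K J) x x"
    using x by (simp_all add: r)
  ultimately have "roof_rel K J `` {(idt K x, idt K x)} = roof_rel K J `` {(idt K x, pzero K x x)}"
    by blast
  moreover have "(idt K x, pzero K x x) \<in> roof_rel K J `` {(idt K x, pzero K x x)}"
    using roof_rel_refl[OF idt_roof[of "pzero K x x" x x]] x by simp
  ultimately have "(idt K x, pzero K x x) \<in> roof_rel K J `` {(idt K x, idt K x)}"
    by (rule equalityD2[THEN subsetD])
  then have "((idt K x, idt K x), (idt K x, pzero K x x)) \<in> roof_rel K J" by simp
  then obtain w u v where uv: "u \<in> Hom K w (src K (idt K x))" "v \<in> Hom K w (src K (idt K x))"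
    "idt K x \<cdot> u = idt K x \<cdot> v" "idt K x \<cdot> u = pzero K x x \<cdot> v" "idt K x \<cdot> u \<in> cone_in K J"
    unfolding roof_rel_iff by blast
  have "idt K x \<cdot> u = pzero K w x" using uv(2) x unfolding uv(4) by simp
  moreover have "w \<in> ob K" using uv(1) by auto
  ultimately show "x \<in> J" using cone_in_zero(2)[OF J, of w x] uv(5) x by simp
next
  assume x: "x \<in> J"
  then have xo: "x \<in> ob K" using thick_ob[OF J] by blast
  obtain z0 where z0: "is_zero K z0" using zero_object by blast
  have z0': "z0 \<in> ob K" "z0 \<in> J" using z0 is_zero_ob thick_zero[OF J] by auto
  have zx: "pzero K z0 x \<in> cone_in K J"
    using triangle_from_zero[OF xo z0] x xo z0' by (auto simp: cone_in_def is_cone_iff)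
  have "\<exists>!A. A \<in> Hom (verdier_quotient K J) y x" if y: "y \<in> ob K" for y
  proof (rule verdier_unique[OF y xo])
    fix s f s' f'
    assume *: "(s, f) \<in> roofs K J" "(s', f') \<in> roofs K J" "tgt K s = y" "tgt K s' = y" "tgt K f = x" "tgt K f' = x"
    have ar: "s \<in> ar K" "f \<in> ar K" "src K s = src K f" "s' \<in> ar K" "f' \<in> ar K" "src K s' = src K f'"
      "s \<in> cone_in K J" "s' \<in> cone_in K J"
      using roofsD[OF *(1)] roofsD[OF *(2)] by blast+
    obtain w u v where uv: "u \<in> Hom K w (src K s)" "v \<in> Hom K w (src K s')" "s \<cdot> u = s' \<cdot> v" "u \<in> cone_in K J"
      using ore[of s s'] ar * by auto
    \<comment> \<open>After passing to a common denominator, \<open>e\<close> is the fibre of the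
      difference of the two numerators. It equalizes them, and its cone is \<open>x\<close>, which
      lies in \<open>J\<close>.\<close>
    obtain w' e h where t: "triangle w' w x e (f \<cdot> u \<boxplus> pneg K (f' \<cdot> v)) h"
      using rotated_triangle_exists[of "f \<cdot> u \<boxplus> pneg K (f' \<cdot> v)" w x] uv ar * by auto
    note ta = triangle_arrow[OF t]
    have "f \<cdot> u \<cdot> e \<boxplus> pneg K (f' \<cdot> v \<cdot> e) = pzero K w' x"
      using triangle_cmp(1)[OF t] ta uv ar * by simp
    then have e1: "f \<cdot> u \<cdot> e = f' \<cdot> v \<cdot> e"
      by (rule padd_pneg_eq_zeroD[rotated 2]) (use ta uv ar * in auto)
    have e2: "s \<cdot> u \<cdot> e = s' \<cdot> v \<cdot> e"
      using reassoc[OF uv(3), of e] uv ta ar * by simp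
    have "e \<in> cone_in K J" using t x ta by (auto simp: cone_in_def is_cone_iff)
    then have e3: "s \<cdot> u \<cdot> e \<in> cone_in K J"
      by (intro cone_in_cmp[OF J cone_in_cmp[OF J _ uv(4)] ar(7)]) (use uv(1) ta ar(1) in auto)
    show "\<exists>w. \<exists>u\<in>Hom K w (src K s). \<exists>v\<in>Hom K w (src K s').
        s \<cdot> u = s' \<cdot> v \<and> f \<cdot> u = f' \<cdot> v \<and> s \<cdot> u \<in> cone_in K J"
      by (rule exI[of _ w'], rule bexI[of _ "u \<cdot> e"], rule bexI[of _ "v \<cdot> e"]) (use e1 e2 e3 uv(1,2) ta in simp_all)
  qed
  moreover have "\<exists>!A. A \<in> Hom (verdier_quotient K J) x y" if y: "y \<in> ob K" for y
  proof (rule verdier_unique[OF xo y])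
    fix s f s' f'
    assume *: "(s, f) \<in> roofs K J" "(s', f') \<in> roofs K J" "tgt K s = x" "tgt K s' = x" "tgt K f = y" "tgt K f' = y"
    have ar: "s \<in> ar K" "f \<in> ar K" "src K s = src K f" "s' \<in> ar K" "f' \<in> ar K" "src K s' = src K f'"
      using roofsD[OF *(1)] roofsD[OF *(2)] by blast+
    \<comment> \<open>Both denominators end in \<open>x\<close>, so composing with a zero arrow from
      \<open>z0\<close> gives the arrow from \<open>z0\<close> to \<open>x\<close>, whose cone is
      \<open>x\<close> itself.\<close>
    show "\<exists>w. \<exists>u\<in>Hom K w (src K s). \<exists>v\<in>Hom K w (src K s').
        s \<cdot> u = s' \<cdot> v \<and> f \<cdot> u = f' \<cdot> v \<and> s \<cdot> u \<in> cone_in K J"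
      by (rule exI[of _ z0], rule bexI[of _ "pzero K z0 (src K s)"], rule bexI[of _ "pzero K z0 (src K s')"])
         (use z0' zx ar * in simp_all)
  qed
  ultimately show "is_zero (verdier_quotient K J) x"
    using xo unfolding is_zero_def verdier_ob by (intro conjI ballI)
qed

end

end

section \<open>Moving suspensions out of tensor products\<close>

context category
begin

text \<open>Naturality squares in a form that can be pasted: \<open>u\<close> and \<open>u'\<close>
  are components of a transformation, \<open>f\<close> and \<open>f'\<close> the values of two
  functors at one arrow.\<close>

definition square where
  "square u u' f f' \<longleftrightarrow> f \<in> ar K \<and> f' \<in> ar K \<and> u \<in> Hom K (src K f) (src K f') \<and>
     u' \<in> Hom K (tgt K f) (tgt K f') \<and> u' \<cdot> f = f' \<cdot> u"

lemma square_idt: "f \<in> ar K \<Longrightarrow> square (idt K (src K f)) (idt K (tgt K f)) f f"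
  by (simp add: square_def)

lemma square_cmp:
  assumes "square u u' f f'" "square v v' f' f''"
  shows "square (v \<cdot> u) (v' \<cdot> u') f f''"
proof -
  have "v' \<cdot> u' \<cdot> f = v' \<cdot> f' \<cdot> u" using assms by (simp add: square_def)
  also have "\<dots> = (f'' \<cdot> v) \<cdot> u"
    by (rule reassoc) (use assms in \<open>auto simp: square_def\<close>)
  finally show ?thesis using assms by (simp add: square_def)
qed

lemma square_inva:
  assumes "square u u' f f'" "iso u" "iso u'"
  shows "square (inva u) (inva u') f' f"
proof -
  have "inva u' \<cdot> f' = f \<cdot> inva u"
    by (rule inva_nat) (use assms in \<open>auto simp: square_def\<close>)
  then show ?thesis using assms by (simp add: square_def)
qed

end

lemma (in category_with_shifts) square_shiftm:
  assumes "square u u' f f'"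
  shows "square (shiftm K n u) (shiftm K n u') (shiftm K n f) (shiftm K n f')"
  using assms shiftm_cmp'[of f u' n] shiftm_cmp'[of u f' n] by (simp add: square_def del: shiftm_cmp')

context symmetric_monoidal_category
begin

lemma tens_ob' [simp]: "\<lbrakk>x \<in> ob K; y \<in> ob K\<rbrakk> \<Longrightarrow> x \<boxtimes> y \<in> ob K"
  by (rule tens_ob)

lemma unit_ob' [simp]: "unit K \<in> ob K"
  by (rule unit_ob)

lemma tensm_arrow [simp]:
  assumes "f \<in> ar K" "g \<in> ar K"
  shows "f \<boxdot> g \<in> ar K" "src K (f \<boxdot> g) = src K f \<boxtimes> src K g" "tgt K (f \<boxdot> g) = tgt K f \<boxtimes> tgt K g"
  using tensm_hom[of f "src K f" "tgt K f" g "src K g" "tgt K g"] assms by auto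

lemma tensm_idt' [simp]: "\<lbrakk>x \<in> ob K; y \<in> ob K\<rbrakk> \<Longrightarrow> idt K x \<boxdot> idt K y = idt K (x \<boxtimes> y)"
  by (rule tensm_idt)

lemma interchange:
  "\<lbrakk>f \<in> ar K; f' \<in> ar K; g \<in> ar K; g' \<in> ar K; tgt K f = src K f'; tgt K g = src K g'\<rbrakk>
    \<Longrightarrow> (f' \<boxdot> g') \<cdot> (f \<boxdot> g) = (f' \<cdot> f) \<boxdot> (g' \<cdot> g)"
  by (rule tensm_cmp[symmetric]) (auto simp: Hom_iff)

lemma square_tensm:
  assumes "square u u' f f'" "square v v' g g'"
  shows "square (u \<boxdot> v) (u' \<boxdot> v') (f \<boxdot> g) (f' \<boxdot> g')"
  using assms interchange[of f u' g v'] interchange[of u f' v g'] by (simp add: square_def)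

lemma iso_tensm [simp]:
  assumes "iso f" "iso g"
  shows "iso (f \<boxdot> g)"
  by (rule isoI[of _ "src K f \<boxtimes> src K g" "tgt K f \<boxtimes> tgt K g" "inva f \<boxdot> inva g"])
     (use assms in \<open>simp_all add: interchange iso_arrow\<close>)

lemma assoc_arrow [simp]:
  assumes "x \<in> ob K" "y \<in> ob K" "z \<in> ob K"
  shows "assoc K x y z \<in> ar K" "src K (assoc K x y z) = (x \<boxtimes> y) \<boxtimes> z"
    "tgt K (assoc K x y z) = x \<boxtimes> (y \<boxtimes> z)" "iso (assoc K x y z)"
  using assoc_iso[OF assms] by auto

lemma lunit_arrow [simp]:
  assumes "x \<in> ob K"
  shows "lunit K x \<in> ar K" "src K (lunit K x) = unit K \<boxtimes> x" "tgt K (lunit K x) = x" "iso (lunit K x)"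
  using lunit_iso[OF assms] by auto

lemma runit_arrow [simp]:
  assumes "x \<in> ob K"
  shows "runit K x \<in> ar K" "src K (runit K x) = x \<boxtimes> unit K" "tgt K (runit K x) = x" "iso (runit K x)"
  using runit_iso[OF assms] by auto

lemma braid_arrow [simp]:
  assumes "x \<in> ob K" "y \<in> ob K"
  shows "braid K x y \<in> ar K" "src K (braid K x y) = x \<boxtimes> y" "tgt K (braid K x y) = y \<boxtimes> x" "iso (braid K x y)"
  using braid_iso[OF assms] by auto

lemma square_assoc: "\<lbrakk>f \<in> ar K; g \<in> ar K; h \<in> ar K\<rbrakk> \<Longrightarrow>
    square (assoc K (src K f) (src K g) (src K h)) (assoc K (tgt K f) (tgt K g) (tgt K h)) ((f \<boxdot> g) \<boxdot> h) (f \<boxdot> (g \<boxdot> h))"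
  by (simp add: square_def assoc_nat[OF iffD2[OF Hom_iff] iffD2[OF Hom_iff] iffD2[OF Hom_iff]])

lemma square_lunit: "f \<in> ar K \<Longrightarrow>
    square (lunit K (src K f)) (lunit K (tgt K f)) (idt K (unit K) \<boxdot> f) f"
  using lunit_nat[of f "src K f" "tgt K f"] by (simp add: square_def)

lemma square_braid: "\<lbrakk>f \<in> ar K; g \<in> ar K\<rbrakk> \<Longrightarrow>
    square (braid K (src K f) (src K g)) (braid K (tgt K f) (tgt K g)) (f \<boxdot> g) (g \<boxdot> f)"
  using braid_nat[of f "src K f" "tgt K f" g "src K g" "tgt K g"] by (simp add: square_def)

end

context category_with_shifts
begin

lemma square_shmul: "f \<in> ar K \<Longrightarrow>
    square (shmul K m n (src K f)) (shmul K m n (tgt K f)) (shiftm K m (shiftm K n f)) (shiftm K (m + n) f)"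
  using shmul_nat[of f "src K f" "tgt K f"] by (simp add: square_def)

lemma square_shunit: "f \<in> ar K \<Longrightarrow> square (shunit K (src K f)) (shunit K (tgt K f)) f (shiftm K 0 f)"
  using shunit_nat[of f "src K f" "tgt K f"] by (simp add: square_def)

lemma square_unshift: "f \<in> ar K \<Longrightarrow>
    square (unshift n (src K f)) (unshift n (tgt K f)) (shiftm K (- n) (shiftm K n f)) f"
  using unshift_nat[of f "src K f" "tgt K f"] by (simp add: square_def)

end

context tt_category
begin

lemma tsusp_arrow [simp]:
  assumes "x \<in> ob K" "y \<in> ob K"
  shows "tsusp K x y \<in> ar K" "src K (tsusp K x y) = shift K 1 x \<boxtimes> y"
    "tgt K (tsusp K x y) = shift K 1 (x \<boxtimes> y)" "iso (tsusp K x y)"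
  using tsusp_iso[OF assms] by auto

lemma tensm_pzero_left [simp]:
  assumes "x \<in> ob K" "y \<in> ob K" "g \<in> ar K"
  shows "pzero K x y \<boxdot> g = pzero K (x \<boxtimes> src K g) (y \<boxtimes> tgt K g)"
proof (rule zero_idem)
  show "pzero K x y \<boxdot> g \<boxplus> pzero K x y \<boxdot> g = pzero K x y \<boxdot> g"
    using tensm_padd_left[of "pzero K x y" x y "pzero K x y" g "src K g" "tgt K g"] assms by simp
qed (use assms in simp)

lemma tensm_pzero_right [simp]:
  assumes "x \<in> ob K" "y \<in> ob K" "g \<in> ar K"
  shows "g \<boxdot> pzero K x y = pzero K (src K g \<boxtimes> x) (tgt K g \<boxtimes> y)"
proof (rule zero_idem)
  show "g \<boxdot> pzero K x y \<boxplus> g \<boxdot> pzero K x y = g \<boxdot> pzero K x y"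
    using tensm_padd_right[of g "src K g" "tgt K g" "pzero K x y" x y "pzero K x y"] assms by simp
qed (use assms in simp)

text \<open>A natural isomorphism that moves the \<open>n\<close>-th shift out of the first tensor
  factor. The category provides one for \<open>n = 1\<close> only. Any choice will do, so no
  compatibility between different \<open>n\<close> is asked for. The squares at identities also fix
  source and target of \<open>t x y\<close>.\<close>

definition shift_tensor where
  "shift_tensor (n::int) t \<longleftrightarrow> (\<forall>x\<in>ob K. \<forall>y\<in>ob K. iso (t x y)) \<and>
     (\<forall>f\<in>ar K. \<forall>g\<in>ar K. square (t (src K f) (src K g)) (t (tgt K f) (tgt K g)) (shiftm K n f \<boxdot> g) (shiftm K n (f \<boxdot> g)))"

lemma shift_tensorD:
  assumes "shift_tensor n t"
  shows "\<lbrakk>x \<in> ob K; y \<in> ob K\<rbrakk> \<Longrightarrow> iso (t x y)"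
    "\<lbrakk>x \<in> ob K; y \<in> ob K\<rbrakk> \<Longrightarrow> t x y \<in> ar K"
    "\<lbrakk>x \<in> ob K; y \<in> ob K\<rbrakk> \<Longrightarrow> src K (t x y) = shift K n x \<boxtimes> y"
    "\<lbrakk>x \<in> ob K; y \<in> ob K\<rbrakk> \<Longrightarrow> tgt K (t x y) = shift K n (x \<boxtimes> y)"
    "\<lbrakk>f \<in> ar K; g \<in> ar K\<rbrakk> \<Longrightarrow>
       square (t (src K f) (src K g)) (t (tgt K f) (tgt K g)) (shiftm K n f \<boxdot> g) (shiftm K n (f \<boxdot> g))"
proof -
  assume xy: "x \<in> ob K" "y \<in> ob K"
  show i: "iso (t x y)" using assms xy by (simp add: shift_tensor_def)
  have "square (t (src K (idt K x)) (src K (idt K y))) (t (tgt K (idt K x)) (tgt K (idt K y)))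
      (shiftm K n (idt K x) \<boxdot> idt K y) (shiftm K n (idt K x \<boxdot> idt K y))"
    using assms xy unfolding shift_tensor_def by (metis idt_arrow(1))
  then show "t x y \<in> ar K" "src K (t x y) = shift K n x \<boxtimes> y" "tgt K (t x y) = shift K n (x \<boxtimes> y)"
    using xy by (simp_all add: square_def)
next
  assume "f \<in> ar K" "g \<in> ar K"
  then show "square (t (src K f) (src K g)) (t (tgt K f) (tgt K g)) (shiftm K n f \<boxdot> g) (shiftm K n (f \<boxdot> g))"
    using assms by (simp add: shift_tensor_def)
qed

lemma shift_tensor_0: "shift_tensor 0 (\<lambda>x y. shunit K (x \<boxtimes> y) \<cdot> (inva (shunit K x) \<boxdot> idt K y))"
  unfolding shift_tensor_def
proof (intro conjI ballI)
  fix f g assume f: "f \<in> ar K" and g: "g \<in> ar K"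
  have 1: "square (inva (shunit K (src K f)) \<boxdot> idt K (src K g)) (inva (shunit K (tgt K f)) \<boxdot> idt K (tgt K g))
      (shiftm K 0 f \<boxdot> g) (f \<boxdot> g)"
    by (rule square_tensm[OF square_inva[OF square_shunit[OF f]] square_idt[OF g]]) (use f in simp_all)
  from square_cmp[OF 1 square_shunit[of "f \<boxdot> g"]]
  show "square (shunit K (src K f \<boxtimes> src K g) \<cdot> (inva (shunit K (src K f)) \<boxdot> idt K (src K g)))
     (shunit K (tgt K f \<boxtimes> tgt K g) \<cdot> (inva (shunit K (tgt K f)) \<boxdot> idt K (tgt K g)))
      (shiftm K 0 f \<boxdot> g) (shiftm K 0 (f \<boxdot> g))" using f g by simp
qed simp

lemma shift_tensor_1: "shift_tensor 1 (tsusp K)"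
  unfolding shift_tensor_def
proof (intro conjI ballI)
  fix f g assume "f \<in> ar K" "g \<in> ar K"
  then show "square (tsusp K (src K f) (src K g)) (tsusp K (tgt K f) (tgt K g)) (shiftm K 1 f \<boxdot> g) (shiftm K 1 (f \<boxdot> g))"
    using tsusp_nat[of f "src K f" "tgt K f" g "src K g" "tgt K g"] by (simp add: square_def)
qed simp

lemma shift_tensor_add:
  assumes a: "shift_tensor m a" and b: "shift_tensor n b"
  shows "shift_tensor (m + n) (\<lambda>x y. shmul K m n (x \<boxtimes> y) \<cdot> shiftm K m (b x y) \<cdot> a (shift K n x) y \<cdot>
     (inva (shmul K m n x) \<boxdot> idt K y))"
  unfolding shift_tensor_def
proof (intro conjI ballI)
  fix x y assume "x \<in> ob K" "y \<in> ob K"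
  then show "iso (shmul K m n (x \<boxtimes> y) \<cdot> shiftm K m (b x y) \<cdot> a (shift K n x) y \<cdot> (inva (shmul K m n x) \<boxdot> idt K y))"
    using shift_tensorD(1-4)[OF a] shift_tensorD(1-4)[OF b] by simp
next
  fix f g assume f: "f \<in> ar K" and g: "g \<in> ar K"
  have 1: "square (inva (shmul K m n (src K f)) \<boxdot> idt K (src K g)) (inva (shmul K m n (tgt K f)) \<boxdot> idt K (tgt K g))
      (shiftm K (m + n) f \<boxdot> g) (shiftm K m (shiftm K n f) \<boxdot> g)"
    by (rule square_tensm[OF square_inva[OF square_shmul[OF f]] square_idt[OF g]]) (use f in simp_all)
  have 2: "square (a (shift K n (src K f)) (src K g)) (a (shift K n (tgt K f)) (tgt K g))
      (shiftm K m (shiftm K n f) \<boxdot> g) (shiftm K m (shiftm K n f \<boxdot> g))"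
    using shift_tensorD(5)[OF a, of "shiftm K n f" g] f g by simp
  have 3: "square (shiftm K m (b (src K f) (src K g))) (shiftm K m (b (tgt K f) (tgt K g)))
      (shiftm K m (shiftm K n f \<boxdot> g)) (shiftm K m (shiftm K n (f \<boxdot> g)))"
    by (rule square_shiftm[OF shift_tensorD(5)[OF b f g]])
  have 4: "square (shmul K m n (src K f \<boxtimes> src K g)) (shmul K m n (tgt K f \<boxtimes> tgt K g))
      (shiftm K m (shiftm K n (f \<boxdot> g))) (shiftm K (m + n) (f \<boxdot> g))"
    using square_shmul[of "f \<boxdot> g"] f g by simp
  have assoc: "(\<And>e. square e e' p q \<longleftrightarrow> square e e' p q)" for e' p q by simp
  from square_cmp[OF square_cmp[OF square_cmp[OF 1 2] 3] 4]
  show "square (shmul K m n (src K f \<boxtimes> src K g) \<cdot> shiftm K m (b (src K f) (src K g)) \<cdot> a (shift K n (src K f)) (src K g) \<cdot>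
       (inva (shmul K m n (src K f)) \<boxdot> idt K (src K g)))
     (shmul K m n (tgt K f \<boxtimes> tgt K g) \<cdot> shiftm K m (b (tgt K f) (tgt K g)) \<cdot> a (shift K n (tgt K f)) (tgt K g) \<cdot>
       (inva (shmul K m n (tgt K f)) \<boxdot> idt K (tgt K g)))
     (shiftm K (m + n) f \<boxdot> g) (shiftm K (m + n) (f \<boxdot> g))" .
qed

text \<open>Apply \<open>a\<close> to the first factor shifted by \<open>-n\<close>. Shifting back
  by \<open>-n\<close> and cancelling with \<open>unshift\<close> on either side gives an
  isomorphism in the required direction.\<close>

lemma shift_tensor_neg:
  assumes a: "shift_tensor n a"
  shows "shift_tensor (- n) (\<lambda>x y. shiftm K (- n) ((unshift (- n) x \<boxdot> idt K y) \<cdot> inva (a (shift K (- n) x) y)) \<cdot>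
     inva (unshift n (shift K (- n) x \<boxtimes> y)))"
  unfolding shift_tensor_def
proof (intro conjI ballI)
  fix x y assume "x \<in> ob K" "y \<in> ob K"
  then show "iso (shiftm K (- n) ((unshift (- n) x \<boxdot> idt K y) \<cdot> inva (a (shift K (- n) x) y)) \<cdot>
     inva (unshift n (shift K (- n) x \<boxtimes> y)))"
    using shift_tensorD(1-4)[OF a] unshift[of x "- n"] by simp
next
  fix f g assume f: "f \<in> ar K" and g: "g \<in> ar K"
  have 1: "square (inva (unshift n (shift K (- n) (src K f) \<boxtimes> src K g))) (inva (unshift n (shift K (- n) (tgt K f) \<boxtimes> tgt K g)))
     (shiftm K (- n) f \<boxdot> g) (shiftm K (- n) (shiftm K n (shiftm K (- n) f \<boxdot> g)))"
    using square_inva[OF square_unshift[of "shiftm K (- n) f \<boxdot> g" n]] f g by simp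
  have 2: "square (inva (a (shift K (- n) (src K f)) (src K g))) (inva (a (shift K (- n) (tgt K f)) (tgt K g)))
     (shiftm K n (shiftm K (- n) f \<boxdot> g)) (shiftm K n (shiftm K (- n) f) \<boxdot> g)"
    using square_inva[OF shift_tensorD(5)[OF a, of "shiftm K (- n) f" g]] shift_tensorD(1)[OF a] f g by simp
  have 3: "square (unshift (- n) (src K f) \<boxdot> idt K (src K g)) (unshift (- n) (tgt K f) \<boxdot> idt K (tgt K g))
     (shiftm K n (shiftm K (- n) f) \<boxdot> g) (f \<boxdot> g)"
    using square_tensm[OF square_unshift[OF f, of "- n"] square_idt[OF g]] by simp
  from square_cmp[OF 1 square_shiftm[OF square_cmp[OF 2 3], of "- n"]]
  show "square (shiftm K (- n) ((unshift (- n) (src K f) \<boxdot> idt K (src K g)) \<cdot> inva (a (shift K (- n) (src K f)) (src K g))) \<cdot>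
       inva (unshift n (shift K (- n) (src K f) \<boxtimes> src K g)))
     (shiftm K (- n) ((unshift (- n) (tgt K f) \<boxdot> idt K (tgt K g)) \<cdot> inva (a (shift K (- n) (tgt K f)) (tgt K g))) \<cdot>
       inva (unshift n (shift K (- n) (tgt K f) \<boxtimes> tgt K g)))
     (shiftm K (- n) f \<boxdot> g) (shiftm K (- n) (f \<boxdot> g))" .
qed

lemma shift_tensor_exists: "\<exists>t. shift_tensor n t"
proof (induction n rule: int_induct[where k = 0])
  case base
  then show ?case using shift_tensor_0 by blast
next
  case (step1 i)
  then show ?case using shift_tensor_add[OF _ shift_tensor_1] by blast
next
  case (step2 i)
  then show ?case using shift_tensor_add[OF _ shift_tensor_neg[OF shift_tensor_1]] by fastforce
qed

definition tshift where "tshift n = (SOME t. shift_tensor n t)"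

lemma shift_tensor_tshift: "shift_tensor n (tshift n)"
  unfolding tshift_def using shift_tensor_exists by (rule someI_ex)

lemma tshift [simp]:
  assumes "x \<in> ob K" "y \<in> ob K"
  shows "tshift n x y \<in> ar K" "src K (tshift n x y) = shift K n x \<boxtimes> y"
    "tgt K (tshift n x y) = shift K n (x \<boxtimes> y)" "iso (tshift n x y)"
  using shift_tensorD(1-4)[OF shift_tensor_tshift] assms by auto

lemma square_tshift: "\<lbrakk>f \<in> ar K; g \<in> ar K\<rbrakk> \<Longrightarrow>
    square (tshift n (src K f) (src K g)) (tshift n (tgt K f) (tgt K g)) (shiftm K n f \<boxdot> g) (shiftm K n (f \<boxdot> g))"
  by (rule shift_tensorD(5)[OF shift_tensor_tshift])

definition rshift where
  "rshift n x = shiftm K n (lunit K x) \<cdot> tshift n (unit K) x \<cdot> braid K x (shift K n (unit K))"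

lemma rshift [simp]:
  assumes "x \<in> ob K"
  shows "rshift n x \<in> ar K" "src K (rshift n x) = x \<boxtimes> shift K n (unit K)"
    "tgt K (rshift n x) = shift K n x" "iso (rshift n x)"
  using assms by (simp_all add: rshift_def)

lemma square_rshift:
  assumes f: "f \<in> ar K"
  shows "square (rshift n (src K f)) (rshift n (tgt K f)) (f \<boxdot> idt K (shift K n (unit K))) (shiftm K n f)"
proof -
  let ?i = "idt K (shift K n (unit K))" and ?e = "idt K (unit K)"
  have 1: "square (braid K (src K f) (shift K n (unit K))) (braid K (tgt K f) (shift K n (unit K)))
      (f \<boxdot> ?i) (?i \<boxdot> f)"
    using square_braid[OF f, of ?i] by simp
  have 2: "square (tshift n (unit K) (src K f)) (tshift n (unit K) (tgt K f)) (?i \<boxdot> f) (shiftm K n (?e \<boxdot> f))"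
    using square_tshift[of ?e f n] f by simp
  show ?thesis unfolding rshift_def
    by (rule square_cmp[OF square_cmp[OF 1 2] square_shiftm[OF square_lunit[OF f]]])
qed

text \<open>Composing with an automorphism of \<open>\<Sigma>\<^sup>n1\<close> normalises \<open>rshift\<close> at the unit, which makes
  the tensor product of two graded endomorphisms of the unit comparable with their product.\<close>

definition rtwist where
  "rtwist n = inva (rshift n (unit K) \<cdot> inva (lunit K (shift K n (unit K))))"

definition runitor where
  "runitor n x = rshift n x \<cdot> (idt K x \<boxdot> rtwist n)"

lemma rtwist [simp]: "rtwist n \<in> ar K" "src K (rtwist n) = shift K n (unit K)" "tgt K (rtwist n) = shift K n (unit K)"
    "iso (rtwist n)"
  by (simp_all add: rtwist_def)

lemma runitor [simp]:
  assumes "x \<in> ob K"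
  shows "runitor n x \<in> ar K" "src K (runitor n x) = x \<boxtimes> shift K n (unit K)"
    "tgt K (runitor n x) = shift K n x" "iso (runitor n x)"
  using assms by (simp_all add: runitor_def)

lemma square_runitor:
  assumes f: "f \<in> ar K"
  shows "square (runitor n (src K f)) (runitor n (tgt K f)) (f \<boxdot> idt K (shift K n (unit K))) (shiftm K n f)"
proof -
  let ?i = "idt K (shift K n (unit K))"
  have w: "square (rtwist n) (rtwist n) ?i ?i" by (simp add: square_def)
  show ?thesis unfolding runitor_def
    by (rule square_cmp[OF square_tensm[OF square_idt[OF f] w] square_rshift[OF f]])
qed

lemma runitor_unit: "runitor n (unit K) = lunit K (shift K n (unit K))"
proof -
  let ?l = "lunit K (shift K n (unit K))" and ?r = "rshift n (unit K)"
  have "?l \<cdot> (idt K (unit K) \<boxdot> rtwist n) = rtwist n \<cdot> ?l"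
    using square_lunit[of "rtwist n"] by (simp add: square_def)
  then have "inva ?l \<cdot> ?l \<cdot> (idt K (unit K) \<boxdot> rtwist n) = inva ?l \<cdot> rtwist n \<cdot> ?l" by simp
  then have "runitor n (unit K) = ?r \<cdot> inva ?l \<cdot> rtwist n \<cdot> ?l" by (simp add: runitor_def)
  also have "?r \<cdot> inva ?l \<cdot> rtwist n \<cdot> ?l = ((?r \<cdot> inva ?l) \<cdot> rtwist n) \<cdot> ?l" by simp
  also have "(?r \<cdot> inva ?l) \<cdot> rtwist n = idt K (shift K n (unit K))"
    unfolding rtwist_def by (subst inva(5)) simp_all
  finally show ?thesis by simp
qed

end

section \<open>The action of graded endomorphisms of the unit\<close>

context tt_category
begin

lemma unit_hom_iff [simp]: "f \<in> unit_hom K n \<longleftrightarrow> f \<in> ar K \<and> src K f = unit K \<and> tgt K f = shift K n (unit K)"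
  by (simp add: unit_hom_def)

text \<open>\<open>act n k f a\<close> is the product of \<open>f : 1 \<rightarrow> \<Sigma>\<^sup>n1\<close> with \<open>a : x \<rightarrow> \<Sigma>\<^sup>k1\<close>, an arrow \<open>x \<rightarrow> \<Sigma>\<^sup>k\<^sup>+\<^sup>n1\<close>. It makes
  \<open>\<Oplus>\<^sub>k Hom(x, \<Sigma>\<^sup>k1)\<close> a graded left module over the endomorphism ring of the unit.\<close>

definition act where
  "act n k f a = shmul K k n (unit K) \<cdot> shiftm K k f \<cdot> a"

lemma act_arrow [simp]:
  assumes "f \<in> unit_hom K n" "a \<in> ar K" "tgt K a = shift K k (unit K)"
  shows "act n k f a \<in> ar K" "src K (act n k f a) = src K a" "tgt K (act n k f a) = shift K (k + n) (unit K)"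
  using assms by (simp_all add: act_def)

lemma act_cmp:
  assumes "f \<in> unit_hom K n" "a \<in> ar K" "tgt K a = shift K k (unit K)" "b \<in> ar K" "tgt K b = src K a"
  shows "act n k f a \<cdot> b = act n k f (a \<cdot> b)"
  using assms by (simp add: act_def)

lemma act_padd_right:
  assumes "f \<in> unit_hom K n" "a \<in> Hom K x (shift K k (unit K))" "b \<in> Hom K x (shift K k (unit K))"
  shows "act n k f (a \<boxplus> b) = act n k f a \<boxplus> act n k f b"
  using assms by (simp add: act_def)

lemma act_padd_left:
  assumes "f \<in> unit_hom K n" "g \<in> unit_hom K n" "a \<in> ar K" "tgt K a = shift K k (unit K)"
  shows "act n k (f \<boxplus> g) a = act n k f a \<boxplus> act n k g a"
  using assms by (simp add: act_def)

lemma act_pneg: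
  assumes "f \<in> unit_hom K n" "a \<in> ar K" "tgt K a = shift K k (unit K)"
  shows "act n k (pneg K f) a = pneg K (act n k f a)" "act n k f (pneg K a) = pneg K (act n k f a)"
  using assms by (simp_all add: act_def)

lemma act_pzero_right [simp]:
  assumes "f \<in> unit_hom K n" "x \<in> ob K"
  shows "act n k f (pzero K x (shift K k (unit K))) = pzero K x (shift K (k + n) (unit K))"
  using assms by (simp add: act_def)

lemma act_pzero_left [simp]:
  assumes "a \<in> ar K" "tgt K a = shift K k (unit K)"
  shows "act n k (pzero K (unit K) (shift K n (unit K))) a = pzero K (src K a) (shift K (k + n) (unit K))"
  using assms by (simp add: act_def)

lemma act_shunit:
  assumes "a \<in> ar K" "tgt K a = shift K k (unit K)"
  shows "act 0 k (shunit K (unit K)) a = a"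
proof -
  have "shmul K k 0 (unit K) \<cdot> shiftm K k (shunit K (unit K)) \<cdot> a = idt K (shift K k (unit K)) \<cdot> a"
    by (rule reassoc[OF shmul_unit_right]) (use assms in simp_all)
  then show ?thesis using assms by (simp add: act_def)
qed

lemma act_on_shunit:
  assumes f: "f \<in> unit_hom K n"
  shows "act n 0 f (shunit K (unit K)) = f"
proof -
  have sq: "shunit K (shift K n (unit K)) \<cdot> f = shiftm K 0 f \<cdot> shunit K (unit K)"
    using f shunit_nat[of f "unit K" "shift K n (unit K)"] by simp
  have "act n 0 f (shunit K (unit K)) = shmul K 0 n (unit K) \<cdot> shunit K (shift K n (unit K)) \<cdot> f"
    unfolding act_def sq ..
  also have "\<dots> = idt K (shift K n (unit K)) \<cdot> f"
    by (rule reassoc[OF shmul_unit_left]) (use f in simp_all)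
  finally show ?thesis using f by simp
qed

text \<open>Naturality of \<open>shmul\<close> at \<open>s\<close> interchanges the shift of
  \<open>s\<close> with \<open>shmul\<close>; the associativity axiom for \<open>shmul\<close> then
  regroups the two multiplications of shifts.\<close>

lemma act_act:
  assumes s: "s \<in> unit_hom K m" and r: "r \<in> unit_hom K n" and a: "a \<in> Hom K x (shift K k (unit K))"
  shows "act m (k + n) s (act n k r a) = act (n + m) k (act m n s r) a"
proof -
  let ?u = "unit K"
  have sq: "shmul K k n (shift K m ?u) \<cdot> shiftm K k (shiftm K n s) = shiftm K (k + n) s \<cdot> shmul K k n ?u"
    using s shmul_nat[of s ?u "shift K m ?u" k n] by simp
  have "act m (k + n) s (act n k r a) = shmul K (k + n) m ?u \<cdot> shiftm K (k + n) s \<cdot> shmul K k n ?u \<cdot> shiftm K k r \<cdot> a"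
    using assms by (simp add: act_def)
  also have "shiftm K (k + n) s \<cdot> shmul K k n ?u \<cdot> shiftm K k r \<cdot> a =
      (shmul K k n (shift K m ?u) \<cdot> shiftm K k (shiftm K n s)) \<cdot> shiftm K k r \<cdot> a"
    by (rule reassoc[OF sq[symmetric]]) (use assms in simp_all)
  also have "\<dots> = shmul K k n (shift K m ?u) \<cdot> shiftm K k (shiftm K n s) \<cdot> shiftm K k r \<cdot> a"
    using assms by simp
  also have "shmul K (k + n) m ?u \<cdot> shmul K k n (shift K m ?u) \<cdot> shiftm K k (shiftm K n s) \<cdot> shiftm K k r \<cdot> a =
      (shmul K k (n + m) ?u \<cdot> shiftm K k (shmul K n m ?u)) \<cdot> shiftm K k (shiftm K n s) \<cdot> shiftm K k r \<cdot> a"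
    by (rule reassoc[OF shmul_assoc]) (use assms in \<open>simp_all add: add.assoc\<close>)
  also have "\<dots> = act (n + m) k (act m n s r) a"
    using assms by (simp add: act_def add.assoc)
  finally show ?thesis .
qed

text \<open>By fullness of the shift, composing with an arrow between shifts of the unit is
  multiplication by a ring element. With the converse \<open>act_idt\<close> this turns arrows
  between free objects into matrices over the ring.\<close>

lemma act_full:
  assumes "p \<in> Hom K (shift K k (unit K)) (shift K (k + n) (unit K))"
  shows "\<exists>f\<in>unit_hom K n. \<forall>a\<in>ar K. tgt K a = shift K k (unit K) \<longrightarrow> p \<cdot> a = act n k f a"
proof -
  let ?u = "unit K"
  obtain f where f: "f \<in> Hom K ?u (shift K n ?u)" "shiftm K k f = inva (shmul K k n ?u) \<cdot> p"
    using shiftm_full[of ?u "shift K n ?u" "inva (shmul K k n ?u) \<cdot> p" k] assms by auto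
  have "p \<cdot> a = act n k f a" if "a \<in> ar K" "tgt K a = shift K k ?u" for a
    using f assms that by (simp add: act_def)
  then show ?thesis using f(1) by (intro bexI[of _ f]) auto
qed

lemma act_idt:
  assumes "f \<in> unit_hom K n"
  shows "\<exists>p\<in>Hom K (shift K k (unit K)) (shift K (k + n) (unit K)). \<forall>a\<in>ar K. tgt K a = shift K k (unit K) \<longrightarrow> p \<cdot> a = act n k f a"
  using assms by (intro bexI[of _ "shmul K k n (unit K) \<cdot> shiftm K k f"]) (auto simp: act_def)

definition act_tensor where
  "act_tensor n l = inva (runitor l (shift K n (unit K))) \<cdot> inva (shmul K l n (unit K))"

lemma act_tensor [simp]: "act_tensor n l \<in> ar K" "src K (act_tensor n l) = shift K (l + n) (unit K)"
    "tgt K (act_tensor n l) = shift K n (unit K) \<boxtimes> shift K l (unit K)" "iso (act_tensor n l)"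
  by (simp_all add: act_tensor_def)

text \<open>Write \<open>f \<boxdot> b\<close> as \<open>f\<close> tensored with an identity after
  an identity tensored with \<open>b\<close>. Naturality of \<open>runitor\<close> at
  \<open>f\<close>, normalized at the unit by \<open>runitor_unit\<close>, and of
  \<open>lunit\<close> at \<open>b\<close> identify the composite with the module action.\<close>

lemma tensm_eq_act:
  assumes f: "f \<in> unit_hom K n" and b: "b \<in> Hom K x (shift K l (unit K))"
  shows "f \<boxdot> b = act_tensor n l \<cdot> act n l f b \<cdot> lunit K x"
proof -
  let ?u = "unit K"
  have x: "x \<in> ob K" using b by auto
  have 1: "f \<boxdot> b = (f \<boxdot> idt K (shift K l ?u)) \<cdot> (idt K ?u \<boxdot> b)"
    using f b by (subst interchange) simp_all
  have 2: "runitor l (shift K n ?u) \<cdot> (f \<boxdot> idt K (shift K l ?u)) = shiftm K l f \<cdot> lunit K (shift K l ?u)"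
    using square_runitor[of f l] f by (simp add: square_def runitor_unit)
  have 3: "lunit K (shift K l ?u) \<cdot> (idt K ?u \<boxdot> b) = b \<cdot> lunit K x"
    using square_lunit[of b] b by (simp add: square_def)
  have "runitor l (shift K n ?u) \<cdot> (f \<boxdot> b) = runitor l (shift K n ?u) \<cdot> (f \<boxdot> idt K (shift K l ?u)) \<cdot> (idt K ?u \<boxdot> b)"
    unfolding 1 ..
  also have "\<dots> = (shiftm K l f \<cdot> lunit K (shift K l ?u)) \<cdot> (idt K ?u \<boxdot> b)"
    by (rule reassoc[OF 2]) (use f b in simp_all)
  also have "\<dots> = shiftm K l f \<cdot> b \<cdot> lunit K x"
    using f b by (simp add: 3)
  finally have 4: "runitor l (shift K n ?u) \<cdot> (f \<boxdot> b) = shiftm K l f \<cdot> b \<cdot> lunit K x" .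
  have "act_tensor n l \<cdot> act n l f b \<cdot> lunit K x = inva (runitor l (shift K n ?u)) \<cdot> shiftm K l f \<cdot> b \<cdot> lunit K x"
    using f b x by (simp add: act_tensor_def act_def)
  also have "\<dots> = inva (runitor l (shift K n ?u)) \<cdot> runitor l (shift K n ?u) \<cdot> (f \<boxdot> b)" unfolding 4 ..
  also have "\<dots> = f \<boxdot> b" using f b by simp
  finally show ?thesis by simp
qed

lemma tensm_zero_iff_act:
  assumes f: "f \<in> unit_hom K n" and b: "b \<in> Hom K x (shift K l (unit K))"
  shows "f \<boxdot> b = pzero K (unit K \<boxtimes> x) (shift K n (unit K) \<boxtimes> shift K l (unit K)) \<longleftrightarrow>
    act n l f b = pzero K x (shift K (l + n) (unit K))"
proof
  have x: "x \<in> ob K" using b by auto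
  note eq = tensm_eq_act[OF assms]
  show "f \<boxdot> b = pzero K (unit K \<boxtimes> x) (shift K n (unit K) \<boxtimes> shift K l (unit K))"
    if "act n l f b = pzero K x (shift K (l + n) (unit K))" using that x unfolding eq by simp
  assume "f \<boxdot> b = pzero K (unit K \<boxtimes> x) (shift K n (unit K) \<boxtimes> shift K l (unit K))"
  then have *: "act_tensor n l \<cdot> act n l f b \<cdot> lunit K x = pzero K (unit K \<boxtimes> x) (shift K n (unit K) \<boxtimes> shift K l (unit K))"
    using eq by simp
  have "act n l f b \<cdot> lunit K x = pzero K (unit K \<boxtimes> x) (shift K (l + n) (unit K))"
    by (rule iso_cancel_left[of "act_tensor n l"]) (use * f b x in simp_all)
  then show "act n l f b = pzero K x (shift K (l + n) (unit K))"
    by (intro iso_cancel_right[of "lunit K x" "act n l f b" "pzero K x (shift K (l + n) (unit K))"]) (use f b x in simp_all)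
qed

text \<open>The braiding only yields commutativity up to automorphisms of \<open>1\<close> and \<open>\<Sigma>\<^sup>m\<^sup>+\<^sup>n1\<close>; multiplying
  with the unit element shows that the first one can be absorbed into the second.\<close>

lemma act_commute:
  "\<exists>e\<in>unit_hom K 0. \<forall>a\<in>unit_hom K m. \<forall>r\<in>unit_hom K n. act m n a r = act 0 (m + n) e (act n m r a)"
proof -
  let ?u = "unit K"
  define b where "b = lunit K ?u \<cdot> braid K ?u ?u \<cdot> inva (lunit K ?u)"
  define th where "th m n = inva (act_tensor m n) \<cdot> inva (braid K (shift K m ?u) (shift K n ?u)) \<cdot> act_tensor n m" for m n
  have b: "b \<in> ar K" "src K b = ?u" "tgt K b = ?u" "iso b" by (simp_all add: b_def)
  have th: "th m n \<in> ar K" "src K (th m n) = shift K (m + n) ?u" "tgt K (th m n) = shift K (n + m) ?u" "iso (th m n)" for m n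
    by (simp_all add: th_def)
  have comm: "act m n a r = th m n \<cdot> act n m r a \<cdot> b"
    if a: "a \<in> unit_hom K m" and r: "r \<in> unit_hom K n" for m n a r
  proof -
    let ?B = "braid K (shift K m ?u) (shift K n ?u)"
    have nat: "?B \<cdot> (a \<boxdot> r) = (r \<boxdot> a) \<cdot> braid K ?u ?u"
      using square_braid[of a r] a r by (simp add: square_def)
    have ar: "a \<boxdot> r = act_tensor m n \<cdot> act m n a r \<cdot> lunit K ?u"
      by (rule tensm_eq_act[OF a]) (use r in simp)
    have ra: "r \<boxdot> a = act_tensor n m \<cdot> act n m r a \<cdot> lunit K ?u"
      by (rule tensm_eq_act[OF r]) (use a in simp)
    have "act m n a r = inva (act_tensor m n) \<cdot> inva ?B \<cdot> (?B \<cdot> (a \<boxdot> r)) \<cdot> inva (lunit K ?u)"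
      using a r by (simp add: ar)
    also have "\<dots> = th m n \<cdot> act n m r a \<cdot> b"
      unfolding nat ra using a r by (simp add: th_def b_def)
    finally show ?thesis .
  qed
  have rb: "r \<cdot> b = inva (th 0 n) \<cdot> r" if r: "r \<in> unit_hom K n" for r n
  proof -
    have s: "shunit K ?u \<in> unit_hom K 0" by simp
    have "r = th 0 n \<cdot> r \<cdot> b" using comm[OF s r] act_shunit[of r n] act_on_shunit[OF r] r by simp
    then have "inva (th 0 n) \<cdot> r = inva (th 0 n) \<cdot> th 0 n \<cdot> r \<cdot> b" by simp
    also have "\<dots> = r \<cdot> b" using th[of 0 n] b r by simp
    finally show ?thesis ..
  qed
  \<comment> \<open>An endomorphism of a shift of the unit, hence multiplication by an element of
    degree 0. It depends on the degrees only.\<close>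
  have "th m n \<cdot> inva (th 0 (m + n)) \<in> Hom K (shift K (m + n) ?u) (shift K (m + n + 0) ?u)"
    using th[of m n] th[of 0 "m + n"] by (simp add: add.commute)
  from act_full[OF this] obtain e where e: "e \<in> unit_hom K 0"
    "\<And>c. c \<in> ar K \<Longrightarrow> tgt K c = shift K (m + n) ?u \<Longrightarrow> (th m n \<cdot> inva (th 0 (m + n))) \<cdot> c = act 0 (m + n) e c"
    by blast
  have "act m n a r = act 0 (m + n) e (act n m r a)"
    if a: "a \<in> unit_hom K m" and r: "r \<in> unit_hom K n" for a r
  proof -
    have ra: "act n m r a \<in> unit_hom K (m + n)" using a r by simp
    have "act m n a r = th m n \<cdot> act n m r a \<cdot> b" by (rule comm[OF a r])
    also have "\<dots> = (th m n \<cdot> inva (th 0 (m + n))) \<cdot> act n m r a"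
      unfolding rb[OF ra] using ra th[of m n] th[of 0 "m + n"] by simp
    also have "\<dots> = act 0 (m + n) e (act n m r a)" by (rule e(2)) (use ra in simp_all)
    finally show ?thesis .
  qed
  then show ?thesis using e(1) by blast
qed

end

section \<open>The graded endomorphism ring\<close>

context additive_category
begin

text \<open>\<open>hom_group\<close> is a record with multiplicative notation, so a finite sum of
  arrows is a \<open>finprod\<close>.\<close>

abbreviation hsum where "hsum x y f A \<equiv> finprod (hom_group K x y) f A"

context
  fixes x y assumes xy: "x \<in> ob K" "y \<in> ob K"
begin

interpretation U: comm_group "hom_group K x y"
  using xy by (rule hom_comm_group)

lemma hsum_closed: "(\<And>n. n \<in> A \<Longrightarrow> f n \<in> Hom K x y) \<Longrightarrow> hsum x y f A \<in> Hom K x y"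
  using U.finprod_closed[of f A] by (simp add: Pi_def)

lemma hsum_empty: "hsum x y f {} = pzero K x y"
  by simp

lemma hsum_insert:
  "\<lbrakk>finite A; a \<notin> A; \<And>n. n \<in> insert a A \<Longrightarrow> f n \<in> Hom K x y\<rbrakk> \<Longrightarrow> hsum x y f (insert a A) = f a \<boxplus> hsum x y f A"
  using U.finprod_insert[of A a f] by (simp add: Pi_def)

lemma hsum_zero: "(\<And>n. n \<in> A \<Longrightarrow> f n = pzero K x y) \<Longrightarrow> hsum x y f A = pzero K x y"
  using U.finprod_one_eqI[of A f] by simp

lemma hsum_padd:
  "\<lbrakk>\<And>n. n \<in> A \<Longrightarrow> f n \<in> Hom K x y; \<And>n. n \<in> A \<Longrightarrow> g n \<in> Hom K x y\<rbrakk>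
    \<Longrightarrow> hsum x y (\<lambda>n. f n \<boxplus> g n) A = hsum x y f A \<boxplus> hsum x y g A"
  using U.finprod_multf[of f A g] by (simp add: Pi_def)

lemma hsum_cong:
  "\<lbrakk>\<And>n. n \<in> A \<Longrightarrow> f n = g n; \<And>n. n \<in> A \<Longrightarrow> g n \<in> Hom K x y\<rbrakk> \<Longrightarrow> hsum x y f A = hsum x y g A"
  using U.finprod_cong[of A A g f] by (auto simp: Pi_def simp_implies_def)

lemma hsum_mono_neutral:
  "\<lbrakk>finite B; A \<subseteq> B; \<And>n. n \<in> B - A \<Longrightarrow> f n = pzero K x y; \<And>n. n \<in> A \<Longrightarrow> f n \<in> Hom K x y\<rbrakk>
    \<Longrightarrow> hsum x y f A = hsum x y f B"
proof -
  assume *: "finite B" "A \<subseteq> B" "\<And>n. n \<in> B - A \<Longrightarrow> f n = pzero K x y" "\<And>n. n \<in> A \<Longrightarrow> f n \<in> Hom K x y"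
  have "f n \<in> Hom K x y" if "n \<in> B" for n
    using *(3,4)[of n] that xy by (cases "n \<in> A") auto
  then have "f \<in> B \<rightarrow> carrier (hom_group K x y)" by simp
  from U.finprod_mono_neutral_cong_left[OF *(1,2) _ _ this, of f] show ?thesis using *(3) by simp
qed

lemma hsum_single:
  assumes "finite A" "i \<in> A" "f i \<in> Hom K x y" "\<And>n. n \<in> A \<Longrightarrow> n \<noteq> i \<Longrightarrow> f n = pzero K x y"
  shows "hsum x y f A = f i"
proof -
  have "hsum x y f {i} = hsum x y f A"
    by (rule hsum_mono_neutral) (use assms in auto)
  moreover have "hsum x y f {i} = f i" using hsum_insert[of "{}" i f] assms(3) by simp
  ultimately show ?thesis by simp
qed

end

lemma hsum_cmp:
  assumes "finite A" "\<And>n. n \<in> A \<Longrightarrow> f n \<in> Hom K x y" "x \<in> ob K" "y \<in> ob K"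
  shows "c \<in> Hom K y z \<Longrightarrow> c \<cdot> hsum x y f A = hsum x z (\<lambda>n. c \<cdot> f n) A"
    and "c \<in> Hom K z x \<Longrightarrow> hsum x y f A \<cdot> c = hsum z y (\<lambda>n. f n \<cdot> c) A"
proof -
  show "c \<cdot> hsum x y f A = hsum x z (\<lambda>n. c \<cdot> f n) A" if c: "c \<in> Hom K y z"
    using assms(1,2)
  proof (induction A)
    case empty
    have "z \<in> ob K" using c by auto
    then show ?case using c assms(3,4) by (simp add: hsum_empty del: hom_group_simps)
  next
    case (insert a A)
    have z: "z \<in> ob K" using c by auto
    have "hsum x y f A \<in> Hom K x y" by (rule hsum_closed) (use assms insert in auto)
    then have "c \<cdot> hsum x y f (insert a A) = c \<cdot> f a \<boxplus> c \<cdot> hsum x y f A"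
      using insert c assms(3,4) by (subst hsum_insert) auto
    also have "\<dots> = hsum x z (\<lambda>n. c \<cdot> f n) (insert a A)"
      using insert c assms(3,4) z by (subst hsum_insert) auto
    finally show ?case .
  qed
  show "hsum x y f A \<cdot> c = hsum z y (\<lambda>n. f n \<cdot> c) A" if c: "c \<in> Hom K z x"
    using assms(1,2)
  proof (induction A)
    case empty
    have "z \<in> ob K" using c by auto
    then show ?case using c assms(3,4) by (simp add: hsum_empty del: hom_group_simps)
  next
    case (insert a A)
    have z: "z \<in> ob K" using c by auto
    have "hsum x y f A \<in> Hom K x y" by (rule hsum_closed) (use assms insert in auto)
    then have "hsum x y f (insert a A) \<cdot> c = f a \<cdot> c \<boxplus> hsum x y f A \<cdot> c"
      using insert c assms(3,4) by (subst hsum_insert) auto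
    also have "\<dots> = hsum z y (\<lambda>n. f n \<cdot> c) (insert a A)"
      using insert c assms(3,4) z by (subst hsum_insert) auto
    finally show ?case .
  qed
qed

end

context tt_category
begin

abbreviation ER where "ER \<equiv> end_ring K"
abbreviation hel where "hel \<equiv> homogeneous_elem K"

lemma ER_carrier: "a \<in> carrier ER \<longleftrightarrow> (\<forall>n. a n \<in> unit_hom K n) \<and> finite {n. a n \<noteq> unit_zero K n}"
  by (simp add: end_ring_def)

lemma ER_carrierD: "a \<in> carrier ER \<Longrightarrow> a n \<in> unit_hom K n" "a \<in> carrier ER \<Longrightarrow> finite {n. a n \<noteq> unit_zero K n}"
  by (simp_all only: ER_carrier)

lemma unit_zero_arrow [simp]: "unit_zero K n \<in> unit_hom K n"
  by (simp add: unit_zero_def)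

lemma ER_zero: "\<zero>\<^bsub>ER\<^esub> = unit_zero K"
  and ER_one: "\<one>\<^bsub>ER\<^esub> = hel 0 (shunit K (unit K))"
  and ER_add: "(a \<oplus>\<^bsub>ER\<^esub> b) n = a n \<boxplus> b n"
  and ER_mult: "(a \<otimes>\<^bsub>ER\<^esub> b) k = hsum (unit K) (shift K k (unit K)) (\<lambda>n. act (k - n) n (a (k - n)) (b n)) {n. b n \<noteq> unit_zero K n}"
  by (simp_all add: end_ring_def act_def)

lemma act_closed:
  assumes "f \<in> unit_hom K n" "a \<in> unit_hom K k"
  shows "act n k f a \<in> unit_hom K (k + n)"
  using assms by simp

lemma ER_mult_eq:
  assumes a: "a \<in> carrier ER" and b: "b \<in> carrier ER" and A: "finite A" "{n. b n \<noteq> unit_zero K n} \<subseteq> A"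
  shows "(a \<otimes>\<^bsub>ER\<^esub> b) k = hsum (unit K) (shift K k (unit K)) (\<lambda>n. act (k - n) n (a (k - n)) (b n)) A"
  unfolding ER_mult
proof (rule hsum_mono_neutral[OF _ _ A])
  fix n assume "n \<in> A - {n. b n \<noteq> unit_zero K n}"
  then have "b n = pzero K (unit K) (shift K n (unit K))" by (simp add: unit_zero_def)
  then show "act (k - n) n (a (k - n)) (b n) = pzero K (unit K) (shift K k (unit K))"
    using ER_carrierD(1)[OF a, of "k - n"] by simp
next
  fix n show "act (k - n) n (a (k - n)) (b n) \<in> Hom K (unit K) (shift K k (unit K))"
    using act_closed[OF ER_carrierD(1)[OF a, of "k - n"] ER_carrierD(1)[OF b, of n]] by simp
qed simp_all

lemma ER_mult_arrow:
  assumes "a \<in> carrier ER" "b \<in> carrier ER"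
  shows "act (k - n) n (a (k - n)) (b n) \<in> Hom K (unit K) (shift K k (unit K))"
  using act_closed[OF ER_carrierD(1)[OF assms(1), of "k - n"] ER_carrierD(1)[OF assms(2), of n]] by simp

lemma ER_zero_closed: "unit_zero K \<in> carrier ER"
  by (simp add: ER_carrier del: unit_hom_iff)

lemma ER_add_closed:
  assumes a: "a \<in> carrier ER" and b: "b \<in> carrier ER"
  shows "a \<oplus>\<^bsub>ER\<^esub> b \<in> carrier ER"
  unfolding ER_carrier
proof (intro conjI allI)
  show "(a \<oplus>\<^bsub>ER\<^esub> b) n \<in> unit_hom K n" for n
    using ER_carrierD(1)[OF a, of n] ER_carrierD(1)[OF b, of n] by (simp add: ER_add)
  have "{n. (a \<oplus>\<^bsub>ER\<^esub> b) n \<noteq> unit_zero K n} \<subseteq> {n. a n \<noteq> unit_zero K n} \<union> {n. b n \<noteq> unit_zero K n}"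
    by (auto simp: ER_add unit_zero_def)
  then show "finite {n. (a \<oplus>\<^bsub>ER\<^esub> b) n \<noteq> unit_zero K n}"
    using ER_carrierD(2)[OF a] ER_carrierD(2)[OF b] by (meson finite_UnI finite_subset)
qed

lemma hel_closed [simp]:
  assumes "f \<in> unit_hom K n"
  shows "hel n f \<in> carrier ER"
  unfolding ER_carrier
proof (intro conjI allI)
  show "hel n f m \<in> unit_hom K m" for m
    using assms unit_zero_arrow[of m] by (simp add: homogeneous_elem_def)
  have "{m. hel n f m \<noteq> unit_zero K m} \<subseteq> {n}" by (auto simp: homogeneous_elem_def)
  then show "finite {m. hel n f m \<noteq> unit_zero K m}" by (rule finite_subset) simp
qed

lemma hel_apply: "hel n f m = (if m = n then f else unit_zero K m)"
  by (simp add: homogeneous_elem_def)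

lemma hel_zero: "hel n (unit_zero K n) = unit_zero K"
  by (auto simp: homogeneous_elem_def)

lemma ER_mult_closed:
  assumes a: "a \<in> carrier ER" and b: "b \<in> carrier ER"
  shows "a \<otimes>\<^bsub>ER\<^esub> b \<in> carrier ER"
  unfolding ER_carrier
proof (intro conjI allI)
  show "(a \<otimes>\<^bsub>ER\<^esub> b) k \<in> unit_hom K k" for k
    unfolding ER_mult unit_hom_def by (rule hsum_closed) (use ER_mult_arrow[OF a b] in auto)
  have "{k. (a \<otimes>\<^bsub>ER\<^esub> b) k \<noteq> unit_zero K k} \<subseteq> (\<lambda>(m, n). m + n) ` ({m. a m \<noteq> unit_zero K m} \<times> {n. b n \<noteq> unit_zero K n})"
  proof
    fix k assume "k \<in> {k. (a \<otimes>\<^bsub>ER\<^esub> b) k \<noteq> unit_zero K k}"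
    then have nz: "(a \<otimes>\<^bsub>ER\<^esub> b) k \<noteq> pzero K (unit K) (shift K k (unit K))" by (simp add: unit_zero_def)
    have "\<exists>n. b n \<noteq> unit_zero K n \<and> a (k - n) \<noteq> unit_zero K (k - n)"
    proof (rule ccontr)
      assume no: "\<not> ?thesis"
      have "(a \<otimes>\<^bsub>ER\<^esub> b) k = pzero K (unit K) (shift K k (unit K))"
        unfolding ER_mult
      proof (rule hsum_zero)
        fix n assume "n \<in> {n. b n \<noteq> unit_zero K n}"
        then have "a (k - n) = pzero K (unit K) (shift K (k - n) (unit K))" using no unfolding unit_zero_def by blast
        then show "act (k - n) n (a (k - n)) (b n) = pzero K (unit K) (shift K k (unit K))"
          using ER_carrierD(1)[OF b, of n] by simp
      qed simp_all
      with nz show False by simp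
    qed
    then obtain n where "b n \<noteq> unit_zero K n" "a (k - n) \<noteq> unit_zero K (k - n)" by blast
    then show "k \<in> (\<lambda>(m, n). m + n) ` ({m. a m \<noteq> unit_zero K m} \<times> {n. b n \<noteq> unit_zero K n})"
      by (intro image_eqI[of _ _ "(k - n, n)"]) simp_all
  qed
  then show "finite {k. (a \<otimes>\<^bsub>ER\<^esub> b) k \<noteq> unit_zero K k}"
    by (rule finite_subset) (intro finite_imageI finite_cartesian_product ER_carrierD(2) a b)
qed

lemma ER_l_distr:
  assumes a: "a \<in> carrier ER" and b: "b \<in> carrier ER" and c: "c \<in> carrier ER"
  shows "(a \<oplus>\<^bsub>ER\<^esub> b) \<otimes>\<^bsub>ER\<^esub> c = a \<otimes>\<^bsub>ER\<^esub> c \<oplus>\<^bsub>ER\<^esub> b \<otimes>\<^bsub>ER\<^esub> c"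
proof
  fix k
  have *: "act (k - n) n (a (k - n) \<boxplus> b (k - n)) (c n) = act (k - n) n (a (k - n)) (c n) \<boxplus> act (k - n) n (b (k - n)) (c n)" for n
    using ER_carrierD(1)[OF c, of n]
    by (intro act_padd_left[OF ER_carrierD(1)[OF a] ER_carrierD(1)[OF b]]) auto
  show "((a \<oplus>\<^bsub>ER\<^esub> b) \<otimes>\<^bsub>ER\<^esub> c) k = (a \<otimes>\<^bsub>ER\<^esub> c \<oplus>\<^bsub>ER\<^esub> b \<otimes>\<^bsub>ER\<^esub> c) k"
    unfolding ER_add ER_mult * using ER_mult_arrow[OF a c] ER_mult_arrow[OF b c] by (intro hsum_padd) auto
qed

lemma ER_r_distr:
  assumes a: "a \<in> carrier ER" and b: "b \<in> carrier ER" and c: "c \<in> carrier ER"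
  shows "c \<otimes>\<^bsub>ER\<^esub> (a \<oplus>\<^bsub>ER\<^esub> b) = c \<otimes>\<^bsub>ER\<^esub> a \<oplus>\<^bsub>ER\<^esub> c \<otimes>\<^bsub>ER\<^esub> b"
proof
  fix k
  let ?A = "{n. a n \<noteq> unit_zero K n} \<union> {n. b n \<noteq> unit_zero K n}"
  have A: "finite ?A" using ER_carrierD(2)[OF a] ER_carrierD(2)[OF b] by simp
  have sub: "{n. (a \<oplus>\<^bsub>ER\<^esub> b) n \<noteq> unit_zero K n} \<subseteq> ?A"
    by (auto simp: ER_add unit_zero_def)
  have *: "act (k - n) n (c (k - n)) (a n \<boxplus> b n) = act (k - n) n (c (k - n)) (a n) \<boxplus> act (k - n) n (c (k - n)) (b n)" for n
    using ER_carrierD(1)[OF a, of n] ER_carrierD(1)[OF b, of n]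
    by (intro act_padd_right[OF ER_carrierD(1)[OF c], of _ "unit K"]) auto
  show "(c \<otimes>\<^bsub>ER\<^esub> (a \<oplus>\<^bsub>ER\<^esub> b)) k = (c \<otimes>\<^bsub>ER\<^esub> a \<oplus>\<^bsub>ER\<^esub> c \<otimes>\<^bsub>ER\<^esub> b) k"
    unfolding ER_mult_eq[OF c ER_add_closed[OF a b] A sub] ER_add ER_mult_eq[OF c a A Un_upper1] ER_mult_eq[OF c b A Un_upper2] *
    using ER_mult_arrow[OF c a] ER_mult_arrow[OF c b] by (intro hsum_padd) auto
qed

lemma mult_hel:
  assumes a: "a \<in> carrier ER" and g: "g \<in> unit_hom K n"
  shows "(a \<otimes>\<^bsub>ER\<^esub> hel n g) k = act (k - n) n (a (k - n)) g"
proof -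
  have sub: "{m. hel n g m \<noteq> unit_zero K m} \<subseteq> {n}" by (auto simp: hel_apply)
  have "(a \<otimes>\<^bsub>ER\<^esub> hel n g) k = hsum (unit K) (shift K k (unit K)) (\<lambda>m. act (k - m) m (a (k - m)) (hel n g m)) {n}"
    by (rule ER_mult_eq[OF a hel_closed[OF g] _ sub]) simp
  also have "\<dots> = act (k - n) n (a (k - n)) (hel n g n)"
    by (rule hsum_single) (use ER_mult_arrow[OF a hel_closed[OF g]] in auto)
  finally show ?thesis by (simp add: hel_apply)
qed

lemma hel_mult_hel:
  assumes f: "f \<in> unit_hom K m" and g: "g \<in> unit_hom K n"
  shows "hel m f \<otimes>\<^bsub>ER\<^esub> hel n g = hel (n + m) (act m n f g)"
proof
  fix k
  show "(hel m f \<otimes>\<^bsub>ER\<^esub> hel n g) k = hel (n + m) (act m n f g) k"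
  proof (cases "k = n + m")
    case True
    then show ?thesis using mult_hel[OF hel_closed[OF f] g, of k] by (simp add: hel_apply)
  next
    case False
    then have "hel m f (k - n) = pzero K (unit K) (shift K (k - n) (unit K))" by (auto simp: hel_apply unit_zero_def)
    then show ?thesis using mult_hel[OF hel_closed[OF f] g, of k] False g by (simp add: hel_apply unit_zero_def)
  qed
qed

text \<open>Proved by truncating \<open>a\<close> to finite sets of degrees. The premise
  \<open>f = a n\<close> in the second case passes membership of all components of \<open>a\<close>
  in a graded ideal on to the induction step.\<close>

lemma ER_induct [consumes 1, case_names zero add]:
  assumes a: "a \<in> carrier ER" and zero: "P (unit_zero K)"
    and add: "\<And>b n f. \<lbrakk>b \<in> carrier ER; f \<in> unit_hom K n; f = a n; P b\<rbrakk> \<Longrightarrow> P (hel n f \<oplus>\<^bsub>ER\<^esub> b)"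
  shows "P a"
proof -
  define r where "r A = (\<lambda>n. if n \<in> A then a n else unit_zero K n)" for A
  have r: "r A \<in> carrier ER" for A
  proof -
    have "finite {n. r A n \<noteq> unit_zero K n}"
      by (rule finite_subset[OF _ ER_carrierD(2)[OF a]]) (auto simp: r_def)
    then show ?thesis using ER_carrierD(1)[OF a] unit_zero_arrow unfolding ER_carrier r_def by presburger
  qed
  have "P (r A)" if "finite A" for A using that
  proof (induction A)
    case empty
    have "r {} = unit_zero K" by (auto simp: r_def)
    with zero show ?case by simp
  next
    case (insert n A)
    have "r (insert n A) k = (hel n (a n) \<oplus>\<^bsub>ER\<^esub> r A) k" for k
      using insert(2) ER_carrierD(1)[OF a, of k] by (auto simp: r_def ER_add hel_apply unit_zero_def)
    then have "r (insert n A) = hel n (a n) \<oplus>\<^bsub>ER\<^esub> r A" by blast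
    then show ?case using add[OF r ER_carrierD(1)[OF a] refl insert(3)] by simp
  qed
  from this[OF ER_carrierD(2)[OF a]] have "P (r {n. a n \<noteq> unit_zero K n})" .
  moreover have "r {n. a n \<noteq> unit_zero K n} = a" by (auto simp: r_def)
  ultimately show ?thesis by simp
qed

lemma ER_mult_zero_left: "b \<in> carrier ER \<Longrightarrow> unit_zero K \<otimes>\<^bsub>ER\<^esub> b = unit_zero K"
proof
  fix k assume b: "b \<in> carrier ER"
  have "(unit_zero K \<otimes>\<^bsub>ER\<^esub> b) k = pzero K (unit K) (shift K k (unit K))" unfolding ER_mult
  proof (rule hsum_zero)
    fix n show "act (k - n) n (unit_zero K (k - n)) (b n) = pzero K (unit K) (shift K k (unit K))"
      using ER_carrierD(1)[OF b, of n] unfolding unit_zero_def by simp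
  qed simp_all
  then show "(unit_zero K \<otimes>\<^bsub>ER\<^esub> b) k = unit_zero K k" by (simp add: unit_zero_def)
qed

lemma ER_mult_zero_right: "a \<otimes>\<^bsub>ER\<^esub> unit_zero K = unit_zero K"
proof
  fix k show "(a \<otimes>\<^bsub>ER\<^esub> unit_zero K) k = unit_zero K k"
    unfolding ER_mult by (simp add: hsum_empty unit_zero_def)
qed

text \<open>Biadditivity reduces to homogeneous elements, one factor at a time starting from the
  right; for these the claim is \<open>act_act\<close>.\<close>

lemma ER_assoc:
  assumes "a \<in> carrier ER" "b \<in> carrier ER" "c \<in> carrier ER"
  shows "(a \<otimes>\<^bsub>ER\<^esub> b) \<otimes>\<^bsub>ER\<^esub> c = a \<otimes>\<^bsub>ER\<^esub> (b \<otimes>\<^bsub>ER\<^esub> c)"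
proof -
  note cl = ER_mult_closed ER_add_closed hel_closed ER_zero_closed
  note zs = ER_mult_zero_left ER_mult_zero_right
  have 0: "(hel l f \<otimes>\<^bsub>ER\<^esub> hel m g) \<otimes>\<^bsub>ER\<^esub> hel n h = hel l f \<otimes>\<^bsub>ER\<^esub> (hel m g \<otimes>\<^bsub>ER\<^esub> hel n h)"
    if f: "f \<in> unit_hom K l" and g: "g \<in> unit_hom K m" and h: "h \<in> unit_hom K n" for f g h l m n
  proof -
    have "h \<in> Hom K (unit K) (shift K n (unit K))" using h by simp
    from act_act[OF f g this]
    have "act l (n + m) f (act m n g h) = act (m + l) n (act l m f g) h" .
    then show ?thesis
      by (simp only: hel_mult_hel[OF f g] hel_mult_hel[OF g h] hel_mult_hel[OF f act_closed[OF g h]]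
          hel_mult_hel[OF act_closed[OF f g] h] add.assoc)
  qed
  have 1: "(hel l f \<otimes>\<^bsub>ER\<^esub> hel m g) \<otimes>\<^bsub>ER\<^esub> c = hel l f \<otimes>\<^bsub>ER\<^esub> (hel m g \<otimes>\<^bsub>ER\<^esub> c)"
    if f: "f \<in> unit_hom K l" and g: "g \<in> unit_hom K m" for f g l m
    using assms(3)
  proof (induction rule: ER_induct)
    case zero
    then show ?case by (simp only: zs)
  next
    case (add d n h)
    then show ?case
      by (simp only: ER_r_distr cl f g 0)
  qed
  have 2: "(hel l f \<otimes>\<^bsub>ER\<^esub> b) \<otimes>\<^bsub>ER\<^esub> c = hel l f \<otimes>\<^bsub>ER\<^esub> (b \<otimes>\<^bsub>ER\<^esub> c)"
    if f: "f \<in> unit_hom K l" for f l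
    using assms(2)
  proof (induction rule: ER_induct)
    case zero
    then show ?case by (simp only: zs assms(3))
  next
    case (add d n h)
    then show ?case
      by (simp only: ER_r_distr ER_l_distr cl f assms(3) 1)
  qed
  show ?thesis using assms(1)
  proof (induction rule: ER_induct)
    case zero
    then show ?case by (simp only: zs assms cl)
  next
    case (add d n h)
    then show ?case
      by (simp only: ER_l_distr cl assms 2)
  qed
qed

lemma ER_ring: "ring ER"
proof (rule ringI)
  show "abelian_group ER"
  proof (rule abelian_groupI)
    fix a b c assume a: "a \<in> carrier ER" and b: "b \<in> carrier ER" and c: "c \<in> carrier ER"
    show "a \<oplus>\<^bsub>ER\<^esub> b \<in> carrier ER" by (rule ER_add_closed[OF a b])
    show "a \<oplus>\<^bsub>ER\<^esub> b \<oplus>\<^bsub>ER\<^esub> c = a \<oplus>\<^bsub>ER\<^esub> (b \<oplus>\<^bsub>ER\<^esub> c)"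
    proof
      fix n show "(a \<oplus>\<^bsub>ER\<^esub> b \<oplus>\<^bsub>ER\<^esub> c) n = (a \<oplus>\<^bsub>ER\<^esub> (b \<oplus>\<^bsub>ER\<^esub> c)) n" unfolding ER_add
        by (rule padd_assoc[of _ "unit K" "shift K n (unit K)"])
           (use ER_carrierD(1)[OF a, of n] ER_carrierD(1)[OF b, of n] ER_carrierD(1)[OF c, of n] in auto)
    qed
    show "a \<oplus>\<^bsub>ER\<^esub> b = b \<oplus>\<^bsub>ER\<^esub> a"
    proof
      fix n show "(a \<oplus>\<^bsub>ER\<^esub> b) n = (b \<oplus>\<^bsub>ER\<^esub> a) n" unfolding ER_add
        by (rule padd_comm[of _ "unit K" "shift K n (unit K)"])
           (use ER_carrierD(1)[OF a, of n] ER_carrierD(1)[OF b, of n] in auto)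
    qed
    show "\<zero>\<^bsub>ER\<^esub> \<oplus>\<^bsub>ER\<^esub> a = a"
    proof
      fix n show "(\<zero>\<^bsub>ER\<^esub> \<oplus>\<^bsub>ER\<^esub> a) n = a n"
        using ER_carrierD(1)[OF a, of n] by (simp add: ER_add ER_zero unit_zero_def)
    qed
  next
    show "\<zero>\<^bsub>ER\<^esub> \<in> carrier ER" unfolding ER_zero by (rule ER_zero_closed)
  next
    fix a assume a: "a \<in> carrier ER"
    have "(\<lambda>n. pneg K (a n)) \<in> carrier ER" unfolding ER_carrier
    proof (intro conjI allI)
      show "pneg K (a n) \<in> unit_hom K n" for n using ER_carrierD(1)[OF a, of n] by simp
      show "finite {n. pneg K (a n) \<noteq> unit_zero K n}"
        by (rule finite_subset[OF _ ER_carrierD(2)[OF a]]) (auto simp: unit_zero_def)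
    qed
    moreover have "(\<lambda>n. pneg K (a n)) \<oplus>\<^bsub>ER\<^esub> a = \<zero>\<^bsub>ER\<^esub>"
    proof
      fix n show "((\<lambda>n. pneg K (a n)) \<oplus>\<^bsub>ER\<^esub> a) n = \<zero>\<^bsub>ER\<^esub> n"
        using ER_carrierD(1)[OF a, of n] by (simp add: ER_add ER_zero unit_zero_def)
    qed
    ultimately show "\<exists>y\<in>carrier ER. y \<oplus>\<^bsub>ER\<^esub> a = \<zero>\<^bsub>ER\<^esub>" by blast
  qed
  show "monoid ER"
  proof (rule monoidI)
    have s: "shunit K (unit K) \<in> unit_hom K 0" by simp
    show "\<one>\<^bsub>ER\<^esub> \<in> carrier ER" unfolding ER_one by (rule hel_closed[OF s])
    fix a assume a: "a \<in> carrier ER"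
    show "a \<otimes>\<^bsub>ER\<^esub> \<one>\<^bsub>ER\<^esub> = a"
    proof
      fix k show "(a \<otimes>\<^bsub>ER\<^esub> \<one>\<^bsub>ER\<^esub>) k = a k"
        unfolding ER_one using mult_hel[OF a s, of k] act_on_shunit[OF ER_carrierD(1)[OF a, of k]] by simp
    qed
    show "\<one>\<^bsub>ER\<^esub> \<otimes>\<^bsub>ER\<^esub> a = a" using a
    proof (induction rule: ER_induct)
      case zero
      then show ?case by (rule ER_mult_zero_right)
    next
      case (add b n f)
      have "\<one>\<^bsub>ER\<^esub> \<otimes>\<^bsub>ER\<^esub> hel n f = hel n f"
        unfolding ER_one using hel_mult_hel[OF s add(2)] act_shunit[of f n] add(2) by simp
      then show ?case using ER_r_distr[OF hel_closed[OF add(2)] add(1) hel_closed[OF s]] add(4) by (simp add: ER_one)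
    qed
  qed (rule ER_mult_closed ER_assoc; assumption)+
qed (rule ER_l_distr ER_r_distr; assumption)+

lemma ER_finsum_apply:
  assumes "finite A" "\<And>i. i \<in> A \<Longrightarrow> f i \<in> carrier ER"
  shows "(\<Oplus>\<^bsub>ER\<^esub>i\<in>A. f i) k = hsum (unit K) (shift K k (unit K)) (\<lambda>i. f i k) A"
  using assms
proof (induction A)
  case empty
  interpret ring ER by (rule ER_ring)
  show ?case by (simp add: hsum_empty ER_zero unit_zero_def del: hom_group_simps)
next
  case (insert i A)
  interpret ring ER by (rule ER_ring)
  have "(\<Oplus>\<^bsub>ER\<^esub>i\<in>insert i A. f i) = f i \<oplus>\<^bsub>ER\<^esub> (\<Oplus>\<^bsub>ER\<^esub>i\<in>A. f i)"
    using insert by (intro finsum_insert) auto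
  then have "(\<Oplus>\<^bsub>ER\<^esub>i\<in>insert i A. f i) k = f i k \<boxplus> hsum (unit K) (shift K k (unit K)) (\<lambda>i. f i k) A"
    using insert by (simp add: ER_add)
  also have "\<dots> = hsum (unit K) (shift K k (unit K)) (\<lambda>i. f i k) (insert i A)"
    using ER_carrierD(1)[OF insert(4), of _ k] insert(1,2) by (intro hsum_insert[symmetric]) auto
  finally show ?case .
qed

section \<open>Homogeneous ideals\<close>

text \<open>Only left multiples are required: right multiples follow because exchanging factors
  costs a factor of degree 0, and negatives are multiples by the negative of the unit
  element.\<close>

definition graded_ideal where
  "graded_ideal H \<longleftrightarrow> (\<forall>n. H n \<subseteq> unit_hom K n \<and> unit_zero K n \<in> H n \<and> (\<forall>a\<in>H n. \<forall>b\<in>H n. a \<boxplus> b \<in> H n)) \<and>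
     (\<forall>n m. \<forall>a\<in>H n. \<forall>r\<in>unit_hom K m. act m n r a \<in> H (n + m))"

definition total where
  "total H = {a \<in> carrier ER. \<forall>n. a n \<in> H n}"

context
  fixes H assumes H: "graded_ideal H"
begin

lemma graded_idealD:
  "a \<in> H n \<Longrightarrow> a \<in> unit_hom K n" "unit_zero K n \<in> H n" "\<lbrakk>a \<in> H n; b \<in> H n\<rbrakk> \<Longrightarrow> a \<boxplus> b \<in> H n"
  "\<lbrakk>a \<in> H n; r \<in> unit_hom K m\<rbrakk> \<Longrightarrow> act m n r a \<in> H (n + m)"
  using H unfolding graded_ideal_def by blast+

lemma graded_ideal_right:
  assumes "a \<in> H n" "r \<in> unit_hom K m"
  shows "act n m a r \<in> H (n + m)"
proof -
  obtain e where "e \<in> unit_hom K 0" "act n m a r = act 0 (n + m) e (act m n r a)"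
    using act_commute[of n m] graded_idealD(1)[OF assms(1)] assms(2) by blast
  then show ?thesis using graded_idealD(4)[OF graded_idealD(4)[OF assms], of e 0] by simp
qed

lemma graded_ideal_pneg:
  assumes "a \<in> H n"
  shows "pneg K a \<in> H n"
proof -
  have a: "a \<in> unit_hom K n" by (rule graded_idealD(1)[OF assms])
  have "act 0 n (pneg K (shunit K (unit K))) a = pneg K a"
    using a by (subst act_pneg) (simp_all add: act_shunit)
  moreover have "act 0 n (pneg K (shunit K (unit K))) a \<in> H (n + 0)"
    by (rule graded_idealD(4)[OF assms]) simp
  ultimately show ?thesis by simp
qed

lemma hel_total: "f \<in> H n \<Longrightarrow> hel n f \<in> total H"
  using graded_idealD(1,2) hel_closed[of f n] by (simp add: total_def hel_apply)

lemma total_hel: "hel n f \<in> total H \<Longrightarrow> f \<in> H n"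
  by (auto simp: total_def hel_apply dest: spec[of _ n])

lemma total_ideal: "ideal (total H) ER"
proof (rule idealI[OF ER_ring])
  interpret ring ER by (rule ER_ring)
  have addc: "a \<oplus>\<^bsub>ER\<^esub> b \<in> total H" if "a \<in> total H" "b \<in> total H" for a b
    using that graded_idealD(3) ER_add_closed by (simp add: total_def ER_add)
  show "subgroup (total H) (add_monoid ER)"
  proof (rule add.subgroupI)
    show "total H \<subseteq> carrier ER" by (auto simp: total_def)
    have "unit_zero K \<in> total H" using graded_idealD(2) ER_zero_closed by (simp add: total_def)
    then show "total H \<noteq> {}" by blast
    fix a assume a: "a \<in> total H"
    then have ac: "a \<in> carrier ER" by (simp add: total_def)
    have "\<one>\<^bsub>ER\<^esub> \<in> carrier ER" by simp
    have "(\<ominus>\<^bsub>ER\<^esub> a) n \<in> H n" for n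
    proof -
      have "(a \<oplus>\<^bsub>ER\<^esub> \<ominus>\<^bsub>ER\<^esub> a) n = \<zero>\<^bsub>ER\<^esub> n" using ac by (simp add: r_neg)
      then have "(\<ominus>\<^bsub>ER\<^esub> a) n = pneg K (a n)"
        using ER_carrierD(1)[OF ac, of n] ER_carrierD(1)[OF a_inv_closed[OF ac], of n]
        by (intro pneg_unique[of "a n" "unit K" "shift K n (unit K)" "(\<ominus>\<^bsub>ER\<^esub> a) n"]) (auto simp: ER_add ER_zero unit_zero_def)
      then show ?thesis using a graded_ideal_pneg by (simp add: total_def)
    qed
    then show "\<ominus>\<^bsub>ER\<^esub> a \<in> total H" using ac by (simp add: total_def)
    show "a \<oplus>\<^bsub>ER\<^esub> b \<in> total H" if "b \<in> total H" for b using addc a that by blast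
  qed
  have homl: "hel m r \<otimes>\<^bsub>ER\<^esub> hel n f \<in> total H" "hel n f \<otimes>\<^bsub>ER\<^esub> hel m r \<in> total H"
    if "f \<in> H n" "r \<in> unit_hom K m" for f n r m
    using hel_total[OF graded_idealD(4)[OF that]] hel_total[OF graded_ideal_right[OF that]] hel_mult_hel graded_idealD(1) that
    by (simp_all add: add.commute del: unit_hom_iff)
  have z: "unit_zero K \<in> total H" using graded_idealD(2) ER_zero_closed by (simp add: total_def)
  fix a x assume a: "a \<in> total H" and x: "x \<in> carrier ER"
  have ac: "a \<in> carrier ER" using a by (simp add: total_def)
  have aH: "a n \<in> H n" for n using a by (simp add: total_def)
  have l: "x \<otimes>\<^bsub>ER\<^esub> hel n f \<in> total H \<and> hel n f \<otimes>\<^bsub>ER\<^esub> x \<in> total H" if f: "f \<in> H n" for n f using x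
  proof (induction rule: ER_induct)
    case zero
    then show ?case using z ER_mult_zero_left[of "hel n f"] ER_mult_zero_right graded_idealD(1)[OF f] by simp
  next
    case (add b m r)
    then show ?case
      using homl[OF f add(2)] addc ER_r_distr[OF hel_closed[OF add(2)] add(1) hel_closed[OF graded_idealD(1)[OF f]]]
        ER_l_distr[OF hel_closed[OF add(2)] add(1) hel_closed[OF graded_idealD(1)[OF f]]] by simp
  qed
  have "x \<otimes>\<^bsub>ER\<^esub> a \<in> total H \<and> a \<otimes>\<^bsub>ER\<^esub> x \<in> total H" using ac
  proof (induction rule: ER_induct)
    case zero
    then show ?case using z ER_mult_zero_left[of x] ER_mult_zero_right x by simp
  next
    case (add b m f)
    have fH: "f \<in> H m" using aH add(3) by simp
    show ?case
      using l[OF fH] add(4) addc ER_r_distr[OF hel_closed[OF add(2)] add(1) x] ER_l_distr[OF hel_closed[OF add(2)] add(1) x]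
      by simp
  qed
  then show "x \<otimes>\<^bsub>ER\<^esub> a \<in> total H" "a \<otimes>\<^bsub>ER\<^esub> x \<in> total H" by auto
qed

text \<open>An element of \<open>total H\<close> is a sum of its components, so containment in the
  generated ideal need only be tested on homogeneous elements.\<close>

lemma total_eq_Idl:
  assumes sub: "S \<subseteq> total H" and gen: "\<And>n f. f \<in> H n \<Longrightarrow> hel n f \<in> Idl\<^bsub>ER\<^esub> S"
  shows "total H = Idl\<^bsub>ER\<^esub> S"
proof
  interpret ring ER by (rule ER_ring)
  show "Idl\<^bsub>ER\<^esub> S \<subseteq> total H" by (rule genideal_minimal[OF total_ideal sub])
  have "S \<subseteq> carrier ER" using sub by (auto simp: total_def)
  then interpret I: ideal "Idl\<^bsub>ER\<^esub> S" ER by (rule genideal_ideal)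
  show "total H \<subseteq> Idl\<^bsub>ER\<^esub> S"
  proof
    fix a assume "a \<in> total H"
    then have ac: "a \<in> carrier ER" and aH: "\<And>n. a n \<in> H n" by (auto simp: total_def)
    from ac show "a \<in> Idl\<^bsub>ER\<^esub> S"
    proof (induction rule: ER_induct)
      case zero
      then show ?case using I.zero_closed by (simp add: ER_zero)
    next
      case (add b n f)
      then show ?case using gen[of f n] aH I.a_closed by simp
    qed
  qed
qed

lemma total_homogeneous: "homogeneous_ideal ER (end_degree K) (total H)"
  unfolding homogeneous_ideal_def
proof
  show "ideal (total H) ER" by (rule total_ideal)
  interpret ring ER by (rule ER_ring)
  show "total H = Idl\<^bsub>ER\<^esub> (total H \<inter> (\<Union>n. end_degree K n))"
  proof (rule total_eq_Idl)
    fix n f assume f: "f \<in> H n"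
    then have "hel n f \<in> total H \<inter> (\<Union>n. end_degree K n)"
      using hel_total[OF f] graded_idealD(1)[OF f] by (auto simp: end_degree_def simp del: unit_hom_iff)
    moreover have "total H \<inter> (\<Union>n. end_degree K n) \<subseteq> carrier ER" by (auto simp: total_def)
    ultimately show "hel n f \<in> Idl\<^bsub>ER\<^esub> (total H \<inter> (\<Union>n. end_degree K n))"
      using genideal_self by blast
  qed simp
qed

end

end

section \<open>Coherent objects\<close>

context additive_category
begin

lemma biproduct_ob: "is_biproduct K x y z \<Longrightarrow> z \<in> ob K"
  by (erule biproductE) auto

lemma hsum_swap:
  assumes "finite A" "finite B" "\<And>a b. a \<in> A \<Longrightarrow> b \<in> B \<Longrightarrow> f a b \<in> Hom K x y" "x \<in> ob K" "y \<in> ob K"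
  shows "hsum x y (\<lambda>a. hsum x y (\<lambda>b. f a b) B) A = hsum x y (\<lambda>b. hsum x y (\<lambda>a. f a b) A) B"
  using assms(1,3)
proof (induction A)
  case empty
  have "hsum x y (\<lambda>b. pzero K x y) B = pzero K x y" by (rule hsum_zero) (use assms in simp_all)
  then show ?case using assms by (simp add: hsum_empty del: hom_group_simps)
next
  case (insert a A)
  note cl = hsum_closed[OF assms(4,5)] and ins = hsum_insert[OF assms(4,5)] and pa = hsum_padd[OF assms(4,5)]
  have "hsum x y (\<lambda>a. hsum x y (\<lambda>b. f a b) B) (insert a A) = hsum x y (\<lambda>b. f a b) B \<boxplus> hsum x y (\<lambda>a. hsum x y (\<lambda>b. f a b) B) A"
    by (rule ins) (use insert in \<open>blast intro: cl\<close>)+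
  also have "\<dots> = hsum x y (\<lambda>b. f a b) B \<boxplus> hsum x y (\<lambda>b. hsum x y (\<lambda>a. f a b) A) B"
    using insert by simp
  also have "\<dots> = hsum x y (\<lambda>b. f a b \<boxplus> hsum x y (\<lambda>a. f a b) A) B"
    by (rule pa[symmetric]) (use insert in \<open>blast intro: cl\<close>)+
  also have "\<dots> = hsum x y (\<lambda>b. hsum x y (\<lambda>a. f a b) (insert a A)) B"
  proof (rule hsum_cong[OF assms(4,5)])
    fix b assume b: "b \<in> B"
    then show "f a b \<boxplus> hsum x y (\<lambda>a. f a b) A = hsum x y (\<lambda>a. f a b) (insert a A)"
      by (intro ins[symmetric]) (use insert in blast)+
    show "hsum x y (\<lambda>a. f a b) (insert a A) \<in> Hom K x y"
      by (rule cl) (use insert b in blast)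
  qed
  finally show ?case .
qed

end

lemma (in category_with_shifts) biproduct_shift:
  assumes "is_biproduct K x y z"
  shows "is_biproduct K (shift K n x) (shift K n y) (shift K n z)"
  using assms
proof (rule biproductE)
  fix i p j q
  assume *: "i \<in> Hom K x z" "p \<in> Hom K z x" "j \<in> Hom K y z" "q \<in> Hom K z y"
    "p \<cdot> i = idt K x" "q \<cdot> j = idt K y" "q \<cdot> i = pzero K x y" "p \<cdot> j = pzero K y x" "i \<cdot> p \<boxplus> j \<cdot> q = idt K z"
  have ob: "x \<in> ob K" "y \<in> ob K" "z \<in> ob K" using *(1,3) by auto
  let ?s = "shiftm K n"
  have "?s p \<cdot> ?s i = ?s (p \<cdot> i)" "?s q \<cdot> ?s j = ?s (q \<cdot> j)" "?s q \<cdot> ?s i = ?s (q \<cdot> i)" "?s p \<cdot> ?s j = ?s (p \<cdot> j)"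
    "?s i \<cdot> ?s p \<boxplus> ?s j \<cdot> ?s q = ?s (i \<cdot> p \<boxplus> j \<cdot> q)"
    using *(1-4) by simp_all
  then show ?thesis
    unfolding *(5-9) by (intro biproductI[of "?s i" _ _ "?s p" "?s j" _ "?s q"]) (use *(1-4) ob in simp_all)
qed

context tt_category
begin

text \<open>Finite sums of shifts of the unit, up to isomorphism. The inductive form matches the
  binary biproducts at hand and lets coordinates be treated by induction.\<close>

inductive_set free where
  free_zero: "is_zero K z \<Longrightarrow> z \<in> free"
| free_unit: "shift K k (unit K) \<in> free"
| free_biproduct: "\<lbrakk>x \<in> free; y \<in> free; is_biproduct K x y z\<rbrakk> \<Longrightarrow> z \<in> free"
| free_iso: "\<lbrakk>x \<in> free; u \<in> Hom K x y; iso u\<rbrakk> \<Longrightarrow> y \<in> free"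

lemma free_ob: "x \<in> free \<Longrightarrow> x \<in> ob K"
  by (induction rule: free.induct) (auto simp: is_zero_ob biproduct_ob)

lemma free_shift: "x \<in> free \<Longrightarrow> shift K n x \<in> free"
proof (induction rule: free.induct)
  case (free_zero z)
  then show ?case using shift_is_zero free.free_zero by blast
next
  case (free_unit k)
  show ?case
    by (rule free.free_iso[OF free.free_unit[of "n + k"], of "inva (shmul K n k (unit K))"]) simp_all
next
  case (free_biproduct x y z)
  then show ?case using biproduct_shift free.free_biproduct by blast
next
  case (free_iso x u y)
  show ?case by (rule free.free_iso[OF free_iso(4), of "shiftm K n u"]) (use free_iso in simp_all)
qed

text \<open>The module \<open>\<Oplus>\<^sub>k Hom(x, \<Sigma>\<^sup>k1)\<close> is finitely generated, by the components of \<open>\<phi> : x \<rightarrow> F\<close>.\<close>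

definition cover where
  "cover x F \<phi> \<longleftrightarrow> F \<in> free \<and> \<phi> \<in> Hom K x F \<and>
     (\<forall>k. \<forall>a\<in>Hom K x (shift K k (unit K)). \<exists>b\<in>Hom K F (shift K k (unit K)). a = b \<cdot> \<phi>)"

text \<open>The relations between the components of \<open>\<phi> : x \<rightarrow> F\<close> are finitely generated, by the components of \<open>\<psi>\<close>.\<close>

definition relations where
  "relations F \<phi> E \<psi> \<longleftrightarrow> E \<in> free \<and> \<psi> \<in> Hom K F E \<and> \<psi> \<cdot> \<phi> = pzero K (src K \<phi>) E \<and>
     (\<forall>k. \<forall>a\<in>Hom K F (shift K k (unit K)). a \<cdot> \<phi> = pzero K (src K \<phi>) (shift K k (unit K)) \<longrightarrow>
        (\<exists>c\<in>Hom K E (shift K k (unit K)). a = c \<cdot> \<psi>))"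

text \<open>Coherence of the module of arrows from \<open>x\<close> to shifts of the unit: it is
  finitely generated, and every finite family of its elements, given as the components of some
  \<open>\<phi>\<close>, has finitely generated relations. Asking this for all
  \<open>\<phi>\<close>, not just for one set of generators, is what survives passage to
  cones.\<close>

definition coherent where
  "coherent x \<longleftrightarrow> x \<in> ob K \<and> (\<exists>F \<phi>. cover x F \<phi>) \<and>
     (\<forall>F\<in>free. \<forall>\<phi>\<in>Hom K x F. \<exists>E \<psi>. relations F \<phi> E \<psi>)"

lemma coverD:
  assumes "cover x F \<phi>"
  shows "F \<in> free" "\<phi> \<in> Hom K x F"
    "a \<in> Hom K x (shift K k (unit K)) \<Longrightarrow> \<exists>b\<in>Hom K F (shift K k (unit K)). a = b \<cdot> \<phi>"
  using assms unfolding cover_def by blast+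

lemma relationsD:
  assumes "relations F \<phi> E \<psi>"
  shows "E \<in> free" "\<psi> \<in> Hom K F E" "\<psi> \<cdot> \<phi> = pzero K (src K \<phi>) E"
    "\<lbrakk>a \<in> Hom K F (shift K k (unit K)); a \<cdot> \<phi> = pzero K (src K \<phi>) (shift K k (unit K))\<rbrakk>
      \<Longrightarrow> \<exists>c\<in>Hom K E (shift K k (unit K)). a = c \<cdot> \<psi>"
  using assms unfolding relations_def by blast+

lemma relationsI:
  assumes "E \<in> free" "\<psi> \<in> Hom K F E" "\<psi> \<cdot> \<phi> = pzero K (src K \<phi>) E"
    "\<And>k a. \<lbrakk>a \<in> Hom K F (shift K k (unit K)); a \<cdot> \<phi> = pzero K (src K \<phi>) (shift K k (unit K))\<rbrakk>
      \<Longrightarrow> \<exists>c\<in>Hom K E (shift K k (unit K)). a = c \<cdot> \<psi>"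
  shows "relations F \<phi> E \<psi>"
  using assms unfolding relations_def by blast

lemma coherentD:
  assumes "coherent x"
  shows "x \<in> ob K" "\<exists>F \<phi>. cover x F \<phi>" "\<lbrakk>F \<in> free; \<phi> \<in> Hom K x F\<rbrakk> \<Longrightarrow> \<exists>E \<psi>. relations F \<phi> E \<psi>"
  using assms unfolding coherent_def by blast+

lemma coherent_zero:
  assumes z: "is_zero K z"
  shows "coherent z"
  unfolding coherent_def
proof (intro conjI ballI)
  note ob = is_zero_ob[OF z]
  show "z \<in> ob K" by (rule ob)
  have "cover z z (idt K z)" unfolding cover_def using free_zero[OF z] ob by auto
  then show "\<exists>F \<phi>. cover z F \<phi>" by blast
  fix F \<phi> assume F: "F \<in> free" and p: "\<phi> \<in> Hom K z F"
  have "\<phi> = pzero K z F" using from_zero[OF z, of \<phi>] p by simp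
  then have "relations F \<phi> F (idt K F)"
    by (intro relationsI) (use F free_ob[OF F] ob in auto)
  then show "\<exists>E \<psi>. relations F \<phi> E \<psi>" by blast
qed

text \<open>Generators restrict along \<open>i\<close>. The relations on \<open>\<phi>\<close> are
  those on \<open>\<phi> \<cdot> r\<close>, because \<open>r\<close> has the section
  \<open>i\<close>.\<close>

lemma coherent_retract:
  assumes y: "coherent y" and i: "i \<in> Hom K x y" and r: "r \<in> Hom K y x" and ri: "r \<cdot> i = idt K x"
  shows "coherent x"
  unfolding coherent_def
proof (intro conjI ballI)
  show x: "x \<in> ob K" using i by auto
  obtain F \<phi> where F: "cover y F \<phi>" using coherentD(2)[OF y] by blast
  have "cover x F (\<phi> \<cdot> i)" unfolding cover_def
  proof (intro conjI allI ballI)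
    show "F \<in> free" "\<phi> \<cdot> i \<in> Hom K x F" using coverD(1,2)[OF F] i by simp_all
    fix k a assume a: "a \<in> Hom K x (shift K k (unit K))"
    then obtain b where b: "b \<in> Hom K F (shift K k (unit K))" "a \<cdot> r = b \<cdot> \<phi>"
      using coverD(3)[OF F, of "a \<cdot> r" k] r by auto
    have "a = a \<cdot> r \<cdot> i" using a ri by simp
    also have "\<dots> = (b \<cdot> \<phi>) \<cdot> i" by (rule reassoc[OF b(2)]) (use a i r in auto)
    finally show "\<exists>b\<in>Hom K F (shift K k (unit K)). a = b \<cdot> \<phi> \<cdot> i"
      using b(1) coverD(2)[OF F] i by (intro bexI[of _ b]) simp_all
  qed
  then show "\<exists>F \<phi>. cover x F \<phi>" by blast
  fix F \<phi> assume F: "F \<in> free" and p: "\<phi> \<in> Hom K x F"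
  obtain E \<psi> where E: "relations F (\<phi> \<cdot> r) E \<psi>" using coherentD(3)[OF y F, of "\<phi> \<cdot> r"] p r by auto
  note d = relationsD[OF E]
  have "relations F \<phi> E \<psi>"
  proof (rule relationsI)
    show "E \<in> free" "\<psi> \<in> Hom K F E" using d by simp_all
    have "\<psi> \<cdot> \<phi> = (\<psi> \<cdot> \<phi> \<cdot> r) \<cdot> i" using d(2) p r i ri by simp
    also have "\<dots> = pzero K y E \<cdot> i" using d(3) p r by simp
    finally show "\<psi> \<cdot> \<phi> = pzero K (src K \<phi>) E" using i p free_ob[OF d(1)] by simp
    fix k a assume a: "a \<in> Hom K F (shift K k (unit K))" "a \<cdot> \<phi> = pzero K (src K \<phi>) (shift K k (unit K))"
    have "a \<cdot> \<phi> \<cdot> r = pzero K (src K \<phi>) (shift K k (unit K)) \<cdot> r"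
      by (rule reassoc[OF a(2)]) (use a p r in auto)
    then show "\<exists>c\<in>Hom K E (shift K k (unit K)). a = c \<cdot> \<psi>"
      using d(4)[OF a(1)] p r by simp
  qed
  then show "\<exists>E \<psi>. relations F \<phi> E \<psi>" by blast
qed

lemma desuspend:
  assumes "a \<in> Hom K (shift K n x) (shift K k (unit K))" "x \<in> ob K"
  shows "\<exists>b\<in>Hom K x (shift K (k - n) (unit K)). a = shmul K n (k - n) (unit K) \<cdot> shiftm K n b"
proof -
  obtain b where b: "b \<in> Hom K x (shift K (k - n) (unit K))" "shiftm K n b = inva (shmul K n (k - n) (unit K)) \<cdot> a"
    using shiftm_full[of x "shift K (k - n) (unit K)" "inva (shmul K n (k - n) (unit K)) \<cdot> a" n] assms by auto
  then show ?thesis using assms by (intro bexI[of _ b]) simp_all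
qed

lemma coherent_shift:
  assumes x: "coherent x"
  shows "coherent (shift K n x)"
  unfolding coherent_def
proof (intro conjI ballI)
  note ob = coherentD(1)[OF x]
  show "shift K n x \<in> ob K" using ob by simp
  obtain F \<phi> where F: "cover x F \<phi>" using coherentD(2)[OF x] by blast
  have "cover (shift K n x) (shift K n F) (shiftm K n \<phi>)" unfolding cover_def
  proof (intro conjI allI ballI)
    show "shift K n F \<in> free" "shiftm K n \<phi> \<in> Hom K (shift K n x) (shift K n F)"
      using coverD(1,2)[OF F] free_shift by simp_all
    fix k a assume a: "a \<in> Hom K (shift K n x) (shift K k (unit K))"
    obtain b where b: "b \<in> Hom K x (shift K (k - n) (unit K))" "a = shmul K n (k - n) (unit K) \<cdot> shiftm K n b"
      using desuspend[OF a ob] by blast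
    obtain c where "c \<in> Hom K F (shift K (k - n) (unit K))" "b = c \<cdot> \<phi>" using coverD(3)[OF F b(1)] by blast
    then show "\<exists>b\<in>Hom K (shift K n F) (shift K k (unit K)). a = b \<cdot> shiftm K n \<phi>"
      using b coverD(2)[OF F] by (intro bexI[of _ "shmul K n (k - n) (unit K) \<cdot> shiftm K n c"]) simp_all
  qed
  then show "\<exists>F \<phi>. cover (shift K n x) F \<phi>" by blast
  fix F \<phi> assume F: "F \<in> free" and p: "\<phi> \<in> Hom K (shift K n x) F"
  define G where "G = shift K (- n) F"
  define e where "e = inva (unshift (- n) F)"
  note Fo = free_ob[OF F]
  have G: "G \<in> free" "G \<in> ob K" unfolding G_def using free_shift[OF F] Fo by simp_all
  have e: "e \<in> ar K" "src K e = F" "tgt K e = shift K n G" "iso e"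
    using unshift[OF Fo, of "- n"] by (simp_all add: e_def G_def)
  obtain \<phi>' where p': "\<phi>' \<in> Hom K x G" "shiftm K n \<phi>' = e \<cdot> \<phi>"
    using shiftm_full[of x G "e \<cdot> \<phi>" n] ob G p e by auto
  obtain E \<psi> where E: "relations G \<phi>' E \<psi>" using coherentD(3)[OF x G(1) p'(1)] by blast
  note d = relationsD[OF E]
  have "relations F \<phi> (shift K n E) (shiftm K n \<psi> \<cdot> e)"
  proof (rule relationsI)
    show "shift K n E \<in> free" "shiftm K n \<psi> \<cdot> e \<in> Hom K F (shift K n E)"
      using d e free_shift by simp_all
    have "(shiftm K n \<psi> \<cdot> e) \<cdot> \<phi> = shiftm K n \<psi> \<cdot> shiftm K n \<phi>'" using p' d e p by simp
    also have "\<dots> = shiftm K n (\<psi> \<cdot> \<phi>')" using p'(1) d(2) by simp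
    finally show "(shiftm K n \<psi> \<cdot> e) \<cdot> \<phi> = pzero K (src K \<phi>) (shift K n E)"
      unfolding d(3) using p p'(1) free_ob[OF d(1)] ob by simp
    fix k a assume a: "a \<in> Hom K F (shift K k (unit K))" "a \<cdot> \<phi> = pzero K (src K \<phi>) (shift K k (unit K))"
    have "a \<cdot> inva e \<in> Hom K (shift K n G) (shift K k (unit K))" using a e by simp
    from desuspend[OF this G(2)] obtain b where
      b: "b \<in> Hom K G (shift K (k - n) (unit K))" "a \<cdot> inva e = shmul K n (k - n) (unit K) \<cdot> shiftm K n b" by blast
    have ae: "a = shmul K n (k - n) (unit K) \<cdot> shiftm K n b \<cdot> e"
    proof -
      have "a = (a \<cdot> inva e) \<cdot> e" using a(1) e by simp
      also have "\<dots> = shmul K n (k - n) (unit K) \<cdot> shiftm K n b \<cdot> e" unfolding b(2) using b(1) e by simp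
      finally show ?thesis .
    qed
    have "shmul K n (k - n) (unit K) \<cdot> shiftm K n (b \<cdot> \<phi>') = a \<cdot> \<phi>"
      unfolding ae using b(1) p'(1) p e by (simp add: p'(2))
    also have "\<dots> = shmul K n (k - n) (unit K) \<cdot> pzero K (shift K n x) (shift K n (shift K (k - n) (unit K)))"
      unfolding a(2) using p ob by simp
    finally have "shiftm K n (b \<cdot> \<phi>') = pzero K (shift K n x) (shift K n (shift K (k - n) (unit K)))"
      by (rule iso_cancel_left[rotated 5]) (use b(1) p'(1) ob in simp_all)
    then have "shiftm K n (b \<cdot> \<phi>') = shiftm K n (pzero K x (shift K (k - n) (unit K)))" using ob by simp
    then have "b \<cdot> \<phi>' = pzero K x (shift K (k - n) (unit K))"
      by (rule shiftm_faithful[of _ x "shift K (k - n) (unit K)", rotated 2]) (use b(1) p'(1) ob in simp_all)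
    then obtain c where "c \<in> Hom K E (shift K (k - n) (unit K))" "b = c \<cdot> \<psi>"
      using d(4)[OF b(1)] p'(1) by auto
    then show "\<exists>c\<in>Hom K (shift K n E) (shift K k (unit K)). a = c \<cdot> shiftm K n \<psi> \<cdot> e"
      using d(2) e unfolding ae
      by (intro bexI[of _ "shmul K n (k - n) (unit K) \<cdot> shiftm K n c"]) simp_all
  qed
  then show "\<exists>E \<psi>. relations F \<phi> E \<psi>" by blast
qed

text \<open>Contravariantly, \<open>\<Oplus>\<^sub>k Hom(z, \<Sigma>\<^sup>k1)\<close> is an extension of the kernel of a map between the modules
  of \<open>y\<close> and \<open>x\<close> by a cokernel of such a map.\<close>

lemma coherent_third:
  assumes t: "triangle x y z f g h" and x: "coherent x" and y: "coherent y"
  shows "coherent z"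
  unfolding coherent_def
proof (intro conjI ballI)
  note ta = triangle_arrow[OF t]
  note sx = coherent_shift[OF x, of 1] and sy = coherent_shift[OF y, of 1]
  show "z \<in> ob K" by (rule ta)
  show "\<exists>F \<phi>. cover z F \<phi>"
  proof -
    obtain F \<phi> where F: "cover y F \<phi>" using coherentD(2)[OF y] by blast
    note Fd = coverD(1,2)[OF F]
    \<comment> \<open>Arrows out of \<open>y\<close> that vanish on \<open>x\<close> are generated
      by \<open>\<psi> \<cdot> \<phi>\<close>, and \<open>e\<close> extends these generators over
      \<open>g\<close>. An arrow out of \<open>z\<close> differs from a combination of
      \<open>e\<close> by one that vanishes on \<open>y\<close>, hence comes from the shift of
      \<open>x\<close>, where \<open>\<kappa>\<close> generates.\<close>
    obtain E \<psi> where E: "relations F (\<phi> \<cdot> f) E \<psi>" using coherentD(3)[OF x Fd(1), of "\<phi> \<cdot> f"] Fd ta by auto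
    note d = relationsD[OF E]
    have "(\<psi> \<cdot> \<phi>) \<cdot> f = pzero K x E" using d(2,3) Fd ta by simp
    then obtain e where e: "e \<in> Hom K z E" "\<psi> \<cdot> \<phi> = e \<cdot> g"
      using exact_contra_mid[OF t, of "\<psi> \<cdot> \<phi>" E] d(2) Fd ta by auto
    obtain G \<kappa> where G: "cover (shift K 1 x) G \<kappa>" using coherentD(2)[OF sx] by blast
    note Gd = coverD(1,2)[OF G]
    obtain B where B: "is_biproduct K E G B" using biproducts free_ob[OF d(1)] free_ob[OF Gd(1)] by blast
    note Bf = free_biproduct[OF d(1) Gd(1) B]
    obtain i p j q where ij: "i \<in> Hom K E B" "p \<in> Hom K B E" "j \<in> Hom K G B" "q \<in> Hom K B G"
      "p \<cdot> i = idt K E" "q \<cdot> j = idt K G" "q \<cdot> i = pzero K E G" "p \<cdot> j = pzero K G E" "i \<cdot> p \<boxplus> j \<cdot> q = idt K B"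
      using B by (rule biproductE)
    define \<mu> where "\<mu> = i \<cdot> e \<boxplus> j \<cdot> \<kappa> \<cdot> h"
    have m: "\<mu> \<in> Hom K z B" using ij(1,3) e(1) Gd ta by (simp add: \<mu>_def)
    have "cover z B \<mu>" unfolding cover_def
    proof (intro conjI allI ballI)
      show "B \<in> free" "\<mu> \<in> Hom K z B" by (rule Bf m)+
      fix k a assume a: "a \<in> Hom K z (shift K k (unit K))"
      let ?k = "shift K k (unit K)"
      obtain b where b: "b \<in> Hom K F ?k" "a \<cdot> g = b \<cdot> \<phi>" using coverD(3)[OF F, of "a \<cdot> g" k] a ta by auto
      have "b \<cdot> \<phi> \<cdot> f = a \<cdot> g \<cdot> f" using reassoc[OF b(2), of f] b(1) a ta Fd by simp
      also have "\<dots> = pzero K x ?k" using triangle_cmp(1)[OF t] a ta by simp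
      finally obtain c where c: "c \<in> Hom K E ?k" "b = c \<cdot> \<psi>"
        using d(4)[OF b(1)] Fd ta by auto
      have "c \<cdot> e \<cdot> g = c \<cdot> \<psi> \<cdot> \<phi>" using e(2) by simp
      also have "\<dots> = a \<cdot> g" unfolding b(2) c(2) using c(1) d(2) Fd by simp
      finally have cg: "c \<cdot> e \<cdot> g = a \<cdot> g" .
      have "(a \<boxplus> pneg K (c \<cdot> e)) \<cdot> g = pzero K y ?k" using a c(1) e(1) ta cg by simp
      then obtain l where l: "l \<in> Hom K (shift K 1 x) ?k" "a \<boxplus> pneg K (c \<cdot> e) = l \<cdot> h"
        using exact_contra_right[OF t, of "a \<boxplus> pneg K (c \<cdot> e)" ?k] a c(1) e(1) ta by auto
      obtain l' where l': "l' \<in> Hom K G ?k" "l = l' \<cdot> \<kappa>" using coverD(3)[OF G l(1)] by blast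
      have "a = (a \<boxplus> pneg K (c \<cdot> e)) \<boxplus> c \<cdot> e" using a c(1) e(1) by simp
      also have "\<dots> = l' \<cdot> \<kappa> \<cdot> h \<boxplus> c \<cdot> e" unfolding l(2) l'(2) using l'(1) Gd ta by simp
      also have "\<dots> = c \<cdot> e \<boxplus> l' \<cdot> \<kappa> \<cdot> h"
        by (rule padd_comm[of _ z ?k]) (use l'(1) Gd ta c(1) e(1) in simp_all)
      finally have a_eq: "a = c \<cdot> e \<boxplus> l' \<cdot> \<kappa> \<cdot> h" .
      have "p \<cdot> \<mu> = (p \<cdot> i) \<cdot> e \<boxplus> (p \<cdot> j) \<cdot> \<kappa> \<cdot> h" using ij(1-4) e(1) Gd ta by (simp add: \<mu>_def)
      then have pm: "p \<cdot> \<mu> = e" unfolding ij(5-8) using ij(1-4) e(1) Gd ta free_ob[OF d(1)] by simp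
      have "q \<cdot> \<mu> = (q \<cdot> i) \<cdot> e \<boxplus> (q \<cdot> j) \<cdot> \<kappa> \<cdot> h" using ij(1-4) e(1) Gd ta by (simp add: \<mu>_def)
      then have qm: "q \<cdot> \<mu> = \<kappa> \<cdot> h" unfolding ij(5-8) using ij(1-4) e(1) Gd ta free_ob[OF Gd(1)] by simp
      have "(c \<cdot> p \<boxplus> l' \<cdot> q) \<cdot> \<mu> = c \<cdot> p \<cdot> \<mu> \<boxplus> l' \<cdot> q \<cdot> \<mu>" using c(1) l'(1) ij(1-4) m by simp
      then have "a = (c \<cdot> p \<boxplus> l' \<cdot> q) \<cdot> \<mu>" unfolding pm qm a_eq ..
      moreover have "c \<cdot> p \<boxplus> l' \<cdot> q \<in> Hom K B ?k" using c(1) l'(1) ij(1-4) by simp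
      ultimately show "\<exists>b\<in>Hom K B ?k. a = b \<cdot> \<mu>" by blast
    qed
    then show ?thesis by blast
  qed
  fix F \<phi> assume F: "F \<in> free" and p: "\<phi> \<in> Hom K z F"
  obtain E \<psi> where E: "relations F (\<phi> \<cdot> g) E \<psi>" using coherentD(3)[OF y F, of "\<phi> \<cdot> g"] p ta by auto
  note d = relationsD[OF E]
  have "(\<psi> \<cdot> \<phi>) \<cdot> g = pzero K y E" using d(2,3) p ta by simp
  then obtain \<kappa> where c: "\<kappa> \<in> Hom K (shift K 1 x) E" "\<psi> \<cdot> \<phi> = \<kappa> \<cdot> h"
    using exact_contra_right[OF t, of "\<psi> \<cdot> \<phi>" E] d(2) p ta by auto
  obtain G \<omega> where G: "cover (shift K 1 y) G \<omega>" using coherentD(2)[OF sy] by blast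
  note Gd = coverD(1,2)[OF G]
  obtain B where B: "is_biproduct K E G B" using biproducts free_ob[OF d(1)] free_ob[OF Gd(1)] by blast
  note Bf = free_biproduct[OF d(1) Gd(1) B]
  obtain i r j q where ij: "i \<in> Hom K E B" "r \<in> Hom K B E" "j \<in> Hom K G B" "q \<in> Hom K B G"
    "r \<cdot> i = idt K E" "q \<cdot> j = idt K G" "q \<cdot> i = pzero K E G" "r \<cdot> j = pzero K G E" "i \<cdot> r \<boxplus> j \<cdot> q = idt K B"
    using B by (rule biproductE)
  let ?sf = "shiftm K 1 f"
  \<comment> \<open>A relation on \<open>\<phi>\<close> is in particular one on
    \<open>\<phi> \<cdot> g\<close>, hence of the form \<open>b \<cdot> \<psi>\<close>. It is a
    relation on \<open>\<phi>\<close> iff \<open>b \<cdot> \<kappa>\<close> comes from the shift of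
    \<open>y\<close> through the shift of \<open>f\<close>, that is, iff \<open>b\<close> is the
    first component of a relation on \<open>\<mu>\<close>.\<close>
  define \<mu> where "\<mu> = i \<cdot> \<kappa> \<boxplus> pneg K (j \<cdot> \<omega> \<cdot> ?sf)"
  have m: "\<mu> \<in> Hom K (shift K 1 x) B" using ij(1-4) c(1) Gd ta by (simp add: \<mu>_def)
  have "r \<cdot> \<mu> = (r \<cdot> i) \<cdot> \<kappa> \<boxplus> pneg K ((r \<cdot> j) \<cdot> \<omega> \<cdot> ?sf)" using ij(1-4) c(1) Gd ta by (simp add: \<mu>_def)
  then have rm: "r \<cdot> \<mu> = \<kappa>" unfolding ij(5-8) using ij(1-4) c(1) Gd ta free_ob[OF d(1)] by simp
  have "q \<cdot> \<mu> = (q \<cdot> i) \<cdot> \<kappa> \<boxplus> pneg K ((q \<cdot> j) \<cdot> \<omega> \<cdot> ?sf)" using ij(1-4) c(1) Gd ta by (simp add: \<mu>_def)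
  then have qm: "q \<cdot> \<mu> = pneg K (\<omega> \<cdot> ?sf)" unfolding ij(5-8) using ij(1-4) c(1) Gd ta free_ob[OF Gd(1)] by simp
  obtain E' \<psi>' where E': "relations B \<mu> E' \<psi>'" using coherentD(3)[OF sx Bf m] by blast
  note d' = relationsD[OF E']
  have "relations F \<phi> E' (\<psi>' \<cdot> i \<cdot> \<psi>)"
  proof (rule relationsI)
    show "E' \<in> free" "\<psi>' \<cdot> i \<cdot> \<psi> \<in> Hom K F E'" using d(2) d'(1,2) ij(1-4) by simp_all
    have "\<mu> \<cdot> h = i \<cdot> \<kappa> \<cdot> h \<boxplus> pneg K (j \<cdot> \<omega> \<cdot> ?sf \<cdot> h)" using ij(1-4) c(1) Gd ta by (simp add: \<mu>_def)
    also have "\<dots> = i \<cdot> \<kappa> \<cdot> h" using triangle_cmp(3)[OF t] ij(1-4) c(1) Gd ta biproduct_ob[OF B] by simp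
    finally have "\<psi>' \<cdot> i \<cdot> \<psi> \<cdot> \<phi> = \<psi>' \<cdot> \<mu> \<cdot> h" using c(2) by simp
    also have "\<dots> = pzero K (src K \<mu>) E' \<cdot> h"
      by (rule reassoc[OF d'(3)]) (use d'(2) m ta in auto)
    finally show "(\<psi>' \<cdot> i \<cdot> \<psi>) \<cdot> \<phi> = pzero K (src K \<phi>) E'"
      using d(2) d'(2) ij(1-4) p m ta free_ob[OF d'(1)] by simp
    fix k a assume a: "a \<in> Hom K F (shift K k (unit K))" "a \<cdot> \<phi> = pzero K (src K \<phi>) (shift K k (unit K))"
    let ?k = "shift K k (unit K)"
    have "a \<cdot> \<phi> \<cdot> g = pzero K z ?k \<cdot> g" by (rule reassoc) (use a p ta in auto)
    then obtain b where b: "b \<in> Hom K E ?k" "a = b \<cdot> \<psi>" using d(4)[OF a(1)] p ta by auto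
    have "(b \<cdot> \<kappa>) \<cdot> h = (b \<cdot> \<psi>) \<cdot> \<phi>" using b(1) c d(2) p ta by simp
    also have "\<dots> = pzero K z ?k" unfolding b(2)[symmetric] a(2) using p by simp
    finally obtain l where l: "l \<in> Hom K (shift K 1 y) ?k" "b \<cdot> \<kappa> = l \<cdot> ?sf"
      using exact_contra_shift[OF t, of "b \<cdot> \<kappa>" ?k] b(1) c(1) ta by auto
    obtain l' where l': "l' \<in> Hom K G ?k" "l = l' \<cdot> \<omega>" using coverD(3)[OF G l(1)] by blast
    have bl: "b \<cdot> r \<boxplus> l' \<cdot> q \<in> Hom K B ?k" using b(1) l'(1) ij(1-4) by simp
    have "(b \<cdot> r \<boxplus> l' \<cdot> q) \<cdot> \<mu> = b \<cdot> r \<cdot> \<mu> \<boxplus> l' \<cdot> q \<cdot> \<mu>" using b(1) l'(1) ij(1-4) m by simp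
    also have "\<dots> = b \<cdot> \<kappa> \<boxplus> pneg K (l' \<cdot> \<omega> \<cdot> ?sf)" unfolding rm qm using l'(1) Gd ta by simp
    also have "\<dots> = pzero K (src K \<mu>) ?k" unfolding l(2) l'(2) using l'(1) Gd ta m by simp
    finally obtain v where v: "v \<in> Hom K E' ?k" "b \<cdot> r \<boxplus> l' \<cdot> q = v \<cdot> \<psi>'" using d'(4)[OF bl] by blast
    have "b = b \<cdot> (r \<cdot> i) \<boxplus> l' \<cdot> (q \<cdot> i)" unfolding ij(5,7) using b(1) l'(1) ij(1-4) free_ob[OF d(1)] by simp
    also have "\<dots> = (b \<cdot> r \<boxplus> l' \<cdot> q) \<cdot> i" using b(1) l'(1) ij(1-4) by simp
    also have "\<dots> = v \<cdot> \<psi>' \<cdot> i" unfolding v(2) using v(1) d'(2) ij(1-4) by simp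
    finally have "a = v \<cdot> \<psi>' \<cdot> i \<cdot> \<psi>" using b(2) v(1) d(2) d'(2) ij(1-4) by simp
    then show "\<exists>c\<in>Hom K E' ?k. a = c \<cdot> \<psi>' \<cdot> i \<cdot> \<psi>" using v(1) by blast
  qed
  then show "\<exists>E \<psi>. relations F \<phi> E \<psi>" by blast
qed

lemma coherent_thick: "thick K {x. coherent x}"
  by (rule thickI)
     (use coherentD(1) coherent_zero coherent_shift coherent_third coherent_retract in blast)+

end

section \<open>Coherence of the unit\<close>

context tt_category
begin

lemma hel_padd:
  assumes "a \<in> unit_hom K n" "b \<in> unit_hom K n"
  shows "hel n (a \<boxplus> b) = hel n a \<oplus>\<^bsub>ER\<^esub> hel n b"
proof
  fix k show "hel n (a \<boxplus> b) k = (hel n a \<oplus>\<^bsub>ER\<^esub> hel n b) k"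
    by (simp add: ER_add hel_apply unit_zero_def)
qed

lemma act_hsum_left:
  assumes "finite A" "\<And>j. j \<in> A \<Longrightarrow> f j \<in> unit_hom K n" "a \<in> Hom K x (shift K k (unit K))"
  shows "act n k (hsum (unit K) (shift K n (unit K)) f A) a = hsum x (shift K (k + n) (unit K)) (\<lambda>j. act n k (f j) a) A"
proof -
  have x: "x \<in> ob K" using assms(3) by auto
  show ?thesis using assms(1,2)
  proof (induction A)
    case empty
    then show ?case using assms(3) x by (simp add: hsum_empty del: hom_group_simps)
  next
    case (insert j A)
    have c: "hsum (unit K) (shift K n (unit K)) f A \<in> unit_hom K n"
      unfolding unit_hom_def by (rule hsum_closed) (use insert in auto)
    have "act n k (hsum (unit K) (shift K n (unit K)) f (insert j A)) a =
        act n k (f j \<boxplus> hsum (unit K) (shift K n (unit K)) f A) a"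
      by (subst hsum_insert) (use insert in auto)
    also have "\<dots> = act n k (f j) a \<boxplus> hsum x (shift K (k + n) (unit K)) (\<lambda>j. act n k (f j) a) A"
      using insert assms(3) c by (subst act_padd_left) auto
    also have "\<dots> = hsum x (shift K (k + n) (unit K)) (\<lambda>j. act n k (f j) a) (insert j A)"
      using insert assms(3) x by (intro hsum_insert[symmetric]) (auto simp: act_arrow)
    finally show ?case .
  qed
qed

text \<open>For free \<open>F\<close> this is the degree \<open>k\<close> part of the ideal
  generated by the components of \<open>\<phi>\<close>, expressed without choosing coordinates on
  \<open>F\<close>.\<close>

definition ideal_of where
  "ideal_of F \<phi> k = {a \<cdot> \<phi> | a. a \<in> Hom K F (shift K k (unit K))}"

lemma ideal_of_graded:
  assumes "\<phi> \<in> Hom K (unit K) F"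
  shows "graded_ideal (ideal_of F \<phi>)"
  unfolding graded_ideal_def
proof (intro conjI allI ballI)
  have F: "F \<in> ob K" using assms by auto
  fix n
  show "ideal_of F \<phi> n \<subseteq> unit_hom K n" using assms by (auto simp: ideal_of_def)
  have "unit_zero K n = pzero K F (shift K n (unit K)) \<cdot> \<phi>" using assms by (simp add: unit_zero_def)
  then show "unit_zero K n \<in> ideal_of F \<phi> n" unfolding ideal_of_def using F by auto
  fix a assume a: "a \<in> ideal_of F \<phi> n"
  then obtain a' where a': "a = a' \<cdot> \<phi>" "a' \<in> Hom K F (shift K n (unit K))" by (auto simp: ideal_of_def)
  show "a \<boxplus> b \<in> ideal_of F \<phi> n" if b: "b \<in> ideal_of F \<phi> n" for b
  proof -
    obtain b' where b': "b = b' \<cdot> \<phi>" "b' \<in> Hom K F (shift K n (unit K))" using b by (auto simp: ideal_of_def)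
    have "a \<boxplus> b = (a' \<boxplus> b') \<cdot> \<phi>" "a' \<boxplus> b' \<in> Hom K F (shift K n (unit K))"
      using a' b' assms by simp_all
    then show ?thesis unfolding ideal_of_def by blast
  qed
  show "act m n r a \<in> ideal_of F \<phi> (n + m)" if r: "r \<in> unit_hom K m" for m r
  proof -
    have "act m n r a = act m n r a' \<cdot> \<phi>" "act m n r a' \<in> Hom K F (shift K (n + m) (unit K))"
      using act_cmp[OF r, of a' n \<phi>] a' assms r by simp_all
    then show ?thesis unfolding ideal_of_def by blast
  qed
qed

text \<open>Induction on \<open>F\<close> collects the components of \<open>\<phi>\<close>.
  Generation is stated as a property of all ideals containing \<open>S\<close>, which passes through
  biproducts and isomorphisms without computing sums of ideals.\<close>

lemma ideal_of_finite:
  assumes "F \<in> free" "\<phi> \<in> Hom K (unit K) F"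
  shows "\<exists>S. finite S \<and> S \<subseteq> total (ideal_of F \<phi>) \<and>
    (\<forall>I. ideal I ER \<longrightarrow> S \<subseteq> I \<longrightarrow> (\<forall>k. \<forall>a\<in>Hom K F (shift K k (unit K)). hel k (a \<cdot> \<phi>) \<in> I))"
  using assms
proof (induction arbitrary: \<phi> rule: free.induct)
  case (free_zero z)
  have "hel k (a \<cdot> \<phi>) \<in> I" if I: "ideal I ER" and a: "a \<in> Hom K z (shift K k (unit K))" for I k a
  proof -
    interpret ideal I ER by (rule I)
    have "a \<cdot> \<phi> = unit_zero K k"
      using from_zero[OF free_zero(1), of a] a free_zero(2) by (simp add: unit_zero_def)
    then have "hel k (a \<cdot> \<phi>) = \<zero>\<^bsub>ER\<^esub>" by (simp add: hel_zero ER_zero)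
    then show ?thesis using zero_closed by simp
  qed
  then show ?case by (intro exI[of _ "{}"]) blast
next
  case (free_unit d)
  have p: "\<phi> \<in> unit_hom K d" using free_unit by simp
  have "\<phi> = idt K (shift K d (unit K)) \<cdot> \<phi>" using free_unit by simp
  then have "\<phi> \<in> ideal_of (shift K d (unit K)) \<phi> d" unfolding ideal_of_def by force
  from hel_total[OF ideal_of_graded[OF free_unit] this]
  have S: "{hel d \<phi>} \<subseteq> total (ideal_of (shift K d (unit K)) \<phi>)" by simp
  have "hel k (a \<cdot> \<phi>) \<in> I" if I: "ideal I ER" "{hel d \<phi>} \<subseteq> I" and a: "a \<in> Hom K (shift K d (unit K)) (shift K k (unit K))" for I k a
  proof -
    interpret ideal I ER by (rule I)
    have "a \<in> Hom K (shift K d (unit K)) (shift K (d + (k - d)) (unit K))" using a by simp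
    from act_full[OF this] obtain r where r: "r \<in> unit_hom K (k - d)" "a \<cdot> \<phi> = act (k - d) d r \<phi>" using p by auto
    have "hel (k - d) r \<otimes>\<^bsub>ER\<^esub> hel d \<phi> = hel k (a \<cdot> \<phi>)" using hel_mult_hel[OF r(1) p] r(2) by simp
    moreover have "hel (k - d) r \<otimes>\<^bsub>ER\<^esub> hel d \<phi> \<in> I"
      by (rule I_l_closed) (use I r in auto)
    ultimately show ?thesis by simp
  qed
  with S show ?case by (intro exI[of _ "{hel d \<phi>}"]) blast
next
  case (free_biproduct x y z)
  obtain i p j q where ij: "i \<in> Hom K x z" "p \<in> Hom K z x" "j \<in> Hom K y z" "q \<in> Hom K z y"
    "p \<cdot> i = idt K x" "q \<cdot> j = idt K y" "q \<cdot> i = pzero K x y" "p \<cdot> j = pzero K y x" "i \<cdot> p \<boxplus> j \<cdot> q = idt K z"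
    using free_biproduct(3) by (rule biproductE)
  note phi = free_biproduct(6)
  have pq: "p \<cdot> \<phi> \<in> Hom K (unit K) x" "q \<cdot> \<phi> \<in> Hom K (unit K) y" using ij(1-4) phi by simp_all
  obtain S where S: "finite S" "S \<subseteq> total (ideal_of x (p \<cdot> \<phi>))"
    "\<forall>I. ideal I ER \<longrightarrow> S \<subseteq> I \<longrightarrow> (\<forall>k. \<forall>a\<in>Hom K x (shift K k (unit K)). hel k (a \<cdot> p \<cdot> \<phi>) \<in> I)"
    using free_biproduct(4)[OF pq(1)] by blast
  obtain T where T: "finite T" "T \<subseteq> total (ideal_of y (q \<cdot> \<phi>))"
    "\<forall>I. ideal I ER \<longrightarrow> T \<subseteq> I \<longrightarrow> (\<forall>k. \<forall>a\<in>Hom K y (shift K k (unit K)). hel k (a \<cdot> q \<cdot> \<phi>) \<in> I)"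
    using free_biproduct(5)[OF pq(2)] by blast
  have sub: "ideal_of w (u \<cdot> \<phi>) k \<subseteq> ideal_of z \<phi> k" if u: "u \<in> Hom K z w" for u w k
  proof
    fix b assume "b \<in> ideal_of w (u \<cdot> \<phi>) k"
    then obtain a where a: "b = a \<cdot> u \<cdot> \<phi>" "a \<in> Hom K w (shift K k (unit K))" unfolding ideal_of_def by blast
    then have "b = (a \<cdot> u) \<cdot> \<phi>" "a \<cdot> u \<in> Hom K z (shift K k (unit K))" using u phi by simp_all
    then show "b \<in> ideal_of z \<phi> k" unfolding ideal_of_def by blast
  qed
  have "S \<union> T \<subseteq> total (ideal_of z \<phi>)"
    using S(2) T(2) sub[OF ij(2)] sub[OF ij(4)] unfolding total_def by blast
  moreover have "hel k (a \<cdot> \<phi>) \<in> I" if I: "ideal I ER" "S \<union> T \<subseteq> I" and a: "a \<in> Hom K z (shift K k (unit K))" for I k a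
  proof -
    interpret ideal I ER by (rule I)
    have "a \<cdot> \<phi> = a \<cdot> idt K z \<cdot> \<phi>" using a phi by simp
    also have "\<dots> = (a \<cdot> i) \<cdot> p \<cdot> \<phi> \<boxplus> (a \<cdot> j) \<cdot> q \<cdot> \<phi>" unfolding ij(9)[symmetric] using a phi ij(1-4) by simp
    finally have eq: "a \<cdot> \<phi> = (a \<cdot> i) \<cdot> p \<cdot> \<phi> \<boxplus> (a \<cdot> j) \<cdot> q \<cdot> \<phi>" .
    have ai: "a \<cdot> i \<in> Hom K x (shift K k (unit K))" "a \<cdot> j \<in> Hom K y (shift K k (unit K))" using a ij(1-4) by simp_all
    have "hel k ((a \<cdot> i) \<cdot> p \<cdot> \<phi>) \<in> I" "hel k ((a \<cdot> j) \<cdot> q \<cdot> \<phi>) \<in> I"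
      using S(3) T(3) I ai by blast+
    moreover have "hel k (a \<cdot> \<phi>) = hel k ((a \<cdot> i) \<cdot> p \<cdot> \<phi>) \<oplus>\<^bsub>ER\<^esub> hel k ((a \<cdot> j) \<cdot> q \<cdot> \<phi>)"
      unfolding eq by (rule hel_padd) (use a phi ij(1-4) in simp_all)
    ultimately show ?thesis using a_closed by simp
  qed
  ultimately show ?case using S(1) T(1) by (intro exI[of _ "S \<union> T"]) blast
next
  case (free_iso x u y)
  have p: "inva u \<cdot> \<phi> \<in> Hom K (unit K) x" using free_iso by simp
  obtain S where S: "finite S" "S \<subseteq> total (ideal_of x (inva u \<cdot> \<phi>))"
    "\<forall>I. ideal I ER \<longrightarrow> S \<subseteq> I \<longrightarrow> (\<forall>k. \<forall>a\<in>Hom K x (shift K k (unit K)). hel k (a \<cdot> inva u \<cdot> \<phi>) \<in> I)"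
    using free_iso(4)[OF p] by blast
  have "ideal_of x (inva u \<cdot> \<phi>) k \<subseteq> ideal_of y \<phi> k" for k
  proof
    fix b assume "b \<in> ideal_of x (inva u \<cdot> \<phi>) k"
    then obtain a where a: "b = a \<cdot> inva u \<cdot> \<phi>" "a \<in> Hom K x (shift K k (unit K))" unfolding ideal_of_def by blast
    then have "b = (a \<cdot> inva u) \<cdot> \<phi>" "a \<cdot> inva u \<in> Hom K y (shift K k (unit K))" using free_iso by simp_all
    then show "b \<in> ideal_of y \<phi> k" unfolding ideal_of_def by blast
  qed
  then have "S \<subseteq> total (ideal_of y \<phi>)" using S(2) unfolding total_def by blast
  moreover have "hel k (a \<cdot> \<phi>) \<in> I" if I: "ideal I ER" "S \<subseteq> I" and a: "a \<in> Hom K y (shift K k (unit K))" for I k a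
  proof -
    have "a \<cdot> u \<in> Hom K x (shift K k (unit K))" using a free_iso by simp
    then have "hel k ((a \<cdot> u) \<cdot> inva u \<cdot> \<phi>) \<in> I" using S(3) I by blast
    then show ?thesis using a free_iso by simp
  qed
  ultimately show ?case using S(1) by (intro exI[of _ S]) blast
qed

text \<open>Each component of \<open>\<phi>\<close> lies in its ideal, hence in that of
  \<open>\<phi>'\<close>, and so is an arrow out of \<open>F'\<close> composed with
  \<open>\<phi>'\<close>. Induction on \<open>F\<close> assembles these arrows into one into
  \<open>F\<close>.\<close>

lemma free_factor:
  assumes "F \<in> free" "\<phi> \<in> Hom K (unit K) F" "\<And>k. ideal_of F \<phi> k \<subseteq> ideal_of F' \<phi>' k" "\<phi>' \<in> Hom K (unit K) F'"
  shows "\<exists>s\<in>Hom K F' F. \<phi> = s \<cdot> \<phi>'"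
  using assms(1-3)
proof (induction arbitrary: \<phi> rule: free.induct)
  case (free_zero z)
  have F': "F' \<in> ob K" "z \<in> ob K" using assms(4) is_zero_ob[OF free_zero(1)] by auto
  have "\<phi> = pzero K F' z \<cdot> \<phi>'"
    using to_zero[OF free_zero(1), of \<phi>] free_zero(2) assms(4) F' by simp
  then show ?case using F' by (intro bexI[of _ "pzero K F' z"]) simp_all
next
  case (free_unit d)
  have "\<phi> = idt K (shift K d (unit K)) \<cdot> \<phi>" using free_unit(1) by simp
  then have "\<phi> \<in> ideal_of (shift K d (unit K)) \<phi> d" unfolding ideal_of_def by force
  then show ?case using free_unit(2) unfolding ideal_of_def by blast
next
  case (free_biproduct x y z)
  obtain i p j q where ij: "i \<in> Hom K x z" "p \<in> Hom K z x" "j \<in> Hom K y z" "q \<in> Hom K z y"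
    "p \<cdot> i = idt K x" "q \<cdot> j = idt K y" "q \<cdot> i = pzero K x y" "p \<cdot> j = pzero K y x" "i \<cdot> p \<boxplus> j \<cdot> q = idt K z"
    using free_biproduct(3) by (rule biproductE)
  note phi = free_biproduct(6)
  have pq: "p \<cdot> \<phi> \<in> Hom K (unit K) x" "q \<cdot> \<phi> \<in> Hom K (unit K) y" using ij(1-4) phi by simp_all
  have sub: "ideal_of w (u \<cdot> \<phi>) k \<subseteq> ideal_of F' \<phi>' k" if u: "u \<in> Hom K z w" for u w k
  proof
    fix b assume "b \<in> ideal_of w (u \<cdot> \<phi>) k"
    then obtain a where a: "b = a \<cdot> u \<cdot> \<phi>" "a \<in> Hom K w (shift K k (unit K))" unfolding ideal_of_def by blast
    then have "b = (a \<cdot> u) \<cdot> \<phi>" "a \<cdot> u \<in> Hom K z (shift K k (unit K))" using u phi by simp_all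
    then have "b \<in> ideal_of z \<phi> k" unfolding ideal_of_def by blast
    then show "b \<in> ideal_of F' \<phi>' k" using free_biproduct(7) by blast
  qed
  obtain s where s: "s \<in> Hom K F' x" "p \<cdot> \<phi> = s \<cdot> \<phi>'" using free_biproduct(4)[OF pq(1) sub[OF ij(2)]] by blast
  obtain t where t: "t \<in> Hom K F' y" "q \<cdot> \<phi> = t \<cdot> \<phi>'" using free_biproduct(5)[OF pq(2) sub[OF ij(4)]] by blast
  have "\<phi> = idt K z \<cdot> \<phi>" using phi by simp
  also have "\<dots> = i \<cdot> p \<cdot> \<phi> \<boxplus> j \<cdot> q \<cdot> \<phi>" unfolding ij(9)[symmetric] using ij(1-4) phi by simp
  also have "\<dots> = (i \<cdot> s \<boxplus> j \<cdot> t) \<cdot> \<phi>'" unfolding s(2) t(2) using ij(1-4) s(1) t(1) assms(4) by simp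
  finally show ?case using ij(1-4) s(1) t(1) by (intro bexI[of _ "i \<cdot> s \<boxplus> j \<cdot> t"]) simp_all
next
  case (free_iso x u y)
  have p: "inva u \<cdot> \<phi> \<in> Hom K (unit K) x" using free_iso by simp
  have sub: "ideal_of x (inva u \<cdot> \<phi>) k \<subseteq> ideal_of F' \<phi>' k" for k
  proof
    fix b assume "b \<in> ideal_of x (inva u \<cdot> \<phi>) k"
    then obtain a where a: "b = a \<cdot> inva u \<cdot> \<phi>" "a \<in> Hom K x (shift K k (unit K))" unfolding ideal_of_def by blast
    then have "b = (a \<cdot> inva u) \<cdot> \<phi>" "a \<cdot> inva u \<in> Hom K y (shift K k (unit K))" using free_iso by simp_all
    then have "b \<in> ideal_of y \<phi> k" unfolding ideal_of_def by blast
    then show "b \<in> ideal_of F' \<phi>' k" using free_iso(6) by blast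
  qed
  obtain s where s: "s \<in> Hom K F' x" "inva u \<cdot> \<phi> = s \<cdot> \<phi>'" using free_iso(4)[OF p sub] by blast
  have "\<phi> = u \<cdot> inva u \<cdot> \<phi>" using free_iso by simp
  also have "\<dots> = (u \<cdot> s) \<cdot> \<phi>'" unfolding s(2) using s(1) free_iso assms(4) by simp
  finally show ?case using s(1) free_iso by (intro bexI[of _ "u \<cdot> s"]) simp_all
qed

text \<open>Coordinates on a free object, to match the lists in
  \<open>graded_finitely_presented\<close>: an arrow into \<open>F\<close> can be prescribed by its
  components, and an arrow out of \<open>F\<close> is a combination of the projections
  \<open>\<pi> i\<close>. That components determine an arrow is derived in
  \<open>free_on_eqI\<close>.\<close>

definition free_on where
  "free_on (n :: nat) d F \<pi> \<longleftrightarrow> F \<in> free \<and> (\<forall>i<n. \<pi> i \<in> Hom K F (shift K (d i) (unit K))) \<and>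
    (\<forall>z\<in>ob K. \<forall>\<zeta>. (\<forall>i<n. \<zeta> i \<in> Hom K z (shift K (d i) (unit K))) \<longrightarrow> (\<exists>t\<in>Hom K z F. \<forall>i<n. \<pi> i \<cdot> t = \<zeta> i)) \<and>
    (\<forall>y. \<forall>a\<in>Hom K F y. \<exists>c. (\<forall>i<n. c i \<in> Hom K (shift K (d i) (unit K)) y) \<and> a = hsum F y (\<lambda>i. c i \<cdot> \<pi> i) {..<n})"

lemma free_onD:
  assumes "free_on n d F \<pi>"
  shows "F \<in> free" "i < n \<Longrightarrow> \<pi> i \<in> Hom K F (shift K (d i) (unit K))"
    "\<lbrakk>z \<in> ob K; \<forall>i<n. \<zeta> i \<in> Hom K z (shift K (d i) (unit K))\<rbrakk> \<Longrightarrow> \<exists>t\<in>Hom K z F. \<forall>i<n. \<pi> i \<cdot> t = \<zeta> i"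
    "a \<in> Hom K F y \<Longrightarrow> \<exists>c. (\<forall>i<n. c i \<in> Hom K (shift K (d i) (unit K)) y) \<and> a = hsum F y (\<lambda>i. c i \<cdot> \<pi> i) {..<n}"
  using assms unfolding free_on_def by blast+

lemma free_on_exists: "\<exists>F \<pi>. free_on n d F \<pi>"
proof (induction n)
  case 0
  obtain z0 where z0: "is_zero K z0" using zero_object by blast
  have "free_on 0 d z0 (\<lambda>_. undefined)" unfolding free_on_def
  proof (intro conjI allI ballI impI)
    show "z0 \<in> free" by (rule free_zero[OF z0])
    show "\<exists>t\<in>Hom K z z0. \<forall>i<0. undefined \<cdot> t = \<zeta> i" if "z \<in> ob K" for z and \<zeta> :: "nat \<Rightarrow> 'm"
      using that is_zero_ob[OF z0] by (intro bexI[of _ "pzero K z z0"]) simp_all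
    fix y a assume a: "a \<in> Hom K z0 y"
    have "a = pzero K z0 y" using from_zero[OF z0, of a] a by simp
    moreover have "y \<in> ob K" using a by auto
    ultimately have "a = hsum z0 y (\<lambda>i. undefined \<cdot> undefined) {..<0::nat}"
      using is_zero_ob[OF z0] by (simp add: hsum_empty del: hom_group_simps)
    then show "\<exists>c. (\<forall>i<0. c i \<in> Hom K (shift K (d i) (unit K)) y) \<and> a = hsum z0 y (\<lambda>i. c i \<cdot> undefined) {..<0::nat}"
      by (intro exI[of _ "\<lambda>_. undefined"]) simp
  qed simp
  then show ?case by blast
next
  case (Suc n)
  let ?d = "\<lambda>i. shift K (d i) (unit K)"
  obtain F \<pi> where "free_on n d F \<pi>" using Suc by blast
  note F = free_onD(1)[OF this] and pi = free_onD(2)[OF this] and un = free_onD(3)[OF this] and co = free_onD(4)[OF this]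
  note Fo = free_ob[OF F]
  obtain G where B: "is_biproduct K F (?d n) G" using biproducts[OF Fo, of "?d n"] by auto
  note Gf = free_biproduct[OF F free_unit B]
  note Go = free_ob[OF Gf]
  obtain i p j q where ij: "i \<in> Hom K F G" "p \<in> Hom K G F" "j \<in> Hom K (?d n) G" "q \<in> Hom K G (?d n)"
    "p \<cdot> i = idt K F" "q \<cdot> j = idt K (?d n)" "q \<cdot> i = pzero K F (?d n)" "p \<cdot> j = pzero K (?d n) F" "i \<cdot> p \<boxplus> j \<cdot> q = idt K G"
    using B by (rule biproductE)
  define \<rho> where "\<rho> l = (if l < n then \<pi> l \<cdot> p else q)" for l
  have rho: "\<rho> l \<in> Hom K G (?d l)" if "l < Suc n" for l
    using that pi[of l] ij(2,4) by (cases "l = n") (auto simp: \<rho>_def)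
  have un': "\<exists>t\<in>Hom K z G. \<forall>l<Suc n. \<rho> l \<cdot> t = \<zeta> l" if z: "z \<in> ob K" and zeta: "\<forall>l<Suc n. \<zeta> l \<in> Hom K z (?d l)" for z \<zeta>
  proof -
    obtain t where t: "t \<in> Hom K z F" "\<forall>l<n. \<pi> l \<cdot> t = \<zeta> l" using un[OF z, of \<zeta>] zeta by auto
    have zn: "\<zeta> n \<in> Hom K z (?d n)" using zeta by simp
    define s where "s = i \<cdot> t \<boxplus> j \<cdot> \<zeta> n"
    have s: "s \<in> Hom K z G" using ij(1,3) t(1) zn by (simp add: s_def)
    have "p \<cdot> s = (p \<cdot> i) \<cdot> t \<boxplus> (p \<cdot> j) \<cdot> \<zeta> n" "q \<cdot> s = (q \<cdot> i) \<cdot> t \<boxplus> (q \<cdot> j) \<cdot> \<zeta> n"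
      using ij(1-4) t(1) zn by (simp_all add: s_def)
    then have ps: "p \<cdot> s = t" "q \<cdot> s = \<zeta> n"
      unfolding ij(5-8) using ij(1-4) t(1) zn Fo z by simp_all
    have "\<rho> l \<cdot> s = \<zeta> l" if "l < Suc n" for l
    proof (cases "l < n")
      case True
      then show ?thesis using pi[OF True] ij(2) s ps(1) t(2) by (simp add: \<rho>_def)
    next
      case False
      then show ?thesis using that ps(2) by (simp add: \<rho>_def less_Suc_eq)
    qed
    then show ?thesis using s by blast
  qed
  have co': "\<exists>c. (\<forall>l<Suc n. c l \<in> Hom K (?d l) y) \<and> a = hsum G y (\<lambda>l. c l \<cdot> \<rho> l) {..<Suc n}" if a: "a \<in> Hom K G y" for a y
  proof -
    have y: "y \<in> ob K" using a by auto
    obtain c where c: "\<forall>l<n. c l \<in> Hom K (?d l) y" "a \<cdot> i = hsum F y (\<lambda>l. c l \<cdot> \<pi> l) {..<n}"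
      using co[of "a \<cdot> i" y] a ij(1) by auto
    define c' where "c' l = (if l < n then c l else a \<cdot> j)" for l
    have c': "c' l \<in> Hom K (?d l) y" if "l < Suc n" for l
      using that c(1) a ij(3) by (cases "l = n") (auto simp: c'_def)
    have "a = a \<cdot> (i \<cdot> p \<boxplus> j \<cdot> q)" unfolding ij(9) using a by simp
    also have "\<dots> = (a \<cdot> i) \<cdot> p \<boxplus> (a \<cdot> j) \<cdot> q" using a ij(1-4) by simp
    also have "(a \<cdot> i) \<cdot> p = hsum G y (\<lambda>l. (c l \<cdot> \<pi> l) \<cdot> p) {..<n}"
      unfolding c(2) by (rule hsum_cmp(2)) (use c(1) pi ij(2) Fo y in auto)
    also have "\<dots> = hsum G y (\<lambda>l. c' l \<cdot> \<rho> l) {..<n}"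
    proof (rule hsum_cong[OF Go y])
      fix l assume "l \<in> {..<n}"
      then have l: "l < n" "l < Suc n" by auto
      then show "(c l \<cdot> \<pi> l) \<cdot> p = c' l \<cdot> \<rho> l" using c(1) pi[OF l(1)] ij(2) by (simp add: c'_def \<rho>_def)
      show "c' l \<cdot> \<rho> l \<in> Hom K G y" using c'[OF l(2)] rho[OF l(2)] by simp
    qed
    also have "hsum G y (\<lambda>l. c' l \<cdot> \<rho> l) {..<n} \<boxplus> (a \<cdot> j) \<cdot> q = (a \<cdot> j) \<cdot> q \<boxplus> hsum G y (\<lambda>l. c' l \<cdot> \<rho> l) {..<n}"
    proof (rule padd_comm)
      show "hsum G y (\<lambda>l. c' l \<cdot> \<rho> l) {..<n} \<in> Hom K G y"
        by (rule hsum_closed[OF Go y]) (use c' rho in auto)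
    qed (use a ij(3,4) in simp)
    also have "\<dots> = hsum G y (\<lambda>l. c' l \<cdot> \<rho> l) (insert n {..<n})"
    proof -
      have "(a \<cdot> j) \<cdot> q = c' n \<cdot> \<rho> n" by (simp add: c'_def \<rho>_def)
      moreover have "hsum G y (\<lambda>l. c' l \<cdot> \<rho> l) (insert n {..<n}) = c' n \<cdot> \<rho> n \<boxplus> hsum G y (\<lambda>l. c' l \<cdot> \<rho> l) {..<n}"
      proof (rule hsum_insert[OF Go y])
        fix l assume "l \<in> insert n {..<n}"
        then have l: "l < Suc n" by auto
        show "c' l \<cdot> \<rho> l \<in> Hom K G y" using c'[OF l] rho[OF l] by simp
      qed simp_all
      ultimately show ?thesis by simp
    qed
    finally have "a = hsum G y (\<lambda>l. c' l \<cdot> \<rho> l) {..<Suc n}" by (simp only: lessThan_Suc)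
    with c' show ?thesis by blast
  qed
  have "free_on (Suc n) d G \<rho>" unfolding free_on_def
  proof (intro conjI allI ballI impI)
    show "\<exists>t\<in>Hom K z G. \<forall>l<Suc n. \<rho> l \<cdot> t = \<zeta> l" if "z \<in> ob K" "\<forall>l<Suc n. \<zeta> l \<in> Hom K z (?d l)" for z \<zeta>
      by (rule un'[OF that])
    show "\<exists>c. (\<forall>l<Suc n. c l \<in> Hom K (?d l) y) \<and> a = hsum G y (\<lambda>l. c l \<cdot> \<rho> l) {..<Suc n}" if "a \<in> Hom K G y" for a y
      by (rule co'[OF that])
    show "\<rho> l \<in> Hom K G (?d l)" if "l < Suc n" for l by (rule rho[OF that])
  qed (rule Gf)
  then show ?case by blast
qed

lemma nat_choice: "(\<And>i. i < (n :: nat) \<Longrightarrow> \<exists>f. P i f) \<Longrightarrow> \<exists>F. \<forall>i<n. P i (F i)"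
  by metis

lemma nat_choice2: "(\<And>j i. \<lbrakk>j < (m :: nat); i < (n :: nat)\<rbrakk> \<Longrightarrow> \<exists>f. P j i f) \<Longrightarrow> \<exists>F. \<forall>j<m. \<forall>i<n. P j i (F j i)"
  by metis

lemma ideal_ofE:
  assumes "f \<in> ideal_of F \<phi> k"
  obtains a where "a \<in> Hom K F (shift K k (unit K))" "f = a \<cdot> \<phi>"
  using assms by (auto simp: ideal_of_def)

text \<open>The identity of \<open>F\<close> is itself a combination of the projections
  \<open>\<pi> i\<close>.\<close>

lemma free_on_eqI:
  assumes F: "free_on n d F \<pi>" and s: "s \<in> Hom K z F" and t: "t \<in> Hom K z F"
    and eq: "\<And>i. i < n \<Longrightarrow> \<pi> i \<cdot> s = \<pi> i \<cdot> t"
  shows "s = t"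
proof -
  note Fo = free_ob[OF free_onD(1)[OF F]]
  have z: "z \<in> ob K" using s by auto
  obtain c where c: "\<And>i. i < n \<Longrightarrow> c i \<in> Hom K (shift K (d i) (unit K)) F" "idt K F = hsum F F (\<lambda>i. c i \<cdot> \<pi> i) {..<n}"
    using free_onD(4)[OF F idt[OF Fo]] by blast
  have cp: "c i \<cdot> \<pi> i \<in> Hom K F F" if "i < n" for i using c(1)[OF that] free_onD(2)[OF F that] by simp
  have "idt K F \<cdot> u = hsum z F (\<lambda>i. (c i \<cdot> \<pi> i) \<cdot> u) {..<n}" if u: "u \<in> Hom K z F" for u
    unfolding c(2) by (rule hsum_cmp(2)) (use cp Fo u in auto)
  moreover have "hsum z F (\<lambda>i. (c i \<cdot> \<pi> i) \<cdot> s) {..<n} = hsum z F (\<lambda>i. (c i \<cdot> \<pi> i) \<cdot> t) {..<n}"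
  proof (rule hsum_cong[OF z Fo])
    fix i assume "i \<in> {..<n}"
    then have i: "i < n" by simp
    then show "(c i \<cdot> \<pi> i) \<cdot> s = (c i \<cdot> \<pi> i) \<cdot> t"
      using c(1)[OF i] free_onD(2)[OF F i] s t eq[OF i] by simp
    show "(c i \<cdot> \<pi> i) \<cdot> t \<in> Hom K z F" using cp[OF i] t by simp
  qed
  ultimately show ?thesis using s t by simp
qed

lemma finsum_delta:
  assumes n: "i < (n::nat)" and f: "\<And>j. j < n \<Longrightarrow> f j \<in> carrier ER"
  shows "(\<Oplus>\<^bsub>ER\<^esub>j\<in>{..<n}. (if j = i then \<one>\<^bsub>ER\<^esub> else \<zero>\<^bsub>ER\<^esub>) \<otimes>\<^bsub>ER\<^esub> f j) = f i"
proof -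
  interpret ring ER by (rule ER_ring)
  have "(\<Oplus>\<^bsub>ER\<^esub>j\<in>{..<n}. (if j = i then \<one>\<^bsub>ER\<^esub> else \<zero>\<^bsub>ER\<^esub>) \<otimes>\<^bsub>ER\<^esub> f j) = (\<Oplus>\<^bsub>ER\<^esub>j\<in>{..<n}. if i = j then f j else \<zero>\<^bsub>ER\<^esub>)"
    by (rule finsum_cong') (use f in auto)
  also have "\<dots> = f i"
    by (rule finsum_singleton) (use n f in auto)
  finally show ?thesis .
qed

text \<open>The relations between the components of \<open>\<phi> : 1 \<rightarrow> F\<close> are read off from a presentation of the
  ideal they generate; as the presentation may use other generators, given by \<open>\<phi>' : 1 \<rightarrow> F'\<close>, one passes
  between \<open>F\<close> and \<open>F'\<close> as in Schanuel's lemma.\<close>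

lemma coherent_unit:
  assumes coh: "graded_coherent ER (end_degree K)"
  shows "coherent (unit K)"
  unfolding coherent_def
proof (intro conjI ballI)
  let ?u = "unit K"
  let ?S = "\<lambda>k. shift K k ?u"
  show "?u \<in> ob K" by simp
  have "cover ?u (?S 0) (shunit K ?u)" unfolding cover_def
  proof (intro conjI allI ballI)
    fix k a assume "a \<in> Hom K ?u (?S k)"
    then show "\<exists>b\<in>Hom K (?S 0) (?S k). a = b \<cdot> shunit K ?u"
      by (intro bexI[of _ "a \<cdot> inva (shunit K ?u)"]) simp_all
  qed (simp_all add: free_unit)
  then show "\<exists>F \<phi>. cover ?u F \<phi>" by blast
  fix F \<phi> assume F: "F \<in> free" and p: "\<phi> \<in> Hom K ?u F"
  interpret ring ER by (rule ER_ring)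
  note Fo = free_ob[OF F]
  define H where "H = ideal_of F \<phi>"
  have H: "graded_ideal H" unfolding H_def by (rule ideal_of_graded[OF p])
  obtain S where Sx: "finite S \<and> S \<subseteq> total H \<and>
    (\<forall>I. ideal I ER \<longrightarrow> S \<subseteq> I \<longrightarrow> (\<forall>k. \<forall>a\<in>Hom K F (?S k). hel k (a \<cdot> \<phi>) \<in> I))"
    using ideal_of_finite[OF F p, folded H_def] ..
  note S = conjunct1[OF Sx] conjunct1[OF conjunct2[OF Sx]] and S_all = conjunct2[OF conjunct2[OF Sx]]
  have S_gen: "hel k (a \<cdot> \<phi>) \<in> I" if "ideal I ER" "S \<subseteq> I" "a \<in> Hom K F (?S k)" for I k a
    by (rule bspec[OF spec[OF mp[OF mp[OF spec[OF S_all] that(1)] that(2)]] that(3)])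
  have Sc: "S \<subseteq> carrier ER" using S(2) by (auto simp: total_def)
  have "total H = Idl\<^bsub>ER\<^esub> S"
  proof (rule total_eq_Idl[OF H S(2)])
    fix k f assume "f \<in> H k"
    then obtain a where a: "a \<in> Hom K F (?S k)" and f: "f = a \<cdot> \<phi>" unfolding H_def by (rule ideal_ofE)
    show "hel k f \<in> Idl\<^bsub>ER\<^esub> S" unfolding f by (rule S_gen[OF genideal_ideal[OF Sc] genideal_self[OF Sc] a])
  qed
  then have "graded_finitely_presented ER (end_degree K) (total H)"
    using coh[unfolded graded_coherent_def, rule_format, of "total H"] total_homogeneous[OF H] S(1) Sc by blast
  then obtain n d a m e b where pres: "(\<forall>i<n::nat. a i \<in> end_degree K (d i)) \<and>
      (\<forall>j<m::nat. \<forall>i<n. b j i \<in> end_degree K (e j - d i)) \<and>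
      total H = (\<lambda>r. \<Oplus>\<^bsub>ER\<^esub>i\<in>{..<n}. r i \<otimes>\<^bsub>ER\<^esub> a i) ` ({..<n} \<rightarrow>\<^sub>E carrier ER) \<and>
      {r \<in> {..<n} \<rightarrow>\<^sub>E carrier ER. (\<Oplus>\<^bsub>ER\<^esub>i\<in>{..<n}. r i \<otimes>\<^bsub>ER\<^esub> a i) = \<zero>\<^bsub>ER\<^esub>} =
        (\<lambda>c. \<lambda>i\<in>{..<n}. \<Oplus>\<^bsub>ER\<^esub>j\<in>{..<m}. c j \<otimes>\<^bsub>ER\<^esub> b j i) ` ({..<m} \<rightarrow>\<^sub>E carrier ER)"
    unfolding graded_finitely_presented_def by (elim exE) (rule that)
  note a = pres[THEN conjunct1, rule_format] and b = pres[THEN conjunct2, THEN conjunct1, rule_format]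
    and I = pres[THEN conjunct2, THEN conjunct2, THEN conjunct1] and R = pres[THEN conjunct2, THEN conjunct2, THEN conjunct2]
  have "\<exists>f. f \<in> unit_hom K (d i) \<and> a i = hel (d i) f" if "i < n" for i
    using a[OF that] unfolding end_degree_def by blast
  from nat_choice[OF this] obtain A where "\<forall>i<n. A i \<in> unit_hom K (d i) \<and> a i = hel (d i) (A i)" ..
  then have A: "\<And>i. i < n \<Longrightarrow> A i \<in> unit_hom K (d i)" "\<And>i. i < n \<Longrightarrow> a i = hel (d i) (A i)" by blast+
  have "\<exists>f. f \<in> unit_hom K (e j - d i) \<and> b j i = hel (e j - d i) f" if "j < m" "i < n" for j i
    using b[OF that] unfolding end_degree_def by blast
  from nat_choice2[OF this] obtain B where "\<forall>j<m. \<forall>i<n. B j i \<in> unit_hom K (e j - d i) \<and> b j i = hel (e j - d i) (B j i)" ..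
  then have B: "\<And>j i. j < m \<Longrightarrow> i < n \<Longrightarrow> B j i \<in> unit_hom K (e j - d i)"
    "\<And>j i. j < m \<Longrightarrow> i < n \<Longrightarrow> b j i = hel (e j - d i) (B j i)" by blast+
  have ac: "a i \<in> carrier ER" if "i < n" for i using hel_closed[OF A(1)[OF that]] A(2)[OF that] by simp
  have bc: "b j i \<in> carrier ER" if "j < m" "i < n" for i j using hel_closed[OF B(1)[OF that]] B(2)[OF that] by simp
  have A1: "A i \<in> Hom K ?u (?S (d i))" if "i < n" for i using A(1)[OF that] by simp

  \<comment> \<open>\<open>F'\<close> carries the coordinates of the generators in the presentation
    and \<open>E'\<close> those of its relations. The components of \<open>\<phi>'\<close> will be
    the generators \<open>A i\<close>, and \<open>\<psi>\<close> will be the matrix of relations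
    \<open>B\<close>.\<close>
  obtain F' \<pi> where F': "free_on n d F' \<pi>" using free_on_exists by blast
  obtain E' \<rho> where E': "free_on m e E' \<rho>" using free_on_exists by blast
  note F'f = free_onD(1)[OF F'] and E'f = free_onD(1)[OF E']
  note F'o = free_ob[OF F'f] and E'o = free_ob[OF E'f]
  have "\<forall>i<n. A i \<in> Hom K ?u (?S (d i))" using A1 by blast
  from free_onD(3)[OF F' unit_ob' this]
  obtain \<phi>' where p': "\<phi>' \<in> Hom K ?u F'" "\<And>i. i < n \<Longrightarrow> \<pi> i \<cdot> \<phi>' = A i" by blast

  have sum_phi': "(hsum F' (?S k) (\<lambda>i. c i \<cdot> \<pi> i) {..<n}) \<cdot> \<phi>' = hsum ?u (?S k) (\<lambda>i. c i \<cdot> A i) {..<n}"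
    if c: "\<And>i. i < n \<Longrightarrow> c i \<in> Hom K (?S (d i)) (?S k)" for c k
  proof -
    have "(hsum F' (?S k) (\<lambda>i. c i \<cdot> \<pi> i) {..<n}) \<cdot> \<phi>' = hsum ?u (?S k) (\<lambda>i. (c i \<cdot> \<pi> i) \<cdot> \<phi>') {..<n}"
      by (rule hsum_cmp(2)) (use c free_onD(2)[OF F'] F'o p'(1) in auto)
    also have "\<dots> = hsum ?u (?S k) (\<lambda>i. c i \<cdot> A i) {..<n}"
    proof (rule hsum_cong)
      fix i assume "i \<in> {..<n}"
      then have i: "i < n" by simp
      show "(c i \<cdot> \<pi> i) \<cdot> \<phi>' = c i \<cdot> A i" using c[OF i] free_onD(2)[OF F' i] p'(1) p'(2)[OF i] by simp
      show "c i \<cdot> A i \<in> Hom K ?u (?S k)" using c[OF i] A1[OF i] by simp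
    qed simp_all
    finally show ?thesis .
  qed

  \<comment> \<open>The original \<open>\<phi>\<close> and the presentation give the same ideal. One
    inclusion yields \<open>s\<close> with \<open>\<phi> = s \<cdot> \<phi>'\<close>, the other one
    \<open>t\<close> with \<open>t \<cdot> \<phi> = \<phi>'\<close>.\<close>
  have sub: "H k \<subseteq> ideal_of F' \<phi>' k" for k
  proof
    fix f assume f: "f \<in> H k"
    have "hel k f \<in> total H" by (rule hel_total[OF H f])
    then obtain r where r: "\<And>i. i < n \<Longrightarrow> r i \<in> carrier ER" "hel k f = (\<Oplus>\<^bsub>ER\<^esub>i\<in>{..<n}. r i \<otimes>\<^bsub>ER\<^esub> a i)"
      unfolding I by auto
    have "\<exists>c. c \<in> Hom K (?S (d i)) (?S k) \<and> c \<cdot> A i = act (k - d i) (d i) (r i (k - d i)) (A i)" if i: "i < n" for i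
    proof -
      obtain c where c: "c \<in> Hom K (?S (d i)) (?S (d i + (k - d i)))"
        "\<forall>x\<in>ar K. tgt K x = ?S (d i) \<longrightarrow> c \<cdot> x = act (k - d i) (d i) (r i (k - d i)) x"
        using act_idt[OF ER_carrierD(1)[OF r(1)[OF i], of "k - d i"], of "d i"] by blast
      have "c \<cdot> A i = act (k - d i) (d i) (r i (k - d i)) (A i)" using c(2) A1[OF i] by simp
      then show ?thesis using c(1) by (intro exI[of _ c]) simp
    qed
    from nat_choice[OF this] obtain c where
      "\<forall>i<n. c i \<in> Hom K (?S (d i)) (?S k) \<and> c i \<cdot> A i = act (k - d i) (d i) (r i (k - d i)) (A i)" ..
    then have c: "\<And>i. i < n \<Longrightarrow> c i \<in> Hom K (?S (d i)) (?S k)"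
      "\<And>i. i < n \<Longrightarrow> c i \<cdot> A i = act (k - d i) (d i) (r i (k - d i)) (A i)" by blast+
    have "f = hel k f k" by (simp add: hel_apply)
    also have "\<dots> = hsum ?u (?S k) (\<lambda>i. (r i \<otimes>\<^bsub>ER\<^esub> a i) k) {..<n}"
      unfolding r(2) by (rule ER_finsum_apply) (use r(1) ac in auto)
    also have "\<dots> = hsum ?u (?S k) (\<lambda>i. c i \<cdot> A i) {..<n}"
    proof (rule hsum_cong)
      fix i assume "i \<in> {..<n}"
      then have i: "i < n" by simp
      show "(r i \<otimes>\<^bsub>ER\<^esub> a i) k = c i \<cdot> A i"
        unfolding A(2)[OF i] c(2)[OF i] by (rule mult_hel[OF r(1)[OF i] A(1)[OF i]])
      show "c i \<cdot> A i \<in> Hom K ?u (?S k)" using c(1)[OF i] A1[OF i] by simp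
    qed simp_all
    also have "\<dots> = (hsum F' (?S k) (\<lambda>i. c i \<cdot> \<pi> i) {..<n}) \<cdot> \<phi>'" by (rule sum_phi'[OF c(1), symmetric])
    finally have "f = (hsum F' (?S k) (\<lambda>i. c i \<cdot> \<pi> i) {..<n}) \<cdot> \<phi>'" .
    moreover have "hsum F' (?S k) (\<lambda>i. c i \<cdot> \<pi> i) {..<n} \<in> Hom K F' (?S k)"
      by (rule hsum_closed[OF F'o]) (use c(1) free_onD(2)[OF F'] in auto)
    ultimately show "f \<in> ideal_of F' \<phi>' k" unfolding ideal_of_def by blast
  qed
  obtain s where s: "s \<in> Hom K F' F" "\<phi> = s \<cdot> \<phi>'"
    using free_factor[OF F p _ p'(1)] sub unfolding H_def by blast

  have "\<exists>t. t \<in> Hom K F (?S (d i)) \<and> t \<cdot> \<phi> = A i" if i: "i < n" for i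
  proof -
      \<comment> \<open>The \<open>i\<close>-th unit vector; its image shows that the generator
        \<open>a i\<close> belongs to the ideal it presents.\<close>
      define r where "r = (\<lambda>l\<in>{..<n}. if l = i then \<one>\<^bsub>ER\<^esub> else \<zero>\<^bsub>ER\<^esub>)"
      have "(\<Oplus>\<^bsub>ER\<^esub>l\<in>{..<n}. r l \<otimes>\<^bsub>ER\<^esub> a l) = (\<Oplus>\<^bsub>ER\<^esub>l\<in>{..<n}. (if l = i then \<one>\<^bsub>ER\<^esub> else \<zero>\<^bsub>ER\<^esub>) \<otimes>\<^bsub>ER\<^esub> a l)"
        by (rule finsum_cong') (use ac in \<open>auto simp: r_def\<close>)
      also have "\<dots> = a i" by (rule finsum_delta[OF i ac])
      finally have "a i = (\<Oplus>\<^bsub>ER\<^esub>l\<in>{..<n}. r l \<otimes>\<^bsub>ER\<^esub> a l)" ..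
      moreover have "r \<in> {..<n} \<rightarrow>\<^sub>E carrier ER" by (auto simp: r_def)
      ultimately have "a i \<in> total H" unfolding I by (rule image_eqI)
      then have "A i \<in> H (d i)" unfolding A(2)[OF i] by (rule total_hel[OF H])
      then obtain t where "t \<in> Hom K F (?S (d i))" "A i = t \<cdot> \<phi>" unfolding H_def by (rule ideal_ofE)
      then show ?thesis by (intro exI[of _ t] conjI) simp_all
  qed
  from nat_choice[OF this] obtain t' where "\<forall>i<n. t' i \<in> Hom K F (?S (d i)) \<and> t' i \<cdot> \<phi> = A i" ..
  then have t': "\<And>i. i < n \<Longrightarrow> t' i \<in> Hom K F (?S (d i))" "\<And>i. i < n \<Longrightarrow> t' i \<cdot> \<phi> = A i" by blast+
  then have "\<forall>i<n. t' i \<in> Hom K F (?S (d i))" by blast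
  from free_onD(3)[OF F' Fo this] obtain t where t: "t \<in> Hom K F F'" "\<And>i. i < n \<Longrightarrow> \<pi> i \<cdot> t = t' i" by blast
  have tp: "t \<cdot> \<phi> = \<phi>'"
  proof (rule free_on_eqI[OF F'])
    show "t \<cdot> \<phi> \<in> Hom K ?u F'" "\<phi>' \<in> Hom K ?u F'" using t(1) p p'(1) by simp_all
    fix i assume i: "i < n"
    have "\<pi> i \<cdot> t \<cdot> \<phi> = t' i \<cdot> \<phi>" by (rule reassoc[OF t(2)[OF i]]) (use t(1) p free_onD(2)[OF F' i] in auto)
    then show "\<pi> i \<cdot> t \<cdot> \<phi> = \<pi> i \<cdot> \<phi>'" unfolding t'(2)[OF i] p'(2)[OF i] .
  qed

  have "\<exists>\<beta>. \<beta> \<in> Hom K (?S (d i)) (?S (e j)) \<and>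
      (\<forall>x\<in>ar K. tgt K x = ?S (d i) \<longrightarrow> \<beta> \<cdot> x = act (e j - d i) (d i) (B j i) x)" if ji: "j < m" "i < n" for j i
  proof -
    have "d i + (e j - d i) = e j" by simp
    with act_idt[OF B(1)[OF ji], of "d i"] show ?thesis by (simp only: Bex_def)
  qed
  from nat_choice2[OF this] obtain \<beta> where "\<forall>j<m. \<forall>i<n. \<beta> j i \<in> Hom K (?S (d i)) (?S (e j)) \<and>
      (\<forall>x\<in>ar K. tgt K x = ?S (d i) \<longrightarrow> \<beta> j i \<cdot> x = act (e j - d i) (d i) (B j i) x)" ..
  then have be: "\<And>j i. j < m \<Longrightarrow> i < n \<Longrightarrow> \<beta> j i \<in> Hom K (?S (d i)) (?S (e j))"
    "\<And>j i x. \<lbrakk>j < m; i < n; x \<in> ar K; tgt K x = ?S (d i)\<rbrakk> \<Longrightarrow> \<beta> j i \<cdot> x = act (e j - d i) (d i) (B j i) x" by blast+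
  \<comment> \<open>The \<open>j\<close>-th relation of the presentation, read as an arrow out of
    \<open>F'\<close>.\<close>
  define \<theta> where "\<theta> j = hsum F' (?S (e j)) (\<lambda>i. \<beta> j i \<cdot> \<pi> i) {..<n}" for j
  have th: "\<theta> j \<in> Hom K F' (?S (e j))" if j: "j < m" for j
    unfolding \<theta>_def by (rule hsum_closed[OF F'o]) (use be(1)[OF j] free_onD(2)[OF F'] in auto)
  then have "\<forall>j<m. \<theta> j \<in> Hom K F' (?S (e j))" by blast
  from free_onD(3)[OF E' F'o this]
  obtain \<psi> where ps: "\<psi> \<in> Hom K F' E'" "\<And>j. j < m \<Longrightarrow> \<rho> j \<cdot> \<psi> = \<theta> j" by blast

  have thp: "\<theta> j \<cdot> \<phi>' = pzero K ?u (?S (e j))" if j: "j < m" for j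
  proof -
    \<comment> \<open>The \<open>j\<close>-th unit vector; the presentation maps it to the
      \<open>j\<close>-th row of \<open>b\<close>, which is therefore a relation between the
      \<open>a i\<close>.\<close>
    define c where "c = (\<lambda>l\<in>{..<m}. if l = j then \<one>\<^bsub>ER\<^esub> else \<zero>\<^bsub>ER\<^esub>)"
    define r where "r = (\<lambda>i\<in>{..<n}. \<Oplus>\<^bsub>ER\<^esub>l\<in>{..<m}. c l \<otimes>\<^bsub>ER\<^esub> b l i)"
    have "c \<in> {..<m} \<rightarrow>\<^sub>E carrier ER" by (auto simp: c_def)
    then have "r \<in> {r \<in> {..<n} \<rightarrow>\<^sub>E carrier ER. (\<Oplus>\<^bsub>ER\<^esub>i\<in>{..<n}. r i \<otimes>\<^bsub>ER\<^esub> a i) = \<zero>\<^bsub>ER\<^esub>}"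
      unfolding R r_def by (rule imageI)
    then have r0: "(\<Oplus>\<^bsub>ER\<^esub>i\<in>{..<n}. r i \<otimes>\<^bsub>ER\<^esub> a i) = \<zero>\<^bsub>ER\<^esub>" by blast
    have rb: "r i = b j i" if i: "i < n" for i
    proof -
      have "r i = (\<Oplus>\<^bsub>ER\<^esub>l\<in>{..<m}. c l \<otimes>\<^bsub>ER\<^esub> b l i)" using i by (simp add: r_def)
      also have "\<dots> = (\<Oplus>\<^bsub>ER\<^esub>l\<in>{..<m}. (if l = j then \<one>\<^bsub>ER\<^esub> else \<zero>\<^bsub>ER\<^esub>) \<otimes>\<^bsub>ER\<^esub> b l i)"
        by (rule finsum_cong') (use bc i in \<open>auto simp: c_def\<close>)
      also have "\<dots> = b j i" by (rule finsum_delta[OF j]) (use bc i in blast)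
      finally show ?thesis .
    qed
    have "\<theta> j \<cdot> \<phi>' = hsum ?u (?S (e j)) (\<lambda>i. \<beta> j i \<cdot> A i) {..<n}"
      unfolding \<theta>_def by (rule sum_phi'[OF be(1)[OF j]])
    also have "\<dots> = hsum ?u (?S (e j)) (\<lambda>i. (r i \<otimes>\<^bsub>ER\<^esub> a i) (e j)) {..<n}"
    proof (rule hsum_cong)
      fix i assume "i \<in> {..<n}"
      then have i: "i < n" by simp
      have "(r i \<otimes>\<^bsub>ER\<^esub> a i) (e j) = act (e j - d i) (d i) (b j i (e j - d i)) (A i)"
        unfolding A(2)[OF i] rb[OF i] by (rule mult_hel[OF bc[OF j i] A(1)[OF i]])
      also have "b j i (e j - d i) = B j i" using B(2)[OF j i] by (simp add: hel_apply)
      finally show eq: "\<beta> j i \<cdot> A i = (r i \<otimes>\<^bsub>ER\<^esub> a i) (e j)" using be(2)[OF j i, of "A i"] A1[OF i] by simp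
      show "(r i \<otimes>\<^bsub>ER\<^esub> a i) (e j) \<in> Hom K ?u (?S (e j))" unfolding eq[symmetric] using be(1)[OF j i] A1[OF i] by simp
    qed simp_all
    also have "\<dots> = (\<Oplus>\<^bsub>ER\<^esub>i\<in>{..<n}. r i \<otimes>\<^bsub>ER\<^esub> a i) (e j)"
      by (rule ER_finsum_apply[symmetric]) (use rb ac bc[OF j] in auto)
    also have "\<dots> = pzero K ?u (?S (e j))" unfolding r0 by (simp add: ER_zero unit_zero_def)
    finally show ?thesis .
  qed
  have psp: "\<psi> \<cdot> \<phi>' = pzero K ?u E'"
  proof (rule free_on_eqI[OF E'])
    show "\<psi> \<cdot> \<phi>' \<in> Hom K ?u E'" "pzero K ?u E' \<in> Hom K ?u E'" using ps(1) p'(1) E'o by simp_all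
    fix j assume j: "j < m"
    have "\<rho> j \<cdot> \<psi> \<cdot> \<phi>' = \<theta> j \<cdot> \<phi>'" by (rule reassoc[OF ps(2)[OF j]]) (use ps(1) p'(1) free_onD(2)[OF E' j] in auto)
    then show "\<rho> j \<cdot> \<psi> \<cdot> \<phi>' = \<rho> j \<cdot> pzero K ?u E'"
      unfolding thp[OF j] using free_onD(2)[OF E' j] E'o by simp
  qed
  have rel': "\<exists>g\<in>Hom K E' (?S k). x = g \<cdot> \<psi>" if x: "x \<in> Hom K F' (?S k)" and x0: "x \<cdot> \<phi>' = pzero K ?u (?S k)" for x k
  proof -
    obtain c where c: "\<And>i. i < n \<Longrightarrow> c i \<in> Hom K (?S (d i)) (?S k)" "x = hsum F' (?S k) (\<lambda>i. c i \<cdot> \<pi> i) {..<n}"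
      using free_onD(4)[OF F' x] by blast
    have "\<exists>f. f \<in> unit_hom K (k - d i) \<and> (\<forall>x\<in>ar K. tgt K x = ?S (d i) \<longrightarrow> c i \<cdot> x = act (k - d i) (d i) f x)"
      if i: "i < n" for i
    proof -
      have "c i \<in> Hom K (?S (d i)) (?S (d i + (k - d i)))" using c(1)[OF i] by simp
      from act_full[OF this] show ?thesis by (simp only: Bex_def)
    qed
    from nat_choice[OF this] obtain q where
      "\<forall>i<n. q i \<in> unit_hom K (k - d i) \<and> (\<forall>x\<in>ar K. tgt K x = ?S (d i) \<longrightarrow> c i \<cdot> x = act (k - d i) (d i) (q i) x)" ..
    then have q: "\<And>i. i < n \<Longrightarrow> q i \<in> unit_hom K (k - d i)"
      "\<And>i x. \<lbrakk>i < n; x \<in> ar K; tgt K x = ?S (d i)\<rbrakk> \<Longrightarrow> c i \<cdot> x = act (k - d i) (d i) (q i) x" by blast+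
    define r where "r = (\<lambda>i\<in>{..<n}. hel (k - d i) (q i))"
    have rc: "r i \<in> carrier ER" if "i < n" for i using hel_closed[OF q(1)[OF that]] that by (simp add: r_def)
    have ra: "r i \<otimes>\<^bsub>ER\<^esub> a i = hel k (c i \<cdot> A i)" if i: "i < n" for i
      using hel_mult_hel[OF q(1)[OF i] A(1)[OF i]] i q(2)[OF i, of "A i"] A1[OF i] by (simp add: r_def A(2)[OF i])
    have "(\<Oplus>\<^bsub>ER\<^esub>i\<in>{..<n}. r i \<otimes>\<^bsub>ER\<^esub> a i) = \<zero>\<^bsub>ER\<^esub>"
    proof
      fix l
      have "(\<Oplus>\<^bsub>ER\<^esub>i\<in>{..<n}. r i \<otimes>\<^bsub>ER\<^esub> a i) l = hsum ?u (?S l) (\<lambda>i. (r i \<otimes>\<^bsub>ER\<^esub> a i) l) {..<n}"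
        by (rule ER_finsum_apply) (use rc ac in auto)
      also have "\<dots> = pzero K ?u (?S l)"
      proof (cases "l = k")
        case True
        have "hsum ?u (?S l) (\<lambda>i. (r i \<otimes>\<^bsub>ER\<^esub> a i) l) {..<n} = hsum ?u (?S k) (\<lambda>i. c i \<cdot> A i) {..<n}"
          unfolding True by (rule hsum_cong) (use ra c(1) A1 in \<open>auto simp: hel_apply\<close>)
        also have "\<dots> = x \<cdot> \<phi>'" unfolding c(2) by (rule sum_phi'[OF c(1), symmetric])
        finally show ?thesis unfolding x0 True .
      next
        case False
        show ?thesis by (rule hsum_zero) (use ra False in \<open>auto simp: hel_apply unit_zero_def\<close>)
      qed
      finally show "(\<Oplus>\<^bsub>ER\<^esub>i\<in>{..<n}. r i \<otimes>\<^bsub>ER\<^esub> a i) l = \<zero>\<^bsub>ER\<^esub> l" by (simp add: ER_zero unit_zero_def)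
    qed
    then have "r \<in> {r \<in> {..<n} \<rightarrow>\<^sub>E carrier ER. (\<Oplus>\<^bsub>ER\<^esub>i\<in>{..<n}. r i \<otimes>\<^bsub>ER\<^esub> a i) = \<zero>\<^bsub>ER\<^esub>}"
      using rc by (auto simp: r_def)
    then obtain w where w: "\<And>j. j < m \<Longrightarrow> w j \<in> carrier ER"
      "r = (\<lambda>i\<in>{..<n}. \<Oplus>\<^bsub>ER\<^esub>j\<in>{..<m}. w j \<otimes>\<^bsub>ER\<^esub> b j i)" unfolding R by auto
    \<comment> \<open>The coefficients \<open>w j\<close> need not be homogeneous. As
      \<open>x\<close> is homogeneous of degree \<open>k\<close>, only their components in degree
      \<open>k - e j\<close> contribute.\<close>
    define W where "W j = w j (k - e j)" for j
    have W: "W j \<in> unit_hom K (k - e j)" if "j < m" for j unfolding W_def by (rule ER_carrierD(1)[OF w(1)[OF that]])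
    have qW: "q i = hsum ?u (?S (k - d i)) (\<lambda>j. act (k - e j) (e j - d i) (W j) (B j i)) {..<m}" if i: "i < n" for i
    proof -
      have "q i = r i (k - d i)" using i by (simp add: r_def hel_apply)
      also have "\<dots> = (\<Oplus>\<^bsub>ER\<^esub>j\<in>{..<m}. w j \<otimes>\<^bsub>ER\<^esub> b j i) (k - d i)" using i w(2) by simp
      also have "\<dots> = hsum ?u (?S (k - d i)) (\<lambda>j. (w j \<otimes>\<^bsub>ER\<^esub> b j i) (k - d i)) {..<m}"
        by (rule ER_finsum_apply) (use w(1) bc i in auto)
      also have "\<dots> = hsum ?u (?S (k - d i)) (\<lambda>j. act (k - e j) (e j - d i) (W j) (B j i)) {..<m}"
      proof (rule hsum_cong)
        fix j assume "j \<in> {..<m}"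
        then have j: "j < m" by simp
        show "(w j \<otimes>\<^bsub>ER\<^esub> b j i) (k - d i) = act (k - e j) (e j - d i) (W j) (B j i)"
          unfolding B(2)[OF j i] using mult_hel[OF w(1)[OF j] B(1)[OF j i], of "k - d i"] by (simp add: W_def)
        show "act (k - e j) (e j - d i) (W j) (B j i) \<in> Hom K ?u (?S (k - d i))"
          using act_closed[OF W[OF j] B(1)[OF j i]] by simp
      qed simp_all
      finally show ?thesis .
    qed
    have "\<exists>g. g \<in> Hom K (?S (e j)) (?S k) \<and> (\<forall>x\<in>ar K. tgt K x = ?S (e j) \<longrightarrow> g \<cdot> x = act (k - e j) (e j) (W j) x)"
      if j: "j < m" for j
    proof -
      have "e j + (k - e j) = k" by simp
      with act_idt[OF W[OF j], of "e j"] show ?thesis by (simp only: Bex_def)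
    qed
    from nat_choice[OF this] obtain g where
      "\<forall>j<m. g j \<in> Hom K (?S (e j)) (?S k) \<and> (\<forall>x\<in>ar K. tgt K x = ?S (e j) \<longrightarrow> g j \<cdot> x = act (k - e j) (e j) (W j) x)" ..
    then have g: "\<And>j. j < m \<Longrightarrow> g j \<in> Hom K (?S (e j)) (?S k)"
      "\<And>j x. \<lbrakk>j < m; x \<in> ar K; tgt K x = ?S (e j)\<rbrakk> \<Longrightarrow> g j \<cdot> x = act (k - e j) (e j) (W j) x" by blast+
    have cg: "c i \<cdot> \<pi> i = hsum F' (?S k) (\<lambda>j. g j \<cdot> \<beta> j i \<cdot> \<pi> i) {..<m}" if i: "i < n" for i
    proof -
      have pi: "\<pi> i \<in> Hom K F' (?S (d i))" by (rule free_onD(2)[OF F' i])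
      have "c i \<cdot> \<pi> i = act (k - d i) (d i) (q i) (\<pi> i)" by (rule q(2)[OF i]) (use pi in simp_all)
      also have "\<dots> = hsum F' (?S (d i + (k - d i))) (\<lambda>j. act (k - d i) (d i) (act (k - e j) (e j - d i) (W j) (B j i)) (\<pi> i)) {..<m}"
        unfolding qW[OF i]
      proof (rule act_hsum_left[OF _ _ pi])
        fix j assume "j \<in> {..<m}"
        then have j: "j < m" by simp
        show "act (k - e j) (e j - d i) (W j) (B j i) \<in> unit_hom K (k - d i)"
          using act_closed[OF W[OF j] B(1)[OF j i]] by (simp del: unit_hom_iff)
      qed simp
      also have "\<dots> = hsum F' (?S k) (\<lambda>j. act (k - d i) (d i) (act (k - e j) (e j - d i) (W j) (B j i)) (\<pi> i)) {..<m}" by simp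
      also have "\<dots> = hsum F' (?S k) (\<lambda>j. g j \<cdot> \<beta> j i \<cdot> \<pi> i) {..<m}"
      proof (rule hsum_cong[OF F'o])
        fix j assume "j \<in> {..<m}"
        then have j: "j < m" by simp
        have bp: "\<beta> j i \<cdot> \<pi> i \<in> Hom K F' (?S (e j))" using be(1)[OF j i] pi by simp
        have "g j \<cdot> \<beta> j i \<cdot> \<pi> i = act (k - e j) (e j) (W j) (\<beta> j i \<cdot> \<pi> i)" by (rule g(2)[OF j]) (use bp in simp_all)
        also have "\<dots> = act (k - e j) (e j) (W j) (act (e j - d i) (d i) (B j i) (\<pi> i))"
          by (subst be(2)[OF j i]) (use pi in simp_all)
        also have "\<dots> = act (k - d i) (d i) (act (k - e j) (e j - d i) (W j) (B j i)) (\<pi> i)"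
          using act_act[OF W[OF j] B(1)[OF j i] pi] by simp
        finally show "act (k - d i) (d i) (act (k - e j) (e j - d i) (W j) (B j i)) (\<pi> i) = g j \<cdot> \<beta> j i \<cdot> \<pi> i" ..
        show "g j \<cdot> \<beta> j i \<cdot> \<pi> i \<in> Hom K F' (?S k)" using g(1)[OF j] bp be(1)[OF j i] pi by simp
      qed simp
      finally show ?thesis .
    qed
    have gbp: "g j \<cdot> \<beta> j i \<cdot> \<pi> i \<in> Hom K F' (?S k)" if "j < m" "i < n" for i j
      using g(1)[OF that(1)] be(1)[OF that] free_onD(2)[OF F' that(2)] by simp
    define G where "G = hsum E' (?S k) (\<lambda>j. g j \<cdot> \<rho> j) {..<m}"
    have G: "G \<in> Hom K E' (?S k)" unfolding G_def
      by (rule hsum_closed[OF E'o]) (use g(1) free_onD(2)[OF E'] in auto)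
    have "x = hsum F' (?S k) (\<lambda>i. hsum F' (?S k) (\<lambda>j. g j \<cdot> \<beta> j i \<cdot> \<pi> i) {..<m}) {..<n}"
      unfolding c(2)
    proof (rule hsum_cong[OF F'o])
      fix i assume "i \<in> {..<n}"
      then have i: "i < n" by simp
      show "c i \<cdot> \<pi> i = hsum F' (?S k) (\<lambda>j. g j \<cdot> \<beta> j i \<cdot> \<pi> i) {..<m}" by (rule cg[OF i])
      show "hsum F' (?S k) (\<lambda>j. g j \<cdot> \<beta> j i \<cdot> \<pi> i) {..<m} \<in> Hom K F' (?S k)"
        by (rule hsum_closed[OF F'o]) (use gbp i in auto)
    qed simp
    also have "\<dots> = hsum F' (?S k) (\<lambda>j. hsum F' (?S k) (\<lambda>i. g j \<cdot> \<beta> j i \<cdot> \<pi> i) {..<n}) {..<m}"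
      by (rule hsum_swap) (use gbp F'o in auto)
    also have "\<dots> = hsum F' (?S k) (\<lambda>j. (g j \<cdot> \<rho> j) \<cdot> \<psi>) {..<m}"
    proof (rule hsum_cong[OF F'o])
      fix j assume "j \<in> {..<m}"
      then have j: "j < m" by simp
      have "(g j \<cdot> \<rho> j) \<cdot> \<psi> = g j \<cdot> \<theta> j" using g(1)[OF j] ps(1) ps(2)[OF j] free_onD(2)[OF E' j] by simp
      also have "\<dots> = hsum F' (?S k) (\<lambda>i. g j \<cdot> \<beta> j i \<cdot> \<pi> i) {..<n}"
        unfolding \<theta>_def by (rule hsum_cmp(1)) (use be(1)[OF j] free_onD(2)[OF F'] g(1)[OF j] F'o in auto)
      finally show "hsum F' (?S k) (\<lambda>i. g j \<cdot> \<beta> j i \<cdot> \<pi> i) {..<n} = (g j \<cdot> \<rho> j) \<cdot> \<psi>" ..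
      show "(g j \<cdot> \<rho> j) \<cdot> \<psi> \<in> Hom K F' (?S k)" using g(1)[OF j] ps(1) free_onD(2)[OF E' j] by simp
    qed simp
    also have "\<dots> = G \<cdot> \<psi>" unfolding G_def
      by (rule hsum_cmp(2)[symmetric]) (use g(1) free_onD(2)[OF E'] ps(1) E'o in auto)
    finally show ?thesis using G by blast
  qed

  obtain E where E: "is_biproduct K F E' E" using biproducts[OF Fo E'o] by blast
  note Ef = free_biproduct[OF F E'f E]
  obtain i r j q where ij: "i \<in> Hom K F E" "r \<in> Hom K E F" "j \<in> Hom K E' E" "q \<in> Hom K E E'"
    "r \<cdot> i = idt K F" "q \<cdot> j = idt K E'" "q \<cdot> i = pzero K F E'" "r \<cdot> j = pzero K E' F" "i \<cdot> r \<boxplus> j \<cdot> q = idt K E"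
    using E by (rule biproductE)
  note Eo = free_ob[OF Ef]
  \<comment> \<open>If \<open>x\<close> kills \<open>\<phi>\<close>, then \<open>x \<cdot> s\<close>
    kills \<open>\<phi>'\<close>, so \<open>x \<cdot> s\<close> is some \<open>g\<close> composed
    with \<open>\<psi>\<close>, and \<open>x\<close> is \<open>x \<cdot> (1 - s \<cdot> t)\<close>
    plus \<open>g \<cdot> \<psi> \<cdot> t\<close>. Both components of \<open>\<mu>\<close> kill
    \<open>\<phi>\<close>, since \<open>s \<cdot> t \<cdot> \<phi> = \<phi>\<close> and
    \<open>t \<cdot> \<phi> = \<phi>'\<close>.\<close>
  define \<mu> where "\<mu> = i \<cdot> (idt K F \<boxplus> pneg K (s \<cdot> t)) \<boxplus> j \<cdot> \<psi> \<cdot> t"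
  have m: "\<mu> \<in> Hom K F E" using ij(1-4) s(1) t(1) ps(1) Fo by (simp add: \<mu>_def)
  have "r \<cdot> \<mu> = (r \<cdot> i) \<cdot> (idt K F \<boxplus> pneg K (s \<cdot> t)) \<boxplus> (r \<cdot> j) \<cdot> \<psi> \<cdot> t"
    using ij(1-4) s(1) t(1) ps(1) Fo by (simp add: \<mu>_def)
  then have rm: "r \<cdot> \<mu> = idt K F \<boxplus> pneg K (s \<cdot> t)"
    unfolding ij(5-8) using ij(1-4) s(1) t(1) ps(1) Fo by simp
  have "q \<cdot> \<mu> = (q \<cdot> i) \<cdot> (idt K F \<boxplus> pneg K (s \<cdot> t)) \<boxplus> (q \<cdot> j) \<cdot> \<psi> \<cdot> t"
    using ij(1-4) s(1) t(1) ps(1) Fo by (simp add: \<mu>_def)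
  then have qm: "q \<cdot> \<mu> = \<psi> \<cdot> t"
    unfolding ij(5-8) using ij(1-4) s(1) t(1) ps(1) Fo E'o by simp
  have "relations F \<phi> E \<mu>"
  proof (rule relationsI)
    show "E \<in> free" "\<mu> \<in> Hom K F E" by (rule Ef m)+
    have "\<mu> \<cdot> \<phi> = i \<cdot> (\<phi> \<boxplus> pneg K (s \<cdot> t \<cdot> \<phi>)) \<boxplus> j \<cdot> \<psi> \<cdot> t \<cdot> \<phi>"
      using ij(1-4) s(1) t(1) ps(1) Fo p by (simp add: \<mu>_def)
    also have "\<dots> = pzero K ?u E"
      unfolding tp psp s(2)[symmetric] using ij(1-4) p Fo Eo E'o by simp
    finally show "\<mu> \<cdot> \<phi> = pzero K (src K \<phi>) E" using p by simp
    fix k x assume x: "x \<in> Hom K F (?S k)" "x \<cdot> \<phi> = pzero K (src K \<phi>) (?S k)"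
    have "(x \<cdot> s) \<cdot> \<phi>' = pzero K ?u (?S k)" using x s p p'(1) by simp
    then obtain g where g: "g \<in> Hom K E' (?S k)" "x \<cdot> s = g \<cdot> \<psi>" using rel'[of "x \<cdot> s" k] x(1) s(1) by auto
    have "(x \<cdot> r \<boxplus> g \<cdot> q) \<cdot> \<mu> = x \<cdot> r \<cdot> \<mu> \<boxplus> g \<cdot> q \<cdot> \<mu>" using x(1) g(1) ij(1-4) m by simp
    also have "\<dots> = (x \<boxplus> pneg K ((x \<cdot> s) \<cdot> t)) \<boxplus> (g \<cdot> \<psi>) \<cdot> t"
      unfolding rm qm using x(1) g(1) s(1) t(1) ps(1) Fo by simp
    also have "\<dots> = x" unfolding g(2) using x(1) g(1) s(1) t(1) ps(1) by simp
    finally have "x = (x \<cdot> r \<boxplus> g \<cdot> q) \<cdot> \<mu>" ..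
    moreover have "x \<cdot> r \<boxplus> g \<cdot> q \<in> Hom K E (?S k)" using x(1) g(1) ij(1-4) by simp
    ultimately show "\<exists>c\<in>Hom K E (?S k). x = c \<cdot> \<mu>" by blast
  qed
  then show "\<exists>E \<psi>. relations F \<phi> E \<psi>" by blast
qed

lemma coherent_all:
  assumes "graded_coherent ER (end_degree K)" "ob K = thick_gen K {unit K}" "x \<in> ob K"
  shows "coherent x"
proof -
  have "thick_gen K {unit K} \<subseteq> {x. coherent x}"
    using coherent_thick coherent_unit[OF assms(1)] unfolding thick_gen_def by blast
  then show ?thesis using assms by blast
qed

end

section \<open>Torsion objects\<close>

context tt_category
begin

text \<open>Annihilation is expressed by a vanishing tensor product. Unlike \<open>act\<close>, this
  makes sense against any arrow, is symmetric, and does not change under isomorphisms of source and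
  target.\<close>

abbreviation tzero where "tzero f g \<equiv> f \<boxdot> g = pzero K (src K f \<boxtimes> src K g) (tgt K f \<boxtimes> tgt K g)"

lemma tzero_right:
  assumes "tzero s f" "s \<in> ar K" "f \<in> ar K" "g \<in> ar K" "tgt K g = src K f"
  shows "tzero s (f \<cdot> g)"
proof -
  have "s \<boxdot> (f \<cdot> g) = (s \<boxdot> f) \<cdot> (idt K (src K s) \<boxdot> g)" using assms(2-5) by (subst interchange) simp_all
  then show ?thesis using assms by simp
qed

lemma tzero_left:
  assumes "tzero s f" "s \<in> ar K" "f \<in> ar K" "g \<in> ar K" "src K g = tgt K f"
  shows "tzero s (g \<cdot> f)"
proof -
  have "s \<boxdot> (g \<cdot> f) = (idt K (tgt K s) \<boxdot> g) \<cdot> (s \<boxdot> f)" using assms(2-5) by (subst interchange) simp_all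
  then show ?thesis using assms by simp
qed

lemma tzero_iso_left:
  assumes "tzero s (g \<cdot> f)" "s \<in> ar K" "f \<in> ar K" "iso g" "src K g = tgt K f"
  shows "tzero s f"
  using tzero_left[OF assms(1), of "inva g"] assms by (simp add: iso_arrow)

lemma tzero_iso_right:
  assumes "tzero s (f \<cdot> g)" "s \<in> ar K" "f \<in> ar K" "iso g" "tgt K g = src K f"
  shows "tzero s f"
  using tzero_right[OF assms(1), of "inva g"] assms by (simp add: iso_arrow)

lemma tzero_swap:
  assumes "tzero f g" "f \<in> ar K" "g \<in> ar K"
  shows "tzero g f"
proof -
  have "(g \<boxdot> f) \<cdot> braid K (src K f) (src K g) = braid K (tgt K f) (tgt K g) \<cdot> (f \<boxdot> g)"
    using square_braid[of f g] assms(2,3) by (simp add: square_def)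
  also have "\<dots> = pzero K (src K g \<boxtimes> src K f) (tgt K g \<boxtimes> tgt K f) \<cdot> braid K (src K f) (src K g)"
    unfolding assms(1) using assms(2,3) by simp
  finally show ?thesis
    by (rule iso_cancel_right[rotated 5]) (use assms(2,3) in simp_all)
qed

lemma tzero_assoc:
  assumes "f \<in> ar K" "g \<in> ar K" "h \<in> ar K"
  shows "tzero (f \<boxdot> g) h \<longleftrightarrow> tzero f (g \<boxdot> h)"
proof -
  let ?a = "assoc K (src K f) (src K g) (src K h)" and ?b = "assoc K (tgt K f) (tgt K g) (tgt K h)"
  have eq: "?b \<cdot> ((f \<boxdot> g) \<boxdot> h) = (f \<boxdot> (g \<boxdot> h)) \<cdot> ?a" using square_assoc[OF assms] by (simp add: square_def)
  show ?thesis
  proof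
    assume *: "tzero (f \<boxdot> g) h"
    have "(f \<boxdot> (g \<boxdot> h)) \<cdot> ?a = pzero K (src K f \<boxtimes> src K g \<boxtimes> src K h) (tgt K f \<boxtimes> tgt K g \<boxtimes> tgt K h) \<cdot> ?a"
      unfolding eq[symmetric] * using assms by simp
    then show "tzero f (g \<boxdot> h)"
      by (intro iso_cancel_right[of ?a "f \<boxdot> (g \<boxdot> h)" "pzero K (src K f \<boxtimes> src K (g \<boxdot> h)) (tgt K f \<boxtimes> tgt K (g \<boxdot> h))"])
         (use assms in simp_all)
  next
    assume *: "tzero f (g \<boxdot> h)"
    have "?b \<cdot> ((f \<boxdot> g) \<boxdot> h) = ?b \<cdot> pzero K ((src K f \<boxtimes> src K g) \<boxtimes> src K h) ((tgt K f \<boxtimes> tgt K g) \<boxtimes> tgt K h)"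
      unfolding eq * using assms by simp
    then show "tzero (f \<boxdot> g) h"
      by (intro iso_cancel_left[of ?b "(f \<boxdot> g) \<boxdot> h" "pzero K (src K (f \<boxdot> g) \<boxtimes> src K h) (tgt K (f \<boxdot> g) \<boxtimes> tgt K h)"])
         (use assms in simp_all)
  qed
qed

text \<open>After reassociating, \<open>tensm_eq_act\<close> replaces the tensor product of
  \<open>t\<close> and \<open>s\<close> by their product in the ring, up to isomorphisms on both
  sides, which do not affect vanishing.\<close>

lemma tzero_act:
  assumes t: "t \<in> unit_hom K m" and s: "s \<in> unit_hom K n" and b: "b \<in> ar K" and z: "tzero t (s \<boxdot> b)"
  shows "tzero (act m n t s) b"
proof -
  let ?A = "act_tensor m n" and ?l = "lunit K (unit K)"
  have ts: "t \<boxdot> s = ?A \<cdot> act m n t s \<cdot> ?l" by (rule tensm_eq_act[OF t]) (use s in simp)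
  have "tzero (t \<boxdot> s) b" using z tzero_assoc[of t s b] t s b by simp
  then have "tzero b (?A \<cdot> act m n t s \<cdot> ?l)" using tzero_swap[of "t \<boxdot> s" b] t s b unfolding ts by simp
  then have "tzero b (act m n t s \<cdot> ?l)" by (rule tzero_iso_left) (use t s b in simp_all)
  then have "tzero b (act m n t s)" by (rule tzero_iso_right) (use t s b in simp_all)
  then show ?thesis by (rule tzero_swap) (use t s b in simp_all)
qed

lemma tzero_iff_act:
  assumes "f \<in> unit_hom K n" "b \<in> Hom K x (shift K l (unit K))"
  shows "tzero f b \<longleftrightarrow> act n l f b = pzero K x (shift K (l + n) (unit K))"
  using tensm_zero_iff_act[OF assms] assms by simp

lemma tensor_is_cone:
  assumes "is_cone K f c" "f \<in> ar K" "x \<in> ob K"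
  shows "is_cone K (f \<boxdot> idt K x) (c \<boxtimes> x)"
proof -
  obtain g h where t: "triangle (src K f) (tgt K f) c f g h" using assms(1) by (auto simp: is_cone_iff)
  note ta = triangle_arrow[OF t]
  have "(f \<boxdot> idt K x, g \<boxdot> idt K x, tsusp K (src K f) x \<cdot> (h \<boxdot> idt K x)) \<in> tri K"
    using tens_exact[of f g h "src K f" "tgt K f" x] t assms(3) unfolding triangle_def by simp
  moreover have "tgt K (g \<boxdot> idt K x) = c \<boxtimes> x" using ta assms(3) by simp
  ultimately show ?thesis unfolding is_cone_def by blast
qed

abbreviation kills where "kills s x \<equiv> tzero s (idt K x)"

lemma kills_from: "\<lbrakk>kills s x; s \<in> ar K; b \<in> ar K; src K b = x\<rbrakk> \<Longrightarrow> tzero s b"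
  using tzero_left[of s "idt K x" b] by auto

lemma kills_to: "\<lbrakk>kills s x; s \<in> ar K; b \<in> ar K; tgt K b = x\<rbrakk> \<Longrightarrow> tzero s b"
  using tzero_right[of s "idt K x" b] by auto

lemma kills_shift:
  assumes k: "kills s x" and s: "s \<in> ar K" and x: "x \<in> ob K"
  shows "kills s (shift K n x)"
proof -
  have z: "idt K x \<boxdot> s = pzero K (x \<boxtimes> src K s) (x \<boxtimes> tgt K s)" using tzero_swap[OF k] s x by simp
  have "tshift n x (tgt K s) \<cdot> (idt K (shift K n x) \<boxdot> s) = shiftm K n (idt K x \<boxdot> s) \<cdot> tshift n x (src K s)"
    using square_tshift[of "idt K x" s n] s x by (simp add: square_def)
  also have "\<dots> = tshift n x (tgt K s) \<cdot> pzero K (shift K n x \<boxtimes> src K s) (shift K n x \<boxtimes> tgt K s)"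
    unfolding z using s x by simp
  finally have "idt K (shift K n x) \<boxdot> s = pzero K (shift K n x \<boxtimes> src K s) (shift K n x \<boxtimes> tgt K s)"
    by (rule iso_cancel_left[rotated 5]) (use s x in simp_all)
  then have "tzero (idt K (shift K n x)) s" using s x by simp
  then show ?thesis by (rule tzero_swap) (use s x in simp_all)
qed

lemma kills_tensor:
  assumes k: "kills s x" and s: "s \<in> ar K" and x: "x \<in> ob K" and y: "y \<in> ob K"
  shows "kills s (x \<boxtimes> y)"
proof -
  have "tzero (s \<boxdot> idt K x) (idt K y)" using k s x y by simp
  then show ?thesis using tzero_assoc[of s "idt K x" "idt K y"] s x y by simp
qed

text \<open>Identifies the target of \<open>s \<boxdot> b\<close> with a shift of \<open>y\<close>,
  so that exact sequences for shifts of a triangle apply to it.\<close>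

definition sunitor where
  "sunitor j k y = shmul K j k y \<cdot> shiftm K j (lunit K (shift K k y)) \<cdot> tshift j (unit K) (shift K k y)"

lemma sunitor [simp]:
  assumes "y \<in> ob K"
  shows "sunitor j k y \<in> ar K" "src K (sunitor j k y) = shift K j (unit K) \<boxtimes> shift K k y"
    "tgt K (sunitor j k y) = shift K (j + k) y" "iso (sunitor j k y)"
  using assms by (simp_all add: sunitor_def)

lemma square_sunitor:
  assumes f: "f \<in> ar K"
  shows "square (sunitor j k (src K f)) (sunitor j k (tgt K f)) (idt K (shift K j (unit K)) \<boxdot> shiftm K k f) (shiftm K (j + k) f)"
proof -
  let ?e = "idt K (unit K)"
  have 1: "square (tshift j (unit K) (shift K k (src K f))) (tshift j (unit K) (shift K k (tgt K f)))
      (idt K (shift K j (unit K)) \<boxdot> shiftm K k f) (shiftm K j (?e \<boxdot> shiftm K k f))"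
    using square_tshift[of ?e "shiftm K k f" j] f by simp
  have 2: "square (shiftm K j (lunit K (shift K k (src K f)))) (shiftm K j (lunit K (shift K k (tgt K f))))
      (shiftm K j (?e \<boxdot> shiftm K k f)) (shiftm K j (shiftm K k f))"
    using square_shiftm[OF square_lunit[of "shiftm K k f"], of j] f by simp
  show ?thesis unfolding sunitor_def by (rule square_cmp[OF square_cmp[OF 1 2] square_shmul[OF f]])
qed

text \<open>Exactness at the \<open>k\<close>-th shift of a triangle. The test arrow is shifted by
  \<open>-k\<close> and compared with the original triangle through \<open>unshift\<close>, so that
  no signs of shifted triangles come up.\<close>

lemma exact_co_shifted:
  assumes t: "triangle x y z f g h" and a: "a \<in> Hom K w (shift K k y)" "shiftm K k g \<cdot> a = pzero K w (shift K k z)"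
  shows "\<exists>b\<in>Hom K w (shift K k x). a = shiftm K k f \<cdot> b"
proof -
  note ta = triangle_arrow[OF t]
  have w: "w \<in> ob K" using a(1) by auto
  let ?s = "shiftm K (- k)"
  have gu: "g \<cdot> unshift k y = unshift k z \<cdot> ?s (shiftm K k g)"
    using square_unshift[of g k] ta by (simp add: square_def)
  have fu: "f \<cdot> unshift k x = unshift k y \<cdot> ?s (shiftm K k f)"
    using square_unshift[of f k] ta by (simp add: square_def)
  have "g \<cdot> unshift k y \<cdot> ?s a = (unshift k z \<cdot> ?s (shiftm K k g)) \<cdot> ?s a"
    by (rule reassoc[OF gu]) (use ta a in simp_all)
  also have "\<dots> = unshift k z \<cdot> ?s (shiftm K k g \<cdot> a)" using ta a(1) by simp
  also have "\<dots> = pzero K (shift K (- k) w) z" unfolding a(2) using ta w by simp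
  finally obtain b where b: "b \<in> Hom K (shift K (- k) w) x" "unshift k y \<cdot> ?s a = f \<cdot> b"
    using exact_co_mid[OF t, of "unshift k y \<cdot> ?s a" "shift K (- k) w"] ta a(1) by auto
  obtain c where c: "c \<in> Hom K w (shift K k x)" "?s c = inva (unshift k x) \<cdot> b"
    using shiftm_full[of w "shift K k x" "inva (unshift k x) \<cdot> b" "- k"] w b(1) ta by auto
  have "unshift k y \<cdot> ?s a = f \<cdot> unshift k x \<cdot> ?s c" unfolding b(2) c(2) using b(1) ta by simp
  also have "\<dots> = (unshift k y \<cdot> ?s (shiftm K k f)) \<cdot> ?s c"
    by (rule reassoc[OF fu]) (use ta c(1) in simp_all)
  also have "\<dots> = unshift k y \<cdot> ?s (shiftm K k f \<cdot> c)" using ta c(1) by simp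
  finally have "?s a = ?s (shiftm K k f \<cdot> c)"
    by (rule iso_cancel_left[rotated 5]) (use ta a(1) c(1) in simp_all)
  then have "a = shiftm K k f \<cdot> c"
    by (rule shiftm_faithful[of _ w "shift K k y", rotated 2]) (use ta a(1) c(1) in simp_all)
  with c(1) show ?thesis by blast
qed

section \<open>Objects annihilated by a multiplicative set of ring elements\<close>

definition mult_set where
  "mult_set S \<longleftrightarrow> (\<forall>n. S n \<subseteq> unit_hom K n) \<and> shunit K (unit K) \<in> S 0 \<and>
     (\<forall>m n. \<forall>a\<in>S m. \<forall>b\<in>S n. act m n a b \<in> S (n + m))"

lemma mult_setD:
  assumes "mult_set S"
  shows "s \<in> S n \<Longrightarrow> s \<in> unit_hom K n" "shunit K (unit K) \<in> S 0"
    "\<lbrakk>a \<in> S m; b \<in> S n\<rbrakk> \<Longrightarrow> act m n a b \<in> S (n + m)"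
  using assms unfolding mult_set_def by blast+

text \<open>One \<open>s\<close> has to annihilate the arrows of all degrees. This uniformity makes
  the objects \<open>y\<close> form a thick subcategory, and for \<open>y = x\<close> the same
  \<open>s\<close> annihilates the identity.\<close>

definition torsion where
  "torsion S x y \<longleftrightarrow> (\<exists>n. \<exists>s\<in>S n. \<forall>k. \<forall>b\<in>Hom K x (shift K k y). tzero s b)"

lemma torsionE:
  assumes "torsion S x y"
  obtains n s where "s \<in> S n" "\<And>k b. b \<in> Hom K x (shift K k y) \<Longrightarrow> tzero s b"
  using assms unfolding torsion_def by blast

lemma torsionI: "\<lbrakk>s \<in> S n; \<And>k b. b \<in> Hom K x (shift K k y) \<Longrightarrow> tzero s b\<rbrakk> \<Longrightarrow> torsion S x y"
  unfolding torsion_def by blast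

text \<open>For \<open>S\<close> the homogeneous elements outside a prime, these are the objects
  that vanish in the localization; see \<open>localization_zero_iff\<close>.\<close>

definition kill_set where
  "kill_set S = {x \<in> ob K. \<exists>n. \<exists>s\<in>S n. kills s x}"

lemma kill_setE:
  assumes "x \<in> kill_set S"
  obtains n s where "x \<in> ob K" "s \<in> S n" "kills s x"
  using assms unfolding kill_set_def by blast

lemma kill_setI: "\<lbrakk>x \<in> ob K; s \<in> S n; kills s x\<rbrakk> \<Longrightarrow> x \<in> kill_set S"
  unfolding kill_set_def by blast

context
  fixes S assumes S: "mult_set S"
begin

lemma S_arrow: "s \<in> S n \<Longrightarrow> s \<in> ar K \<and> src K s = unit K \<and> tgt K s = shift K n (unit K)"
  using mult_setD(1)[OF S, of s n] by simp

lemma torsion_shift: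
  assumes t: "torsion S x y" and y: "y \<in> ob K"
  shows "torsion S x (shift K n y)"
proof -
  obtain m s where s: "s \<in> S m" "\<And>k b. b \<in> Hom K x (shift K k y) \<Longrightarrow> tzero s b"
    using t by (rule torsionE) blast
  have "tzero s b" if b: "b \<in> Hom K x (shift K k (shift K n y))" for k b
  proof -
    have "tzero s (shmul K k n y \<cdot> b)" by (rule s(2)[of _ "k + n"]) (use b y in simp)
    then show ?thesis by (rule tzero_iso_left) (use b y S_arrow[OF s(1)] in simp_all)
  qed
  with s(1) show ?thesis by (rule torsionI)
qed

text \<open>For a cone \<open>c\<close> of \<open>y -> y'\<close>: if \<open>s\<close> annihilates
  arrows to shifts of \<open>shift K 1 y\<close>, then \<open>s \<boxdot> b\<close> dies there and
  lifts to a shift of \<open>y'\<close>. If \<open>r\<close> annihilates arrows to those shifts, the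
  product of \<open>r\<close> and \<open>s\<close> annihilates \<open>b\<close>.\<close>

lemma torsion_thick:
  assumes x: "x \<in> ob K"
  shows "thick K {y \<in> ob K. torsion S x y}"
proof (rule thickI)
  fix z assume z: "is_zero K z"
  have "tzero (shunit K (unit K)) b" if b: "b \<in> Hom K x (shift K k z)" for k b
    using to_zero[OF shift_is_zero[OF z, of k], of b] b x is_zero_ob[OF z] by simp
  then have "torsion S x z" by (rule torsionI[where S = S, OF mult_setD(2)[OF S]])
  then show "z \<in> {y \<in> ob K. torsion S x y}" using is_zero_ob[OF z] by simp
next
  fix y n assume "y \<in> {y \<in> ob K. torsion S x y}"
  then show "shift K n y \<in> {y \<in> ob K. torsion S x y}" using torsion_shift by simp
next
  fix y y' c f g h assume t: "triangle y y' c f g h" and "y \<in> {y \<in> ob K. torsion S x y}" "y' \<in> {y \<in> ob K. torsion S x y}"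
  then have y: "torsion S x (shift K 1 y)" and y': "torsion S x y'" using torsion_shift by auto
  note ta = triangle_arrow[OF t]
  obtain n s where s: "s \<in> S n" "\<And>k b. b \<in> Hom K x (shift K k (shift K 1 y)) \<Longrightarrow> tzero s b"
    using y by (rule torsionE) blast
  obtain m r where r: "r \<in> S m" "\<And>k b. b \<in> Hom K x (shift K k y') \<Longrightarrow> tzero r b"
    using y' by (rule torsionE) blast
  note sa = S_arrow[OF s(1)] and ra = S_arrow[OF r(1)]
  have "tzero (act m n r s) b" if b: "b \<in> Hom K x (shift K k c)" for k b
  proof -
    let ?o = "sunitor n k" and ?j = "idt K (shift K n (unit K))"
    have 1: "tzero s (shiftm K k h \<cdot> b)" by (rule s(2)[of _ k]) (use b ta in simp)
    have "(?j \<boxdot> shiftm K k h) \<cdot> (s \<boxdot> b) = s \<boxdot> (shiftm K k h \<cdot> b)"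
      using sa b ta by (subst interchange) simp_all
    then have 2: "(?j \<boxdot> shiftm K k h) \<cdot> (s \<boxdot> b) = pzero K (unit K \<boxtimes> x) (shift K n (unit K) \<boxtimes> shift K k (shift K 1 y))"
      using 1 sa b ta by simp
    have 3: "shiftm K (n + k) h \<cdot> ?o c = ?o (shift K 1 y) \<cdot> (?j \<boxdot> shiftm K k h)"
      using square_sunitor[of h n k] ta by (simp add: square_def)
    have "shiftm K (n + k) h \<cdot> ?o c \<cdot> (s \<boxdot> b) = (?o (shift K 1 y) \<cdot> (?j \<boxdot> shiftm K k h)) \<cdot> (s \<boxdot> b)"
      by (rule reassoc[OF 3]) (use sa b ta in simp_all)
    also have "\<dots> = ?o (shift K 1 y) \<cdot> (?j \<boxdot> shiftm K k h) \<cdot> (s \<boxdot> b)" using sa b ta by simp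
    also have "\<dots> = pzero K (unit K \<boxtimes> x) (shift K (n + k) (shift K 1 y))" unfolding 2 using x ta by simp
    finally obtain e where e: "e \<in> Hom K (unit K \<boxtimes> x) (shift K (n + k) y')" "?o c \<cdot> (s \<boxdot> b) = shiftm K (n + k) g \<cdot> e"
      using exact_co_shifted[OF triangle_rotate[OF t], of "?o c \<cdot> (s \<boxdot> b)" "unit K \<boxtimes> x" "n + k"] sa b ta by auto
    have "tzero r (e \<cdot> inva (lunit K x))" by (rule r(2)[of _ "n + k"]) (use e(1) x in simp)
    then have "tzero r e" by (rule tzero_iso_right) (use e(1) x ra in simp_all)
    then have "tzero r (shiftm K (n + k) g \<cdot> e)" by (rule tzero_left) (use e(1) ra ta in simp_all)
    then have "tzero r (?o c \<cdot> (s \<boxdot> b))" unfolding e(2) .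
    then have "tzero r (s \<boxdot> b)" by (rule tzero_iso_left) (use sa b ta ra in simp_all)
    then show ?thesis by (rule tzero_act[rotated 3]) (use mult_setD(1)[OF S] r(1) s(1) b in simp_all)
  qed
  then have "torsion S x c" by (rule torsionI[where S = S, OF mult_setD(3)[OF S, OF r(1) s(1)]])
  then show "c \<in> {y \<in> ob K. torsion S x y}" using ta by simp
next
  fix z y i p assume "y \<in> {y \<in> ob K. torsion S x y}" and i: "i \<in> Hom K z y" and p: "p \<in> Hom K y z" and pi: "p \<cdot> i = idt K z"
  then have y: "torsion S x y" "y \<in> ob K" by auto
  have z: "z \<in> ob K" using i by auto
  obtain n s where s: "s \<in> S n" "\<And>k b. b \<in> Hom K x (shift K k y) \<Longrightarrow> tzero s b"
    using y(1) by (rule torsionE) blast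
  note sa = S_arrow[OF s(1)]
  have "tzero s b" if b: "b \<in> Hom K x (shift K k z)" for k b
  proof -
    have "tzero s (shiftm K k i \<cdot> b)" by (rule s(2)[of _ k]) (use b i in simp)
    then have "tzero s (shiftm K k p \<cdot> shiftm K k i \<cdot> b)" by (rule tzero_left) (use sa b i p in simp_all)
    moreover have "shiftm K k p \<cdot> shiftm K k i = idt K (shift K k z)"
      using shiftm_cmp'[of i p k] i p pi z by simp
    from reassoc[OF this, of b] have "shiftm K k p \<cdot> shiftm K k i \<cdot> b = b" using b i p by simp
    ultimately show ?thesis by simp
  qed
  then have "torsion S x z" by (rule torsionI[where S = S, OF s(1)])
  then show "z \<in> {y \<in> ob K. torsion S x y}" using z by simp
qed blast

lemma kills_torsion:
  assumes "x \<in> kill_set S"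
  shows "torsion S w x"
  using assms
proof (rule kill_setE)
  fix n s assume x: "x \<in> ob K" and s: "s \<in> S n" and k: "kills s x"
  note sa = S_arrow[OF s]
  show ?thesis
  proof (rule torsionI[where S = S, OF s])
    fix k b assume "b \<in> Hom K w (shift K k x)"
    then show "tzero s b" using kills_to[OF kills_shift[OF k _ x, of k], of b] sa by simp
  qed
qed

lemma torsion_kills:
  assumes t: "torsion S x x" and x: "x \<in> ob K"
  shows "x \<in> kill_set S"
  using t
proof (rule torsionE)
  fix n s assume s: "s \<in> S n" "\<And>k b. b \<in> Hom K x (shift K k x) \<Longrightarrow> tzero s b"
  note sa = S_arrow[OF s(1)]
  have "tzero s (shunit K x \<cdot> idt K x)" by (rule s(2)[of _ 0]) (use x in simp)
  then have "kills s x" by (rule tzero_iso_left) (use x sa in simp_all)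
  then show ?thesis by (rule kill_setI[where S = S, OF x s(1)])
qed

text \<open>For a cone \<open>z\<close>, test on arrows out of \<open>z\<close> itself: the objects
  \<open>y\<close> with \<open>torsion S z y\<close> form a thick subcategory that contains the
  other two vertices, hence \<open>z\<close>. Then the identity of \<open>z\<close> is
  annihilated.\<close>

lemma kill_set_thick_ideal: "thick_ideal K (kill_set S)"
  unfolding thick_ideal_def
proof (intro conjI ballI)
  show "thick K (kill_set S)"
  proof (rule thickI)
    show "kill_set S \<subseteq> ob K" by (auto simp: kill_set_def)
    show "z \<in> kill_set S" if z: "is_zero K z" for z
    proof (rule kill_setI[where S = S, OF is_zero_ob[OF z] mult_setD(2)[OF S]])
      have "idt K z = pzero K z z" using z by (simp add: is_zero_iff)
      then show "kills (shunit K (unit K)) z" using is_zero_ob[OF z] by simp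
    qed
    fix x assume x: "x \<in> kill_set S"
    show "shift K n x \<in> kill_set S" for n using x
    proof (rule kill_setE)
      fix m s assume x: "x \<in> ob K" and s: "s \<in> S m" and k: "kills s x"
      show ?thesis by (rule kill_setI[where S = S, OF _ s kills_shift[OF k _ x]]) (use x S_arrow[OF s] in simp_all)
    qed
    show "z \<in> kill_set S" if t: "triangle x y z f g h" and y: "y \<in> kill_set S" for y z f g h
    proof -
      note ta = triangle_arrow[OF t]
      have "z \<in> {y \<in> ob K. torsion S z y}"
        by (rule thick_third[OF torsion_thick[OF ta(12)] t]) (use kills_torsion x y ta in simp_all)
      then show ?thesis using torsion_kills by simp
    qed
    show "y \<in> kill_set S" if i: "i \<in> Hom K y x" and r: "r \<in> Hom K x y" and ri: "r \<cdot> i = idt K y" for y i r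
      using x
    proof (rule kill_setE)
      fix m s assume x: "x \<in> ob K" and s: "s \<in> S m" and k: "kills s x"
      have "tzero s (r \<cdot> i)"
        by (rule tzero_right[OF kills_from[OF k]]) (use i r S_arrow[OF s] in simp_all)
      then have "kills s y" unfolding ri .
      moreover have "y \<in> ob K" using i by auto
      ultimately show ?thesis using s by (intro kill_setI[where S = S])
    qed
  qed
  show "x \<boxtimes> y \<in> kill_set S" if x: "x \<in> kill_set S" and y: "y \<in> ob K" for x y using x
  proof (rule kill_setE)
    fix m s assume x: "x \<in> ob K" and s: "s \<in> S m" and k: "kills s x"
    show ?thesis by (rule kill_setI[where S = S, OF _ s kills_tensor[OF k _ x y]]) (use x y S_arrow[OF s] in simp_all)
  qed
qed

text \<open>It suffices to test on arrows to suspensions of the unit, since the unit generates.\<close>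

lemma kill_set_act:
  assumes gen: "ob K = thick_gen K {unit K}" and x: "x \<in> ob K" and s: "s \<in> S n"
    and z: "\<And>k a. a \<in> Hom K x (shift K k (unit K)) \<Longrightarrow> act n k s a = pzero K x (shift K (k + n) (unit K))"
  shows "x \<in> kill_set S"
proof -
  have "torsion S x (unit K)"
  proof (rule torsionI[where S = S, OF s])
    fix k b assume b: "b \<in> Hom K x (shift K k (unit K))"
    show "tzero s b" unfolding tzero_iff_act[OF mult_setD(1)[OF S, OF s] b] by (rule z[OF b])
  qed
  then have "thick_gen K {unit K} \<subseteq> {y \<in> ob K. torsion S x y}"
    using torsion_thick[OF x] unfolding thick_gen_def by (intro Inter_lower) simp
  then show ?thesis using gen x torsion_kills by blast
qed

end

text \<open>The action of \<open>s\<close> on \<open>x\<close> has cone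
  \<open>c \<boxtimes> x\<close>. If the action is zero, this cone contains a suspension of
  \<open>unit K \<boxtimes> x\<close> as a retract.\<close>

lemma kill_set_retract:
  assumes J: "thick_ideal K J" and t: "is_cone K s c" "c \<boxtimes> x \<in> J" and s: "s \<in> unit_hom K n"
    and k: "kills s x" and x: "x \<in> ob K"
  shows "x \<in> J"
proof -
  have T: "thick K J" using J by (simp add: thick_ideal_def)
  have "is_cone K (s \<boxdot> idt K x) (c \<boxtimes> x)" by (rule tensor_is_cone[OF t(1) _ x]) (use s in simp)
  then have "pzero K (unit K \<boxtimes> x) (shift K n (unit K) \<boxtimes> x) \<in> cone_in K J"
    using t(2) k s x by (auto simp: cone_in_def)
  then have "unit K \<boxtimes> x \<in> J" by (rule cone_in_zero(1)[OF T]) (use x in simp_all)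
  then show ?thesis by (rule thick_iso[OF T, of _ "lunit K x"]) (use x in simp_all)
qed

end

section \<open>Primes\<close>

context tt_category
begin

text \<open>\<open>act_commute\<close> read through \<open>act_act\<close>. The factor
  \<open>e\<close> of degree 0 is the same for all \<open>s\<close>, \<open>r\<close> and
  \<open>a\<close>, and is absorbed by ideals and submodules.\<close>

lemma act_exchange:
  "\<exists>e\<in>unit_hom K 0. \<forall>s\<in>unit_hom K m. \<forall>r\<in>unit_hom K n. \<forall>a\<in>Hom K x (shift K k (unit K)).
     act m (k + n) s (act n k r a) = act 0 (k + (m + n)) e (act n (k + m) r (act m k s a))"
proof -
  obtain e where e: "e \<in> unit_hom K 0" "\<And>s r. \<lbrakk>s \<in> unit_hom K m; r \<in> unit_hom K n\<rbrakk> \<Longrightarrow> act m n s r = act 0 (m + n) e (act n m r s)"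
    using act_commute[of m n] by blast
  have "act m (k + n) s (act n k r a) = act 0 (k + (m + n)) e (act n (k + m) r (act m k s a))"
    if s: "s \<in> unit_hom K m" and r: "r \<in> unit_hom K n" and a: "a \<in> Hom K x (shift K k (unit K))" for s r a
  proof -
    have rs: "act n m r s \<in> unit_hom K (m + n)" by (rule act_closed[OF r s])
    have "act m (k + n) s (act n k r a) = act (n + m) k (act m n s r) a" by (rule act_act[OF s r a])
    also have "\<dots> = act (m + n + 0) k (act 0 (m + n) e (act n m r s)) a" unfolding e(2)[OF s r] by (simp add: add.commute)
    also have "\<dots> = act 0 (k + (m + n)) e (act (m + n) k (act n m r s) a)" by (rule act_act[OF e(1) rs a, symmetric])
    also have "act (m + n) k (act n m r s) a = act n (k + m) r (act m k s a)" by (rule act_act[OF r s a, symmetric])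
    finally show ?thesis .
  qed
  with e(1) show ?thesis by blast
qed

text \<open>Against elements of degree 0 the commutation factor can be computed: inserting the unit
  element shows that it acts as the identity in degree \<open>n\<close>.\<close>

lemma act_0_central:
  assumes f: "f \<in> unit_hom K n" and e: "e \<in> unit_hom K 0"
  shows "act n 0 f e = act 0 n e f"
proof -
  obtain e' where e': "e' \<in> unit_hom K 0"
    "\<And>a r. \<lbrakk>a \<in> unit_hom K n; r \<in> unit_hom K 0\<rbrakk> \<Longrightarrow> act n 0 a r = act 0 (n + 0) e' (act 0 n r a)"
    using act_commute[of n 0] by blast
  have s: "shunit K (unit K) \<in> unit_hom K 0" by simp
  have triv: "act 0 n e' a = a" if a: "a \<in> unit_hom K n" for a
    using e'(2)[OF a s] act_on_shunit[OF a] act_shunit[of a n] a by simp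
  have "act 0 n e f \<in> unit_hom K n" using act_closed[OF e f] by simp
  then show ?thesis using e'(2)[OF f e] triv by simp
qed

text \<open>A factor of degree 0 acts by precomposition. This moves it to the right of
  \<open>f\<close>, out of the way of an arrow composed with \<open>f\<close> on the left.\<close>

lemma act_0_right:
  assumes f: "f \<in> unit_hom K n" and e: "e \<in> unit_hom K 0"
  shows "act 0 n e f = f \<cdot> inva (shunit K (unit K)) \<cdot> e"
proof -
  let ?u = "unit K"
  have sq: "shunit K (shift K n ?u) \<cdot> f = shiftm K 0 f \<cdot> shunit K ?u"
    using f shunit_nat[of f ?u "shift K n ?u"] by simp
  have "shiftm K 0 f = shiftm K 0 f \<cdot> shunit K ?u \<cdot> inva (shunit K ?u)" using f by simp
  also have "\<dots> = (shunit K (shift K n ?u) \<cdot> f) \<cdot> inva (shunit K ?u)"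
    by (rule reassoc[OF sq[symmetric]]) (use f in simp_all)
  finally have "shiftm K 0 f = shunit K (shift K n ?u) \<cdot> f \<cdot> inva (shunit K ?u)" using f by simp
  then have "act n 0 f e = shmul K 0 n ?u \<cdot> shunit K (shift K n ?u) \<cdot> f \<cdot> inva (shunit K ?u) \<cdot> e"
    using f e by (simp add: act_def)
  also have "\<dots> = idt K (shift K n ?u) \<cdot> f \<cdot> inva (shunit K ?u) \<cdot> e"
    by (rule reassoc[OF shmul_unit_left]) (use f e in simp_all)
  finally show ?thesis using act_0_central[OF f e] f e by simp
qed

text \<open>There are two ways of removing a tensor factor \<open>shift K n (unit K)\<close>, on the
  left and on the right. They turn \<open>g \<boxdot> f\<close> into the shift of
  \<open>g \<cdot> t \<cdot> f\<close> for an endomorphism \<open>t\<close> comparing the two ways.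
  As \<open>t\<close> is multiplication by an element of degree 0, it can be moved to the right of
  \<open>f\<close>, and then \<open>g \<cdot> f = 0\<close> applies.\<close>

lemma tzero_cone_map:
  assumes f: "f \<in> unit_hom K n" and g: "g \<in> Hom K (shift K n (unit K)) c" and gf: "g \<cdot> f = pzero K (unit K) c"
  shows "tzero f g"
proof -
  let ?u = "unit K" and ?N = "shift K n (unit K)"
  let ?R = "runitor n" and ?L = "\<lambda>y. shiftm K n (lunit K y) \<cdot> tshift n (unit K) y"
  have c: "c \<in> ob K" using g by auto
  have L: "square (?L (src K h)) (?L (tgt K h)) (idt K ?N \<boxdot> h) (shiftm K n h)" if h: "h \<in> ar K" for h
  proof -
    have "square (tshift n ?u (src K h)) (tshift n ?u (tgt K h)) (idt K ?N \<boxdot> h) (shiftm K n (idt K ?u \<boxdot> h))"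
      using square_tshift[of "idt K ?u" h n] h by simp
    from square_cmp[OF this square_shiftm[OF square_lunit[OF h]]] show ?thesis .
  qed
  have 1: "?R c \<cdot> (g \<boxdot> idt K ?N) = shiftm K n g \<cdot> ?R ?N"
    using square_runitor[of g n] g by (simp add: square_def)
  have 2: "?L ?N \<cdot> (idt K ?N \<boxdot> f) = shiftm K n f \<cdot> ?L ?u"
    using L[of f] f by (simp add: square_def)
  have 3: "idt K ?N \<boxdot> f = inva (?L ?N) \<cdot> shiftm K n f \<cdot> ?L ?u"
  proof -
    have "idt K ?N \<boxdot> f = inva (?L ?N) \<cdot> ?L ?N \<cdot> (idt K ?N \<boxdot> f)" using f by (subst inva_left) simp_all
    then show ?thesis unfolding 2 .
  qed
  obtain t where t: "t \<in> Hom K ?N ?N" "shiftm K n t = ?R ?N \<cdot> inva (?L ?N)"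
    using shiftm_full[of ?N ?N "?R ?N \<cdot> inva (?L ?N)" n] by auto
  have "t \<in> Hom K ?N (shift K (n + 0) ?u)" using t(1) by simp
  from act_full[OF this] obtain e where e: "e \<in> unit_hom K 0" "t \<cdot> f = act 0 n e f" using f by auto
  have "g \<cdot> t \<cdot> f = g \<cdot> f \<cdot> inva (shunit K ?u) \<cdot> e" unfolding e(2) act_0_right[OF f e(1)] ..
  also have "\<dots> = pzero K ?u c \<cdot> inva (shunit K ?u) \<cdot> e"
    by (rule reassoc[OF gf]) (use g f e(1) in simp_all)
  also have "\<dots> = pzero K ?u c" using e(1) c by simp
  finally have gtf: "g \<cdot> t \<cdot> f = pzero K ?u c" .
  have "?R c \<cdot> (g \<boxdot> f) = ?R c \<cdot> (g \<boxdot> idt K ?N) \<cdot> (idt K ?N \<boxdot> f)"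
    using f g by (subst interchange) simp_all
  also have "\<dots> = (shiftm K n g \<cdot> ?R ?N) \<cdot> (idt K ?N \<boxdot> f)"
    by (rule reassoc[OF 1]) (use f g c in simp_all)
  also have "\<dots> = shiftm K n g \<cdot> (?R ?N \<cdot> inva (?L ?N)) \<cdot> shiftm K n f \<cdot> ?L ?u"
    unfolding 3 using f g c by simp
  also have "\<dots> = shiftm K n (g \<cdot> t \<cdot> f) \<cdot> ?L ?u" unfolding t(2)[symmetric] using f g t(1) by simp
  also have "\<dots> = ?R c \<cdot> pzero K (?N \<boxtimes> ?u) (c \<boxtimes> ?N)" unfolding gtf using c by simp
  finally have "g \<boxdot> f = pzero K (?N \<boxtimes> ?u) (c \<boxtimes> ?N)"
    by (rule iso_cancel_left[rotated 5]) (use f g c in simp_all)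
  then have "tzero g f" using f g by simp
  then show ?thesis by (rule tzero_swap) (use f g in simp_all)
qed

text \<open>Both \<open>g\<close> and \<open>h\<close> are annihilated by \<open>f\<close>. So the
  action of \<open>f\<close> on \<open>c\<close> vanishes on \<open>g\<close> and factors through
  \<open>h\<close>, and a second factor \<open>f\<close> annihilates it. A single factor is not
  enough in general, since \<open>f\<close> need not act as zero on its cone.\<close>

lemma square_kills_cone:
  assumes f: "f \<in> unit_hom K n" and c: "is_cone K f c"
  shows "kills (act n n f f) c"
proof -
  let ?u = "unit K" and ?N = "shift K n (unit K)"
  obtain g h where t: "triangle ?u ?N c f g h" using c f by (auto simp: is_cone_iff)
  note ta = triangle_arrow[OF t]
  have fg: "tzero f g" by (rule tzero_cone_map[OF f _ triangle_cmp(1)[OF t]]) (use ta in simp)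
  have "act n 1 f h = pzero K c (shift K (1 + n) ?u)"
    using triangle_cmp(3)[OF t] ta f by (simp add: act_def)
  moreover have h: "h \<in> Hom K c (shift K 1 ?u)" using ta by simp
  ultimately have fh: "tzero f h" using tzero_iff_act[OF f h] by blast
  have e1: "(f \<boxdot> idt K c) \<cdot> inva (lunit K c) \<cdot> g = (f \<boxdot> g) \<cdot> inva (lunit K ?N)"
  proof -
    have "inva (lunit K c) \<cdot> g = (idt K ?u \<boxdot> g) \<cdot> inva (lunit K ?N)"
      using square_inva[OF square_lunit[of g]] ta by (simp add: square_def)
    then have "(f \<boxdot> idt K c) \<cdot> inva (lunit K c) \<cdot> g = (f \<boxdot> idt K c) \<cdot> (idt K ?u \<boxdot> g) \<cdot> inva (lunit K ?N)" by simp
    also have "\<dots> = (f \<boxdot> g) \<cdot> inva (lunit K ?N)"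
      by (rule reassoc) (use ta f interchange[of "idt K ?u" f g "idt K c"] in simp_all)
    finally show ?thesis .
  qed
  then have "((f \<boxdot> idt K c) \<cdot> inva (lunit K c)) \<cdot> g = pzero K ?N (?N \<boxtimes> c)" using fg ta by simp
  then obtain k where k: "k \<in> Hom K (shift K 1 ?u) (?N \<boxtimes> c)" "(f \<boxdot> idt K c) \<cdot> inva (lunit K c) = k \<cdot> h"
    using exact_contra_right[OF t, of "(f \<boxdot> idt K c) \<cdot> inva (lunit K c)" "?N \<boxtimes> c"] ta by auto
  have "tzero f (k \<cdot> h)" by (rule tzero_left[OF fh]) (use ta k(1) in simp_all)
  then have "tzero f ((f \<boxdot> idt K c) \<cdot> inva (lunit K c))" unfolding k(2) .
  then have "tzero f (f \<boxdot> idt K c)" by (rule tzero_iso_right) (use ta in simp_all)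
  then show ?thesis by (rule tzero_act[OF f f, rotated]) (use ta in simp)
qed

section \<open>Annihilators of objects and homogeneous primes\<close>

definition Ann where
  "Ann d n = {f \<in> unit_hom K n. kills f d}"

lemma Ann_graded:
  assumes d: "d \<in> ob K"
  shows "graded_ideal (Ann d)"
  unfolding graded_ideal_def
proof (intro conjI allI ballI)
  fix n
  show "Ann d n \<subseteq> unit_hom K n" unfolding Ann_def by blast
  show "unit_zero K n \<in> Ann d n" using d by (simp add: Ann_def unit_zero_def)
  fix a assume "a \<in> Ann d n"
  then have a: "a \<in> unit_hom K n" "kills a d" unfolding Ann_def by blast+
  show "a \<boxplus> b \<in> Ann d n" if "b \<in> Ann d n" for b
  proof -
    have b: "b \<in> unit_hom K n" "kills b d" using that unfolding Ann_def by blast+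
    have "(a \<boxplus> b) \<boxdot> idt K d = a \<boxdot> idt K d \<boxplus> b \<boxdot> idt K d"
      by (rule tensm_padd_left) (use a(1) b(1) d in auto)
    then have "kills (a \<boxplus> b) d" using a b d by simp
    then show ?thesis using a(1) b(1) unfolding Ann_def by simp
  qed
  show "act m n r a \<in> Ann d (n + m)" if r: "r \<in> unit_hom K m" for m r
  proof -
    have "tzero (idt K d) a" by (rule tzero_swap[OF a(2)]) (use a(1) d in simp_all)
    then have "tzero (idt K d) ((shmul K n m (unit K) \<cdot> shiftm K n r) \<cdot> a)"
      by (rule tzero_left) (use a(1) r d in simp_all)
    then have "tzero (idt K d) (act m n r a)" using a(1) r by (simp add: act_def)
    then have "kills (act m n r a) d" by (rule tzero_swap) (use a(1) r d in simp_all)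
    then show ?thesis using act_closed[OF r a(1)] unfolding Ann_def by blast
  qed
qed

text \<open>Every product of three factors from \<open>f\<close> and \<open>g\<close> contains one
  of them twice, and the repeated factor can be collected up to a factor of degree 0. The square of
  the sum would not do because of the mixed terms.\<close>

lemma cube_in_ideal:
  assumes A: "graded_ideal A" and f: "f \<in> unit_hom K n" and g: "g \<in> unit_hom K n"
    and ff: "act n n f f \<in> A (n + n)" and gg: "act n n g g \<in> A (n + n)"
  shows "act n (n + n) (f \<boxplus> g) (act n n (f \<boxplus> g) (f \<boxplus> g)) \<in> A (n + n + n)"
proof -
  note AD = graded_idealD[OF A] and AR = graded_ideal_right[OF A]
  let ?q = "f \<boxplus> g"
  have q: "?q \<in> unit_hom K n" using f g by simp
  have H: "a \<in> Hom K (unit K) (shift K k (unit K))" if "a \<in> unit_hom K k" for a k using that by simp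
  have rrs: "act n (n + n) a (act n n a b) \<in> A (n + n + n)"
    if a: "a \<in> unit_hom K n" and b: "b \<in> unit_hom K n" and aa: "act n n a a \<in> A (n + n)" for a b
    using act_act[OF a a H[OF b]] AR[OF aa b] by (simp add: add.assoc)
  have rsr: "act n (n + n) a (act n n b a) \<in> A (n + n + n)"
    if a: "a \<in> unit_hom K n" and b: "b \<in> unit_hom K n" and aa: "act n n a a \<in> A (n + n)" for a b
  proof -
    obtain e where "e \<in> unit_hom K 0"
      "act n (n + n) a (act n n b a) = act 0 (n + (n + n)) e (act n (n + n) b (act n n a a))"
      using act_exchange[of n n "unit K" n] a b H[OF a] by blast
    then show ?thesis using AD(4)[OF AD(4)[OF aa b], of e 0] by (simp add: add.assoc)
  qed
  have q1: "act n (n + n) ?q x = act n (n + n) f x \<boxplus> act n (n + n) g x" if "x \<in> unit_hom K (n + n)" for x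
    by (rule act_padd_left[OF f g]) (use that in simp_all)
  have fg: "act n n f g \<in> unit_hom K (n + n)" "act n n g f \<in> unit_hom K (n + n)"
     "act n n f f \<in> unit_hom K (n + n)" "act n n g g \<in> unit_hom K (n + n)"
    by (rule act_closed[OF f g] act_closed[OF g f] act_closed[OF f f] act_closed[OF g g])+
  have "act n n ?q ?q = act n n f ?q \<boxplus> act n n g ?q" by (rule act_padd_left[OF f g]) (use q in simp_all)
  also have "\<dots> = (act n n f f \<boxplus> act n n f g) \<boxplus> (act n n g f \<boxplus> act n n g g)"
    using act_padd_right[OF f H[OF f] H[OF g]] act_padd_right[OF g H[OF f] H[OF g]] by simp
  finally have qq: "act n n ?q ?q = (act n n f f \<boxplus> act n n f g) \<boxplus> (act n n g f \<boxplus> act n n g g)" .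
  have in1: "act n (n + n) ?q (act n n f g) \<in> A (n + n + n)" "act n (n + n) ?q (act n n g f) \<in> A (n + n + n)"
    unfolding q1[OF fg(1)] q1[OF fg(2)]
    by (intro AD(3) rrs[OF f g ff] rsr[OF g f gg] rsr[OF f g ff] rrs[OF g f gg])+
  have in2: "act n (n + n) ?q (act n n f f) \<in> A (n + n + n)" "act n (n + n) ?q (act n n g g) \<in> A (n + n + n)"
    using AD(4)[OF ff q] AD(4)[OF gg q] by simp_all
  have "act n (n + n) ?q (act n n ?q ?q) = (act n (n + n) ?q (act n n f f) \<boxplus> act n (n + n) ?q (act n n f g)) \<boxplus>
      (act n (n + n) ?q (act n n g f) \<boxplus> act n (n + n) ?q (act n n g g))"
    unfolding qq using act_padd_right[OF q H[OF fg(3)] H[OF fg(1)]] act_padd_right[OF q H[OF fg(2)] H[OF fg(4)]]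
      act_padd_right[OF q, of "act n n f f \<boxplus> act n n f g" "unit K" "n + n" "act n n g f \<boxplus> act n n g g"] fg by simp
  then show ?thesis using in1 in2 AD(3) by simp
qed

text \<open>A homogeneous prime recorded by its homogeneous parts, as a family of sets of arrows;
  \<open>total\<close> and \<open>fam\<close> translate to and from ideals of
  \<open>ER\<close>.\<close>

definition prime_family where
  "prime_family H \<longleftrightarrow> graded_ideal H \<and> shunit K (unit K) \<notin> H 0 \<and>
     (\<forall>m n. \<forall>a\<in>unit_hom K m. \<forall>b\<in>unit_hom K n. act m n a b \<in> H (n + m) \<longrightarrow> a \<in> H m \<or> b \<in> H n)"

lemma prime_familyD:
  assumes "prime_family H"
  shows "graded_ideal H" "shunit K (unit K) \<notin> H 0"
    "\<lbrakk>a \<in> unit_hom K m; b \<in> unit_hom K n; act m n a b \<in> H (n + m)\<rbrakk> \<Longrightarrow> a \<in> H m \<or> b \<in> H n"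
  using assms unfolding prime_family_def by blast+

definition compl where
  "compl H n = unit_hom K n - H n"

lemma compl_mult_set: "prime_family H \<Longrightarrow> mult_set (compl H)"
  unfolding mult_set_def
proof (intro conjI allI ballI)
  assume H: "prime_family H"
  show "compl H n \<subseteq> unit_hom K n" for n unfolding compl_def by blast
  show "shunit K (unit K) \<in> compl H 0" using prime_familyD(2)[OF H] unfolding compl_def by simp
  fix m n a b assume "a \<in> compl H m" "b \<in> compl H n"
  then have a: "a \<in> unit_hom K m" "a \<notin> H m" and b: "b \<in> unit_hom K n" "b \<notin> H n" unfolding compl_def by blast+
  have "act m n a b \<notin> H (n + m)" using prime_familyD(3)[OF H a(1) b(1)] a(2) b(2) by blast
  then show "act m n a b \<in> compl H (n + m)" using act_closed[OF a(1) b(1)] unfolding compl_def by blast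
qed

definition fam where
  "fam p n = {f \<in> unit_hom K n. hel n f \<in> p}"

lemma end_degree_iff: "a \<in> (\<Union>n. end_degree K n) \<longleftrightarrow> (\<exists>n. \<exists>f\<in>unit_hom K n. a = hel n f)"
  unfolding end_degree_def by blast

lemma total_prime:
  assumes H: "prime_family H"
  shows "total H \<in> homogeneous_primes ER (end_degree K)"
proof -
  note g = prime_familyD(1)[OF H]
  have 1: "hel 0 (shunit K (unit K)) \<notin> total H" using total_hel[OF g] prime_familyD(2)[OF H] by blast
  have 2: "hel 0 (shunit K (unit K)) \<in> carrier ER" by (rule hel_closed) simp
  have "total H \<noteq> carrier ER"
  proof
    assume "total H = carrier ER"
    then show False using 1 2 by (simp only: not_True_eq_False)
  qed
  moreover have "a \<in> total H \<or> b \<in> total H" if ab: "a \<in> (\<Union>n. end_degree K n)" "b \<in> (\<Union>n. end_degree K n)" "a \<otimes>\<^bsub>ER\<^esub> b \<in> total H" for a b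
  proof -
    obtain m f where f: "f \<in> unit_hom K m" "a = hel m f" using ab(1) unfolding end_degree_iff by blast
    obtain n h where h: "h \<in> unit_hom K n" "b = hel n h" using ab(2) unfolding end_degree_iff by blast
    have "act m n f h \<in> H (n + m)" by (rule total_hel[OF g]) (use ab(3) hel_mult_hel[OF f(1) h(1)] f(2) h(2) in simp)
    then show ?thesis using prime_familyD(3)[OF H f(1) h(1)] hel_total[OF g] f(2) h(2) by blast
  qed
  ultimately show ?thesis unfolding homogeneous_primes_def using total_homogeneous[OF g] by blast
qed

text \<open>A homogeneous ideal is generated by its homogeneous elements, so \<open>p\<close> can be
  recovered from \<open>fam p\<close>. With \<open>fam_total\<close> this identifies homogeneous
  primes with prime families.\<close>

lemma fam_prime:
  assumes p: "p \<in> homogeneous_primes ER (end_degree K)"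
  shows "prime_family (fam p)" "total (fam p) = p"
proof -
  have hi: "homogeneous_ideal ER (end_degree K) p" and ne: "p \<noteq> carrier ER"
    and pr: "\<And>a b. \<lbrakk>a \<in> (\<Union>n. end_degree K n); b \<in> (\<Union>n. end_degree K n); a \<otimes>\<^bsub>ER\<^esub> b \<in> p\<rbrakk> \<Longrightarrow> a \<in> p \<or> b \<in> p"
    using p unfolding homogeneous_primes_def by blast+
  have pid: "ideal p ER" and pgen: "p = Idl\<^bsub>ER\<^esub> (p \<inter> (\<Union>n. end_degree K n))"
    using hi unfolding homogeneous_ideal_def by blast+
  interpret ideal p ER by (rule pid)
  have g: "graded_ideal (fam p)" unfolding graded_ideal_def
  proof (intro conjI allI ballI)
    fix n
    show "fam p n \<subseteq> unit_hom K n" unfolding fam_def by blast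
    have "hel n (unit_zero K n) \<in> p" unfolding hel_zero using additive_subgroup.zero_closed[OF ideal.axioms(1)[OF pid]] by (simp only: ER_zero)
    then show "unit_zero K n \<in> fam p n" using unit_zero_arrow unfolding fam_def by blast
    fix a assume "a \<in> fam p n"
    then have a: "a \<in> unit_hom K n" "hel n a \<in> p" unfolding fam_def by blast+
    show "a \<boxplus> b \<in> fam p n" if "b \<in> fam p n" for b
    proof -
      have b: "b \<in> unit_hom K n" "hel n b \<in> p" using that unfolding fam_def by blast+
      have "hel n (a \<boxplus> b) \<in> p" unfolding hel_padd[OF a(1) b(1)] by (rule additive_subgroup.a_closed[OF ideal.axioms(1)[OF pid] a(2) b(2)])
      moreover have "a \<boxplus> b \<in> unit_hom K n" using a(1) b(1) by simp
      ultimately show ?thesis unfolding fam_def by blast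
    qed
    show "act m n r a \<in> fam p (n + m)" if r: "r \<in> unit_hom K m" for m r
    proof -
      have "hel m r \<otimes>\<^bsub>ER\<^esub> hel n a \<in> p" by (rule I_l_closed[OF a(2) hel_closed[OF r]])
      then show ?thesis using hel_mult_hel[OF r a(1)] act_closed[OF r a(1)] unfolding fam_def by simp
    qed
  qed
  have "shunit K (unit K) \<notin> fam p 0"
  proof
    assume "shunit K (unit K) \<in> fam p 0"
    then have "\<one>\<^bsub>ER\<^esub> \<in> p" unfolding fam_def ER_one by blast
    then show False using one_imp_carrier ne by blast
  qed
  moreover have "a \<in> fam p m \<or> b \<in> fam p n"
    if a: "a \<in> unit_hom K m" and b: "b \<in> unit_hom K n" and ab: "act m n a b \<in> fam p (n + m)" for a b m n
  proof -
    have "hel m a \<otimes>\<^bsub>ER\<^esub> hel n b \<in> p" using ab hel_mult_hel[OF a b] unfolding fam_def by simp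
    moreover have "hel m a \<in> (\<Union>n. end_degree K n)" "hel n b \<in> (\<Union>n. end_degree K n)"
      using a b unfolding end_degree_iff by blast+
    ultimately show ?thesis using pr a b unfolding fam_def by blast
  qed
  ultimately show "prime_family (fam p)" unfolding prime_family_def using g by blast
  have "total (fam p) = Idl\<^bsub>ER\<^esub> (p \<inter> (\<Union>n. end_degree K n))"
  proof (rule total_eq_Idl[OF g])
    show "p \<inter> (\<Union>n. end_degree K n) \<subseteq> total (fam p)"
    proof
      fix a assume a: "a \<in> p \<inter> (\<Union>n. end_degree K n)"
      then obtain n f where f: "f \<in> unit_hom K n" "a = hel n f" using end_degree_iff[of a] by blast
      then have "f \<in> fam p n" using a unfolding fam_def by blast
      then show "a \<in> total (fam p)" unfolding f(2) by (rule hel_total[OF g])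
    qed
    fix n f assume "f \<in> fam p n"
    then show "hel n f \<in> Idl\<^bsub>ER\<^esub> (p \<inter> (\<Union>n. end_degree K n))" unfolding pgen[symmetric] fam_def by blast
  qed
  then show "total (fam p) = p" using pgen by simp
qed

section \<open>The comparison map\<close>

lemma tt_primeD:
  assumes "P \<in> tt_primes K"
  shows "thick_ideal K P" "thick K P" "P \<noteq> ob K"
    "\<lbrakk>x \<in> ob K; y \<in> ob K; x \<boxtimes> y \<in> P\<rbrakk> \<Longrightarrow> x \<in> P \<or> y \<in> P"
    "\<lbrakk>x \<in> P; y \<in> ob K\<rbrakk> \<Longrightarrow> x \<boxtimes> y \<in> P"
  using assms unfolding tt_primes_def thick_ideal_def by blast+

lemma unit_notin_tt_prime:
  assumes P: "P \<in> tt_primes K"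
  shows "unit K \<notin> P"
proof
  assume u: "unit K \<in> P"
  note PD = tt_primeD[OF P]
  have "x \<in> P" if x: "x \<in> ob K" for x
    by (rule thick_iso[OF PD(2) PD(5)[OF u x], of "lunit K x"]) (use x in simp_all)
  then show False using PD(3) thick_ob[OF PD(2)] by blast
qed

lemma thick_ideal_swap:
  assumes J: "thick_ideal K J" and x: "x \<in> ob K" "y \<in> ob K" and xy: "x \<boxtimes> y \<in> J"
  shows "y \<boxtimes> x \<in> J"
proof -
  have "thick K J" using J by (simp add: thick_ideal_def)
  from thick_iso[OF this xy, of "braid K x y"] show ?thesis using x by simp
qed

lemma thick_ideal_tensor:
  assumes "thick_ideal K J" "x \<in> J" "y \<in> ob K"
  shows "x \<boxtimes> y \<in> J" "y \<boxtimes> x \<in> J"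
proof -
  have "x \<in> ob K" using assms by (auto simp: thick_ideal_def intro: thick_ob)
  moreover show "x \<boxtimes> y \<in> J" using assms by (simp add: thick_ideal_def)
  ultimately show "y \<boxtimes> x \<in> J" using thick_ideal_swap[OF assms(1)] assms(3) by blast
qed

lemma cone_in_tensor:
  assumes J: "thick_ideal K J" and f: "f \<in> cone_in K J" and x: "x \<in> ob K"
  shows "f \<boxdot> idt K x \<in> cone_in K J" "idt K x \<boxdot> f \<in> cone_in K J"
proof -
  have T: "thick K J" using J by (simp add: thick_ideal_def)
  obtain c where fa: "f \<in> ar K" and c: "c \<in> J" "is_cone K f c" using f unfolding cone_in_def by blast
  have "is_cone K (f \<boxdot> idt K x) (c \<boxtimes> x)" by (rule tensor_is_cone[OF c(2) fa x])
  then show 1: "f \<boxdot> idt K x \<in> cone_in K J"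
    using thick_ideal_tensor(1)[OF J c(1) x] fa x unfolding cone_in_def by auto
  show "idt K x \<boxdot> f \<in> cone_in K J"
    by (rule cone_in_conj[OF T 1, of "braid K (src K f) x" "braid K (tgt K f) x"])
       (use square_braid[of f "idt K x"] fa x in \<open>simp_all add: square_def\<close>)
qed

text \<open>Up to isomorphisms the product is \<open>f \<boxdot> g\<close>, a composite of
  \<open>g\<close> and \<open>f\<close> tensored with identities, and their cones stay in the
  ideal.\<close>

lemma cone_in_act:
  assumes J: "thick_ideal K J" and f: "f \<in> unit_hom K m" "f \<in> cone_in K J" and g: "g \<in> unit_hom K n" "g \<in> cone_in K J"
  shows "act m n f g \<in> cone_in K J"
proof -
  have T: "thick K J" using J by (simp add: thick_ideal_def)
  have "(f \<boxdot> idt K (shift K n (unit K))) \<cdot> (idt K (unit K) \<boxdot> g) \<in> cone_in K J"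
    by (rule cone_in_cmp[OF T cone_in_tensor(2)[OF J g(2)] cone_in_tensor(1)[OF J f(2)]]) (use f(1) g(1) in simp_all)
  then have fg: "f \<boxdot> g \<in> cone_in K J" using f(1) g(1) by (simp add: interchange)
  have eq: "f \<boxdot> g = act_tensor m n \<cdot> act m n f g \<cdot> lunit K (unit K)"
    by (rule tensm_eq_act[OF f(1)]) (use g(1) in simp)
  have "act m n f g \<cdot> lunit K (unit K) = inva (act_tensor m n) \<cdot> (f \<boxdot> g)"
    unfolding eq using f(1) g(1) by simp
  then show ?thesis
    by (intro cone_in_conj[OF T fg, of "lunit K (unit K)" "inva (act_tensor m n)"]) (use f(1) g(1) in simp_all)
qed

text \<open>Modulo \<open>P\<close> the element \<open>f\<close> is invertible and yet acts as zero
  on \<open>d\<close>, so \<open>d\<close> vanishes there. This holds for any thick ideal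
  \<open>P\<close>.\<close>

lemma kills_in_prime:
  assumes P: "thick_ideal K P" and f: "f \<in> unit_hom K n" "f \<in> cone_in K P" and k: "kills f d" and d: "d \<in> ob K"
  shows "d \<in> P"
proof -
  obtain c where c: "c \<in> P" "is_cone K f c" using f(2) unfolding cone_in_def by blast
  show ?thesis by (rule kill_set_retract[OF P c(2) thick_ideal_tensor(1)[OF P c(1) d] f(1) k d])
qed

text \<open>The elements that do not become invertible modulo \<open>P\<close>. For a tt-prime they
  turn out to be the homogeneous elements of \<open>comparison K P\<close>.\<close>

definition noninv where
  "noninv P n = {f \<in> unit_hom K n. f \<notin> cone_in K P}"

lemma cone_exists: "f \<in> ar K \<Longrightarrow> \<exists>c. is_cone K f c \<and> c \<in> ob K"
  using triangle_exists[of f "src K f" "tgt K f"] triangle_arrow(12) unfolding is_cone_iff by fastforce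

lemma noninv_cone:
  assumes P: "P \<in> tt_primes K" and f: "f \<in> noninv P n"
  shows "\<exists>c. is_cone K f c \<and> c \<in> ob K \<and> c \<notin> P"
proof -
  have fa: "f \<in> ar K" "f \<notin> cone_in K P" using f unfolding noninv_def by auto
  obtain c where c: "is_cone K f c" "c \<in> ob K" using cone_exists[OF fa(1)] by blast
  then show ?thesis using cone_in_iff[OF tt_primeD(2)[OF P] fa(1) c(1)] fa(2) by blast
qed

text \<open>The criterion \<open>crit\<close> says that an element is not invertible modulo
  \<open>P\<close> if its square or cube annihilates an object outside of \<open>P\<close>. For a
  sum, take the tensor product of the cones of \<open>a\<close> and \<open>b\<close>: it lies
  outside of \<open>P\<close> because \<open>P\<close> is prime, and the cube of the sum annihilates
  it because the squares of \<open>a\<close> and \<open>b\<close> do.\<close>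

lemma noninv_prime:
  assumes P: "P \<in> tt_primes K"
  shows "prime_family (noninv P)"
proof -
  note PD = tt_primeD[OF P]
  note unitP = unit_notin_tt_prime[OF P]
  have crit: "f \<in> noninv P n" if f: "f \<in> unit_hom K n" and d: "d \<in> ob K" "d \<notin> P"
    and k: "act n n f f \<in> Ann d (n + n) \<or> act n (n + n) f (act n n f f) \<in> Ann d (n + n + n)" for f n d
  proof (rule ccontr)
    assume "f \<notin> noninv P n"
    then have fc: "f \<in> cone_in K P" using f unfolding noninv_def by blast
    have ff: "act n n f f \<in> cone_in K P" by (rule cone_in_act[OF PD(1) f fc f fc])
    have ffu: "act n n f f \<in> unit_hom K (n + n)" by (rule act_closed[OF f f])
    have fff: "act n (n + n) f (act n n f f) \<in> cone_in K P" by (rule cone_in_act[OF PD(1) f fc ffu ff])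
    have fffu: "act n (n + n) f (act n n f f) \<in> unit_hom K (n + n + n)" by (rule act_closed[OF f ffu])
    show False using k
    proof
      assume "act n n f f \<in> Ann d (n + n)"
      then have "kills (act n n f f) d" unfolding Ann_def by blast
      then show False using kills_in_prime[OF PD(1) ffu ff _ d(1)] d(2) by blast
    next
      assume "act n (n + n) f (act n n f f) \<in> Ann d (n + n + n)"
      then have "kills (act n (n + n) f (act n n f f)) d" unfolding Ann_def by blast
      then show False using kills_in_prime[OF PD(1) fffu fff _ d(1)] d(2) by blast
    qed
  qed
  have sq: "act n n f f \<in> Ann c (n + n)" if "f \<in> unit_hom K n" "is_cone K f c" for f n c
    using square_kills_cone[OF that] act_closed[OF that(1) that(1)] unfolding Ann_def by blast
  have nu: "f \<in> unit_hom K n" if "f \<in> noninv P n" for f n using that unfolding noninv_def by blast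
  have "graded_ideal (noninv P)" unfolding graded_ideal_def
  proof (intro conjI allI ballI)
    fix n
    show "noninv P n \<subseteq> unit_hom K n" using nu by blast
    have z: "unit_zero K n \<in> Ann (unit K) n" for n by (rule graded_idealD(2)[OF Ann_graded[OF unit_ob']])
    have "act n n (unit_zero K n) (unit_zero K n) = unit_zero K (n + n)" by (simp add: unit_zero_def)
    then show "unit_zero K n \<in> noninv P n"
      using crit[OF unit_zero_arrow unit_ob' unitP] z by simp
    fix a assume a: "a \<in> noninv P n"
    note au = nu[OF a]
    obtain c where c: "is_cone K a c" "c \<in> ob K" "c \<notin> P" using noninv_cone[OF P a] by blast
    show "a \<boxplus> b \<in> noninv P n" if b: "b \<in> noninv P n" for b
    proof -
      note bu = nu[OF b]
      obtain d where d: "is_cone K b d" "d \<in> ob K" "d \<notin> P" using noninv_cone[OF P b] by blast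
      have cd: "c \<boxtimes> d \<in> ob K" "c \<boxtimes> d \<notin> P" using c d PD(4) by auto
      have "kills (act n n a a) c" "kills (act n n b b) d"
        using square_kills_cone[OF au c(1)] square_kills_cone[OF bu d(1)] by blast+
      then have k: "kills (act n n a a) (c \<boxtimes> d)" "kills (act n n b b) (d \<boxtimes> c)"
        using kills_tensor c d act_closed[OF au au] act_closed[OF bu bu] by simp_all
      have "tzero (act n n b b) (braid K c d)"
        by (rule kills_to[OF k(2)]) (use c d act_closed[OF bu bu] in simp_all)
      then have "tzero (act n n b b) (braid K c d \<cdot> idt K (c \<boxtimes> d))" using c d by simp
      then have k': "kills (act n n b b) (c \<boxtimes> d)"
        by (rule tzero_iso_left) (use c d act_closed[OF bu bu] in simp_all)
      have "act n n a a \<in> Ann (c \<boxtimes> d) (n + n)" "act n n b b \<in> Ann (c \<boxtimes> d) (n + n)"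
        using k(1) k' act_closed[OF au au] act_closed[OF bu bu] unfolding Ann_def by blast+
      from cube_in_ideal[OF Ann_graded[OF cd(1)] au bu this]
      show ?thesis using crit[of "a \<boxplus> b" n "c \<boxtimes> d"] cd au bu by simp
    qed
    show "act m n r a \<in> noninv P (n + m)" if r: "r \<in> unit_hom K m" for m r
    proof -
      let ?b = "act m n r a"
      note A = Ann_graded[OF c(2)]
      have b: "?b \<in> unit_hom K (n + m)" by (rule act_closed[OF r au])
      have bH: "?b \<in> Hom K (unit K) (shift K (n + m) (unit K))" using b by simp
      have aH: "a \<in> Hom K (unit K) (shift K n (unit K))" using au by simp
      \<comment> \<open>Collecting the two factors \<open>a\<close> in the square of
        \<open>?b\<close>, up to a factor of degree 0, exhibits the square of \<open>a\<close>,
        which annihilates the cone \<open>c\<close> of \<open>a\<close>.\<close>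
      obtain e where e: "e \<in> unit_hom K 0" "act n (n + m) a ?b = act 0 (n + (n + m)) e (act m (n + n) r (act n n a a))"
        using act_exchange[of n m "unit K" n] au r aH by blast
      have "act n (n + m) a ?b \<in> Ann c (n + n + m)"
        unfolding e(2) using graded_idealD(4)[OF A graded_idealD(4)[OF A sq[OF au c(1)] r] e(1)] by (simp add: add.assoc)
      from graded_idealD(4)[OF A this r]
      have "act m (n + m + n) r (act n (n + m) a ?b) \<in> Ann c ((n + m) + (n + m))" by (simp add: algebra_simps)
      then have "act (n + m) (n + m) ?b ?b \<in> Ann c ((n + m) + (n + m))" using act_act[OF r au bH] by simp
      then show ?thesis using crit[OF b c(2,3)] by blast
    qed
  qed
  moreover have "shunit K (unit K) \<notin> noninv P 0"
    using cone_in_iso[OF PD(2), of "shunit K (unit K)"] unfolding noninv_def by simp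
  moreover have "a \<in> noninv P m \<or> b \<in> noninv P n"
    if "a \<in> unit_hom K m" "b \<in> unit_hom K n" "act m n a b \<in> noninv P (n + m)" for a b m n
    using cone_in_act[OF PD(1) that(1) _ that(2)] that unfolding noninv_def by blast
  ultimately show ?thesis unfolding prime_family_def by blast
qed

text \<open>The elements with cone outside of \<open>P\<close> are already closed under sums and
  multiples, so the ideal they generate has no further homogeneous elements.\<close>

lemma comparison_eq:
  assumes P: "P \<in> tt_primes K"
  shows "comparison K P = total (noninv P)"
proof -
  note g = prime_familyD(1)[OF noninv_prime[OF P]]
  let ?S = "{hel n f | n f. f \<in> unit_hom K n \<and> (\<exists>c. is_cone K f c \<and> c \<notin> P)}"
  have iff: "f \<in> noninv P n \<longleftrightarrow> f \<in> unit_hom K n \<and> (\<exists>c. is_cone K f c \<and> c \<notin> P)" for f n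
  proof
    assume "f \<in> noninv P n"
    then show "f \<in> unit_hom K n \<and> (\<exists>c. is_cone K f c \<and> c \<notin> P)"
      using noninv_cone[OF P, of f n] unfolding noninv_def by blast
  next
    assume f: "f \<in> unit_hom K n \<and> (\<exists>c. is_cone K f c \<and> c \<notin> P)"
    then have "f \<notin> cone_in K P" using cone_in_iff[OF tt_primeD(2)[OF P], of f] by auto
    with f show "f \<in> noninv P n" unfolding noninv_def by blast
  qed
  have S: "?S = {hel n f | n f. f \<in> noninv P n}" unfolding iff ..
  have "?S \<subseteq> total (noninv P)" unfolding S using hel_total[OF g] by blast
  moreover from this have "?S \<subseteq> carrier ER" unfolding total_def by blast
  interpret ring ER by (rule ER_ring)
  have "hel n f \<in> Idl\<^bsub>ER\<^esub> ?S" if "f \<in> noninv P n" for n f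
    using genideal_self[OF \<open>?S \<subseteq> carrier ER\<close>] that unfolding S by blast
  ultimately have "total (noninv P) = Idl\<^bsub>ER\<^esub> ?S" by (intro total_eq_Idl[OF g])
  then show ?thesis unfolding comparison_def ..
qed

lemma hel_comparison_iff:
  assumes "P \<in> tt_primes K" "f \<in> unit_hom K n"
  shows "hel n f \<in> comparison K P \<longleftrightarrow> f \<notin> cone_in K P"
proof -
  note g = prime_familyD(1)[OF noninv_prime[OF assms(1)]]
  have "hel n f \<in> total (noninv P) \<longleftrightarrow> f \<in> noninv P n" using hel_total[OF g] total_hel[OF g] by blast
  then show ?thesis unfolding comparison_eq[OF assms(1)] noninv_def using assms(2) by blast
qed

text \<open>The cone of \<open>s\<close> is annihilated by the square of \<open>s\<close>, which
  lies in \<open>S\<close> again. Conversely, if \<open>s\<close> annihilates \<open>x\<close>, then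
  \<open>x\<close> lies in every thick ideal containing the cone of \<open>s\<close>, because
  \<open>s\<close> is invertible modulo that ideal.\<close>

lemma kill_set_eq_gen:
  assumes S: "mult_set S"
  shows "kill_set S = thick_ideal_gen K {c. \<exists>n. \<exists>s\<in>S n. is_cone K s c}"
proof
  let ?C = "{c. \<exists>n. \<exists>s\<in>S n. is_cone K s c}"
  show "thick_ideal_gen K ?C \<subseteq> kill_set S"
    unfolding thick_ideal_gen_def
  proof (rule Inter_lower, intro CollectI conjI subsetI)
    show "thick_ideal K (kill_set S)" by (rule kill_set_thick_ideal[OF S])
    fix c assume "c \<in> ?C"
    then obtain n s where s: "s \<in> S n" "is_cone K s c" by blast
    note su = mult_setD(1)[OF S s(1)]
    have c: "c \<in> ob K" using s(2) triangle_arrow(12) unfolding is_cone_iff by blast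
    show "c \<in> kill_set S"
      by (rule kill_setI[where S = S, OF c mult_setD(3)[OF S, OF s(1) s(1)] square_kills_cone[OF su s(2)]])
  qed
  show "kill_set S \<subseteq> thick_ideal_gen K ?C"
    unfolding thick_ideal_gen_def
  proof (intro Inter_greatest subsetI)
    fix J x assume J: "J \<in> {T. thick_ideal K T \<and> ?C \<subseteq> T}" and "x \<in> kill_set S"
    from this(2) show "x \<in> J"
    proof (rule kill_setE)
      fix n s assume x: "x \<in> ob K" and s: "s \<in> S n" and k: "kills s x"
      note su = mult_setD(1)[OF S s]
      obtain c where c: "is_cone K s c" using cone_exists[of s] su by auto
      then have "c \<in> J" "thick_ideal K J" using J s by blast+
      then have "s \<in> cone_in K J" using c su unfolding cone_in_def by auto
      then show "x \<in> J" using kills_in_prime[OF \<open>thick_ideal K J\<close> su _ k x] by blast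
    qed
  qed
qed

lemma localization_zero_iff:
  assumes p: "p \<in> homogeneous_primes ER (end_degree K)"
  shows "is_zero (localization K p) x \<longleftrightarrow> x \<in> kill_set (compl (fam p))"
proof -
  note S = compl_mult_set[OF fam_prime(1)[OF p]]
  have "{c. \<exists>n. \<exists>s\<in>unit_hom K n. hel n s \<notin> p \<and> is_cone K s c} = {c. \<exists>n. \<exists>s\<in>compl (fam p) n. is_cone K s c}"
    unfolding compl_def fam_def by blast
  then have "localization K p = verdier_quotient K (kill_set (compl (fam p)))"
    unfolding localization_def kill_set_eq_gen[OF S] by simp
  then show ?thesis using verdier_zero_iff[of "kill_set (compl (fam p))" x] kill_set_thick_ideal[OF S]
    unfolding thick_ideal_def by simp
qed

end

section \<open>Nakayama's lemma\<close>

context tt_category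
begin

definition submodule where
  "submodule x L \<longleftrightarrow> (\<forall>k. L k \<subseteq> Hom K x (shift K k (unit K)) \<and> pzero K x (shift K k (unit K)) \<in> L k \<and>
     (\<forall>a\<in>L k. \<forall>b\<in>L k. a \<boxplus> b \<in> L k)) \<and> (\<forall>k n. \<forall>a\<in>L k. \<forall>r\<in>unit_hom K n. act n k r a \<in> L (k + n))"

lemma submoduleD:
  assumes "submodule x L"
  shows "a \<in> L k \<Longrightarrow> a \<in> Hom K x (shift K k (unit K))" "pzero K x (shift K k (unit K)) \<in> L k"
    "\<lbrakk>a \<in> L k; b \<in> L k\<rbrakk> \<Longrightarrow> a \<boxplus> b \<in> L k" "\<lbrakk>a \<in> L k; r \<in> unit_hom K n\<rbrakk> \<Longrightarrow> act n k r a \<in> L (k + n)"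
  using assms unfolding submodule_def by blast+

text \<open>Says that \<open>L\<close> and the components of \<open>\<phi>\<close> together generate
  the module of \<open>x\<close> after localization at \<open>H\<close>. The denominator
  \<open>t\<close> is the same for all arrows and degrees.\<close>

definition generated where
  "generated H x F \<phi> L \<longleftrightarrow> (\<exists>q. \<exists>t\<in>compl H q. \<forall>k. \<forall>b\<in>Hom K x (shift K k (unit K)).
     \<exists>a\<in>Hom K F (shift K (k + q) (unit K)). \<exists>l\<in>L (k + q). act q k t b = a \<cdot> \<phi> \<boxplus> l)"

lemma generatedE:
  assumes "generated H x F \<phi> L"
  obtains q t where "t \<in> compl H q" "\<And>k b. b \<in> Hom K x (shift K k (unit K)) \<Longrightarrow>
     \<exists>a\<in>Hom K F (shift K (k + q) (unit K)). \<exists>l\<in>L (k + q). act q k t b = a \<cdot> \<phi> \<boxplus> l"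
  using assms unfolding generated_def by blast

lemma generatedI:
  assumes "t \<in> compl H q" "\<And>k b. b \<in> Hom K x (shift K k (unit K)) \<Longrightarrow>
     \<exists>a\<in>Hom K F (shift K (k + q) (unit K)). \<exists>l\<in>L (k + q). act q k t b = a \<cdot> \<phi> \<boxplus> l"
  shows "generated H x F \<phi> L"
  using assms unfolding generated_def by blast

text \<open>The generators given by \<open>\<phi>\<close> are eliminated one after the other: an equation
  \<open>T \<phi> = G \<phi> + l\<close> with \<open>G\<close> in the prime and \<open>T\<close> outside of it expresses a multiple of \<open>\<phi>\<close> through \<open>L\<close>.\<close>

lemma eliminate:
  assumes H: "prime_family H" and x: "x \<in> ob K" and s: "s \<in> compl H m"
    and div: "\<And>k a. a \<in> Hom K x (shift K k (unit K)) \<Longrightarrow>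
      \<exists>f\<in>H n. \<exists>b\<in>Hom K x (shift K (k + m - n) (unit K)). act m k s a = act n (k + m - n) f b"
    and F: "F \<in> free" and p: "\<phi> \<in> Hom K x F" and L: "submodule x L" and gen: "generated H x F \<phi> L"
  shows "\<exists>q. \<exists>t\<in>compl H q. \<forall>k. \<forall>b\<in>Hom K x (shift K k (unit K)). act q k t b \<in> L (k + q)"
  using F p L gen
proof (induction arbitrary: \<phi> L rule: free.induct)
  case (free_zero z)
  obtain q t where t: "t \<in> compl H q" "\<And>k b. b \<in> Hom K x (shift K k (unit K)) \<Longrightarrow>
     \<exists>a\<in>Hom K z (shift K (k + q) (unit K)). \<exists>l\<in>L (k + q). act q k t b = a \<cdot> \<phi> \<boxplus> l"
    using free_zero(4) by (rule generatedE) blast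
  have "act q k t b \<in> L (k + q)" if b: "b \<in> Hom K x (shift K k (unit K))" for k b
  proof -
    obtain a l where a: "a \<in> Hom K z (shift K (k + q) (unit K))" and l: "l \<in> L (k + q)" and eq: "act q k t b = a \<cdot> \<phi> \<boxplus> l"
      using t(2)[OF b] by blast
    have "a \<cdot> \<phi> = pzero K x (shift K (k + q) (unit K))" using from_zero[OF free_zero(1), of a] a free_zero(2) by simp
    then have "act q k t b = l" unfolding eq using submoduleD(1)[OF free_zero(3) l] by simp
    then show ?thesis using l by simp
  qed
  then show ?case using t(1) by blast
next
  case (free_unit d)
  note LD = submoduleD[OF free_unit(2)]
  note g = prime_familyD(1)[OF H] and S = compl_mult_set[OF H]
  have ph: "\<phi> \<in> Hom K x (shift K d (unit K))" by (rule free_unit(1))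
  obtain q t where t: "t \<in> compl H q" "\<And>k b. b \<in> Hom K x (shift K k (unit K)) \<Longrightarrow>
     \<exists>a\<in>Hom K (shift K d (unit K)) (shift K (k + q) (unit K)). \<exists>l\<in>L (k + q). act q k t b = a \<cdot> \<phi> \<boxplus> l"
    using free_unit(3) by (rule generatedE) blast
  note tu = mult_setD(1)[OF S, OF t(1)] and su = mult_setD(1)[OF S, OF s]
  have full: "\<exists>r\<in>unit_hom K (k - d). a \<cdot> \<phi> = act (k - d) d r \<phi>" if "a \<in> Hom K (shift K d (unit K)) (shift K k (unit K))" for a k
    using act_full[of a d "k - d"] that ph by auto
  \<comment> \<open>\<open>k0\<close> is the degree of the quotient \<open>b\<close> in
    \<open>s \<phi> = f b\<close>, and \<open>\<rho>\<close> is the degree of the coefficient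
    \<open>r\<close> in \<open>t b = r \<phi> + l\<close>.\<close>
  define k0 where "k0 = d + m - n"
  define \<rho> where "\<rho> = m - n + q"
  obtain f b where f: "f \<in> H n" and b: "b \<in> Hom K x (shift K k0 (unit K))" and fb: "act m d s \<phi> = act n k0 f b"
    using div[OF ph] unfolding k0_def by blast
  note fu = graded_idealD(1)[OF g f]
  obtain a l where a: "a \<in> Hom K (shift K d (unit K)) (shift K (k0 + q) (unit K))" and l: "l \<in> L (k0 + q)"
    and tb: "act q k0 t b = a \<cdot> \<phi> \<boxplus> l" using t(2)[OF b] by blast
  have deg: "k0 + q = d + \<rho>" "k0 + q - d = \<rho>" "k0 + n = d + m" "d + \<rho> + n = d + (m + q)" "\<rho> + n = m + q" "n + \<rho> = m + q"
    unfolding k0_def \<rho>_def by simp_all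
  obtain r where r: "r \<in> unit_hom K \<rho>" and ar: "a \<cdot> \<phi> = act \<rho> d r \<phi>" using full[OF a, unfolded deg(2)] by blast
  have l1: "l \<in> L (d + \<rho>)" using l unfolding deg .
  have lH: "l \<in> Hom K x (shift K (d + \<rho>) (unit K))" by (rule LD(1)[OF l1])
  have rp: "act \<rho> d r \<phi> \<in> Hom K x (shift K (d + \<rho>) (unit K))" using r ph by simp
  obtain e where e: "e \<in> unit_hom K 0"
    "act q (k0 + n) t (act n k0 f b) = act 0 (k0 + (q + n)) e (act n (k0 + q) f (act q k0 t b))"
    using act_exchange[of q n x k0] tu fu b by blast
  define T0 where "T0 = act q m t s"
  have T0: "T0 \<in> compl H (m + q)" unfolding T0_def by (rule mult_setD(3)[OF S, OF t(1) s])
  note T0u = mult_setD(1)[OF S, OF T0]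
  define G where "G = act 0 (m + q) e (act n \<rho> f r)"
  have fr: "act n \<rho> f r \<in> H (m + q)" using graded_ideal_right[OF g f r] unfolding deg .
  have GH: "G \<in> H (m + q)" unfolding G_def using graded_idealD(4)[OF g fr e(1)] by simp
  note Gu = graded_idealD(1)[OF g GH] and fru = graded_idealD(1)[OF g fr]
  define l' where "l' = act 0 (d + (m + q)) e (act n (d + \<rho>) f l)"
  have fl: "act n (d + \<rho>) f l \<in> L (d + (m + q))" using LD(4)[OF l1 fu] unfolding deg .
  have l': "l' \<in> L (d + (m + q))" unfolding l'_def using LD(4)[OF fl e(1)] by simp
  have "act (m + q) d T0 \<phi> = act q (d + m) t (act m d s \<phi>)"
    unfolding T0_def by (rule act_act[OF tu su ph, symmetric])
  also have "\<dots> = act q (k0 + n) t (act n k0 f b)" unfolding fb deg ..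
  also have "\<dots> = act 0 (k0 + (q + n)) e (act n (d + \<rho>) f (act \<rho> d r \<phi> \<boxplus> l))"
    unfolding e(2) unfolding tb ar unfolding deg(1) ..
  also have "k0 + (q + n) = d + (m + q)" unfolding k0_def by simp
  also have "act n (d + \<rho>) f (act \<rho> d r \<phi> \<boxplus> l) = act n (d + \<rho>) f (act \<rho> d r \<phi>) \<boxplus> act n (d + \<rho>) f l"
    by (rule act_padd_right[OF fu rp lH])
  also have "act n (d + \<rho>) f (act \<rho> d r \<phi>) = act (m + q) d (act n \<rho> f r) \<phi>"
    using act_act[OF fu r ph] unfolding deg .
  also have "act 0 (d + (m + q)) e (act (m + q) d (act n \<rho> f r) \<phi> \<boxplus> act n (d + \<rho>) f l) =
      act 0 (d + (m + q)) e (act (m + q) d (act n \<rho> f r) \<phi>) \<boxplus> l'"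
    unfolding l'_def by (rule act_padd_right[OF e(1), of _ x]) (use fru ph LD(1)[OF fl] in simp_all)
  also have "act 0 (d + (m + q)) e (act (m + q) d (act n \<rho> f r) \<phi>) = act (m + q) d G \<phi>"
    unfolding G_def using act_act[OF e(1) fru ph] by simp
  finally have T0p: "act (m + q) d T0 \<phi> = act (m + q) d G \<phi> \<boxplus> l'" .
  \<comment> \<open>\<open>T0\<close> lies outside of \<open>H\<close> and \<open>G\<close> inside,
    so the difference lies outside; it multiplies \<open>\<phi>\<close> into
    \<open>L\<close>.\<close>
  define T where "T = T0 \<boxplus> pneg K G"
  have Tu: "T \<in> unit_hom K (m + q)" unfolding T_def using T0u Gu by simp
  have T: "T \<in> compl H (m + q)"
  proof -
    have "T \<notin> H (m + q)"
    proof
      assume "T \<in> H (m + q)"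
      then have "T \<boxplus> G \<in> H (m + q)" by (rule graded_idealD(3)[OF g _ GH])
      moreover have "T \<boxplus> G = T0" unfolding T_def using T0u Gu by simp
      ultimately show False using T0 unfolding compl_def by simp
    qed
    then show ?thesis using Tu unfolding compl_def by blast
  qed
  have Gp: "act (m + q) d G \<phi> \<in> Hom K x (shift K (d + (m + q)) (unit K))" using Gu ph by simp
  note l'H = LD(1)[OF l']
  have "act (m + q) d T \<phi> = act (m + q) d T0 \<phi> \<boxplus> pneg K (act (m + q) d G \<phi>)"
    unfolding T_def using T0u Gu ph by (subst act_padd_left) (simp_all add: act_pneg)
  also have "\<dots> = (l' \<boxplus> act (m + q) d G \<phi>) \<boxplus> pneg K (act (m + q) d G \<phi>)"
    unfolding T0p padd_comm[OF Gp l'H] ..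
  also have "\<dots> = l'" using Gp l'H by simp
  finally have Tp: "act (m + q) d T \<phi> \<in> L (d + (m + q))" using l' by simp
  \<comment> \<open>Multiplication by \<open>t\<close> reduces any arrow to a multiple of
    \<open>\<phi>\<close> modulo \<open>L\<close>, and \<open>T\<close> then carries that multiple
    into \<open>L\<close>.\<close>
  define T' where "T' = act (m + q) q T t"
  have T': "T' \<in> compl H (q + (m + q))" unfolding T'_def by (rule mult_setD(3)[OF S, OF T t(1)])
  have "act (q + (m + q)) k T' b \<in> L (k + (q + (m + q)))" if b: "b \<in> Hom K x (shift K k (unit K))" for k b
  proof -
    obtain a l where a: "a \<in> Hom K (shift K d (unit K)) (shift K (k + q) (unit K))" and l: "l \<in> L (k + q)"
      and tb: "act q k t b = a \<cdot> \<phi> \<boxplus> l" using t(2)[OF b] by blast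
    define \<sigma> where "\<sigma> = k + q - d"
    have dg: "k + q = d + \<sigma>" unfolding \<sigma>_def by simp
    obtain r where r: "r \<in> unit_hom K \<sigma>" and ar: "a \<cdot> \<phi> = act \<sigma> d r \<phi>" using full[OF a] unfolding \<sigma>_def by blast
    have l1: "l \<in> L (d + \<sigma>)" using l unfolding dg .
    obtain e where e: "e \<in> unit_hom K 0"
      "act (m + q) (d + \<sigma>) T (act \<sigma> d r \<phi>) = act 0 (d + (m + q + \<sigma>)) e (act \<sigma> (d + (m + q)) r (act (m + q) d T \<phi>))"
      using act_exchange[of "m + q" \<sigma> x d] Tu r ph by blast
    have "act (q + (m + q)) k T' b = act (m + q) (k + q) T (act q k t b)"
      unfolding T'_def by (rule act_act[OF Tu tu b, symmetric])
    also have "\<dots> = act (m + q) (d + \<sigma>) T (act \<sigma> d r \<phi> \<boxplus> l)" unfolding tb ar dg ..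
    also have "\<dots> = act (m + q) (d + \<sigma>) T (act \<sigma> d r \<phi>) \<boxplus> act (m + q) (d + \<sigma>) T l"
      by (rule act_padd_right[OF Tu, of _ x]) (use r ph LD(1)[OF l1] in simp_all)
    finally have eq: "act (q + (m + q)) k T' b = act (m + q) (d + \<sigma>) T (act \<sigma> d r \<phi>) \<boxplus> act (m + q) (d + \<sigma>) T l" .
    have dg': "d + \<sigma> + (m + q) = k + (q + (m + q))" "d + (m + q) + \<sigma> + 0 = k + (q + (m + q))" using dg by simp_all
    have "act (m + q) (d + \<sigma>) T l \<in> L (k + (q + (m + q)))" using LD(4)[OF l1 Tu] unfolding dg' .
    moreover have "act (m + q) (d + \<sigma>) T (act \<sigma> d r \<phi>) \<in> L (k + (q + (m + q)))"
      unfolding e(2) using LD(4)[OF LD(4)[OF Tp r] e(1)] unfolding dg' by (simp add: add.assoc)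
    ultimately show ?thesis unfolding eq by (rule LD(3)[rotated])
  qed
  then show ?case using T' by blast
next
  case (free_biproduct F1 F2 z)
  obtain i p j q where ij: "i \<in> Hom K F1 z" "p \<in> Hom K z F1" "j \<in> Hom K F2 z" "q \<in> Hom K z F2"
    "p \<cdot> i = idt K F1" "q \<cdot> j = idt K F2" "q \<cdot> i = pzero K F1 F2" "p \<cdot> j = pzero K F2 F1" "i \<cdot> p \<boxplus> j \<cdot> q = idt K z"
    using free_biproduct(3) by (rule biproductE)
  note ph = free_biproduct(6) and LD = submoduleD[OF free_biproduct(7)]
  have pq: "p \<cdot> \<phi> \<in> Hom K x F1" "q \<cdot> \<phi> \<in> Hom K x F2" using ij(1-4) ph by simp_all
  \<comment> \<open>The components of \<open>\<phi>\<close> in the second summand are first put into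
    the submodule. Eliminating those in \<open>F1\<close> then leaves a module generated by the ones
    in \<open>F2\<close> modulo \<open>L\<close>.\<close>
  define L' where "L' k = {a \<cdot> q \<cdot> \<phi> \<boxplus> l | a l. a \<in> Hom K F2 (shift K k (unit K)) \<and> l \<in> L k}" for k
  have L'I: "a \<cdot> q \<cdot> \<phi> \<boxplus> l \<in> L' k" if "a \<in> Hom K F2 (shift K k (unit K))" "l \<in> L k" for a l k
    using that unfolding L'_def by blast
  have L'E: "\<exists>a l. a \<in> Hom K F2 (shift K k (unit K)) \<and> l \<in> L k \<and> b = a \<cdot> q \<cdot> \<phi> \<boxplus> l" if "b \<in> L' k" for b k
    using that unfolding L'_def by blast
  have L': "submodule x L'" unfolding submodule_def
  proof (intro conjI allI ballI subsetI)
    fix k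
    let ?k = "shift K k (unit K)"
    have F2: "F2 \<in> ob K" using ij(3) by auto
    have "pzero K F2 ?k \<cdot> q \<cdot> \<phi> \<boxplus> pzero K x ?k \<in> L' k" by (rule L'I) (use F2 LD(2) in simp_all)
    then show "pzero K x ?k \<in> L' k" using ij(4) ph x by simp
    fix b assume "b \<in> L' k"
    then obtain a l where a: "a \<in> Hom K F2 ?k" and l: "l \<in> L k" and b: "b = a \<cdot> q \<cdot> \<phi> \<boxplus> l" using L'E by blast
    note lH = LD(1)[OF l]
    show "b \<in> Hom K x ?k" unfolding b using a lH ij(4) ph by simp
    show "b \<boxplus> b' \<in> L' k" if b'L: "b' \<in> L' k" for b'
    proof -
      obtain a' l' where a': "a' \<in> Hom K F2 ?k" and l': "l' \<in> L k" and b': "b' = a' \<cdot> q \<cdot> \<phi> \<boxplus> l'" using L'E[OF b'L] by blast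
      note l'H = LD(1)[OF l']
      have A: "a \<cdot> q \<cdot> \<phi> \<in> Hom K x ?k" "a' \<cdot> q \<cdot> \<phi> \<in> Hom K x ?k" using a a' ij(4) ph by simp_all
      have "b \<boxplus> b' = a \<cdot> q \<cdot> \<phi> \<boxplus> (l \<boxplus> (a' \<cdot> q \<cdot> \<phi> \<boxplus> l'))" unfolding b b'
        by (rule padd_assoc) (use A lH l'H in simp_all)
      also have "l \<boxplus> (a' \<cdot> q \<cdot> \<phi> \<boxplus> l') = (l \<boxplus> a' \<cdot> q \<cdot> \<phi>) \<boxplus> l'"
        by (rule padd_assoc[symmetric]) (use A lH l'H in simp_all)
      also have "l \<boxplus> a' \<cdot> q \<cdot> \<phi> = a' \<cdot> q \<cdot> \<phi> \<boxplus> l" by (rule padd_comm[OF lH A(2)])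
      also have "(a' \<cdot> q \<cdot> \<phi> \<boxplus> l) \<boxplus> l' = a' \<cdot> q \<cdot> \<phi> \<boxplus> (l \<boxplus> l')"
        by (rule padd_assoc[OF A(2) lH l'H])
      also have "a \<cdot> q \<cdot> \<phi> \<boxplus> (a' \<cdot> q \<cdot> \<phi> \<boxplus> (l \<boxplus> l')) = (a \<cdot> q \<cdot> \<phi> \<boxplus> a' \<cdot> q \<cdot> \<phi>) \<boxplus> (l \<boxplus> l')"
        by (rule padd_assoc[symmetric, of _ x ?k]) (use A lH l'H in simp_all)
      also have "a \<cdot> q \<cdot> \<phi> \<boxplus> a' \<cdot> q \<cdot> \<phi> = (a \<boxplus> a') \<cdot> q \<cdot> \<phi>" using a a' ij(4) ph by simp
      finally have "b \<boxplus> b' = (a \<boxplus> a') \<cdot> q \<cdot> \<phi> \<boxplus> (l \<boxplus> l')" .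
      moreover have "a \<boxplus> a' \<in> Hom K F2 ?k" using a a' by simp
      ultimately show ?thesis using L'I LD(3)[OF l l'] by metis
    qed
    show "act n k r b \<in> L' (k + n)" if r: "r \<in> unit_hom K n" for n r
    proof -
      have "act n k r b = act n k r (a \<cdot> q \<cdot> \<phi>) \<boxplus> act n k r l" unfolding b
        by (rule act_padd_right[OF r, of _ x]) (use a lH ij(4) ph in simp_all)
      also have "act n k r (a \<cdot> q \<cdot> \<phi>) = act n k r a \<cdot> q \<cdot> \<phi>"
        by (rule act_cmp[OF r, symmetric]) (use a ij(4) ph in simp_all)
      finally have "act n k r b = act n k r a \<cdot> q \<cdot> \<phi> \<boxplus> act n k r l" .
      moreover have "act n k r a \<in> Hom K F2 (shift K (k + n) (unit K))" using r a by simp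
      ultimately show ?thesis using L'I LD(4)[OF l r] by metis
    qed
  qed
  obtain m t where t: "t \<in> compl H m" "\<And>k b. b \<in> Hom K x (shift K k (unit K)) \<Longrightarrow>
     \<exists>a\<in>Hom K z (shift K (k + m) (unit K)). \<exists>l\<in>L (k + m). act m k t b = a \<cdot> \<phi> \<boxplus> l"
    using free_biproduct(8) by (rule generatedE) blast
  have "generated H x F1 (p \<cdot> \<phi>) L'"
  proof (rule generatedI[OF t(1)])
    fix k b assume "b \<in> Hom K x (shift K k (unit K))"
    then obtain a l where a: "a \<in> Hom K z (shift K (k + m) (unit K))" and l: "l \<in> L (k + m)" and eq: "act m k t b = a \<cdot> \<phi> \<boxplus> l"
      using t(2) by blast
    have "a \<cdot> \<phi> = (a \<cdot> idt K z) \<cdot> \<phi>" using a by simp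
    also have "\<dots> = (a \<cdot> i) \<cdot> p \<cdot> \<phi> \<boxplus> (a \<cdot> j) \<cdot> q \<cdot> \<phi>" unfolding ij(9)[symmetric] using a ij(1-4) ph by simp
    finally have "act m k t b = ((a \<cdot> i) \<cdot> p \<cdot> \<phi> \<boxplus> (a \<cdot> j) \<cdot> q \<cdot> \<phi>) \<boxplus> l" unfolding eq by simp
    also have "\<dots> = (a \<cdot> i) \<cdot> p \<cdot> \<phi> \<boxplus> ((a \<cdot> j) \<cdot> q \<cdot> \<phi> \<boxplus> l)"
      by (rule padd_assoc[of _ x "shift K (k + m) (unit K)"]) (use a ij(1-4) ph LD(1)[OF l] in simp_all)
    finally have "act m k t b = (a \<cdot> i) \<cdot> p \<cdot> \<phi> \<boxplus> ((a \<cdot> j) \<cdot> q \<cdot> \<phi> \<boxplus> l)" .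
    moreover have "(a \<cdot> j) \<cdot> q \<cdot> \<phi> \<boxplus> l \<in> L' (k + m)" by (rule L'I[OF _ l]) (use a ij(3) in simp)
    moreover have "a \<cdot> i \<in> Hom K F1 (shift K (k + m) (unit K))" using a ij(1) by simp
    ultimately show "\<exists>a\<in>Hom K F1 (shift K (k + m) (unit K)). \<exists>l\<in>L' (k + m). act m k t b = a \<cdot> p \<cdot> \<phi> \<boxplus> l" by blast
  qed
  from free_biproduct(4)[OF pq(1) L' this] obtain m' t' where t': "t' \<in> compl H m'"
    "\<And>k b. b \<in> Hom K x (shift K k (unit K)) \<Longrightarrow> act m' k t' b \<in> L' (k + m')" by blast
  have "generated H x F2 (q \<cdot> \<phi>) L"
    by (rule generatedI[OF t'(1)]) (use L'E[OF t'(2)] in blast)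
  from free_biproduct(5)[OF pq(2) free_biproduct(7) this] show ?case .
next
  case (free_iso y u z)
  have p: "inva u \<cdot> \<phi> \<in> Hom K x y" using free_iso by simp
  obtain q t where t: "t \<in> compl H q" "\<And>k b. b \<in> Hom K x (shift K k (unit K)) \<Longrightarrow>
     \<exists>a\<in>Hom K z (shift K (k + q) (unit K)). \<exists>l\<in>L (k + q). act q k t b = a \<cdot> \<phi> \<boxplus> l"
    using free_iso(7) by (rule generatedE) blast
  have "generated H x y (inva u \<cdot> \<phi>) L"
  proof (rule generatedI[OF t(1)])
    fix k b assume "b \<in> Hom K x (shift K k (unit K))"
    then obtain a l where a: "a \<in> Hom K z (shift K (k + q) (unit K))" and l: "l \<in> L (k + q)" and eq: "act q k t b = a \<cdot> \<phi> \<boxplus> l"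
      using t(2) by blast
    have "a \<cdot> \<phi> = (a \<cdot> u) \<cdot> inva u \<cdot> \<phi>" using a free_iso by simp
    then have "act q k t b = (a \<cdot> u) \<cdot> inva u \<cdot> \<phi> \<boxplus> l" unfolding eq by simp
    moreover have "a \<cdot> u \<in> Hom K y (shift K (k + q) (unit K))" using a free_iso by simp
    ultimately show "\<exists>a\<in>Hom K y (shift K (k + q) (unit K)). \<exists>l\<in>L (k + q). act q k t b = a \<cdot> inva u \<cdot> \<phi> \<boxplus> l"
      using l by blast
  qed
  from free_iso(4)[OF p free_iso(6) this] show ?case .
qed

text \<open>The fibre \<open>w\<close> of the action of \<open>f\<close> on \<open>x\<close>
  vanishes at \<open>H\<close>, so some \<open>s\<close> outside of \<open>H\<close> annihilates it.
  Then \<open>s a\<close> vanishes on \<open>w\<close> and extends along the action of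
  \<open>f\<close>, which means that it is a multiple of \<open>f\<close>, up to a factor of degree
  0.\<close>

lemma divide_by_cone:
  assumes H: "prime_family H" and x: "x \<in> ob K" and f: "f \<in> H n" and c: "is_cone K f c"
    and k: "c \<boxtimes> x \<in> kill_set (compl H)"
  shows "\<exists>m. \<exists>s\<in>compl H m. \<forall>k. \<forall>a\<in>Hom K x (shift K k (unit K)).
    \<exists>g\<in>H n. \<exists>b\<in>Hom K x (shift K (k + m - n) (unit K)). act m k s a = act n (k + m - n) g b"
proof -
  let ?u = "unit K" and ?J = "kill_set (compl H)"
  note g = prime_familyD(1)[OF H] and S = compl_mult_set[OF H]
  note fu = graded_idealD(1)[OF g f]
  have J: "thick K ?J" using kill_set_thick_ideal[OF S] by (simp add: thick_ideal_def)
  let ?f = "f \<boxdot> idt K x" and ?N = "shift K n ?u"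
  have fx: "?f \<in> Hom K (?u \<boxtimes> x) (?N \<boxtimes> x)" using fu x by simp
  have "is_cone K ?f (c \<boxtimes> x)" by (rule tensor_is_cone[OF c _ x]) (use fu in simp)
  then have fJ: "?f \<in> cone_in K ?J" using k fx unfolding cone_in_def by auto
  obtain w \<delta> h where t: "triangle w (?u \<boxtimes> x) (?N \<boxtimes> x) \<delta> ?f h" using rotated_triangle_exists[OF fx] by blast
  note ta = triangle_arrow[OF t]
  have "is_cone K ?f (shift K 1 w)" using triangle_rotate[OF t] fx by (auto simp: is_cone_iff)
  then have "shift K 1 w \<in> ?J" using cone_in_iff[OF J ta(4)] fJ by blast
  then have "w \<in> ?J" using thick_unshift[OF J] ta(10) by blast
  then obtain m s where s: "s \<in> compl H m" "kills s w" by (rule kill_setE) blast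
  note su = mult_setD(1)[OF S, OF s(1)]
  have "\<exists>g\<in>H n. \<exists>b\<in>Hom K x (shift K (k + m - n) ?u). act m k s a = act n (k + m - n) g b"
    if a: "a \<in> Hom K x (shift K k ?u)" for k a
  proof -
    define l where "l = k + m - n"
    let ?L = "shift K l ?u"
    have nl: "n + l = k + m" "l + n = k + m" "k + m - n = l" unfolding l_def by simp_all
    define y where "y = a \<cdot> lunit K x"
    have y: "y \<in> Hom K (?u \<boxtimes> x) (shift K k ?u)" unfolding y_def using a x by simp
    have "tzero s (y \<cdot> \<delta>)" by (rule kills_from[OF s(2)]) (use su y ta in simp_all)
    moreover have yd: "y \<cdot> \<delta> \<in> Hom K w (shift K k ?u)" using y ta by simp
    ultimately have "act m k s (y \<cdot> \<delta>) = pzero K w (shift K (k + m) ?u)" using tzero_iff_act[OF su yd] by blast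
    then have "act m k s y \<cdot> \<delta> = pzero K w (shift K (k + m) ?u)"
      using act_cmp[OF su, of y k \<delta>] y ta by simp
    then obtain b where b: "b \<in> Hom K (?N \<boxtimes> x) (shift K (k + m) ?u)" "act m k s y = b \<cdot> ?f"
      using exact_contra_mid[OF t, of "act m k s y" "shift K (k + m) ?u"] su y by auto
    let ?t = "tshift n ?u x"
    have bt: "b \<cdot> inva ?t \<in> Hom K (shift K n (?u \<boxtimes> x)) (shift K (k + m) ?u)" using b(1) x by simp
    obtain b0 where b0: "b0 \<in> Hom K (?u \<boxtimes> x) ?L" "b \<cdot> inva ?t = shmul K n l ?u \<cdot> shiftm K n b0"
      using desuspend[OF bt] x unfolding nl by auto
    define \<beta> where "\<beta> = b0 \<cdot> inva (lunit K x)"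
    have be: "\<beta> \<in> Hom K x ?L" unfolding \<beta>_def using b0(1) x by simp
    have b0_eq: "b0 = lunit K ?L \<cdot> (idt K ?u \<boxdot> \<beta>)"
      using square_lunit[of \<beta>] be b0(1) x by (simp add: square_def, simp add: \<beta>_def)
    have sq: "tshift n ?u ?L \<cdot> (idt K ?N \<boxdot> \<beta>) = shiftm K n (idt K ?u \<boxdot> \<beta>) \<cdot> ?t"
      using square_tshift[of "idt K ?u" \<beta> n] be by (simp add: square_def)
    have "b = (b \<cdot> inva ?t) \<cdot> ?t" using b(1) x by simp
    also have "\<dots> = shmul K n l ?u \<cdot> shiftm K n b0 \<cdot> ?t" unfolding b0(2) using b0(1) x by simp
    also have "\<dots> = shmul K n l ?u \<cdot> shiftm K n (lunit K ?L) \<cdot> shiftm K n (idt K ?u \<boxdot> \<beta>) \<cdot> ?t"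
      unfolding b0_eq using be x by simp
    also have "\<dots> = sunitor n l ?u \<cdot> (idt K ?N \<boxdot> \<beta>)"
      unfolding sq[symmetric] sunitor_def using be by simp
    finally have b_eq: "b = sunitor n l ?u \<cdot> (idt K ?N \<boxdot> \<beta>)" .
    have "(idt K ?N \<boxdot> \<beta>) \<cdot> ?f = f \<boxdot> \<beta>" using fu be x by (subst interchange) simp_all
    then have "b \<cdot> ?f = sunitor n l ?u \<cdot> (f \<boxdot> \<beta>)" unfolding b_eq using fu be x by simp
    also have "f \<boxdot> \<beta> = act_tensor n l \<cdot> act n l f \<beta> \<cdot> lunit K x" by (rule tensm_eq_act[OF fu be])
    also have "sunitor n l ?u \<cdot> act_tensor n l \<cdot> act n l f \<beta> \<cdot> lunit K x =
        (sunitor n l ?u \<cdot> act_tensor n l) \<cdot> act n l f \<beta> \<cdot> lunit K x" using fu be x by simp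
    finally have bf: "b \<cdot> ?f = (sunitor n l ?u \<cdot> act_tensor n l) \<cdot> act n l f \<beta> \<cdot> lunit K x" .
    \<comment> \<open>What remains of the identifications is an endomorphism of a shift of the unit,
      i.e. a factor \<open>e\<close> of degree 0. It is absorbed into \<open>f\<close>, which stays
      in \<open>H\<close>.\<close>
    have "sunitor n l ?u \<cdot> act_tensor n l \<in> Hom K (shift K (l + n) ?u) (shift K (l + n + 0) ?u)"
      by (simp add: add.commute)
    from act_full[OF this] obtain e where e: "e \<in> unit_hom K 0"
      "\<And>v. \<lbrakk>v \<in> ar K; tgt K v = shift K (l + n) ?u\<rbrakk> \<Longrightarrow> (sunitor n l ?u \<cdot> act_tensor n l) \<cdot> v = act 0 (l + n) e v" by blast
    have "b \<cdot> ?f = act 0 (l + n) e (act n l f \<beta> \<cdot> lunit K x)"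
      unfolding bf by (rule e(2)) (use fu be x in simp_all)
    also have "\<dots> = act 0 (l + n) e (act n l f \<beta>) \<cdot> lunit K x"
      by (rule act_cmp[OF e(1), symmetric]) (use fu be x in simp_all)
    also have "act 0 (l + n) e (act n l f \<beta>) = act (n + 0) l (act 0 n e f) \<beta>" by (rule act_act[OF e(1) fu be])
    finally have bf': "b \<cdot> ?f = act n l (act 0 n e f) \<beta> \<cdot> lunit K x" by simp
    have fe: "act 0 n e f \<in> H n" using graded_idealD(4)[OF g f e(1)] by simp
    note feu = graded_idealD(1)[OF g fe]
    have "act m k s a \<cdot> lunit K x = act n l (act 0 n e f) \<beta> \<cdot> lunit K x"
      using b(2) bf' act_cmp[OF su, of a k "lunit K x"] a x unfolding y_def by simp
    then have "act m k s a = act n l (act 0 n e f) \<beta>"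
      by (rule iso_cancel_right[rotated 5]) (use su feu a be x nl in simp_all)
    then show ?thesis unfolding nl using fe be by blast
  qed
  then show ?thesis using s(1) by blast
qed

text \<open>Elimination starts from a finite set of generators, the zero submodule and the unit
  element as denominator. It ends with one \<open>t\<close> outside of \<open>H\<close> that
  annihilates all arrows from \<open>x\<close> to shifts of the unit, hence \<open>x\<close>
  itself.\<close>

lemma nakayama:
  assumes gen: "ob K = thick_gen K {unit K}" and H: "prime_family H" and x: "coherent x"
    and f: "f \<in> H n" and c: "is_cone K f c" and k: "c \<boxtimes> x \<in> kill_set (compl H)"
  shows "x \<in> kill_set (compl H)"
proof -
  let ?S = "\<lambda>k. shift K k (unit K)"
  note xo = coherentD(1)[OF x] and S = compl_mult_set[OF H]
  obtain m s where s: "s \<in> compl H m" "\<And>k a. a \<in> Hom K x (?S k) \<Longrightarrow>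
    \<exists>g\<in>H n. \<exists>b\<in>Hom K x (?S (k + m - n)). act m k s a = act n (k + m - n) g b"
    using divide_by_cone[OF H xo f c k] by blast
  obtain F \<phi> where F: "cover x F \<phi>" using coherentD(2)[OF x] by blast
  define L where "L k = {pzero K x (?S k)}" for k
  have L: "submodule x L" unfolding submodule_def L_def using xo by simp
  have "generated H x F \<phi> L"
  proof (rule generatedI[OF mult_setD(2)[OF S]])
    fix k b assume b: "b \<in> Hom K x (?S k)"
    obtain a where "a \<in> Hom K F (?S k)" "b = a \<cdot> \<phi>" using coverD(3)[OF F b] by blast
    then show "\<exists>a\<in>Hom K F (?S (k + 0)). \<exists>l\<in>L (k + 0). act 0 k (shunit K (unit K)) b = a \<cdot> \<phi> \<boxplus> l"
      using act_shunit[of b k] b xo coverD(2)[OF F] unfolding L_def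
      by (intro bexI[of _ a] bexI[of _ "pzero K x (?S (k + 0))"]) simp_all
  qed
  from eliminate[OF H xo s coverD(1,2)[OF F] L this]
  obtain q t where t: "t \<in> compl H q" "\<And>k b. b \<in> Hom K x (?S k) \<Longrightarrow> act q k t b \<in> L (k + q)" by blast
  show ?thesis
    by (rule kill_set_act[OF S gen xo t(1)]) (use t(2) in \<open>unfold L_def, blast\<close>)
qed

end

section \<open>Existence of primes\<close>

context tt_category
begin

lemma thick_ideal_assoc:
  assumes J: "thick_ideal K J" and "x \<in> ob K" "y \<in> ob K" "z \<in> ob K"
  shows "(x \<boxtimes> y) \<boxtimes> z \<in> J \<longleftrightarrow> x \<boxtimes> y \<boxtimes> z \<in> J"
proof -
  have T: "thick K J" using J by (simp add: thick_ideal_def)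
  show ?thesis
  proof
    assume "(x \<boxtimes> y) \<boxtimes> z \<in> J"
    from thick_iso[OF T this, of "assoc K x y z"] show "x \<boxtimes> y \<boxtimes> z \<in> J" using assms(2-4) by simp
  next
    assume "x \<boxtimes> y \<boxtimes> z \<in> J"
    from thick_iso[OF T this, of "inva (assoc K x y z)"] show "(x \<boxtimes> y) \<boxtimes> z \<in> J" using assms(2-4) by simp
  qed
qed

lemma colon_thick_ideal:
  assumes P: "thick_ideal K P" and b: "b \<in> ob K"
  shows "thick_ideal K {z \<in> ob K. z \<boxtimes> b \<in> P}"
proof -
  have T: "thick K P" using P by (simp add: thick_ideal_def)
  have "thick K {z \<in> ob K. z \<boxtimes> b \<in> P}"
  proof (rule thickI)
    fix z assume "is_zero K z"
    then have z: "z \<in> ob K" "idt K z = pzero K z z" by (simp_all add: is_zero_iff)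
    have "idt K (z \<boxtimes> b) = idt K z \<boxdot> idt K b" using z(1) b by simp
    also have "\<dots> = pzero K (z \<boxtimes> b) (z \<boxtimes> b)" unfolding z(2) using z(1) b by simp
    finally have "is_zero K (z \<boxtimes> b)" using z(1) b by (simp add: is_zero_iff)
    then show "z \<in> {z \<in> ob K. z \<boxtimes> b \<in> P}" using thick_zero[OF T] z(1) by blast
  next
    fix x n assume "x \<in> {z \<in> ob K. z \<boxtimes> b \<in> P}"
    then have x: "x \<in> ob K" "x \<boxtimes> b \<in> P" by blast+
    have "shift K n x \<boxtimes> b \<in> P"
      by (rule thick_iso[OF T thick_shift[OF T x(2), of n], of "inva (tshift n x b)"]) (use x(1) b in simp_all)
    then show "shift K n x \<in> {z \<in> ob K. z \<boxtimes> b \<in> P}" using x(1) by simp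
  next
    fix x y z f g h
    assume t: "triangle x y z f g h" and xy: "x \<in> {z \<in> ob K. z \<boxtimes> b \<in> P}" "y \<in> {z \<in> ob K. z \<boxtimes> b \<in> P}"
    note ta = triangle_arrow[OF t]
    have "is_cone K f z" using t ta by (auto simp: is_cone_iff)
    then have "is_cone K (f \<boxdot> idt K b) (z \<boxtimes> b)" by (rule tensor_is_cone[OF _ _ b]) (use ta in simp)
    then obtain g' h' where "triangle (x \<boxtimes> b) (y \<boxtimes> b) (z \<boxtimes> b) (f \<boxdot> idt K b) g' h'"
      unfolding is_cone_iff using ta b by auto
    then have "z \<boxtimes> b \<in> P" using thick_third[OF T] xy by blast
    then show "z \<in> {z \<in> ob K. z \<boxtimes> b \<in> P}" using ta by simp
  next
    fix x y i r
    assume y: "y \<in> {z \<in> ob K. z \<boxtimes> b \<in> P}" and ir: "i \<in> Hom K x y" "r \<in> Hom K y x" "r \<cdot> i = idt K x"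
    then have x: "x \<in> ob K" by auto
    have "x \<boxtimes> b \<in> P"
      by (rule thick_retract[OF T, of "y \<boxtimes> b" "i \<boxdot> idt K b" _ "r \<boxdot> idt K b"])
        (use y ir x b in \<open>simp_all add: interchange\<close>)
    then show "x \<in> {z \<in> ob K. z \<boxtimes> b \<in> P}" using x by simp
  qed blast
  moreover have "z \<boxtimes> y \<in> {z \<in> ob K. z \<boxtimes> b \<in> P}" if "z \<in> {z \<in> ob K. z \<boxtimes> b \<in> P}" and y: "y \<in> ob K" for z y
  proof -
    have z: "z \<in> ob K" "z \<boxtimes> b \<in> P" using that by blast+
    have "(b \<boxtimes> z) \<boxtimes> y \<in> P" by (rule thick_ideal_tensor[OF P thick_ideal_swap[OF P z(1) b z(2)] y])
    then have "b \<boxtimes> z \<boxtimes> y \<in> P" using thick_ideal_assoc[OF P b z(1) y] by blast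
    then have "(z \<boxtimes> y) \<boxtimes> b \<in> P" by (rule thick_ideal_swap[OF P b, rotated]) (use z y in simp)
    then show ?thesis using z(1) y by simp
  qed
  ultimately show ?thesis unfolding thick_ideal_def by blast
qed

lemma thick_ideal_Union:
  assumes ne: "C \<noteq> {}" and C: "subset.chain {I. thick_ideal K I} C"
  shows "thick_ideal K (\<Union>C)"
proof -
  have CI: "C \<subseteq> {I. thick_ideal K I}" and tot: "\<And>A B. \<lbrakk>A \<in> C; B \<in> C\<rbrakk> \<Longrightarrow> A \<subseteq> B \<or> B \<subseteq> A"
    using C unfolding subset_chain_def by simp_all
  have I: "thick_ideal K I" "thick K I" if "I \<in> C" for I
  proof -
    show "thick_ideal K I" using CI that by blast
    then show "thick K I" unfolding thick_ideal_def by (rule conjunct1)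
  qed
  have two: "\<exists>I\<in>C. x \<in> I \<and> y \<in> I" if xy: "x \<in> \<Union>C" "y \<in> \<Union>C" for x y
  proof -
    obtain A B where AB: "A \<in> C" "B \<in> C" "x \<in> A" "y \<in> B" using xy by blast
    from tot[OF AB(1,2)] show ?thesis
    proof
      assume "A \<subseteq> B"
      then have "x \<in> B \<and> y \<in> B" using AB(3,4) by blast
      then show ?thesis by (rule bexI[OF _ AB(2)])
    next
      assume "B \<subseteq> A"
      then have "x \<in> A \<and> y \<in> A" using AB(3,4) by blast
      then show ?thesis by (rule bexI[OF _ AB(1)])
    qed
  qed
  have "thick K (\<Union>C)"
  proof (rule thickI)
    show "\<Union>C \<subseteq> ob K" using thick_ob[OF I(2)] by blast
    show "z \<in> \<Union>C" if "is_zero K z" for z using thick_zero[OF I(2) that] ne by blast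
    show "shift K n x \<in> \<Union>C" if "x \<in> \<Union>C" for x n using thick_shift[OF I(2)] that by blast
    show "z \<in> \<Union>C" if "triangle x y z f g h" "x \<in> \<Union>C" "y \<in> \<Union>C" for x y z f g h
      using thick_third[OF I(2) that(1)] two[OF that(2,3)] by blast
    show "x \<in> \<Union>C" if "y \<in> \<Union>C" "i \<in> Hom K x y" "r \<in> Hom K y x" "r \<cdot> i = idt K x" for x y i r
      using thick_retract[OF I(2) _ that(2-4)] that(1) by blast
  qed
  moreover have "x \<boxtimes> y \<in> \<Union>C" if "x \<in> \<Union>C" "y \<in> ob K" for x y
    using that I(1) thick_ideal_tensor(1) by blast
  ultimately show ?thesis unfolding thick_ideal_def by blast
qed

text \<open>Zorn's lemma gives a \<open>P\<close> maximal among the thick ideals containing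
  \<open>J\<close> and avoiding \<open>M\<close>. If \<open>a \<boxtimes> b\<close> is in
  \<open>P\<close> but neither factor is, the colon ideal of \<open>b\<close> is strictly larger and
  meets \<open>M\<close> in some \<open>m\<close>; the colon ideal of \<open>m\<close> contains
  \<open>b\<close> and meets \<open>M\<close> in some \<open>m'\<close>. Now
  \<open>m' \<boxtimes> m\<close> lies both in \<open>P\<close> and in \<open>M\<close>.\<close>

lemma tt_prime_avoiding:
  assumes J: "thick_ideal K J" and M: "M \<noteq> {}" "M \<subseteq> ob K" "\<And>a b. \<lbrakk>a \<in> M; b \<in> M\<rbrakk> \<Longrightarrow> a \<boxtimes> b \<in> M"
    and JM: "J \<inter> M = {}"
  shows "\<exists>P\<in>tt_primes K. J \<subseteq> P \<and> P \<inter> M = {}"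
proof -
  define A where "A = {I. thick_ideal K I \<and> J \<subseteq> I \<and> I \<inter> M = {}}"
  have "A \<noteq> {}" using J JM unfolding A_def by blast
  moreover have "\<Union>C \<in> A" if C: "C \<noteq> {}" "subset.chain A C" for C
  proof -
    have CA: "C \<subseteq> A" using C(2) unfolding subset_chain_def by blast
    have "subset.chain {I. thick_ideal K I} C" using C(2) unfolding A_def subset_chain_def by blast
    then have "thick_ideal K (\<Union>C)" by (rule thick_ideal_Union[OF C(1)])
    then show ?thesis using CA C(1) unfolding A_def by blast
  qed
  ultimately obtain P where PA: "P \<in> A" and max: "\<And>X. X \<in> A \<Longrightarrow> P \<subseteq> X \<Longrightarrow> X = P"
    using subset_Zorn_nonempty[of A] by blast
  then have P: "thick_ideal K P" "J \<subseteq> P" "P \<inter> M = {}" unfolding A_def by blast+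
  have T: "thick K P" using P(1) by (simp add: thick_ideal_def)
  have colon: "\<exists>m\<in>M. m \<boxtimes> b \<in> P" if a: "a \<in> ob K" "a \<notin> P" and b: "b \<in> ob K" and ab: "a \<boxtimes> b \<in> P" for a b
  proof (rule ccontr)
    let ?C = "{z \<in> ob K. z \<boxtimes> b \<in> P}"
    assume no: "\<not> (\<exists>m\<in>M. m \<boxtimes> b \<in> P)"
    have sub: "P \<subseteq> ?C" using thick_ob[OF T] thick_ideal_tensor(1)[OF P(1) _ b] by blast
    have "?C \<in> A" unfolding A_def using colon_thick_ideal[OF P(1) b] sub P(2) no by blast
    from max[OF this sub] show False using a ab by blast
  qed
  have "a \<in> P \<or> b \<in> P" if ab: "a \<in> ob K" "b \<in> ob K" "a \<boxtimes> b \<in> P" for a b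
  proof (rule ccontr)
    assume no: "\<not> (a \<in> P \<or> b \<in> P)"
    then obtain m where m: "m \<in> M" "m \<boxtimes> b \<in> P" using colon[OF ab(1) _ ab(2,3)] by blast
    have mo: "m \<in> ob K" using m(1) M(2) by blast
    obtain m' where m': "m' \<in> M" "m' \<boxtimes> m \<in> P"
      using colon[OF ab(2) _ mo thick_ideal_swap[OF P(1) mo ab(2) m(2)]] no by blast
    show False using M(3)[OF m'(1) m(1)] m'(2) P(3) by blast
  qed
  moreover have "P \<noteq> ob K" using P(3) M(1,2) by blast
  ultimately have "P \<in> tt_primes K" unfolding tt_primes_def using P(1) by blast
  then show ?thesis using P(2,3) by blast
qed

text \<open>All bracketings are included, as the tensor product is not strictly associative and
  \<open>tt_prime_avoiding\<close> needs a set closed under it.\<close>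

inductive_set products for B :: "'o set" where
  base: "b \<in> B \<Longrightarrow> b \<in> products B"
| prod: "\<lbrakk>a \<in> products B; b \<in> products B\<rbrakk> \<Longrightarrow> a \<boxtimes> b \<in> products B"

text \<open>By Nakayama's lemma, cones of elements of the prime \<open>H\<close> can be cancelled modulo the objects that
  vanish at \<open>H\<close>. So a product of such cones and of elements of \<open>X\<close> does not vanish at \<open>H\<close>.\<close>

lemma tt_prime_over:
  assumes gen: "ob K = thick_gen K {unit K}" and coh: "\<And>x. x \<in> ob K \<Longrightarrow> coherent x"
    and H: "prime_family H" and X: "X \<noteq> {}" "X \<subseteq> ob K"
    and XX: "\<And>x y. \<lbrakk>x \<in> X; y \<in> X\<rbrakk> \<Longrightarrow>
      \<exists>z\<in>X. \<forall>w\<in>ob K. w \<boxtimes> x \<boxtimes> y \<in> kill_set (compl H) \<longrightarrow> w \<boxtimes> z \<in> kill_set (compl H)"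
    and XJ: "X \<inter> kill_set (compl H) = {}"
  shows "\<exists>P\<in>tt_primes K. noninv P = H \<and> P \<inter> X = {}"
proof -
  let ?J = "kill_set (compl H)" and ?C = "{c. \<exists>n. \<exists>f\<in>H n. is_cone K f c}"
  note g = prime_familyD(1)[OF H] and S = compl_mult_set[OF H]
  have J: "thick_ideal K ?J" by (rule kill_set_thick_ideal[OF S])
  have T: "thick K ?J" using J by (simp add: thick_ideal_def)
  define M where "M = products (X \<union> ?C)"
  have XM: "X \<subseteq> M" "?C \<subseteq> M" unfolding M_def using products.base[of _ "X \<union> ?C"] by blast+
  \<comment> \<open>\<open>Q m x\<close> says that a factor \<open>m\<close> may be replaced by
    \<open>x\<close> without leaving \<open>?J\<close>. For the cone of an element of
    \<open>H\<close>, Nakayama's lemma removes the factor, and any \<open>x\<close> can take its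
    place. The quantification over \<open>w\<close> makes the relation compatible with
    products.\<close>
  define Q where "Q m x \<longleftrightarrow> (\<forall>w\<in>ob K. w \<boxtimes> m \<in> ?J \<longrightarrow> w \<boxtimes> x \<in> ?J)" for m x
  have QI: "(\<And>w. \<lbrakk>w \<in> ob K; w \<boxtimes> m \<in> ?J\<rbrakk> \<Longrightarrow> w \<boxtimes> x \<in> ?J) \<Longrightarrow> Q m x"
    and QD: "\<lbrakk>Q m x; w \<in> ob K; w \<boxtimes> m \<in> ?J\<rbrakk> \<Longrightarrow> w \<boxtimes> x \<in> ?J" for m x w
    unfolding Q_def by simp_all
  have M: "m \<in> ob K \<and> (\<exists>x\<in>X. Q m x)" if "m \<in> M" for m
    using that unfolding M_def
  proof induction
    case (base b)
    then consider "b \<in> X" | n f where "f \<in> H n" "is_cone K f b" by blast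
    then show ?case
    proof cases
      case 1
      moreover have "Q b b" by (rule QI)
      ultimately show ?thesis using X(2) by blast
    next
      case 2
      then have b: "b \<in> ob K" using triangle_arrow(12) unfolding is_cone_iff by blast
      obtain x where x: "x \<in> X" "x \<in> ob K" using X by blast
      have "w \<boxtimes> x \<in> ?J" if w: "w \<in> ob K" "w \<boxtimes> b \<in> ?J" for w
        using nakayama[OF gen H coh[OF w(1)] 2 thick_ideal_swap[OF J w(1) b w(2)]] thick_ideal_tensor(1)[OF J _ x(2)] by blast
      then have "Q b x" by (rule QI)
      then show ?thesis using b x(1) by blast
    qed
  next
    case (prod a b)
    then obtain x y where x: "x \<in> X" "Q a x" and y: "y \<in> X" "Q b y" and ab: "a \<in> ob K" "b \<in> ob K" by blast
    note xo = subsetD[OF X(2) x(1)] and yo = subsetD[OF X(2) y(1)]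
    obtain z where z: "z \<in> X" "Q (x \<boxtimes> y) z" using XX[OF x(1) y(1)] unfolding Q_def by (rule bexE)
    have "w \<boxtimes> z \<in> ?J" if w: "w \<in> ob K" "w \<boxtimes> a \<boxtimes> b \<in> ?J" for w
    proof -
      have "(w \<boxtimes> a) \<boxtimes> b \<in> ?J" using w(2) thick_ideal_assoc[OF J w(1) ab] by blast
      then have "(w \<boxtimes> a) \<boxtimes> y \<in> ?J" by (rule QD[OF y(2), rotated]) (use w(1) ab in simp)
      then have "y \<boxtimes> w \<boxtimes> a \<in> ?J" by (rule thick_ideal_swap[OF J _ yo, rotated]) (use w(1) ab in simp)
      then have "(y \<boxtimes> w) \<boxtimes> a \<in> ?J" using thick_ideal_assoc[OF J yo w(1) ab(1)] by blast
      then have "(y \<boxtimes> w) \<boxtimes> x \<in> ?J" by (rule QD[OF x(2), rotated]) (use w(1) yo in simp)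
      then have "y \<boxtimes> w \<boxtimes> x \<in> ?J" using thick_ideal_assoc[OF J yo w(1) xo] by blast
      then have "(w \<boxtimes> x) \<boxtimes> y \<in> ?J" by (rule thick_ideal_swap[OF J yo, rotated]) (use w(1) xo in simp)
      then have "w \<boxtimes> x \<boxtimes> y \<in> ?J" using thick_ideal_assoc[OF J w(1) xo yo] by blast
      then show ?thesis by (rule QD[OF z(2) w(1)])
    qed
    then have "Q (a \<boxtimes> b) z" by (rule QI)
    then show ?case using tens_ob[OF ab] z(1) by blast
  qed
  have "m \<notin> ?J" if m: "m \<in> M" for m
  proof
    assume mJ: "m \<in> ?J"
    obtain x where x: "x \<in> X" "Q m x" using M[OF m] by blast
    have "unit K \<boxtimes> x \<in> ?J" by (rule QD[OF x(2)]) (use thick_ideal_tensor(2)[OF J mJ] in simp_all)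
    from thick_iso[OF T this, of "lunit K x"] have "x \<in> ?J" using subsetD[OF X(2) x(1)] by simp
    then show False using XJ x(1) by blast
  qed
  then have JM: "?J \<inter> M = {}" by blast
  have "\<exists>P\<in>tt_primes K. ?J \<subseteq> P \<and> P \<inter> M = {}"
  proof (rule tt_prime_avoiding[OF J _ _ _ JM])
    show "M \<noteq> {}" using XM(1) X(1) by blast
    show "M \<subseteq> ob K" using M by blast
    show "a \<boxtimes> b \<in> M" if "a \<in> M" "b \<in> M" for a b using that unfolding M_def by (rule products.prod)
  qed
  then obtain P where P: "P \<in> tt_primes K" "?J \<subseteq> P" "P \<inter> M = {}" by blast
  \<comment> \<open>Since \<open>P\<close> contains \<open>?J\<close>, elements outside of
    \<open>H\<close> are invertible modulo \<open>P\<close>; since \<open>P\<close> avoids the cones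
    of elements of \<open>H\<close>, these are not.\<close>
  have "f \<in> noninv P n \<longleftrightarrow> f \<in> H n" for f n
  proof
    assume f: "f \<in> noninv P n"
    then have fu: "f \<in> unit_hom K n" unfolding noninv_def by blast
    obtain c where c: "is_cone K f c" "c \<in> ob K" "c \<notin> P" using noninv_cone[OF P(1) f] by blast
    show "f \<in> H n"
    proof (rule ccontr)
      assume "f \<notin> H n"
      then have fS: "f \<in> compl H n" using fu unfolding compl_def by blast
      have "c \<in> ?J"
        by (rule kill_setI[where S = "compl H", OF c(2) mult_setD(3)[OF S, OF fS fS] square_kills_cone[OF fu c(1)]])
      then show False using P(2) c(3) by blast
    qed
  next
    assume f: "f \<in> H n"
    have "f \<notin> cone_in K P" using f XM(2) P(3) unfolding cone_in_def by blast
    then show "f \<in> noninv P n" using graded_idealD(1)[OF g f] unfolding noninv_def by blast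
  qed
  then have "noninv P = H" by blast
  then show ?thesis using P XM(1) by blast
qed

lemma fam_total:
  assumes "prime_family H"
  shows "fam (total H) = H"
proof -
  note g = prime_familyD(1)[OF assms]
  have "f \<in> fam (total H) n \<longleftrightarrow> f \<in> H n" for f n
    unfolding fam_def using hel_total[OF g] total_hel[OF g] graded_idealD(1)[OF g] by blast
  then show ?thesis by blast
qed

text \<open>The condition \<open>XX\<close> covers two applications: families closed under tensor
  products, for closed sets, and a single object, for supports, where rigidity allows the factor
  \<open>x \<boxtimes> x\<close> to be replaced by \<open>x\<close>.\<close>

lemma comparison_image:
  assumes gen: "ob K = thick_gen K {unit K}" and coh: "\<And>x. x \<in> ob K \<Longrightarrow> coherent x"
    and X: "X \<noteq> {}" "X \<subseteq> ob K"
    and XX: "\<And>J x y. \<lbrakk>thick_ideal K J; x \<in> X; y \<in> X\<rbrakk> \<Longrightarrow> \<exists>z\<in>X. \<forall>w\<in>ob K. w \<boxtimes> x \<boxtimes> y \<in> J \<longrightarrow> w \<boxtimes> z \<in> J"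
  shows "comparison K ` {P \<in> tt_primes K. P \<inter> X = {}} =
    {p \<in> homogeneous_primes ER (end_degree K). X \<inter> kill_set (compl (fam p)) = {}}" (is "?L = ?R")
proof
  show "?L \<subseteq> ?R"
  proof
    fix p assume "p \<in> ?L"
    then obtain P where P: "P \<in> tt_primes K" "P \<inter> X = {}" and p: "p = comparison K P" by blast
    note H = noninv_prime[OF P(1)]
    have pt: "p = total (noninv P)" unfolding p by (rule comparison_eq[OF P(1)])
    have fp: "fam p = noninv P" unfolding pt by (rule fam_total[OF H])
    have "x \<in> P" if "x \<in> kill_set (compl (noninv P))" for x
      using that
    proof (rule kill_setE)
      fix n s assume x: "x \<in> ob K" and s: "s \<in> compl (noninv P) n" and k: "kills s x"
      have su: "s \<in> unit_hom K n" "s \<in> cone_in K P" using s unfolding compl_def noninv_def by blast+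
      show "x \<in> P" by (rule kills_in_prime[OF tt_primeD(1)[OF P(1)] su k x])
    qed
    then have "X \<inter> kill_set (compl (fam p)) = {}" unfolding fp using P(2) by blast
    moreover have "p \<in> homogeneous_primes ER (end_degree K)" unfolding pt by (rule total_prime[OF H])
    ultimately show "p \<in> ?R" by blast
  qed
  show "?R \<subseteq> ?L"
  proof
    fix p assume "p \<in> ?R"
    then have p: "p \<in> homogeneous_primes ER (end_degree K)" and pX: "X \<inter> kill_set (compl (fam p)) = {}" by blast+
    note H = fam_prime(1)[OF p]
    have "\<exists>P\<in>tt_primes K. noninv P = fam p \<and> P \<inter> X = {}"
      by (rule tt_prime_over[OF gen coh H X XX[OF kill_set_thick_ideal[OF compl_mult_set[OF H]]] pX])
    then obtain P where P: "P \<in> tt_primes K" "noninv P = fam p" "P \<inter> X = {}" by blast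
    have "comparison K P = p" using comparison_eq[OF P(1)] P(2) fam_prime(2)[OF p] by simp
    then show "p \<in> ?L" using P(1,3) by blast
  qed
qed

end

section \<open>Topology\<close>

context tt_category
begin

lemma unit_notin_kill_set:
  assumes H: "prime_family H"
  shows "unit K \<notin> kill_set (compl H)"
proof
  assume "unit K \<in> kill_set (compl H)"
  then obtain n s where s: "s \<in> compl H n" and k: "kills s (unit K)" by (rule kill_setE)
  have su: "s \<in> unit_hom K n" "s \<notin> H n" using s unfolding compl_def by blast+
  have "tzero s (shunit K (unit K))" by (rule kills_from[OF k]) (use su(1) in simp_all)
  moreover have "shunit K (unit K) \<in> Hom K (unit K) (shift K 0 (unit K))" by simp
  ultimately have "act n 0 s (shunit K (unit K)) = pzero K (unit K) (shift K (0 + n) (unit K))"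
    using tzero_iff_act[OF su(1)] by blast
  then have "s = unit_zero K n" using act_on_shunit[OF su(1)] by (simp add: unit_zero_def)
  then show False using su(2) graded_idealD(2)[OF prime_familyD(1)[OF H]] by simp
qed

text \<open>Makes the generating open sets of \<open>Spc K\<close> stable under intersection: the
  one of a biproduct is the intersection of those of its summands.\<close>

lemma tt_primes_biproduct:
  assumes P: "P \<in> tt_primes K" and z: "is_biproduct K x y z"
  shows "z \<in> P \<longleftrightarrow> x \<in> P \<and> y \<in> P"
proof
  note T = tt_primeD(2)[OF P]
  show "z \<in> P" if "x \<in> P \<and> y \<in> P" using thick_biproduct[OF T z] that by blast
  assume "z \<in> P"
  with z show "x \<in> P \<and> y \<in> P"
    by (elim biproductE) (use thick_retract[OF T] in blast)
qed

lemma topspace_Spc: "topspace (Spc K) = tt_primes K"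
proof -
  obtain z where z: "is_zero K z" using zero_object by blast
  have "P \<in> tt_primes K - supp K z" if "P \<in> tt_primes K" for P
    using thick_zero[OF tt_primeD(2)[OF that] z] that unfolding supp_def by blast
  then show ?thesis unfolding Spc_def topology_generated_by_topspace using is_zero_ob[OF z] by blast
qed

lemma openin_Spc_imp:
  assumes "openin (Spc K) U" "P \<in> U"
  shows "\<exists>x\<in>ob K. x \<in> P \<and> tt_primes K - supp K x \<subseteq> U"
proof -
  let ?B = "{tt_primes K - supp K x | x. x \<in> ob K}"
  have "generate_topology_on ?B U" using assms(1) unfolding Spc_def by (rule openin_topology_generated_by)
  moreover have "U \<subseteq> tt_primes K" using openin_subset[OF assms(1)] unfolding topspace_Spc .
  ultimately have "\<forall>P\<in>U. \<exists>x\<in>ob K. x \<in> P \<and> tt_primes K - supp K x \<subseteq> U"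
  proof induction
    case Empty
    show ?case by blast
  next
    case (Int a b)
    show ?case
    proof
      fix P assume P: "P \<in> a \<inter> b"
      have gen: "U \<subseteq> tt_primes K" if "generate_topology_on ?B U" for U
        using openin_subset[of "topology_generated_by ?B" U] that topspace_Spc
        unfolding Spc_def openin_topology_generated_by_iff by blast
      note sub = gen[OF Int.hyps(1)] gen[OF Int.hyps(2)]
      obtain x where x: "x \<in> ob K" "x \<in> P" "tt_primes K - supp K x \<subseteq> a" using Int.IH(1)[OF sub(1)] P by blast
      obtain y where y: "y \<in> ob K" "y \<in> P" "tt_primes K - supp K y \<subseteq> b" using Int.IH(2)[OF sub(2)] P by blast
      obtain z where z: "z \<in> ob K" "is_biproduct K x y z" using biproducts[OF x(1) y(1)] by blast
      have "z \<in> P" using tt_primes_biproduct[OF _ z(2)] x(2) y(2) P sub by blast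
      moreover have "tt_primes K - supp K z \<subseteq> a \<inter> b"
        using tt_primes_biproduct[OF _ z(2)] x(3) y(3) unfolding supp_def by blast
      ultimately show "\<exists>x\<in>ob K. x \<in> P \<and> tt_primes K - supp K x \<subseteq> a \<inter> b" using z(1) by blast
    qed
  next
    case (UN \<U>)
    show ?case
    proof
      fix P assume "P \<in> \<Union>\<U>"
      then obtain V where V: "V \<in> \<U>" "P \<in> V" by blast
      have "V \<subseteq> tt_primes K" using UN.prems V(1) by blast
      then obtain x where "x \<in> ob K" "x \<in> P" "tt_primes K - supp K x \<subseteq> V" using UN.IH[OF V(1)] V(2) by blast
      then show "\<exists>x\<in>ob K. x \<in> P \<and> tt_primes K - supp K x \<subseteq> \<Union>\<U>" using V(1) by blast
    qed
  next
    case (Basis s)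
    then show ?case unfolding supp_def by blast
  qed
  then show ?thesis using assms(2) by blast
qed

lemma topspace_homogeneous_Spec:
  "topspace (homogeneous_Spec ER (end_degree K)) = homogeneous_primes ER (end_degree K)"
proof -
  have u: "shunit K (unit K) \<in> unit_hom K 0" by simp
  have "hel 0 (shunit K (unit K)) \<notin> p" if "p \<in> homogeneous_primes ER (end_degree K)" for p
    using prime_familyD(2)[OF fam_prime(1)[OF that]] u unfolding fam_def by blast
  moreover have "hel 0 (shunit K (unit K)) \<in> (\<Union>n. end_degree K n)" using u unfolding end_degree_iff by blast
  ultimately show ?thesis unfolding homogeneous_Spec_def topology_generated_by_topspace by blast
qed

lemma comparison_homogeneous_prime:
  "P \<in> tt_primes K \<Longrightarrow> comparison K P \<in> homogeneous_primes ER (end_degree K)"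
  using comparison_eq total_prime[OF noninv_prime] by simp

text \<open>The preimage of the open set where a homogeneous \<open>f\<close> does not belong to the
  prime is the complement of the support of a cone of \<open>f\<close>.\<close>

lemma continuous_comparison:
  "continuous_map (Spc K) (homogeneous_Spec ER (end_degree K)) (comparison K)"
  unfolding homogeneous_Spec_def
proof (rule continuous_on_generated_topo)
  let ?S = "{{p \<in> homogeneous_primes ER (end_degree K). a \<notin> p} | a. a \<in> (\<Union>n. end_degree K n)}"
  show "comparison K ` topspace (Spc K) \<subseteq> \<Union>?S"
    using comparison_homogeneous_prime topspace_homogeneous_Spec
    unfolding topspace_Spc homogeneous_Spec_def topology_generated_by_topspace by blast
  fix U assume "U \<in> ?S"
  then obtain a where U: "U = {p \<in> homogeneous_primes ER (end_degree K). a \<notin> p}" and "a \<in> (\<Union>n. end_degree K n)" by blast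
  then obtain n f where f: "f \<in> unit_hom K n" and a: "a = hel n f" unfolding end_degree_iff by blast
  have fa: "f \<in> ar K" using f by simp
  obtain c where c: "is_cone K f c" "c \<in> ob K" using cone_exists[OF fa] by blast
  have "P \<in> comparison K -` U \<longleftrightarrow> c \<in> P" if P: "P \<in> tt_primes K" for P
    using hel_comparison_iff[OF P f] cone_in_iff[OF tt_primeD(2)[OF P] fa c(1)] comparison_homogeneous_prime[OF P]
    unfolding U a by blast
  then have "comparison K -` U \<inter> topspace (Spc K) = tt_primes K - supp K c"
    unfolding topspace_Spc supp_def by blast
  moreover have "openin (Spc K) (tt_primes K - supp K c)"
    unfolding Spc_def by (rule topology_generated_by_Basis) (use c(2) in blast)
  ultimately show "openin (Spc K) (comparison K -` U \<inter> topspace (Spc K))" by simp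
qed

lemma closed_comparison:
  assumes gen: "ob K = thick_gen K {unit K}" and coh: "\<And>x. x \<in> ob K \<Longrightarrow> coherent x"
  shows "closed_map (Spc K) (homogeneous_Spec ER (end_degree K)) (comparison K)"
  unfolding closed_map_def
proof (intro allI impI)
  let ?hp = "homogeneous_primes ER (end_degree K)"
  fix Z assume Z: "closedin (Spc K) Z"
  then have Zs: "Z \<subseteq> tt_primes K" and Zo: "openin (Spc K) (tt_primes K - Z)"
    unfolding closedin_def topspace_Spc by blast+
  \<comment> \<open>All objects contained in no member of \<open>Z\<close>. Because the members are
    tt-primes, \<open>X\<close> is closed under tensor products, and since \<open>Z\<close> is
    closed, it consists of the tt-primes disjoint from \<open>X\<close>.\<close>
  define X where "X = {x \<in> ob K. \<forall>P\<in>Z. x \<notin> P}"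
  have "P \<in> Z" if P: "P \<in> tt_primes K" "P \<inter> X = {}" for P
  proof (rule ccontr)
    assume "P \<notin> Z"
    then obtain x where x: "x \<in> ob K" "x \<in> P" "tt_primes K - supp K x \<subseteq> tt_primes K - Z"
      using openin_Spc_imp[OF Zo, of P] P(1) by blast
    have "x \<in> X" using x(1,3) Zs unfolding X_def supp_def by blast
    then show False using x(2) P(2) by blast
  qed
  then have "Z = {P \<in> tt_primes K. P \<inter> X = {}}" using Zs unfolding X_def by blast
  moreover have "comparison K ` {P \<in> tt_primes K. P \<inter> X = {}} = {p \<in> ?hp. X \<inter> kill_set (compl (fam p)) = {}}"
  proof (rule comparison_image[OF gen coh])
    show "X \<noteq> {}" using unit_notin_tt_prime Zs unit_ob' unfolding X_def by blast
    show "X \<subseteq> ob K" unfolding X_def by blast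
    fix J x y assume xy: "x \<in> X" "y \<in> X"
    have "x \<boxtimes> y \<notin> P" if "P \<in> Z" for P
      using tt_primeD(4)[OF subsetD[OF Zs that], of x y] xy that unfolding X_def by blast
    then have "x \<boxtimes> y \<in> X" using xy unfolding X_def by simp
    then show "\<exists>z\<in>X. \<forall>w\<in>ob K. w \<boxtimes> x \<boxtimes> y \<in> J \<longrightarrow> w \<boxtimes> z \<in> J" by (rule bexI[rotated]) simp
  qed
  ultimately have im: "comparison K ` Z = {p \<in> ?hp. X \<inter> kill_set (compl (fam p)) = {}}" by simp
  \<comment> \<open>An object vanishes at \<open>p\<close> iff some homogeneous \<open>s\<close>
    that annihilates it lies outside of \<open>p\<close>. So the complement of the image is a union
    of basic open sets, indexed by the annihilators of members of \<open>X\<close>.\<close>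
  define C where "C = {{p \<in> ?hp. hel n s \<notin> p} | n s. s \<in> unit_hom K n \<and> (\<exists>x\<in>X. kills s x)}"
  have "?hp - comparison K ` Z = \<Union>C"
  proof
    show "?hp - comparison K ` Z \<subseteq> \<Union>C"
    proof
      fix p assume "p \<in> ?hp - comparison K ` Z"
      then have p: "p \<in> ?hp" and "X \<inter> kill_set (compl (fam p)) \<noteq> {}" unfolding im by simp_all
      then obtain x where x: "x \<in> X" "x \<in> kill_set (compl (fam p))" by blast
      from x(2) obtain n s where s: "s \<in> compl (fam p) n" and k: "kills s x" by (rule kill_setE)
      then have s: "s \<in> unit_hom K n" "hel n s \<notin> p" unfolding compl_def fam_def by simp_all
      have "{p \<in> ?hp. hel n s \<notin> p} \<in> C" unfolding C_def using s(1) x(1) k by blast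
      then show "p \<in> \<Union>C" using p s(2) by blast
    qed
    show "\<Union>C \<subseteq> ?hp - comparison K ` Z"
    proof
      fix p assume "p \<in> \<Union>C"
      then obtain n s x where s: "s \<in> unit_hom K n" and x: "x \<in> X" and k: "kills s x"
        and p: "p \<in> ?hp" "hel n s \<notin> p" unfolding C_def by blast
      have "s \<in> compl (fam p) n" using s p(2) unfolding compl_def fam_def by simp
      then have "x \<in> kill_set (compl (fam p))" using x k unfolding X_def by (intro kill_setI) simp_all
      then show "p \<in> ?hp - comparison K ` Z" using p(1) x unfolding im by blast
    qed
  qed
  moreover have "openin (homogeneous_Spec ER (end_degree K)) (\<Union>C)"
  proof (rule openin_Union)
    fix U assume "U \<in> C"
    then obtain n s where U: "U = {p \<in> ?hp. hel n s \<notin> p}" and s: "s \<in> unit_hom K n" unfolding C_def by blast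
    have "hel n s \<in> (\<Union>n. end_degree K n)" using s unfolding end_degree_iff by blast
    then show "openin (homogeneous_Spec ER (end_degree K)) U"
      unfolding homogeneous_Spec_def U by (intro topology_generated_by_Basis) blast
  qed
  moreover have "comparison K ` Z \<subseteq> ?hp" unfolding im by blast
  ultimately show "closedin (homogeneous_Spec ER (end_degree K)) (comparison K ` Z)"
    unfolding closedin_def topspace_homogeneous_Spec by simp
qed

end

context rigid_tt_category
begin

text \<open>By rigidity \<open>x\<close> is a retract of \<open>(x \<otimes> v) \<otimes> x\<close> for a dual \<open>v\<close>.\<close>

lemma tensor_square_cancel:
  assumes J: "thick_ideal K J" and w: "w \<in> ob K" and x: "x \<in> ob K" and wxx: "w \<boxtimes> x \<boxtimes> x \<in> J"
  shows "w \<boxtimes> x \<in> J"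
proof -
  have T: "thick K J" using J by (simp add: thick_ideal_def)
  obtain v coev ev where v: "v \<in> ob K" and ce: "coev \<in> Hom K (unit K) (x \<boxtimes> v)" "ev \<in> Hom K (v \<boxtimes> x) (unit K)"
    and eq: "runit K x \<cdot> (idt K x \<boxdot> ev) \<cdot> assoc K x v x \<cdot> (coev \<boxdot> idt K x) = lunit K x"
    using dualizable[OF x] unfolding is_dual_def by blast
  define i where "i = (coev \<boxdot> idt K x) \<cdot> inva (lunit K x)"
  define r where "r = runit K x \<cdot> (idt K x \<boxdot> ev) \<cdot> assoc K x v x"
  have i: "i \<in> Hom K x ((x \<boxtimes> v) \<boxtimes> x)" unfolding i_def using x v ce by simp
  have r: "r \<in> Hom K ((x \<boxtimes> v) \<boxtimes> x) x" unfolding r_def using x v ce by simp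
  have "r \<cdot> i = (runit K x \<cdot> (idt K x \<boxdot> ev) \<cdot> assoc K x v x \<cdot> (coev \<boxdot> idt K x)) \<cdot> inva (lunit K x)"
    unfolding r_def i_def using x v ce by simp
  then have ri: "r \<cdot> i = idt K x" unfolding eq using x by simp
  note swap = thick_ideal_swap[OF J] and assoc = thick_ideal_assoc[OF J]
  \<comment> \<open>Swaps and reassociations bring \<open>w \<boxtimes> x \<boxtimes> x\<close>,
    tensored with \<open>v\<close>, into the form
    \<open>w \<boxtimes> (x \<boxtimes> v) \<boxtimes> x\<close>, which has
    \<open>w \<boxtimes> x\<close> as a retract.\<close>
  have "(w \<boxtimes> x) \<boxtimes> x \<in> J" using assoc[OF w x x] wxx by blast
  then have "x \<boxtimes> w \<boxtimes> x \<in> J" by (rule swap[OF _ x, rotated]) (use w x in simp)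
  then have "(x \<boxtimes> w) \<boxtimes> x \<in> J" using assoc[OF x w x] by blast
  then have "((x \<boxtimes> w) \<boxtimes> x) \<boxtimes> v \<in> J" by (rule thick_ideal_tensor[OF J _ v])
  then have "(x \<boxtimes> w) \<boxtimes> x \<boxtimes> v \<in> J" using assoc[OF tens_ob[OF x w] x v] by blast
  then have "x \<boxtimes> w \<boxtimes> x \<boxtimes> v \<in> J" using assoc[OF x w tens_ob[OF x v]] by blast
  then have "(w \<boxtimes> x \<boxtimes> v) \<boxtimes> x \<in> J" by (rule swap[OF x, rotated]) (use w x v in simp)
  then have "w \<boxtimes> (x \<boxtimes> v) \<boxtimes> x \<in> J" using assoc[OF w tens_ob[OF x v] x] by blast
  then show ?thesis
    by (rule thick_retract[OF T, of _ "idt K w \<boxdot> i" _ "idt K w \<boxdot> r"])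
      (use w x i r ri in \<open>simp_all add: interchange\<close>)
qed

lemma comparison_supp:
  assumes gen: "ob K = thick_gen K {unit K}" and coh: "\<And>x. x \<in> ob K \<Longrightarrow> coherent x" and x: "x \<in> ob K"
  shows "comparison K ` supp K x =
    {p \<in> homogeneous_primes ER (end_degree K). x \<notin> kill_set (compl (fam p))}"
proof -
  have "comparison K ` {P \<in> tt_primes K. P \<inter> {x} = {}} =
      {p \<in> homogeneous_primes ER (end_degree K). {x} \<inter> kill_set (compl (fam p)) = {}}"
  proof (rule comparison_image[OF gen coh])
    fix J y z assume J: "thick_ideal K J" and "y \<in> {x}" "z \<in> {x}"
    then have yz: "y = x" "z = x" by simp_all
    show "\<exists>z'\<in>{x}. \<forall>w\<in>ob K. w \<boxtimes> y \<boxtimes> z \<in> J \<longrightarrow> w \<boxtimes> z' \<in> J"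
      unfolding yz by (rule bexI[OF _ singletonI]) (intro ballI impI, rule tensor_square_cancel[OF J _ x])
  qed (use x in simp_all)
  moreover have "supp K x = {P \<in> tt_primes K. P \<inter> {x} = {}}" unfolding supp_def by blast
  ultimately show ?thesis by simp
qed

text \<open>The description of supports is applied to the unit, which lies in no tt-prime and
  vanishes at no homogeneous prime.\<close>

lemma comparison_surjective:
  assumes gen: "ob K = thick_gen K {unit K}" and coh: "\<And>x. x \<in> ob K \<Longrightarrow> coherent x"
  shows "comparison K ` tt_primes K = homogeneous_primes ER (end_degree K)"
proof -
  have "supp K (unit K) = tt_primes K" using unit_notin_tt_prime unfolding supp_def by blast
  moreover have "unit K \<notin> kill_set (compl (fam p))" if "p \<in> homogeneous_primes ER (end_degree K)" for p
    by (rule unit_notin_kill_set[OF fam_prime(1)[OF that]])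
  ultimately show ?thesis using comparison_supp[OF gen coh unit_ob'] by auto
qed

end

theorem proposition10p6:
  fixes K :: "('o, 'm) ttcategory"
  assumes "rigid_tt_category K"
    and "ob K = thick_gen K {unit K}"
    and "graded_coherent (end_ring K) (end_degree K)"
  shows "quotient_map (Spc K) (homogeneous_Spec (end_ring K) (end_degree K)) (comparison K) \<and>
    closed_map (Spc K) (homogeneous_Spec (end_ring K) (end_degree K)) (comparison K) \<and>
    (\<forall>x\<in>ob K. comparison K ` supp K x =
       {p \<in> homogeneous_primes (end_ring K) (end_degree K). \<not> is_zero (localization K p) x})"
proof -
  interpret rigid_tt_category K by (rule assms(1))
  note coh = coherent_all[OF assms(3,2)]
  have closed: "closed_map (Spc K) (homogeneous_Spec (end_ring K) (end_degree K)) (comparison K)"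
    by (rule closed_comparison[OF assms(2) coh])
  have "comparison K ` topspace (Spc K) = topspace (homogeneous_Spec (end_ring K) (end_degree K))"
    unfolding topspace_Spc topspace_homogeneous_Spec by (rule comparison_surjective[OF assms(2) coh])
  from continuous_closed_imp_quotient_map[OF continuous_comparison closed this]
  have quotient: "quotient_map (Spc K) (homogeneous_Spec (end_ring K) (end_degree K)) (comparison K)" .
  have supp: "comparison K ` supp K x =
      {p \<in> homogeneous_primes (end_ring K) (end_degree K). \<not> is_zero (localization K p) x}" if "x \<in> ob K" for x
  proof -
    have "comparison K ` supp K x =
        {p \<in> homogeneous_primes (end_ring K) (end_degree K). x \<notin> kill_set (compl (fam p))}"
      by (rule comparison_supp[OF assms(2) coh that])
    then show ?thesis using localization_zero_iff by blast
  qed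
  from quotient closed supp show ?thesis by blast
qed

end
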